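(* If $G$ is a countably infinite precompact non-metrizable topological group, then $1_G$ is not an isolated point of $\widehat G$, where $\widehat G$ carries the Fell topology.
   Context: All topological groups are assumed Hausdorff. A topological group $G$ is precompact if it is isomorphic, as a topological group, to a subgroup of a compact group. A unitary representation of $G$ is a continuous homomorphism $\rho:G\to U(\mathcal H)$, where $\mathcal H$ is a complex Hilbert space and the unitary group $U(\mathcal H)$ carries the strong operator topology. It is irreducible if there is no closed $\rho(G)$-invariant subspace $E$ with $\{0\}\subsetneq E\subsetneq\mathcal H$. The dual object $\widehat G$ is the set of (unitary) equivalence classes of irreducible unitary representations of $G$. $1_G$ is the class of the trivial one-dimensional representation. For a unitary representation $\rho$ of $G$ on $\mathcal H$, $P_\rho'$ is the set of functions $g\mapsto(\rho(g)v,v)$ on $G$ with $v\in\mathcal H$, and $P_\rho$ is the set of finite sums of elements of $P_\rho'$; these depend only on the equivalence class $[\rho]$. Fell topology on a set $\mathcal R$ of equivalence classes of unitary representations of $G$: the basic neighborhoods of $[\rho]\in\mathcal R$ are the sets $$W(f_1,\dots,f_n,C,\epsilon)=\{[\sigma]\in\mathcal R:\ \exists g_1,\dots,g_n\in P_\sigma\ \ \forall x\in C\ \ \forall i\ \ |f_i(x)-g_i(x)|<\epsilon\},$$ where $f_1,\dots,f_n\in P_\rho$, $C$ is a compact subset of $G$ and $\epsilon>0$. *)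

theory Defs
  imports "HOL-Analysis.Analysis" "HOL-Algebra.Module" "HOL-Algebra.Bij"
begin

section \<open>Topological groups\<close>

locale topological_group = group G for G (structure) +
  fixes T :: "'a topology"
  assumes topspace_eq: "topspace T = carrier G"
    and continuous_mult: "continuous_map (prod_topology T T) T (\<lambda>(x, y). x \<otimes> y)"
    and continuous_inv: "continuous_map T T (\<lambda>x. inv x)"
    and Hausdorff: "Hausdorff_space T"

text \<open>HOL cannot quantify existentially over types, so the type \<open>'k\<close> in which the compact group
  lives is a parameter. In a theorem it occurs only in this hypothesis and hence is universally
  quantified: the theorem covers compact groups of every type.\<close>

definition precompact_group :: "'k itself \<Rightarrow> 'a monoid \<Rightarrow> 'a topology \<Rightarrow> bool"
  where "precompact_group _ G T \<longleftrightarrow>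
    (\<exists>(K :: 'k monoid) S H \<phi>. topological_group K S \<and> compact_space S \<and> subgroup H K \<and>
       \<phi> \<in> iso G (K\<lparr>carrier := H\<rparr>) \<and> homeomorphic_map T (subtopology S H) \<phi>)"


section \<open>Complex Hilbert spaces\<close>

definition complex_field :: "complex ring"
  where "complex_field = \<lparr>carrier = UNIV, mult = (*), one = 1, zero = 0, add = (+)\<rparr>"

text \<open>The fields \<open>mult\<close> and \<open>one\<close> inherited from the module record play no role.\<close>

record 'h inner_space = "(complex, 'h) module" +
  cinner :: "'h \<Rightarrow> 'h \<Rightarrow> complex"

definition hnorm :: "'h inner_space \<Rightarrow> 'h \<Rightarrow> real"
  where "hnorm H x = sqrt (Re (cinner H x x))"

text \<open>The value \<open>0\<close> off the carrier makes \<open>hdist\<close> nonnegative and symmetric everywhere, which the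
  locale \<^locale>\<open>Metric_space\<close> demands.\<close>

definition hdist :: "'h inner_space \<Rightarrow> 'h \<Rightarrow> 'h \<Rightarrow> real"
  where "hdist H x y =
    (if x \<in> carrier H \<and> y \<in> carrier H then hnorm H (x \<ominus>\<^bsub>H\<^esub> y) else 0)"

locale hilbert_space = Module.module complex_field H for H :: "'h inner_space" (structure) +
  assumes cinner_add_left: "\<lbrakk>x \<in> carrier H; y \<in> carrier H; z \<in> carrier H\<rbrakk> \<Longrightarrow>
      cinner H (x \<oplus> y) z = cinner H x z + cinner H y z"
    and cinner_smult_left: "\<lbrakk>x \<in> carrier H; y \<in> carrier H\<rbrakk> \<Longrightarrow>
      cinner H (c \<odot> x) y = c * cinner H x y"
    and cinner_commute: "\<lbrakk>x \<in> carrier H; y \<in> carrier H\<rbrakk> \<Longrightarrow> cinner H x y = cnj (cinner H y x)"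
    and cinner_pos: "\<lbrakk>x \<in> carrier H; x \<noteq> \<zero>\<rbrakk> \<Longrightarrow> 0 < Re (cinner H x x)"
    and complete: "Metric_space.mcomplete (carrier H) (hdist H)"

definition hilbert_topology :: "'h inner_space \<Rightarrow> 'h topology"
  where "hilbert_topology H = Metric_space.mtopology (carrier H) (hdist H)"

text \<open>Operators are extensional functions on the carrier, as in \<^const>\<open>Bij\<close>.\<close>

definition unitary_ops :: "'h inner_space \<Rightarrow> 'k inner_space \<Rightarrow> ('h \<Rightarrow> 'k) set"
  where "unitary_ops H K = {U \<in> extensional (carrier H). bij_betw U (carrier H) (carrier K) \<and>
    (\<forall>x\<in>carrier H. \<forall>y\<in>carrier H. U (x \<oplus>\<^bsub>H\<^esub> y) = U x \<oplus>\<^bsub>K\<^esub> U y) \<and>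
    (\<forall>c. \<forall>x\<in>carrier H. U (c \<odot>\<^bsub>H\<^esub> x) = c \<odot>\<^bsub>K\<^esub> U x) \<and>
    (\<forall>x\<in>carrier H. \<forall>y\<in>carrier H. cinner K (U x) (U y) = cinner H x y)}"

definition unitary_group :: "'h inner_space \<Rightarrow> ('h \<Rightarrow> 'h) monoid"
  where "unitary_group H = (BijGroup (carrier H))\<lparr>carrier := unitary_ops H H\<rparr>"

text \<open>The strong operator topology: pointwise convergence in norm.\<close>

definition unitary_topology :: "'h inner_space \<Rightarrow> ('h \<Rightarrow> 'h) topology"
  where "unitary_topology H =
    subtopology (product_topology (\<lambda>_. hilbert_topology H) (carrier H)) (unitary_ops H H)"


section \<open>Unitary representations\<close>

type_synonym ('a, 'h) rep = "'h inner_space \<times> ('a \<Rightarrow> 'h \<Rightarrow> 'h)"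

definition unitary_rep :: "'a monoid \<Rightarrow> 'a topology \<Rightarrow> ('a, 'h) rep \<Rightarrow> bool"
  where "unitary_rep G T = (\<lambda>(H, \<rho>). hilbert_space H \<and> \<rho> \<in> hom G (unitary_group H) \<and>
    continuous_map T (unitary_topology H) \<rho>)"

text \<open>The zero space is excluded, following the usual convention for irreducibility.\<close>

definition irreducible_rep :: "'a monoid \<Rightarrow> 'a topology \<Rightarrow> ('a, 'h) rep \<Rightarrow> bool"
  where "irreducible_rep G T = (\<lambda>(H, \<rho>). unitary_rep G T (H, \<rho>) \<and> carrier H \<noteq> {\<zero>\<^bsub>H\<^esub>} \<and>
    \<not> (\<exists>E. submodule E complex_field H \<and> closedin (hilbert_topology H) E \<and>
          (\<forall>g\<in>carrier G. \<rho> g ` E \<subseteq> E) \<and> {\<zero>\<^bsub>H\<^esub>} \<subset> E \<and> E \<subset> carrier H))"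

definition rep_equiv :: "'a monoid \<Rightarrow> ('a, 'h) rep \<Rightarrow> ('a, 'k) rep \<Rightarrow> bool"
  where "rep_equiv G = (\<lambda>(H, \<rho>) (K, \<sigma>). \<exists>U\<in>unitary_ops H K.
    \<forall>g\<in>carrier G. \<forall>v\<in>carrier H. U (\<rho> g v) = \<sigma> g (U v))"

text \<open>An equivalence class of representations has to be a set of representations on Hilbert spaces
  whose elements have one fixed type, here \<open>'a \<Rightarrow> complex\<close>, where \<open>'a\<close> is the type of the
  group elements. This loses no irreducible representation of \<open>G\<close>: every orbit of a nonzero vector
  is total, so an orthonormal basis has at most as many elements as \<open>G\<close>, and the representation is
  equivalent to one on a closed subspace of \<open>\<ell>\<^sup>2(G)\<close>, a set of functions from \<open>'a\<close> to the complex
  numbers.\<close>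

definition rep_class :: "'a monoid \<Rightarrow> 'a topology \<Rightarrow> ('a, 'h) rep \<Rightarrow> ('a, 'a \<Rightarrow> complex) rep set"
  where "rep_class G T \<rho> = {\<sigma>. unitary_rep G T \<sigma> \<and> rep_equiv G \<rho> \<sigma>}"

definition dual_object :: "'a monoid \<Rightarrow> 'a topology \<Rightarrow> ('a, 'a \<Rightarrow> complex) rep set set"
  where "dual_object G T = {rep_class G T \<rho> | \<rho> :: ('a, 'a \<Rightarrow> complex) rep. irreducible_rep G T \<rho>}"

text \<open>The one-dimensional Hilbert space of constant functions; \<open>undefined\<close> is just some point at
  which to evaluate.\<close>

definition const_line :: "('a \<Rightarrow> complex) inner_space"
  where "const_line = \<lparr>carrier = range (\<lambda>c _. c), mult = (\<lambda>x y a. x a * y a), one = (\<lambda>_. 1),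
    zero = (\<lambda>_. 0), add = (\<lambda>x y a. x a + y a), smult = (\<lambda>c x a. c * x a),
    cinner = (\<lambda>x y. x undefined * cnj (y undefined))\<rparr>"

definition trivial_rep :: "('a, 'a \<Rightarrow> complex) rep"
  where "trivial_rep = (const_line, \<lambda>g. \<lambda>x\<in>carrier const_line. x)"

definition trivial_class :: "'a monoid \<Rightarrow> 'a topology \<Rightarrow> ('a, 'a \<Rightarrow> complex) rep set"
  where "trivial_class G T = rep_class G T trivial_rep"


subsection \<open>The trivial class is a point of the dual object\<close>

lemma const_line_simps [simp]:
  "carrier const_line = range (\<lambda>c _. c)" "zero const_line = (\<lambda>_. 0)"
  "add const_line x y = (\<lambda>a. x a + y a)" "smult const_line c x = (\<lambda>a. c * x a)"
  "cinner const_line x y = x undefined * cnj (y undefined)"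
  by (simp_all add: const_line_def)

lemma cring_complex_field: "cring complex_field"
proof (rule cringI)
  show "abelian_group complex_field"
    by (rule abelian_groupI) (auto simp: complex_field_def intro: exI[of _ "- x" for x :: complex] right_minus)
  show "Group.comm_monoid complex_field"
    by (rule comm_monoidI) (auto simp: complex_field_def)
qed (auto simp: complex_field_def algebra_simps)

lemma module_const_line: "Module.module complex_field (const_line :: ('a \<Rightarrow> complex) inner_space)"
proof (rule Module.moduleI[OF cring_complex_field])
  show "abelian_group (const_line :: ('a \<Rightarrow> complex) inner_space)"
  proof (rule abelian_groupI)
    fix x :: "'a \<Rightarrow> complex" assume "x \<in> carrier const_line"
    then obtain c where "x = (\<lambda>_. c)" by auto
    then show "\<exists>y\<in>carrier const_line. y \<oplus>\<^bsub>const_line\<^esub> x = \<zero>\<^bsub>const_line\<^esub>"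
      by (intro bexI[of _ "\<lambda>_. - c"]) auto
  qed (auto simp: algebra_simps)
qed (auto simp: complex_field_def algebra_simps)

lemma hdist_const_line:
  "hdist (const_line :: ('a \<Rightarrow> complex) inner_space) (\<lambda>_. a) (\<lambda>_. b) = dist a b"
proof -
  let ?L = "const_line :: ('a \<Rightarrow> complex) inner_space"
  interpret L: Module.module complex_field ?L by (rule module_const_line)
  have "\<ominus>\<^bsub>?L\<^esub> (\<lambda>_. b) = (\<lambda>_. - b)" by (rule L.M.minus_equality) auto
  then have "(\<lambda>_. a) \<ominus>\<^bsub>?L\<^esub> (\<lambda>_. b) = (\<lambda>_. a - b)" by (simp add: a_minus_def)
  then show ?thesis
    by (simp add: hdist_def hnorm_def dist_norm cmod_def power2_eq_square algebra_simps)
qed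

lemma Metric_space_const_line: "Metric_space (carrier const_line) (hdist const_line)"
proof
  fix x y :: "'a \<Rightarrow> complex"
  have "0 \<le> hdist const_line x y \<and> hdist const_line x y = hdist const_line y x"
  proof (cases "x \<in> carrier const_line \<and> y \<in> carrier const_line")
    case True
    then show ?thesis by (auto simp: hdist_const_line dist_commute)
  next
    case False
    then show ?thesis unfolding hdist_def by (auto simp del: const_line_simps)
  qed
  then show "0 \<le> hdist const_line x y" "hdist const_line x y = hdist const_line y x" by auto
qed (auto simp: hdist_const_line dist_triangle)

lemma hilbert_space_const_line: "hilbert_space (const_line :: ('a \<Rightarrow> complex) inner_space)"
proof -
  let ?L = "const_line :: ('a \<Rightarrow> complex) inner_space"
  note dist = hdist_const_line
  interpret D: Metric_space "carrier ?L" "hdist ?L" by (rule Metric_space_const_line)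
  have "D.mcomplete"
    unfolding D.mcomplete_def
  proof (intro allI impI)
    fix \<sigma> :: "nat \<Rightarrow> 'a \<Rightarrow> complex" assume M: "D.MCauchy \<sigma>"
    note M = M[unfolded D.MCauchy_def]
    have "range \<sigma> \<subseteq> range (\<lambda>c _. c)" using M[THEN conjunct1] by simp
    then have "\<forall>n. \<exists>c. \<sigma> n = (\<lambda>_. c)" by (simp add: image_subset_iff image_iff)
    then obtain s where s: "\<And>n. \<sigma> n = (\<lambda>_. s n)" by metis
    have "Cauchy s" using M[THEN conjunct2] unfolding Cauchy_def s dist by meson
    then obtain l where "s \<longlonglongrightarrow> l" using Cauchy_convergent convergent_def by blast
    then have "limitin D.mtopology \<sigma> (\<lambda>_. l) sequentially"
      unfolding D.limit_metric_sequentially by (auto simp: s dist lim_sequentially)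
    then show "\<exists>x. limitin D.mtopology \<sigma> x sequentially" by blast
  qed
  then show ?thesis
  proof (intro hilbert_space.intro module_const_line hilbert_space_axioms.intro, goal_cases)
    case (4 x)
    then obtain c where c: "x = (\<lambda>_. c)" "c \<noteq> 0" by auto
    have "0 < (Re c)\<^sup>2 + (Im c)\<^sup>2" using c(2) by (simp add: complex_neq_0)
    then show ?case by (simp add: c(1) power2_eq_square)
  qed (auto simp: algebra_simps)
qed

lemma unitary_rep_trivial_rep:
  assumes "topological_group G T"
  shows "unitary_rep G T (trivial_rep :: ('a, 'a \<Rightarrow> complex) rep)"
proof -
  let ?L = "const_line :: ('a \<Rightarrow> complex) inner_space"
  let ?I = "\<lambda>x\<in>carrier ?L. x"
  interpret topological_group G T by fact
  have ops: "?I \<in> unitary_ops ?L ?L"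
    using id_Bij[of "carrier ?L"] by (auto simp: unitary_ops_def Bij_def)
  have "(\<lambda>g. ?I) \<in> hom G (unitary_group ?L)"
    by (auto simp: hom_def unitary_group_def BijGroup_def ops id_Bij simp del: const_line_simps)
  moreover have "topspace (unitary_topology ?L) \<inter> {?I} = {?I}"
  proof -
    have "Metric_space (carrier ?L) (hdist ?L)" by (rule Metric_space_const_line)
    then have "topspace (hilbert_topology ?L) = carrier ?L"
      by (simp add: hilbert_topology_def Metric_space.topspace_mtopology del: const_line_simps)
    then show ?thesis using ops
      by (auto simp: unitary_topology_def PiE_def Pi_def simp del: const_line_simps)
  qed
  then have "continuous_map T (unitary_topology ?L) (\<lambda>g. ?I)"
    by (subst continuous_map_const) auto
  ultimately show ?thesis
    by (simp add: unitary_rep_def trivial_rep_def hilbert_space_const_line del: const_line_simps)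
qed

lemma irreducible_rep_trivial_rep:
  assumes "topological_group G T"
  shows "irreducible_rep G T (trivial_rep :: ('a, 'a \<Rightarrow> complex) rep)"
proof -
  let ?L = "const_line :: ('a \<Rightarrow> complex) inner_space"
  have "E = carrier ?L" if E: "submodule E complex_field ?L" "{\<zero>\<^bsub>?L\<^esub>} \<subset> E" "E \<subseteq> carrier ?L" for E
  proof -
    obtain e where e: "e \<in> E" "e \<noteq> (\<lambda>_. 0)" using E(2) by auto
    then obtain c where c: "e = (\<lambda>_. c)" "c \<noteq> 0" using E(3) by auto
    have "(\<lambda>_. z) \<in> E" for z
      using submodule.smult_closed[OF E(1), of "z / c" e] e c by (simp add: complex_field_def)
    then show ?thesis using E(3) by auto
  qed
  moreover have "carrier ?L \<noteq> {\<zero>\<^bsub>?L\<^esub>}"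
  proof
    assume "carrier ?L = {\<zero>\<^bsub>?L\<^esub>}"
    moreover have "(\<lambda>_. 1) \<in> carrier ?L" by simp
    ultimately show False by (simp add: fun_eq_iff)
  qed
  ultimately show ?thesis
    using unitary_rep_trivial_rep[OF assms] unfolding irreducible_rep_def trivial_rep_def by blast
qed

lemma trivial_class_in_dual_object:
  "topological_group G T \<Longrightarrow> trivial_class G T \<in> dual_object G T"
  unfolding dual_object_def trivial_class_def using irreducible_rep_trivial_rep by blast


section \<open>The Fell topology\<close>

text \<open>Functions on \<open>G\<close> are extensional functions on \<open>carrier G\<close>. The set \<open>coeffs\<close> is
  \<open>P\<^sub>\<rho>'\<close>, and \<open>coeff_sums\<close> is \<open>P\<^sub>\<rho>\<close>.\<close>

definition coeffs :: "'a monoid \<Rightarrow> ('a, 'h) rep \<Rightarrow> ('a \<Rightarrow> complex) set"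
  where "coeffs G = (\<lambda>(H, \<rho>). {\<lambda>g\<in>carrier G. cinner H (\<rho> g v) v | v. v \<in> carrier H})"

definition coeff_sums :: "'a monoid \<Rightarrow> ('a, 'h) rep \<Rightarrow> ('a \<Rightarrow> complex) set"
  where "coeff_sums G \<rho> =
    {\<lambda>g\<in>carrier G. \<Sum>i<n. p i g | (n :: nat) p. \<forall>i<n. p i \<in> coeffs G \<rho>}"

text \<open>\<open>coeff_sums\<close> depends only on the equivalence class, so the union below is over equal sets.\<close>

definition class_coeff_sums :: "'a monoid \<Rightarrow> ('a, 'h) rep set \<Rightarrow> ('a \<Rightarrow> complex) set"
  where "class_coeff_sums G c = (\<Union>\<rho>\<in>c. coeff_sums G \<rho>)"

definition fell_nbhd ::
  "'a monoid \<Rightarrow> ('a, 'h) rep set set \<Rightarrow> ('a \<Rightarrow> complex) list \<Rightarrow> 'a set \<Rightarrow> real \<Rightarrow> ('a, 'h) rep set set"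
  where "fell_nbhd G R fs C \<epsilon> = {c \<in> R. \<exists>gs. length gs = length fs \<and>
    set gs \<subseteq> class_coeff_sums G c \<and>
    (\<forall>x\<in>C. \<forall>i<length fs. cmod ((fs ! i) x - (gs ! i) x) < \<epsilon>)}"

text \<open>The sets \<open>fell_nbhd G R fs C \<epsilon>\<close> with \<open>fs\<close> taken from \<open>P\<^sub>\<rho>\<close> are the basic neighbourhoods of \<open>[\<rho>]\<close>.
  They are themselves open: the functions in question are continuous, so a strict bound on the
  compact set \<open>C\<close> leaves some room.\<close>

definition fell_open :: "'a monoid \<Rightarrow> 'a topology \<Rightarrow> ('a, 'h) rep set set \<Rightarrow> ('a, 'h) rep set set \<Rightarrow> bool"
  where "fell_open G T R U \<longleftrightarrow> U \<subseteq> R \<and> (\<forall>c\<in>U. \<exists>fs C \<epsilon>. set fs \<subseteq> class_coeff_sums G c \<and>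
    compactin T C \<and> 0 < \<epsilon> \<and> fell_nbhd G R fs C \<epsilon> \<subseteq> U)"

definition fell_topology :: "'a monoid \<Rightarrow> 'a topology \<Rightarrow> ('a, 'h) rep set set \<Rightarrow> ('a, 'h) rep set topology"
  where "fell_topology G T R = topology (fell_open G T R)"

lemma fell_nbhd_append:
  "fell_nbhd G R (fs @ fs') (C \<union> C') (min \<epsilon> \<epsilon>') \<subseteq> fell_nbhd G R fs C \<epsilon> \<inter> fell_nbhd G R fs' C' \<epsilon>'"
proof
  fix c assume "c \<in> fell_nbhd G R (fs @ fs') (C \<union> C') (min \<epsilon> \<epsilon>')"
  then obtain gs where c: "c \<in> R" and gs: "length gs = length (fs @ fs')"
      "set gs \<subseteq> class_coeff_sums G c"
      "\<And>x i. x \<in> C \<union> C' \<Longrightarrow> i < length (fs @ fs') \<Longrightarrow>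
         cmod (((fs @ fs') ! i) x - (gs ! i) x) < min \<epsilon> \<epsilon>'"
    unfolding fell_nbhd_def by blast
  have "c \<in> fell_nbhd G R fs C \<epsilon>"
  proof -
    have "cmod ((fs ! i) x - (take (length fs) gs ! i) x) < \<epsilon>" if "x \<in> C" "i < length fs" for x i
      using gs(3)[of x i] that by (simp add: nth_append)
    moreover have "length (take (length fs) gs) = length fs" "set (take (length fs) gs) \<subseteq> class_coeff_sums G c"
      using gs(1,2) set_take_subset[of "length fs" gs] by simp_all
    ultimately show ?thesis
      using c unfolding fell_nbhd_def by blast
  qed
  moreover have "c \<in> fell_nbhd G R fs' C' \<epsilon>'"
  proof -
    have "cmod ((fs' ! i) x - (drop (length fs) gs ! i) x) < \<epsilon>'" if "x \<in> C'" "i < length fs'" for x i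
      using gs(1) gs(3)[of x "length fs + i"] that by (simp add: nth_append)
    moreover have "length (drop (length fs) gs) = length fs'" "set (drop (length fs) gs) \<subseteq> class_coeff_sums G c"
      using gs(1,2) set_drop_subset[of "length fs" gs] by simp_all
    ultimately show ?thesis
      using c unfolding fell_nbhd_def by blast
  qed
  ultimately show "c \<in> fell_nbhd G R fs C \<epsilon> \<inter> fell_nbhd G R fs' C' \<epsilon>'" by blast
qed

lemma istopology_fell_open: "istopology (fell_open G T R)"
  unfolding istopology_def
proof (intro conjI allI impI)
  fix U V assume U: "fell_open G T R U" and V: "fell_open G T R V"
  show "fell_open G T R (U \<inter> V)"
    unfolding fell_open_def
  proof (intro conjI ballI)
    show "U \<inter> V \<subseteq> R" using U by (auto simp: fell_open_def)
    fix c assume c: "c \<in> U \<inter> V"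
    obtain fs C \<epsilon> where 1: "set fs \<subseteq> class_coeff_sums G c" "compactin T C" "0 < \<epsilon>"
        "fell_nbhd G R fs C \<epsilon> \<subseteq> U"
      using U c unfolding fell_open_def by blast
    obtain fs' C' \<epsilon>' where 2: "set fs' \<subseteq> class_coeff_sums G c" "compactin T C'" "0 < \<epsilon>'"
        "fell_nbhd G R fs' C' \<epsilon>' \<subseteq> V"
      using V c unfolding fell_open_def by blast
    have "set (fs @ fs') \<subseteq> class_coeff_sums G c" "compactin T (C \<union> C')" "0 < min \<epsilon> \<epsilon>'"
      using 1 2 by (simp_all add: compactin_Un)
    moreover have "fell_nbhd G R (fs @ fs') (C \<union> C') (min \<epsilon> \<epsilon>') \<subseteq> U \<inter> V"
      using fell_nbhd_append 1(4) 2(4) by blast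
    ultimately show "\<exists>fs C \<epsilon>. set fs \<subseteq> class_coeff_sums G c \<and> compactin T C \<and> 0 < \<epsilon> \<and>
        fell_nbhd G R fs C \<epsilon> \<subseteq> U \<inter> V"
      by blast
  qed
next
  fix \<K> assume K: "\<forall>U\<in>\<K>. fell_open G T R U"
  show "fell_open G T R (\<Union>\<K>)"
    unfolding fell_open_def
  proof (intro conjI ballI)
    show "\<Union>\<K> \<subseteq> R" using K unfolding fell_open_def by blast
    fix c assume "c \<in> \<Union>\<K>"
    then obtain U where UK: "U \<in> \<K>" and cU: "c \<in> U" by (rule UnionE)
    have "fell_open G T R U" using K UK by (rule bspec)
    then obtain fs C \<epsilon> where "set fs \<subseteq> class_coeff_sums G c" "compactin T C" "0 < \<epsilon>"
        "fell_nbhd G R fs C \<epsilon> \<subseteq> U"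
      using cU unfolding fell_open_def by blast
    moreover have "U \<subseteq> \<Union>\<K>" using UK by (rule Union_upper)
    ultimately show "\<exists>fs C \<epsilon>. set fs \<subseteq> class_coeff_sums G c \<and> compactin T C \<and> 0 < \<epsilon> \<and>
        fell_nbhd G R fs C \<epsilon> \<subseteq> \<Union>\<K>"
      by blast
  qed
qed

lemma openin_fell_topology: "openin (fell_topology G T R) U \<longleftrightarrow> fell_open G T R U"
  unfolding fell_topology_def by (simp only: topology_inverse'[OF istopology_fell_open])

end

theory Submission
  imports Defs "HOL-Library.Function_Algebras" "HOL-Complex_Analysis.Great_Picard"
begin

text \<open>On a precompact group, averaging a uniformly continuous function over right translates contracts
  its oscillation, which gives an invariant mean and hence an inner product on the space of uniformly
  continuous functions without reference to a Haar measure of the completion. The finite-dimensional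
  eigenspaces of convolution operators with central kernels are invariant under translation from both sides, and
  the minimal two-sided invariant spaces determine the topology. They are pairwise orthogonal, so if the group is not
  metrizable, there are uncountably many of them. A compact subset \<open>C\<close> of the countable group has
  a separable space of continuous functions, so two different minimal spaces of the same dimension
  have matrix coefficients \<open>\<pi>\<close> and \<open>\<pi>'\<close> that are arbitrarily close on \<open>C\<close>. The matrix entries of
  \<open>\<pi>(x) \<pi>'(x)\<^sup>*\<close> span a left-invariant space without nonzero constants, and the normalized trace of
  this matrix is almost fixed by the translations from \<open>C\<close>. One of its irreducible components is not small and
  hence is, after normalization, an almost invariant vector in a nontrivial irreducible representation.\<close>

section \<open>Uniformly continuous functions and their mean\<close>

text \<open>The obstacle is quantitative. Passing from the normalized trace to one component divides
  the error by a norm that is controlled only in terms of the dimension \<open>n\<close>, so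
  \<open>n\<close> must be fixed before the closeness of the two representations is chosen.
  Uncountability allows this: it survives a pigeonhole on the dimension and then another one on the
  coefficients over \<open>C\<close>.

  Invariance from both sides is what makes different minimal spaces orthogonal. Under left
  translations alone this fails, since equivalent spaces need not be orthogonal. Kernels are central
  so that the eigenspaces inherit both invariances. Nontriviality of the final representation comes
  from its functions having mean zero: a vector fixed by all translations is a constant.

  Countability of the group enters three times: a diagonal subsequence replaces the Arzela-Ascoli
  theorem on the completion, the base points of the pseudometrics that define the topology range
  over a countable set, and every compact subset, being countable, has a countable base.\<close>

context topological_group
begin

text \<open>Translating on both sides at once makes this a bi-invariant condition: it can be moved
  to any base point from the left or from the right, and nearness to the identity is stable under
  inversion.\<close>

definition near :: "('a \<Rightarrow> complex) \<Rightarrow> real \<Rightarrow> 'a \<Rightarrow> 'a \<Rightarrow> bool"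
  where "near f \<epsilon> x y \<longleftrightarrow>
    (\<forall>s\<in>carrier G. \<forall>t\<in>carrier G. cmod (f (s \<otimes> x \<otimes> t) - f (s \<otimes> y \<otimes> t)) \<le> \<epsilon>)"

text \<open>On a precompact group these are, on the carrier, the restrictions of the continuous
  functions on the completion. The completion itself is never constructed.\<close>

definition unif_cont :: "('a \<Rightarrow> complex) \<Rightarrow> bool"
  where "unif_cont f \<longleftrightarrow> (\<forall>\<epsilon>>0. \<exists>N. openin T N \<and> \<one> \<in> N \<and> (\<forall>x\<in>N. near f \<epsilon> x \<one>))"

lemma openin_carrier: "openin T N \<Longrightarrow> x \<in> N \<Longrightarrow> x \<in> carrier G"
  using openin_subset topspace_eq by blast

lemma nearD: "near f \<epsilon> x y \<Longrightarrow> s \<in> carrier G \<Longrightarrow> t \<in> carrier G \<Longrightarrow>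
    cmod (f (s \<otimes> x \<otimes> t) - f (s \<otimes> y \<otimes> t)) \<le> \<epsilon>"
  unfolding near_def by blast

lemma nearD1: "near f \<epsilon> x y \<Longrightarrow> x \<in> carrier G \<Longrightarrow> y \<in> carrier G \<Longrightarrow> cmod (f x - f y) \<le> \<epsilon>"
  using nearD[of f \<epsilon> x y \<one> \<one>] by simp

lemma near_translate:
  assumes "near f \<epsilon> x y" "x \<in> carrier G" "y \<in> carrier G" "a \<in> carrier G" "b \<in> carrier G"
  shows "near f \<epsilon> (a \<otimes> x \<otimes> b) (a \<otimes> y \<otimes> b)"
  unfolding near_def
proof (intro ballI)
  fix s t assume "s \<in> carrier G" "t \<in> carrier G"
  then show "cmod (f (s \<otimes> (a \<otimes> x \<otimes> b) \<otimes> t) - f (s \<otimes> (a \<otimes> y \<otimes> b) \<otimes> t)) \<le> \<epsilon>"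
    using nearD[OF assms(1), of "s \<otimes> a" "b \<otimes> t"] assms(2-) by (simp add: m_assoc)
qed

lemma near_cancel_left:
  assumes "near f \<epsilon> (inv a \<otimes> x) \<one>" "x \<in> carrier G" "a \<in> carrier G"
  shows "near f \<epsilon> x a"
proof -
  have "a \<otimes> (inv a \<otimes> x) = x"
    using assms(2,3) by (simp add: m_assoc[symmetric])
  then show ?thesis
    using near_translate[OF assms(1), of a \<one>] assms by simp
qed

lemma near_cancel_right:
  assumes "near f \<epsilon> x a" "x \<in> carrier G" "a \<in> carrier G"
  shows "near f \<epsilon> (x \<otimes> inv a) \<one>"
  using near_translate[OF assms(1), of \<one> "inv a"] assms by simp

lemma near_sym: "near f \<epsilon> x y \<Longrightarrow> near f \<epsilon> y x"
  unfolding near_def by (simp add: norm_minus_commute)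

lemma near_inv:
  assumes "near f \<epsilon> x \<one>" "x \<in> carrier G"
  shows "near f \<epsilon> (inv x) \<one>"
  using near_translate[OF near_sym[OF assms(1)], of \<one> "inv x"] assms by simp

lemma near_mono: "near f \<epsilon> x y \<Longrightarrow> \<epsilon> \<le> \<epsilon>' \<Longrightarrow> near f \<epsilon>' x y"
  unfolding near_def by (meson order_trans)

lemma near_reflect:
  assumes "near f \<epsilon> x \<one>" "x \<in> carrier G"
  shows "near (\<lambda>x. f (inv x)) \<epsilon> x \<one>"
  unfolding near_def
proof (intro ballI)
  fix s t assume "s \<in> carrier G" "t \<in> carrier G"
  then show "cmod (f (inv (s \<otimes> x \<otimes> t)) - f (inv (s \<otimes> \<one> \<otimes> t))) \<le> \<epsilon>"
    using nearD[OF near_inv[OF assms], of "inv t" "inv s"] assms(2)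
    by (simp add: inv_mult_group m_assoc)
qed

lemma common_nbhd:
  assumes "finite F" "\<And>f. f \<in> F \<Longrightarrow> unif_cont f" "0 < \<delta>"
  shows "\<exists>N. openin T N \<and> \<one> \<in> N \<and> (\<forall>f\<in>F. \<forall>x\<in>N. near f \<delta> x \<one>)"
  using assms(1,2)
proof (induction F)
  case empty
  then show ?case using openin_topspace[of T] topspace_eq by blast
next
  case (insert f F)
  then obtain N where N: "openin T N" "\<one> \<in> N" "\<forall>f\<in>F. \<forall>x\<in>N. near f \<delta> x \<one>" by blast
  obtain N' where N': "openin T N'" "\<one> \<in> N'" "\<forall>x\<in>N'. near f \<delta> x \<one>"
    using insert.prems[of f] assms(3) unfolding unif_cont_def by blast
  show ?case
    by (rule exI[of _ "N \<inter> N'"]) (use N N' in auto)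
qed

text \<open>Hides the neighbourhoods of the identity: a closure property of \<open>unif_cont\<close>
  becomes an estimate at a single point \<open>x\<close>. A finite set of functions is allowed
  because sums and products depend on two of them.\<close>

lemma unif_cont_dominated:
  assumes "\<And>\<epsilon>. 0 < \<epsilon> \<Longrightarrow> \<exists>F \<delta>. finite F \<and> (\<forall>f\<in>F. unif_cont f) \<and> 0 < \<delta> \<and>
      (\<forall>x\<in>carrier G. (\<forall>f\<in>F. near f \<delta> x \<one>) \<longrightarrow> near g \<epsilon> x \<one>)"
  shows "unif_cont g"
  unfolding unif_cont_def
proof (intro allI impI)
  fix \<epsilon> :: real assume "0 < \<epsilon>"
  obtain F \<delta> where F: "finite F" "\<forall>f\<in>F. unif_cont f" "0 < \<delta>"
      "\<forall>x\<in>carrier G. (\<forall>f\<in>F. near f \<delta> x \<one>) \<longrightarrow> near g \<epsilon> x \<one>"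
    using assms[OF \<open>0 < \<epsilon>\<close>] by (elim exE conjE)
  then obtain N where "openin T N" "\<one> \<in> N" "\<forall>f\<in>F. \<forall>x\<in>N. near f \<delta> x \<one>"
    using common_nbhd[OF F(1) _ F(3)] F(2) by auto
  moreover from this have "\<forall>x\<in>N. near g \<epsilon> x \<one>"
    using F(4) openin_carrier by simp
  ultimately show "\<exists>N. openin T N \<and> \<one> \<in> N \<and> (\<forall>x\<in>N. near g \<epsilon> x \<one>)"
    by (intro exI[of _ N]) simp
qed

lemma unif_cont_dominated1:
  assumes "unif_cont f" "\<And>\<epsilon>. 0 < \<epsilon> \<Longrightarrow> \<exists>\<delta>>0. \<forall>x\<in>carrier G. near f \<delta> x \<one> \<longrightarrow> near g \<epsilon> x \<one>"
  shows "unif_cont g"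
proof (rule unif_cont_dominated)
  fix \<epsilon> :: real assume "0 < \<epsilon>"
  then obtain \<delta> where "0 < \<delta>" "\<forall>x\<in>carrier G. near f \<delta> x \<one> \<longrightarrow> near g \<epsilon> x \<one>"
    using assms(2)[of \<epsilon>] by auto
  then show "\<exists>F \<delta>. finite F \<and> (\<forall>f\<in>F. unif_cont f) \<and> 0 < \<delta> \<and>
      (\<forall>x\<in>carrier G. (\<forall>f\<in>F. near f \<delta> x \<one>) \<longrightarrow> near g \<epsilon> x \<one>)"
    using assms(1) by (intro exI[of _ "{f}"] exI[of _ \<delta>]) auto
qed

lemma unif_cont_nearI:
  assumes "unif_cont f" "\<And>\<epsilon> x. x \<in> carrier G \<Longrightarrow> near f \<epsilon> x \<one> \<Longrightarrow> near g \<epsilon> x \<one>"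
  shows "unif_cont g"
  using assms(2) by (intro unif_cont_dominated1[OF assms(1)]) blast

lemma unif_cont_const [simp]: "unif_cont (\<lambda>_. c)"
  unfolding unif_cont_def near_def
  by (intro allI impI exI[of _ "carrier G"]) (use openin_topspace[of T] topspace_eq in auto)

lemma near_add:
  assumes "near f \<delta> x y" "near h \<epsilon> x y"
  shows "near (\<lambda>x. f x + h x) (\<delta> + \<epsilon>) x y"
  unfolding near_def
proof (intro ballI)
  fix s t assume "s \<in> carrier G" "t \<in> carrier G"
  then have "cmod (f (s \<otimes> x \<otimes> t) - f (s \<otimes> y \<otimes> t)) \<le> \<delta>" "cmod (h (s \<otimes> x \<otimes> t) - h (s \<otimes> y \<otimes> t)) \<le> \<epsilon>"
    using nearD[OF assms(1)] nearD[OF assms(2)] by auto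
  then show "cmod (f (s \<otimes> x \<otimes> t) + h (s \<otimes> x \<otimes> t) - (f (s \<otimes> y \<otimes> t) + h (s \<otimes> y \<otimes> t))) \<le> \<delta> + \<epsilon>"
    using norm_triangle_ineq[of "f (s \<otimes> x \<otimes> t) - f (s \<otimes> y \<otimes> t)" "h (s \<otimes> x \<otimes> t) - h (s \<otimes> y \<otimes> t)"]
    by (simp add: algebra_simps)
qed

lemma unif_cont_add:
  assumes "unif_cont f" "unif_cont h"
  shows "unif_cont (\<lambda>x. f x + h x)"
proof (rule unif_cont_dominated)
  fix \<epsilon> :: real assume e: "0 < \<epsilon>"
  show "\<exists>F \<delta>. finite F \<and> (\<forall>f\<in>F. unif_cont f) \<and> 0 < \<delta> \<and>
      (\<forall>x\<in>carrier G. (\<forall>f\<in>F. near f \<delta> x \<one>) \<longrightarrow> near (\<lambda>x. f x + h x) \<epsilon> x \<one>)"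
  proof (intro exI conjI)
    show "\<forall>x\<in>carrier G. (\<forall>f\<in>{f, h}. near f (\<epsilon>/2) x \<one>) \<longrightarrow> near (\<lambda>x. f x + h x) \<epsilon> x \<one>"
      using near_add[of f "\<epsilon>/2" _ \<one> h "\<epsilon>/2"] by simp
  qed (use assms e in auto)
qed

lemma unif_cont_cnj: "unif_cont f \<Longrightarrow> unif_cont (\<lambda>x. cnj (f x))"
  by (erule unif_cont_nearI) (simp add: near_def flip: complex_cnj_diff)

lemma unif_cont_left:
  assumes "unif_cont f" "g \<in> carrier G" shows "unif_cont (\<lambda>x. f (g \<otimes> x))"
proof (rule unif_cont_nearI[OF assms(1)])
  fix \<epsilon> x assume x: "x \<in> carrier G" "near f \<epsilon> x \<one>"
  show "near (\<lambda>x. f (g \<otimes> x)) \<epsilon> x \<one>"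
    unfolding near_def
  proof (intro ballI)
    fix s t assume "s \<in> carrier G" "t \<in> carrier G"
    then show "cmod (f (g \<otimes> (s \<otimes> x \<otimes> t)) - f (g \<otimes> (s \<otimes> \<one> \<otimes> t))) \<le> \<epsilon>"
      using nearD[OF x(2), of "g \<otimes> s" t] x(1) assms(2) by (simp add: m_assoc)
  qed
qed

lemma unif_cont_right:
  assumes "unif_cont f" "g \<in> carrier G" shows "unif_cont (\<lambda>x. f (x \<otimes> g))"
proof (rule unif_cont_nearI[OF assms(1)])
  fix \<epsilon> x assume x: "x \<in> carrier G" "near f \<epsilon> x \<one>"
  show "near (\<lambda>x. f (x \<otimes> g)) \<epsilon> x \<one>"
    unfolding near_def
  proof (intro ballI)
    fix s t assume "s \<in> carrier G" "t \<in> carrier G"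
    then show "cmod (f (s \<otimes> x \<otimes> t \<otimes> g) - f (s \<otimes> \<one> \<otimes> t \<otimes> g)) \<le> \<epsilon>"
      using nearD[OF x(2), of s "t \<otimes> g"] x(1) assms(2) by (simp add: m_assoc)
  qed
qed

lemma unif_cont_reflect: "unif_cont f \<Longrightarrow> unif_cont (\<lambda>x. f (inv x))"
  by (erule unif_cont_nearI) (rule near_reflect)

lemma unif_cont_cong:
  assumes "unif_cont f" "\<And>x. x \<in> carrier G \<Longrightarrow> f x = h x"
  shows "unif_cont h"
  by (rule unif_cont_nearI[OF assms(1)]) (use assms(2) in \<open>auto simp: near_def\<close>)

lemma translate_open:
  assumes "openin T U" "a \<in> carrier G"
  shows "openin T {x \<in> carrier G. a \<otimes> x \<in> U}"
proof -
  have "continuous_map T (prod_topology T T) (\<lambda>y. (a, y))"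
    using assms(2) topspace_eq by (simp add: continuous_map_pairedI)
  from continuous_map_compose[OF this continuous_mult] have "continuous_map T T (\<lambda>y. a \<otimes> y)" by (simp add: o_def)
  from openin_continuous_map_preimage[OF this assms(1)] show ?thesis by (simp only: topspace_eq)
qed

lemma unif_cont_continuous:
  assumes "unif_cont f" shows "continuous_map T euclidean f"
proof -
  have "\<forall>x\<in>topspace T. \<forall>\<epsilon>>0. \<exists>U. openin T U \<and> x \<in> U \<and> (\<forall>y\<in>U. f y \<in> ball (f x) \<epsilon>)"
  proof (intro ballI allI impI)
    fix x and \<epsilon> :: real assume x: "x \<in> topspace T" and e: "0 < \<epsilon>"
    then have xG: "x \<in> carrier G" using topspace_eq by simp
    obtain N where N: "openin T N" "\<one> \<in> N" "\<forall>y\<in>N. near f (\<epsilon>/2) y \<one>"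
      using assms e unfolding unif_cont_def by (meson half_gt_zero)
    have "openin T {y \<in> topspace T. inv x \<otimes> y \<in> N}"
      using translate_open[OF N(1), of "inv x"] xG topspace_eq by simp
    moreover have "x \<in> {y \<in> topspace T. inv x \<otimes> y \<in> N}" using x xG N(2) by simp
    moreover have "f y \<in> ball (f x) \<epsilon>" if "y \<in> {y \<in> topspace T. inv x \<otimes> y \<in> N}" for y
    proof -
      have "y \<in> carrier G" "near f (\<epsilon>/2) (inv x \<otimes> y) \<one>" using that N(3) topspace_eq by auto
      then have "cmod (f y - f x) \<le> \<epsilon>/2"
        using nearD1[OF near_cancel_left] xG by blast
      then show ?thesis using e by (simp add: dist_norm norm_minus_commute)
    qed
    ultimately show "\<exists>U. openin T U \<and> x \<in> U \<and> (\<forall>y\<in>U. f y \<in> ball (f x) \<epsilon>)" by blast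
  qed
  then show ?thesis
    unfolding mtopology_is_euclidean[symmetric] Met_TC.continuous_map_to_metric by simp
qed

section \<open>Averages over translates and their oscillation\<close>

definition avg_family :: "nat set \<Rightarrow> (nat \<Rightarrow> 'a) \<Rightarrow> bool"
  where "avg_family I b \<longleftrightarrow> finite I \<and> I \<noteq> {} \<and> b ` I \<subseteq> carrier G"

text \<open>The points are indexed by numbers instead of forming a set, since composing two averages
  may produce the same point several times.\<close>

definition ravg :: "nat set \<Rightarrow> (nat \<Rightarrow> 'a) \<Rightarrow> ('a \<Rightarrow> complex) \<Rightarrow> 'a \<Rightarrow> complex"
  where "ravg I b f x = (\<Sum>i\<in>I. f (x \<otimes> b i)) / of_nat (card I)"

definition lavg :: "nat set \<Rightarrow> (nat \<Rightarrow> 'a) \<Rightarrow> ('a \<Rightarrow> complex) \<Rightarrow> 'a \<Rightarrow> complex"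
  where "lavg I b f x = (\<Sum>i\<in>I. f (b i \<otimes> x)) / of_nat (card I)"

definition osc_le :: "('a \<Rightarrow> complex) \<Rightarrow> real \<Rightarrow> bool"
  where "osc_le f D \<longleftrightarrow> (\<forall>x\<in>carrier G. \<forall>y\<in>carrier G. cmod (f x - f y) \<le> D)"

lemma avg_bound:
  assumes "avg_family I b" "\<And>i. i \<in> I \<Longrightarrow> cmod (u i - c) \<le> \<epsilon>"
  shows "cmod ((\<Sum>i\<in>I. u i) / of_nat (card I) - c) \<le> \<epsilon>"
proof -
  have I: "finite I" "card I > 0" "I \<noteq> {}" using assms(1) by (auto simp: avg_family_def card_gt_0_iff)
  have "(\<Sum>i\<in>I. u i) / of_nat (card I) - c = (\<Sum>i\<in>I. u i - c) / of_nat (card I)"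
    using I by (simp add: sum_subtractf diff_divide_distrib)
  also have "cmod \<dots> \<le> (\<Sum>i\<in>I. cmod (u i - c)) / card I"
    by (simp add: norm_divide divide_right_mono norm_sum)
  also have "\<dots> \<le> (\<Sum>i\<in>I. \<epsilon>) / card I"
    using assms(2) by (intro divide_right_mono sum_mono) auto
  also have "\<dots> = \<epsilon>" using I by simp
  finally show ?thesis .
qed

lemma avg_bound2:
  assumes "avg_family I b" "\<And>i. i \<in> I \<Longrightarrow> cmod (u i - v i) \<le> \<epsilon>"
  shows "cmod ((\<Sum>i\<in>I. u i) / of_nat (card I) - (\<Sum>i\<in>I. v i) / of_nat (card I)) \<le> \<epsilon>"
  using avg_bound[OF assms(1), of "\<lambda>i. u i - v i" 0 \<epsilon>] assms(2)
  by (simp add: sum_subtractf diff_divide_distrib)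

lemma near_ravg:
  assumes "avg_family I b" "near f \<epsilon> x y" "x \<in> carrier G" "y \<in> carrier G"
  shows "near (ravg I b f) \<epsilon> x y"
  unfolding near_def ravg_def
proof (intro ballI avg_bound2[OF assms(1)])
  fix s t i assume "s \<in> carrier G" "t \<in> carrier G" "i \<in> I"
  moreover from this have "b i \<in> carrier G" using assms(1) by (auto simp: avg_family_def)
  ultimately show "cmod (f (s \<otimes> x \<otimes> t \<otimes> b i) - f (s \<otimes> y \<otimes> t \<otimes> b i)) \<le> \<epsilon>"
    using nearD[OF assms(2), of s "t \<otimes> b i"] assms(3,4) by (simp add: m_assoc)
qed

text \<open>The new points are the products \<open>c j \<otimes> b i\<close>, with the pair of
  indices coded as one number. A contraction repeated finitely often is therefore again a single
  average.\<close>

lemma ravg_comp: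
  assumes "avg_family I b" "avg_family J c"
  obtains K d where "avg_family K d"
    "\<And>f x. x \<in> carrier G \<Longrightarrow> ravg K d f x = ravg J c (ravg I b f) x"
proof
  define K where "K = prod_encode ` (J \<times> I)"
  define d where "d k = (case prod_decode k of (j, i) \<Rightarrow> c j \<otimes> b i)" for k
  have fin: "finite I" "finite J" "I \<noteq> {}" "J \<noteq> {}" and car: "\<And>i. i \<in> I \<Longrightarrow> b i \<in> carrier G"
      "\<And>j. j \<in> J \<Longrightarrow> c j \<in> carrier G"
    using assms by (auto simp: avg_family_def)
  show "avg_family K d"
    using fin car by (auto simp: avg_family_def K_def d_def)
  fix f :: "'a \<Rightarrow> complex" and x assume x: "x \<in> carrier G"
  have cK: "card K = card J * card I"
    unfolding K_def by (simp add: card_image inj_prod_encode card_cartesian_product)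
  have "(\<Sum>k\<in>K. f (x \<otimes> d k)) = (\<Sum>p\<in>J \<times> I. f (x \<otimes> d (prod_encode p)))"
    unfolding K_def by (simp add: sum.reindex inj_prod_encode)
  also have "\<dots> = (\<Sum>j\<in>J. \<Sum>i\<in>I. f (x \<otimes> c j \<otimes> b i))"
    using x car by (auto simp: d_def sum.cartesian_product m_assoc intro!: sum.cong)
  finally show "ravg K d f x = ravg J c (ravg I b f) x"
    using x car by (simp add: ravg_def cK sum_divide_distrib mult.commute)
qed

text \<open>Left and right translations commute. This is what forces the limits of the two kinds of
  average to agree.\<close>

lemma ravg_lavg_commute:
  assumes "avg_family I b" "avg_family J c" "x \<in> carrier G"
  shows "ravg I b (lavg J c f) x = lavg J c (ravg I b f) x"
proof -
  have car: "\<And>i. i \<in> I \<Longrightarrow> b i \<in> carrier G" "\<And>j. j \<in> J \<Longrightarrow> c j \<in> carrier G"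
    using assms by (auto simp: avg_family_def)
  have "(\<Sum>i\<in>I. \<Sum>j\<in>J. f (c j \<otimes> (x \<otimes> b i))) = (\<Sum>j\<in>J. \<Sum>i\<in>I. f (c j \<otimes> x \<otimes> b i))"
    using car assms(3) by (subst sum.swap) (auto simp: m_assoc intro!: sum.cong)
  then show ?thesis
    by (simp add: ravg_def lavg_def sum_divide_distrib[symmetric] mult.commute)
qed

text \<open>Inversion turns a left average of \<open>f\<close> into a right average of the reflected
  function, so the contraction has to be proved on one side only.\<close>

lemma lavg_eq_ravg:
  assumes "avg_family I b" "x \<in> carrier G"
  shows "lavg I (\<lambda>i. inv (b i)) f x = ravg I b (\<lambda>x. f (inv x)) (inv x)"
proof -
  have "\<And>i. i \<in> I \<Longrightarrow> b i \<in> carrier G" using assms by (auto simp: avg_family_def)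
  then show ?thesis
    using assms(2) by (auto simp: lavg_def ravg_def inv_mult_group intro!: sum.cong arg_cong2[where f="(/)"])
qed

end

text \<open>Total boundedness is all that the mean, the inner product and the self-adjointness of
  convolution take from the compact group.\<close>

locale totally_bounded_group = topological_group G T for G :: "'a monoid" (structure) and T +
  assumes finite_cover: "\<lbrakk>openin T N; \<one> \<in> N\<rbrakk> \<Longrightarrow>
    \<exists>A. finite A \<and> A \<subseteq> carrier G \<and> (\<forall>x\<in>carrier G. \<exists>a\<in>A. inv a \<otimes> x \<in> N)"
begin

text \<open>If \<open>a\<^sub>1, \<dots>, a\<^sub>n\<close> are the centres of a finite cover by translates of \<open>N\<close>, then for any \<open>x\<close>, \<open>y\<close>
  one of the points \<open>x a\<^sub>i\<^sup>-\<^sup>1\<close> and one of the points \<open>y a\<^sub>j\<^sup>-\<^sup>1\<close> are both close to the identity, so averaging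
  over the \<open>a\<^sub>i\<^sup>-\<^sup>1\<close> contracts the oscillation.\<close>

lemma ravg_contraction:
  assumes "openin T N" "\<one> \<in> N" "0 < \<epsilon>"
  shows "\<exists>n I b. avg_family I b \<and> 0 < (n::nat) \<and>
    (\<forall>f D. (\<forall>x\<in>N. near f \<epsilon> x \<one>) \<longrightarrow> osc_le f D \<longrightarrow>
       osc_le (ravg I b f) ((1 - 1 / n) * D + 2 * \<epsilon> / n))"
proof -
  obtain A where A: "finite A" "A \<subseteq> carrier G" "\<forall>x\<in>carrier G. \<exists>a\<in>A. inv a \<otimes> x \<in> N"
    using finite_cover[OF assms(1,2)] by blast
  define n where "n = card A"
  obtain h where h: "bij_betw h {..<n} A"
    using ex_bij_betw_nat_finite[OF A(1)] unfolding n_def atLeast0LessThan by blast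
  define b where "b i = inv (h i)" for i
  have hA: "i < n \<Longrightarrow> h i \<in> A" for i using h by (auto simp: bij_betw_def)
  have bG: "i < n \<Longrightarrow> b i \<in> carrier G" "i < n \<Longrightarrow> h i \<in> carrier G" for i
    using hA A(2) by (auto simp: b_def)
  have "A \<noteq> {}" using A(3) one_closed by blast
  then have n: "0 < n" using A(1) by (simp add: n_def card_gt_0_iff)
  then have fam: "avg_family {..<n} b" using bG(1) by (auto simp: avg_family_def)
  moreover have "osc_le (ravg {..<n} b f) ((1 - 1 / n) * D + 2 * \<epsilon> / n)"
    if near: "\<forall>x\<in>N. near f \<epsilon> x \<one>" and osc: "osc_le f D" for f D
    unfolding osc_le_def
  proof (intro ballI)
    fix x y assume x: "x \<in> carrier G" and y: "y \<in> carrier G"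
    have *: "\<exists>i<n. cmod (f (z \<otimes> b i) - f \<one>) \<le> \<epsilon>" if z: "z \<in> carrier G" for z
    proof -
      obtain a where a: "a \<in> A" "inv a \<otimes> z \<in> N" using A(3) z by blast
      then have "a \<in> h ` {..<n}" using h by (simp add: bij_betw_def)
      then obtain i where i: "i < n" "a = h i" by auto
      have "near f \<epsilon> (z \<otimes> inv a) \<one>"
        using near_cancel_right[OF near_cancel_left[OF near[rule_format, OF a(2)]]] z bG(2)[OF i(1)] i(2) by simp
      then show ?thesis
        using nearD1[of f \<epsilon> "z \<otimes> inv a" \<one>] i z bG(1)[OF i(1)] by (auto simp: b_def)
    qed
    obtain i where i: "i < n" "cmod (f (x \<otimes> b i) - f \<one>) \<le> \<epsilon>" using *[OF x] by blast
    obtain j where j: "j < n" "cmod (f (y \<otimes> b j) - f \<one>) \<le> \<epsilon>" using *[OF y] by blast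
    \<comment> \<open>Reindexing the second sum by this transposition pairs the term of
      \<open>x\<close> that is close to \<open>f \<one>\<close> with the term of \<open>y\<close>
      that is close to it. This pair contributes at most 2\<epsilon>, every other pair at most
      \<open>D\<close>.\<close>
    let ?\<tau> = "Transposition.transpose i j"
    have perm: "bij_betw ?\<tau> {..<n} {..<n}"
      using i(1) j(1) by simp
    then have \<tau>: "?\<tau> k < n" if "k < n" for k using that bij_betwE by blast
    have "(\<Sum>k<n. f (y \<otimes> b k)) = (\<Sum>k<n. f (y \<otimes> b (?\<tau> k)))"
      using sum.reindex_bij_betw[OF perm, of "\<lambda>k. f (y \<otimes> b k)"] by simp
    then have "ravg {..<n} b f x - ravg {..<n} b f y
        = (\<Sum>k<n. f (x \<otimes> b k) - f (y \<otimes> b (?\<tau> k))) / of_nat n"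
      by (simp add: ravg_def sum_subtractf diff_divide_distrib)
    also have "cmod \<dots> \<le> (\<Sum>k<n. cmod (f (x \<otimes> b k) - f (y \<otimes> b (?\<tau> k)))) / n"
      by (simp add: norm_divide divide_right_mono norm_sum)
    also have "\<dots> \<le> (\<Sum>k<n. if k = i then 2 * \<epsilon> else D) / n"
    proof (intro divide_right_mono sum_mono)
      fix k assume "k \<in> {..<n}"
      then have k: "k < n" by simp
      show "cmod (f (x \<otimes> b k) - f (y \<otimes> b (?\<tau> k))) \<le> (if k = i then 2 * \<epsilon> else D)"
      proof (cases "k = i")
        case True
        have "cmod (f (x \<otimes> b i) - f (y \<otimes> b j)) \<le> cmod (f (x \<otimes> b i) - f \<one>) + cmod (f (y \<otimes> b j) - f \<one>)"
          using norm_triangle_ineq4[of "f (x \<otimes> b i) - f \<one>" "f (y \<otimes> b j) - f \<one>"] by simp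
        then show ?thesis using True i(2) j(2) by simp
      next
        case False
        then show ?thesis using osc x y bG(1)[OF k] bG(1)[OF \<tau>[OF k]] by (simp add: osc_le_def)
      qed
    qed simp
    also have "(\<Sum>k<n. if k = i then 2 * \<epsilon> else D) = 2 * \<epsilon> + (real n - 1) * D"
    proof -
      have "(\<Sum>k<n. if k = i then 2 * \<epsilon> else D) = (\<Sum>k<n. D + (if k = i then 2 * \<epsilon> - D else 0))"
        by (intro sum.cong) auto
      also have "\<dots> = n * D + (2 * \<epsilon> - D)" using i(1) by (simp add: sum.distrib)
      finally show ?thesis by (simp add: algebra_simps)
    qed
    also have "(2 * \<epsilon> + (real n - 1) * D) / n = (1 - 1 / n) * D + 2 * \<epsilon> / n"
      using n by (simp add: field_simps)
    finally show "cmod (ravg {..<n} b f x - ravg {..<n} b f y) \<le> (1 - 1 / n) * D + 2 * \<epsilon> / n" .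
  qed
  ultimately show ?thesis using n by (intro exI[of _ n] exI[of _ "{..<n}"] exI[of _ b]) simp
qed

text \<open>One contraction replaces a bound D by q D + 2\<epsilon>/n with q = 1 - 1/n. This map has
  the fixed point 2\<epsilon>, and iterating it comes within \<epsilon> of that point. One family
  serves all functions with a common neighbourhood and a common oscillation bound; the linearity of
  the mean and the interchange of two means rest on this uniformity.\<close>

lemma ravg_small_osc:
  assumes N: "openin T N" "\<one> \<in> N" and e: "0 < \<epsilon>"
  shows "\<exists>I b. avg_family I b \<and>
    (\<forall>f. (\<forall>x\<in>N. near f \<epsilon> x \<one>) \<longrightarrow> osc_le f D \<longrightarrow> osc_le (ravg I b f) (3 * \<epsilon>))"
proof -
  obtain n J c where n: "avg_family J c" "0 < (n::nat)"
    "\<And>f D. \<forall>x\<in>N. near f \<epsilon> x \<one> \<Longrightarrow> osc_le f D \<Longrightarrow>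
       osc_le (ravg J c f) ((1 - 1 / n) * D + 2 * \<epsilon> / n)"
    using ravg_contraction[OF assms] by auto
  define q where "q = 1 - 1 / real n"
  have q: "0 \<le> q" "q < 1" using n(2) by (auto simp: q_def)
  have iter: "\<exists>I b. avg_family I b \<and> (\<forall>f. (\<forall>x\<in>N. near f \<epsilon> x \<one>) \<longrightarrow> osc_le f D \<longrightarrow>
      osc_le (ravg I b f) (q ^ k * \<bar>D\<bar> + 2 * \<epsilon>))" for k
  proof (induction k)
    case 0
    have "osc_le (ravg {0} (\<lambda>_. \<one>) f) (\<bar>D\<bar> + 2 * \<epsilon>)" if f: "osc_le f D" for f
      unfolding osc_le_def
    proof (intro ballI)
      fix x y assume "x \<in> carrier G" "y \<in> carrier G"
      then show "cmod (ravg {0} (\<lambda>_. \<one>) f x - ravg {0} (\<lambda>_. \<one>) f y) \<le> \<bar>D\<bar> + 2 * \<epsilon>"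
        using f e unfolding osc_le_def ravg_def by force
    qed
    then show ?case by (intro exI[of _ "{0}"] exI[of _ "\<lambda>_. \<one>"]) (auto simp: avg_family_def)
  next
    case (Suc k)
    then obtain I b where I: "avg_family I b" "\<And>f. (\<forall>x\<in>N. near f \<epsilon> x \<one>) \<Longrightarrow> osc_le f D \<Longrightarrow>
      osc_le (ravg I b f) (q ^ k * \<bar>D\<bar> + 2 * \<epsilon>)" by blast
    obtain K d where K: "avg_family K d"
        "\<And>f x. x \<in> carrier G \<Longrightarrow> ravg K d f x = ravg J c (ravg I b f) x"
      by (rule ravg_comp[OF I(1) n(1)]) (rule that)
    have "osc_le (ravg K d f) (q ^ Suc k * \<bar>D\<bar> + 2 * \<epsilon>)" if f: "\<forall>x\<in>N. near f \<epsilon> x \<one>" "osc_le f D" for f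
    proof -
      have "osc_le (ravg J c (ravg I b f)) (q * (q ^ k * \<bar>D\<bar> + 2 * \<epsilon>) + 2 * \<epsilon> / n)"
        unfolding q_def[of]
        by (rule n(3)) (use f N I near_ravg openin_carrier in \<open>auto simp: q_def\<close>)
      also have "q * (q ^ k * \<bar>D\<bar> + 2 * \<epsilon>) + 2 * \<epsilon> / n = q ^ Suc k * \<bar>D\<bar> + 2 * \<epsilon>"
        by (simp add: q_def algebra_simps)
      finally show ?thesis using K(2) by (simp add: osc_le_def)
    qed
    then show ?case using K(1) by blast
  qed
  obtain k where k: "q ^ k * \<bar>D\<bar> \<le> \<epsilon>"
  proof -
    have "(\<lambda>k. q ^ k * \<bar>D\<bar>) \<longlonglongrightarrow> 0 * \<bar>D\<bar>"
      using q by (intro tendsto_mult LIMSEQ_power_zero) auto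
    then have "\<forall>\<^sub>F k in sequentially. q ^ k * \<bar>D\<bar> < \<epsilon>"
      using e by (intro order_tendstoD(2)[of _ "0 * \<bar>D\<bar>"]) auto
    then show ?thesis using that by (meson eventually_sequentially less_imp_le order_refl)
  qed
  obtain I b where I: "avg_family I b" "\<And>f. (\<forall>x\<in>N. near f \<epsilon> x \<one>) \<Longrightarrow> osc_le f D \<Longrightarrow>
      osc_le (ravg I b f) (q ^ k * \<bar>D\<bar> + 2 * \<epsilon>)"
    using iter by blast
  have "osc_le (ravg I b f) (3 * \<epsilon>)" if f: "\<forall>x\<in>N. near f \<epsilon> x \<one>" "osc_le f D" for f
    unfolding osc_le_def
  proof (intro ballI)
    fix x y assume "x \<in> carrier G" "y \<in> carrier G"
    then have "cmod (ravg I b f x - ravg I b f y) \<le> q ^ k * \<bar>D\<bar> + 2 * \<epsilon>"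
      using I(2)[OF f] unfolding osc_le_def by blast
    then show "cmod (ravg I b f x - ravg I b f y) \<le> 3 * \<epsilon>" using k by linarith
  qed
  then show ?thesis using I(1) by blast
qed

end

lemma eq_if_close:
  fixes a b :: "'b :: real_normed_vector"
  assumes "\<And>\<epsilon>. 0 < \<epsilon> \<Longrightarrow> norm (a - b) \<le> K * \<epsilon>"
  shows "a = b"
proof (rule ccontr)
  assume "a \<noteq> b"
  then have d: "0 < norm (a - b)" by simp
  have "norm (a - b) \<le> K * (norm (a - b) / (2 * (\<bar>K\<bar> + 1)))" using d by (intro assms) auto
  also have "\<dots> \<le> (\<bar>K\<bar> + 1) * (norm (a - b) / (2 * (\<bar>K\<bar> + 1)))"
    by (intro mult_right_mono) auto
  also have "\<dots> = norm (a - b) / 2" by (simp add: field_simps)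
  finally show False using d by simp
qed

section \<open>Existence of the invariant mean\<close>

context totally_bounded_group
begin

lemma unif_contI:
  assumes "\<And>\<epsilon>. 0 < \<epsilon> \<Longrightarrow> \<exists>N. openin T N \<and> \<one> \<in> N \<and> (\<forall>x\<in>N. near f \<epsilon> x \<one>)"
  shows "unif_cont f"
  unfolding unif_cont_def by (intro allI impI assms)

lemma unif_cont_bounded:
  assumes "unif_cont f"
  shows "\<exists>B\<ge>0. \<forall>x\<in>carrier G. cmod (f x) \<le> B"
proof -
  obtain N where N: "openin T N" "\<one> \<in> N" "\<forall>x\<in>N. near f 1 x \<one>"
    using assms unfolding unif_cont_def by (meson zero_less_one)
  obtain A where A: "finite A" "A \<subseteq> carrier G" "\<forall>x\<in>carrier G. \<exists>a\<in>A. inv a \<otimes> x \<in> N"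
    using finite_cover[OF N(1,2)] by blast
  have "cmod (f x) \<le> 1 + (\<Sum>a\<in>A. cmod (f a))" if x: "x \<in> carrier G" for x
  proof -
    obtain a where a: "a \<in> A" "inv a \<otimes> x \<in> N" using A(3) x by blast
    then have aG: "a \<in> carrier G" using A(2) by blast
    have "near f 1 x a" using near_cancel_left[OF N(3)[rule_format, OF a(2)] x aG] .
    then have "cmod (f x - f a) \<le> 1" using nearD1 x aG by blast
    moreover have "cmod (f a) \<le> (\<Sum>a\<in>A. cmod (f a))" using A(1) a(1) by (intro member_le_sum) auto
    ultimately show ?thesis using norm_triangle_ineq2[of "f x" "f a"] by linarith
  qed
  then show ?thesis by (intro exI[of _ "1 + (\<Sum>a\<in>A. cmod (f a))"]) (simp add: sum_nonneg)
qed

lemma osc_leI: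
  assumes "\<And>x. x \<in> carrier G \<Longrightarrow> cmod (f x) \<le> B"
  shows "osc_le f (2 * B)"
  unfolding osc_le_def
proof (intro ballI)
  fix x y assume "x \<in> carrier G" "y \<in> carrier G"
  then show "cmod (f x - f y) \<le> 2 * B"
    using assms[of x] assms[of y] norm_triangle_ineq4[of "f x" "f y"] by linarith
qed

lemma ravg_ex:
  assumes "unif_cont f" "0 < \<epsilon>"
  shows "\<exists>I b. avg_family I b \<and> osc_le (ravg I b f) \<epsilon>"
proof -
  obtain B where "0 \<le> B" "\<And>x. x \<in> carrier G \<Longrightarrow> cmod (f x) \<le> B"
    using unif_cont_bounded[OF assms(1)] by auto
  then have D: "osc_le f (2 * B)" by (intro osc_leI)
  have e: "0 < \<epsilon> / 3" using assms(2) by simp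
  then obtain N where N: "openin T N" "\<one> \<in> N" "\<forall>x\<in>N. near f (\<epsilon> / 3) x \<one>"
    using assms(1) unfolding unif_cont_def by blast
  show ?thesis using ravg_small_osc[OF N(1,2) e, of "2 * B"] D N(3) by auto
qed

lemma lavg_ex:
  assumes "unif_cont f" "0 < \<epsilon>"
  shows "\<exists>I b. avg_family I b \<and> osc_le (lavg I b f) \<epsilon>"
proof -
  obtain I b where b: "avg_family I b" "osc_le (ravg I b (\<lambda>x. f (inv x))) \<epsilon>"
    using ravg_ex[OF unif_cont_reflect[OF assms(1)] assms(2)] by blast
  have "osc_le (lavg I (\<lambda>i. inv (b i)) f) \<epsilon>"
    using b(2) unfolding osc_le_def by (simp add: lavg_eq_ravg[OF b(1)])
  moreover have "avg_family I (\<lambda>i. inv (b i))" using b(1) by (auto simp: avg_family_def)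
  ultimately show ?thesis by blast
qed

text \<open>The double average, taken in either order, is the same number. As a left average of a
  nearly constant right average it is within \<epsilon> of the latter, and symmetrically within
  \<delta> of the left average.\<close>

lemma ravg_lavg_close:
  assumes R: "avg_family I b" "osc_le (ravg I b f) \<epsilon>"
    and L: "avg_family J c" "osc_le (lavg J c f) \<delta>"
    and x: "x \<in> carrier G" and y: "y \<in> carrier G"
  shows "cmod (ravg I b f x - lavg J c f y) \<le> \<epsilon> + \<delta>"
proof -
  have car: "\<And>i. i \<in> I \<Longrightarrow> b i \<in> carrier G" "\<And>j. j \<in> J \<Longrightarrow> c j \<in> carrier G"
    using R(1) L(1) by (auto simp: avg_family_def)
  have "cmod (lavg J c (ravg I b f) \<one> - ravg I b f x) \<le> \<epsilon>"
    unfolding lavg_def[of J c "ravg I b f"]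
    by (intro avg_bound[OF L(1)]) (use R(2) x car in \<open>auto simp: osc_le_def\<close>)
  moreover have "cmod (ravg I b (lavg J c f) \<one> - lavg J c f y) \<le> \<delta>"
    unfolding ravg_def[of I b "lavg J c f"]
    by (intro avg_bound[OF R(1)]) (use L(2) y car in \<open>auto simp: osc_le_def\<close>)
  ultimately show ?thesis
    using ravg_lavg_commute[OF R(1) L(1) one_closed, of f]
      norm_triangle_ineq4[of "lavg J c (ravg I b f) \<one> - lavg J c f y" "lavg J c (ravg I b f) \<one> - ravg I b f x"]
    by simp
qed

text \<open>Both kinds of average must approximate the same number: right averages will give
  invariance of the mean under left translations, left averages invariance under right
  translations.\<close>

definition is_mean :: "('a \<Rightarrow> complex) \<Rightarrow> complex \<Rightarrow> bool"
  where "is_mean f c \<longleftrightarrow>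
    (\<forall>I b \<epsilon>. avg_family I b \<longrightarrow> osc_le (ravg I b f) \<epsilon> \<longrightarrow> (\<forall>x\<in>carrier G. cmod (ravg I b f x - c) \<le> \<epsilon>)) \<and>
    (\<forall>I b \<epsilon>. avg_family I b \<longrightarrow> osc_le (lavg I b f) \<epsilon> \<longrightarrow> (\<forall>x\<in>carrier G. cmod (lavg I b f x - c) \<le> \<epsilon>))"

definition mean :: "('a \<Rightarrow> complex) \<Rightarrow> complex"
  where "mean f = (SOME c. is_mean f c)"

text \<open>Two right averages are never compared directly. Each is close to every nearly constant
  left average, which makes a sequence of ever flatter right averages Cauchy and identifies its
  limit with that of the left averages.\<close>

lemma is_mean_ex:
  assumes f: "unif_cont f"
  shows "\<exists>c. is_mean f c"
proof -
  have "\<forall>n. \<exists>p. avg_family (fst p) (snd p) \<and> osc_le (ravg (fst p) (snd p) f) (1 / real (Suc n))"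
    using ravg_ex[OF f] by simp
  then obtain pr where pr: "\<forall>n. avg_family (fst (pr n)) (snd (pr n)) \<and>
      osc_le (ravg (fst (pr n)) (snd (pr n)) f) (1 / real (Suc n))"
    by (rule choice[THEN exE])
  define I b where "I n = fst (pr n)" and "b n = snd (pr n)" for n
  have R: "avg_family (I n) (b n)" "osc_le (ravg (I n) (b n) f) (1 / real (Suc n))" for n
    using pr unfolding I_def b_def by blast+
  have "\<forall>n. \<exists>p. avg_family (fst p) (snd p) \<and> osc_le (lavg (fst p) (snd p) f) (1 / real (Suc n))"
    using lavg_ex[OF f] by simp
  then obtain pl where pl: "\<forall>n. avg_family (fst (pl n)) (snd (pl n)) \<and>
      osc_le (lavg (fst (pl n)) (snd (pl n)) f) (1 / real (Suc n))"
    by (rule choice[THEN exE])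
  define J c where "J n = fst (pl n)" and "c n = snd (pl n)" for n
  have L: "avg_family (J n) (c n)" "osc_le (lavg (J n) (c n) f) (1 / real (Suc n))" for n
    using pl unfolding J_def c_def by blast+
  define s where "s n = ravg (I n) (b n) f \<one>" for n
  define l where "l n = lavg (J n) (c n) f \<one>" for n
  have sl: "cmod (s n - l k) \<le> 1 / real (Suc n) + 1 / real (Suc k)" for n k
    unfolding s_def l_def using ravg_lavg_close[OF R L] by simp
  have lim0: "(\<lambda>n. 1 / real (Suc n)) \<longlonglongrightarrow> 0" using LIMSEQ_inverse_real_of_nat by (simp add: field_simps)
  have "Cauchy s"
  proof (rule CauchyI)
    fix e :: real assume "0 < e"
    then have "\<forall>\<^sub>F n in sequentially. 1 / real (Suc n) < e / 4"
      using order_tendstoD(2)[OF lim0, of "e / 4"] by simp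
    then obtain M where M: "1 / real (Suc M) < e / 4" unfolding eventually_sequentially by blast
    have "cmod (s m - s n) < e" if "m \<ge> M" "n \<ge> M" for m n
    proof -
      have "1 / real (Suc m) \<le> 1 / real (Suc M)" "1 / real (Suc n) \<le> 1 / real (Suc M)"
        using that by (auto simp: frac_le)
      then show ?thesis
        using sl[of m M] sl[of n M] M norm_triangle_ineq4[of "s m - l M" "s n - l M"] by simp
    qed
    then show "\<exists>M. \<forall>m\<ge>M. \<forall>n\<ge>M. norm (s m - s n) < e" by blast
  qed
  then obtain z where z: "s \<longlonglongrightarrow> z" using Cauchy_convergent convergent_def by blast
  have Lz: "cmod (lavg K d f x - z) \<le> \<epsilon>" if "avg_family K d" "osc_le (lavg K d f) \<epsilon>" "x \<in> carrier G" for K d \<epsilon> x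
  proof (rule LIMSEQ_le)
    show "(\<lambda>n. cmod (lavg K d f x - s n)) \<longlonglongrightarrow> cmod (lavg K d f x - z)" by (intro tendsto_intros z)
    show "(\<lambda>n. 1 / real (Suc n) + \<epsilon>) \<longlonglongrightarrow> \<epsilon>" using tendsto_add[OF lim0 tendsto_const[of \<epsilon>]] by simp
    show "\<exists>N. \<forall>n\<ge>N. cmod (lavg K d f x - s n) \<le> 1 / real (Suc n) + \<epsilon>"
      using ravg_lavg_close[OF R that(1,2) one_closed that(3)] by (simp add: s_def norm_minus_commute)
  qed
  have "l \<longlonglongrightarrow> z"
  proof (rule Lim_transform2[OF tendsto_const[of z]])
    show "(\<lambda>n. z - l n) \<longlonglongrightarrow> 0"
      by (rule Lim_null_comparison[OF _ lim0])
        (use Lz[OF L one_closed] in \<open>simp add: l_def norm_minus_commute\<close>)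
  qed
  have Rz: "cmod (ravg K d f x - z) \<le> \<epsilon>" if "avg_family K d" "osc_le (ravg K d f) \<epsilon>" "x \<in> carrier G" for K d \<epsilon> x
  proof (rule LIMSEQ_le)
    show "(\<lambda>n. cmod (ravg K d f x - l n)) \<longlonglongrightarrow> cmod (ravg K d f x - z)" by (intro tendsto_intros \<open>l \<longlonglongrightarrow> z\<close>)
    show "(\<lambda>n. \<epsilon> + 1 / real (Suc n)) \<longlonglongrightarrow> \<epsilon>" using tendsto_add[OF tendsto_const[of \<epsilon>] lim0] by simp
    show "\<exists>N. \<forall>n\<ge>N. cmod (ravg K d f x - l n) \<le> \<epsilon> + 1 / real (Suc n)"
      using ravg_lavg_close[OF that(1,2) L that(3) one_closed] by (simp add: l_def)
  qed
  show ?thesis using Lz Rz unfolding is_mean_def by blast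
qed

lemma is_mean_mean: "unif_cont f \<Longrightarrow> is_mean f (mean f)"
  unfolding mean_def by (rule someI_ex[OF is_mean_ex])

lemma mean_ravg: "\<lbrakk>unif_cont f; avg_family I b; osc_le (ravg I b f) \<epsilon>; x \<in> carrier G\<rbrakk>
    \<Longrightarrow> cmod (ravg I b f x - mean f) \<le> \<epsilon>"
  using is_mean_mean unfolding is_mean_def by blast

lemma mean_lavg: "\<lbrakk>unif_cont f; avg_family I b; osc_le (lavg I b f) \<epsilon>; x \<in> carrier G\<rbrakk>
    \<Longrightarrow> cmod (lavg I b f x - mean f) \<le> \<epsilon>"
  using is_mean_mean unfolding is_mean_def by blast

text \<open>Equicontinuity and a common oscillation bound let one finite family of translates
  approximate all the means at once. Identities between averages pass to the mean in this
  way.\<close>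

lemma mean_family:
  assumes "\<And>\<epsilon>. 0 < \<epsilon> \<Longrightarrow> \<exists>N. openin T N \<and> \<one> \<in> N \<and> (\<forall>f\<in>F. \<forall>x\<in>N. near f \<epsilon> x \<one>)"
    and "\<And>f. f \<in> F \<Longrightarrow> osc_le f D" and "0 < \<epsilon>"
  shows "\<exists>I b. avg_family I b \<and> (\<forall>f\<in>F. \<forall>x\<in>carrier G. cmod (ravg I b f x - mean f) \<le> \<epsilon>)"
proof -
  have e: "0 < \<epsilon> / 3" using assms(3) by simp
  obtain N where N: "openin T N" "\<one> \<in> N" "\<forall>f\<in>F. \<forall>x\<in>N. near f (\<epsilon> / 3) x \<one>"
    using assms(1)[OF e] by blast
  obtain I b where I: "avg_family I b"
    "\<forall>f. (\<forall>x\<in>N. near f (\<epsilon> / 3) x \<one>) \<longrightarrow> osc_le f D \<longrightarrow> osc_le (ravg I b f) (3 * (\<epsilon> / 3))"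
    using ravg_small_osc[OF N(1,2) e, of D] by (elim exE conjE) (rule that)
  have "cmod (ravg I b f x - mean f) \<le> \<epsilon>" if f: "f \<in> F" and x: "x \<in> carrier G" for f x
  proof (rule mean_ravg[OF _ I(1) _ x])
    show "unif_cont f"
    proof (rule unif_contI)
      fix \<epsilon> :: real assume "0 < \<epsilon>"
      from assms(1)[OF this] show "\<exists>N. openin T N \<and> \<one> \<in> N \<and> (\<forall>x\<in>N. near f \<epsilon> x \<one>)" using f by blast
    qed
    show "osc_le (ravg I b f) \<epsilon>" using I(2) N(3) f assms(2)[OF f] by simp
  qed
  then show ?thesis using I(1) by blast
qed

lemma mean_finite_family:
  assumes "finite F" "\<forall>f\<in>F. unif_cont f" and "0 < \<epsilon>"
  shows "\<exists>I b. avg_family I b \<and> (\<forall>f\<in>F. \<forall>x\<in>carrier G. cmod (ravg I b f x - mean f) \<le> \<epsilon>)"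
proof -
  have "\<exists>D\<ge>0. \<forall>x\<in>carrier G. cmod (f x) \<le> D" if "f \<in> F" for f
    by (rule unif_cont_bounded[OF assms(2)[rule_format, OF that]])
  then have "\<forall>f\<in>F. \<exists>D. 0 \<le> D \<and> (\<forall>x\<in>carrier G. cmod (f x) \<le> D)" by blast
  then obtain B where "\<forall>f\<in>F. 0 \<le> B f \<and> (\<forall>x\<in>carrier G. cmod (f x) \<le> B f)"
    by (rule bchoice[THEN exE])
  then have B: "\<And>f. f \<in> F \<Longrightarrow> 0 \<le> B f" "\<And>f x. f \<in> F \<Longrightarrow> x \<in> carrier G \<Longrightarrow> cmod (f x) \<le> B f"
    by blast+
  show ?thesis
  proof (rule mean_family[OF _ _ assms(3), of _ "2 * sum B F"])
    show "\<exists>N. openin T N \<and> \<one> \<in> N \<and> (\<forall>f\<in>F. \<forall>x\<in>N. near f \<epsilon> x \<one>)" if "0 < \<epsilon>" for \<epsilon>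
      by (rule common_nbhd[OF assms(1) assms(2)[rule_format] that])
    show "osc_le f (2 * sum B F)" if f: "f \<in> F" for f
    proof (rule osc_leI)
      fix x assume x: "x \<in> carrier G"
      have "sum B F = B f + sum B (F - {f})" by (rule sum.remove[OF assms(1) f])
      moreover have "0 \<le> sum B (F - {f})" by (rule sum_nonneg) (use B(1) in blast)
      ultimately have "B f \<le> sum B F" by linarith
      then show "cmod (f x) \<le> sum B F" by (rule order_trans[OF B(2)[OF f x]])
    qed
  qed
qed

lemma ravg_add: "ravg I b (\<lambda>x. f x + h x) x = ravg I b f x + ravg I b h x"
  by (simp add: ravg_def sum.distrib add_divide_distrib)

lemma ravg_cmult: "ravg I b (\<lambda>x. c * f x) x = c * ravg I b f x"
  by (simp add: ravg_def sum_distrib_left)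

lemma ravg_cnj: "ravg I b (\<lambda>x. cnj (f x)) x = cnj (ravg I b f x)"
  by (simp add: ravg_def)

lemma unif_cont_cmult:
  assumes "unif_cont f" shows "unif_cont (\<lambda>x. c * f x)"
proof (rule unif_cont_dominated1[OF assms])
  fix \<epsilon> :: real assume e: "0 < \<epsilon>"
  have "near (\<lambda>x. c * f x) \<epsilon> x \<one>" if "near f (\<epsilon> / (cmod c + 1)) x \<one>" for x
    unfolding near_def
  proof (intro ballI)
    fix s t assume "s \<in> carrier G" "t \<in> carrier G"
    then have *: "cmod (f (s \<otimes> x \<otimes> t) - f (s \<otimes> \<one> \<otimes> t)) \<le> \<epsilon> / (cmod c + 1)" using nearD[OF that] by blast
    have "cmod (c * f (s \<otimes> x \<otimes> t) - c * f (s \<otimes> \<one> \<otimes> t)) = cmod c * cmod (f (s \<otimes> x \<otimes> t) - f (s \<otimes> \<one> \<otimes> t))"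
      by (simp add: norm_mult flip: right_diff_distrib)
    also have "\<dots> \<le> (cmod c + 1) * (\<epsilon> / (cmod c + 1))" using * by (intro mult_mono) auto
    also have "\<dots> = \<epsilon>" using norm_ge_zero[of c] by (simp add: add_nonneg_eq_0_iff)
    finally show "cmod (c * f (s \<otimes> x \<otimes> t) - c * f (s \<otimes> \<one> \<otimes> t)) \<le> \<epsilon>" .
  qed
  then show "\<exists>\<delta>>0. \<forall>x\<in>carrier G. near f \<delta> x \<one> \<longrightarrow> near (\<lambda>x. c * f x) \<epsilon> x \<one>"
    using e by (intro exI[of _ "\<epsilon> / (cmod c + 1)"] conjI ballI impI divide_pos_pos add_nonneg_pos) auto
qed

lemma unif_cont_diff: "unif_cont f \<Longrightarrow> unif_cont h \<Longrightarrow> unif_cont (\<lambda>x. f x - h x)"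
  using unif_cont_add[of f "\<lambda>x. -1 * h x"] unif_cont_cmult[of h "-1"] by simp

lemma unif_cont_sum:
  "finite I \<Longrightarrow> (\<And>i. i \<in> I \<Longrightarrow> unif_cont (f i)) \<Longrightarrow> unif_cont (\<lambda>x. \<Sum>i\<in>I. f i x)"
  by (induction I rule: finite_induct) (auto intro: unif_cont_add)

lemma near_mult:
  assumes "near f \<delta> x y" "near h \<epsilon> x y" "x \<in> carrier G" "y \<in> carrier G"
    and "\<And>x. x \<in> carrier G \<Longrightarrow> cmod (f x) \<le> B" "\<And>x. x \<in> carrier G \<Longrightarrow> cmod (h x) \<le> C"
  shows "near (\<lambda>x. f x * h x) (\<delta> * C + B * \<epsilon>) x y"
  unfolding near_def
proof (intro ballI)
  fix s t assume st: "s \<in> carrier G" "t \<in> carrier G"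
  let ?p = "s \<otimes> x \<otimes> t" and ?q = "s \<otimes> y \<otimes> t"
  have 1: "cmod (f ?p - f ?q) \<le> \<delta>" "cmod (h ?p - h ?q) \<le> \<epsilon>" by (rule nearD[OF assms(1) st], rule nearD[OF assms(2) st])
  have 2: "cmod (h ?p) \<le> C" "cmod (f ?q) \<le> B"
    by (rule assms(6), use assms(3) st in simp, rule assms(5), use assms(4) st in simp)
  have nn: "0 \<le> \<delta>" "0 \<le> B" using order_trans[OF norm_ge_zero 1(1)] order_trans[OF norm_ge_zero 2(2)] by this
  have eq: "f ?p * h ?p - f ?q * h ?q = (f ?p - f ?q) * h ?p + f ?q * (h ?p - h ?q)" by (simp add: algebra_simps)
  have "cmod ((f ?p - f ?q) * h ?p) \<le> \<delta> * C" "cmod (f ?q * (h ?p - h ?q)) \<le> B * \<epsilon>"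
    unfolding norm_mult using 1 2 nn by (simp_all add: mult_mono)
  then show "cmod (f ?p * h ?p - f ?q * h ?q) \<le> \<delta> * C + B * \<epsilon>"
    unfolding eq using norm_triangle_ineq[of "(f ?p - f ?q) * h ?p" "f ?q * (h ?p - h ?q)"] by linarith
qed

lemma unif_cont_mult:
  assumes "unif_cont f" "unif_cont h"
  shows "unif_cont (\<lambda>x. f x * h x)"
proof (rule unif_cont_dominated)
  fix \<epsilon> :: real assume e: "0 < \<epsilon>"
  obtain B where B: "0 \<le> B" "\<And>x. x \<in> carrier G \<Longrightarrow> cmod (f x) \<le> B" using unif_cont_bounded[OF assms(1)] by auto
  obtain C where C: "0 \<le> C" "\<And>x. x \<in> carrier G \<Longrightarrow> cmod (h x) \<le> C" using unif_cont_bounded[OF assms(2)] by auto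
  define \<delta> where "\<delta> = \<epsilon> / (B + C + 1)"
  have \<delta>: "0 < \<delta>" using e B C by (simp add: \<delta>_def)
  have "\<delta> * C + B * \<delta> \<le> (B + C + 1) * \<delta>" using \<delta> by (simp add: algebra_simps)
  also have "\<dots> = \<epsilon>" using B(1) C(1) by (simp add: \<delta>_def)
  finally have le: "\<delta> * C + B * \<delta> \<le> \<epsilon>" .
  have "near (\<lambda>x. f x * h x) \<epsilon> x \<one>" if "x \<in> carrier G" "near f \<delta> x \<one>" "near h \<delta> x \<one>" for x
    using near_mono[OF near_mult[OF that(2,3,1) one_closed B(2) C(2)] le] by simp
  then have "\<forall>x\<in>carrier G. (\<forall>k\<in>{f, h}. near k \<delta> x \<one>) \<longrightarrow> near (\<lambda>x. f x * h x) \<epsilon> x \<one>"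
    by blast
  moreover have "\<forall>k\<in>{f, h}. unif_cont k" "finite {f, h}" using assms by simp_all
  ultimately show "\<exists>F \<delta>. finite F \<and> (\<forall>f\<in>F. unif_cont f) \<and> 0 < \<delta> \<and>
      (\<forall>x\<in>carrier G. (\<forall>f\<in>F. near f \<delta> x \<one>) \<longrightarrow> near (\<lambda>x. f x * h x) \<epsilon> x \<one>)"
    using \<delta> by (intro exI[of _ "{f, h}"] exI[of _ \<delta>] conjI)
qed

section \<open>Linearity, positivity and invariance of the mean\<close>

lemma mean_add:
  assumes "unif_cont f" "unif_cont h"
  shows "mean (\<lambda>x. f x + h x) = mean f + mean h"
proof (rule eq_if_close[where K = 3])
  fix \<epsilon> :: real assume e: "0 < \<epsilon>"
  have u: "unif_cont (\<lambda>x. f x + h x)" using assms by (rule unif_cont_add)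
  have F: "finite {f, h, \<lambda>x. f x + h x}" "\<forall>k\<in>{f, h, \<lambda>x. f x + h x}. unif_cont k" using assms u by auto
  from mean_finite_family[OF F e]
  obtain I b where "\<forall>k\<in>{f, h, \<lambda>x. f x + h x}. \<forall>x\<in>carrier G. cmod (ravg I b k x - mean k) \<le> \<epsilon>"
    by (elim exE conjE) (rule that)
  then have "cmod (ravg I b f \<one> - mean f) \<le> \<epsilon>" "cmod (ravg I b h \<one> - mean h) \<le> \<epsilon>"
      "cmod (ravg I b f \<one> + ravg I b h \<one> - mean (\<lambda>x. f x + h x)) \<le> \<epsilon>"
    by (auto simp flip: ravg_add)
  then show "cmod (mean (\<lambda>x. f x + h x) - (mean f + mean h)) \<le> 3 * \<epsilon>"
    using norm_triangle_ineq4[of "(ravg I b f \<one> - mean f) + (ravg I b h \<one> - mean h)"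
        "ravg I b f \<one> + ravg I b h \<one> - mean (\<lambda>x. f x + h x)"]
      norm_triangle_ineq[of "ravg I b f \<one> - mean f" "ravg I b h \<one> - mean h"]
    by (simp add: algebra_simps)
qed

lemma mean_cmult:
  assumes "unif_cont f"
  shows "mean (\<lambda>x. c * f x) = c * mean f"
proof (rule eq_if_close[where K = "1 + cmod c"])
  fix \<epsilon> :: real assume e: "0 < \<epsilon>"
  have u: "unif_cont (\<lambda>x. c * f x)" using assms by (rule unif_cont_cmult)
  have F: "finite {f, \<lambda>x. c * f x}" "\<forall>k\<in>{f, \<lambda>x. c * f x}. unif_cont k" using assms u by auto
  from mean_finite_family[OF F e]
  obtain I b where "\<forall>k\<in>{f, \<lambda>x. c * f x}. \<forall>x\<in>carrier G. cmod (ravg I b k x - mean k) \<le> \<epsilon>"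
    by (elim exE conjE) (rule that)
  then have 1: "cmod (ravg I b f \<one> - mean f) \<le> \<epsilon>" "cmod (c * ravg I b f \<one> - mean (\<lambda>x. c * f x)) \<le> \<epsilon>"
    by (auto simp flip: ravg_cmult)
  have "cmod (c * (ravg I b f \<one> - mean f)) \<le> cmod c * \<epsilon>" using 1(1) by (simp add: norm_mult mult_left_mono)
  then show "cmod (mean (\<lambda>x. c * f x) - c * mean f) \<le> (1 + cmod c) * \<epsilon>"
    using 1(2) norm_triangle_ineq4[of "c * (ravg I b f \<one> - mean f)" "c * ravg I b f \<one> - mean (\<lambda>x. c * f x)"]
    by (simp add: algebra_simps)
qed

lemma mean_cnj:
  assumes "unif_cont f"
  shows "mean (\<lambda>x. cnj (f x)) = cnj (mean f)"
proof (rule eq_if_close[where K = "2"])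
  fix \<epsilon> :: real assume e: "0 < \<epsilon>"
  have u: "unif_cont (\<lambda>x. cnj (f x))" using assms by (rule unif_cont_cnj)
  have F: "finite {f, \<lambda>x. cnj (f x)}" "\<forall>k\<in>{f, \<lambda>x. cnj (f x)}. unif_cont k" using assms u by auto
  from mean_finite_family[OF F e]
  obtain I b where "\<forall>k\<in>{f, \<lambda>x. cnj (f x)}. \<forall>x\<in>carrier G. cmod (ravg I b k x - mean k) \<le> \<epsilon>"
    by (elim exE conjE) (rule that)
  then have 1: "cmod (ravg I b f \<one> - mean f) \<le> \<epsilon>" "cmod (cnj (ravg I b f \<one>) - mean (\<lambda>x. cnj (f x))) \<le> \<epsilon>"
    by (auto simp flip: ravg_cnj)
  have "cmod (cnj (ravg I b f \<one>) - cnj (mean f)) \<le> \<epsilon>"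
    using 1(1) by (metis complex_cnj_diff complex_mod_cnj)
  then show "cmod (mean (\<lambda>x. cnj (f x)) - cnj (mean f)) \<le> 2 * \<epsilon>"
    using 1(2) norm_triangle_ineq4[of "cnj (ravg I b f \<one>) - cnj (mean f)" "cnj (ravg I b f \<one>) - mean (\<lambda>x. cnj (f x))"]
    by simp
qed

lemma mean_sum:
  "finite I \<Longrightarrow> (\<And>i. i \<in> I \<Longrightarrow> unif_cont (f i)) \<Longrightarrow> mean (\<lambda>x. \<Sum>i\<in>I. f i x) = (\<Sum>i\<in>I. mean (f i))"
proof (induction I rule: finite_induct)
  case empty
  show ?case using mean_cmult[OF unif_cont_const[of 0], of 0] by simp
next
  case (insert i I)
  then show ?case by (simp add: mean_add unif_cont_sum)
qed

lemma mean_diff: "unif_cont f \<Longrightarrow> unif_cont h \<Longrightarrow> mean (\<lambda>x. f x - h x) = mean f - mean h"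
  using mean_add[of f "\<lambda>x. -1 * h x"] mean_cmult[of h "-1"] unif_cont_cmult[of h "-1"] by simp

text \<open>The mean is a limit of averages, so a closed condition shared by all of them holds for
  it. Bounds and positivity are instances.\<close>

lemma mean_in_closed:
  assumes "unif_cont f" "\<And>I b. avg_family I b \<Longrightarrow> ravg I b f \<one> \<in> S" "closed S"
  shows "mean f \<in> S"
proof -
  have "\<exists>y\<in>S. dist y (mean f) < e" if "0 < e" for e
  proof -
    obtain I b where I: "avg_family I b" "osc_le (ravg I b f) (e / 2)"
      using ravg_ex[OF assms(1), of "e / 2"] \<open>0 < e\<close> by auto
    have "cmod (ravg I b f \<one> - mean f) \<le> e / 2" by (rule mean_ravg[OF assms(1) I one_closed])
    then show ?thesis using assms(2)[OF I(1)] that by (intro bexI[of _ "ravg I b f \<one>"]) (auto simp: dist_norm)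
  qed
  then have "mean f \<in> closure S" by (simp add: closure_approachable)
  then show ?thesis using assms(3) by simp
qed

lemma mean_in_cball:
  assumes "unif_cont f" "\<And>x. x \<in> carrier G \<Longrightarrow> cmod (f x - c) \<le> B"
  shows "cmod (mean f - c) \<le> B"
proof -
  have "mean f \<in> cball c B"
  proof (rule mean_in_closed[OF assms(1)])
    fix I b assume I: "avg_family I b"
    then have "\<And>i. i \<in> I \<Longrightarrow> b i \<in> carrier G" by (auto simp: avg_family_def)
    then have "cmod (ravg I b f \<one> - c) \<le> B"
      unfolding ravg_def using assms(2) by (intro avg_bound[OF I]) auto
    then show "ravg I b f \<one> \<in> cball c B" by (simp add: dist_norm norm_minus_commute)
  qed simp
  then show ?thesis by (simp add: dist_norm norm_minus_commute)
qed

lemma mean_bound: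
  "unif_cont f \<Longrightarrow> (\<And>x. x \<in> carrier G \<Longrightarrow> cmod (f x) \<le> B) \<Longrightarrow> cmod (mean f) \<le> B"
  using mean_in_cball[of f 0 B] by simp

lemma mean_eq_const:
  assumes "\<And>x. x \<in> carrier G \<Longrightarrow> f x = c"
  shows "mean f = c"
proof -
  have "unif_cont f" by (rule unif_cont_cong[OF unif_cont_const[of c]]) (simp add: assms)
  then have "cmod (mean f - c) \<le> 0" by (rule mean_in_cball) (simp add: assms)
  then show ?thesis by simp
qed

lemma mean_const [simp]: "mean (\<lambda>_. c) = c"
  by (rule mean_eq_const) simp

lemma mean_cong:
  assumes "unif_cont f" "\<And>x. x \<in> carrier G \<Longrightarrow> f x = h x"
  shows "mean f = mean h"
proof -
  have h: "unif_cont h" using assms by (rule unif_cont_cong)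
  have "mean (\<lambda>x. f x - h x) = 0" by (rule mean_eq_const) (simp add: assms(2))
  then show ?thesis using mean_diff[OF assms(1) h] by simp
qed

lemma mean_nonneg:
  assumes "unif_cont f" "\<And>x. x \<in> carrier G \<Longrightarrow> f x \<in> \<real>\<^sub>\<ge>\<^sub>0"
  shows "mean f \<in> \<real>\<^sub>\<ge>\<^sub>0"
proof (rule mean_in_closed[OF assms(1)])
  fix I b assume "avg_family I b"
  then have "\<And>i. i \<in> I \<Longrightarrow> f (\<one> \<otimes> b i) \<in> \<real>\<^sub>\<ge>\<^sub>0" using assms(2) by (auto simp: avg_family_def)
  then have "(\<Sum>i\<in>I. f (\<one> \<otimes> b i)) \<in> \<real>\<^sub>\<ge>\<^sub>0" by (induction I rule: infinite_finite_induct) auto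
  then show "ravg I b f \<one> \<in> \<real>\<^sub>\<ge>\<^sub>0" by (simp add: ravg_def)
qed (rule closed_nonneg_Reals_complex)

lemma mean_left:
  assumes "unif_cont f" "g \<in> carrier G"
  shows "mean (\<lambda>x. f (g \<otimes> x)) = mean f"
proof (rule eq_if_close[where K = "2"])
  fix \<epsilon> :: real assume e: "0 < \<epsilon>"
  obtain I b where I: "avg_family I b" "osc_le (ravg I b f) \<epsilon>" using ravg_ex[OF assms(1) e] by blast
  have "\<And>i. i \<in> I \<Longrightarrow> b i \<in> carrier G" using I by (auto simp: avg_family_def)
  then have *: "ravg I b (\<lambda>x. f (g \<otimes> x)) x = ravg I b f (g \<otimes> x)" if "x \<in> carrier G" for x
    using that assms(2) by (simp add: ravg_def m_assoc)
  have "cmod (ravg I b (\<lambda>x. f (g \<otimes> x)) (inv g) - mean (\<lambda>x. f (g \<otimes> x))) \<le> \<epsilon>"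
    using I(2) assms * by (intro mean_ravg unif_cont_left I(1)) (auto simp: osc_le_def)
  moreover have "cmod (ravg I b f \<one> - mean f) \<le> \<epsilon>" using mean_ravg[OF assms(1) I] by simp
  ultimately show "cmod (mean (\<lambda>x. f (g \<otimes> x)) - mean f) \<le> 2 * \<epsilon>"
    using norm_triangle_ineq4[of "ravg I b f \<one> - mean f" "ravg I b f \<one> - mean (\<lambda>x. f (g \<otimes> x))"] *[of "inv g"] assms(2)
    by simp
qed

lemma mean_right:
  assumes "unif_cont f" "g \<in> carrier G"
  shows "mean (\<lambda>x. f (x \<otimes> g)) = mean f"
proof (rule eq_if_close[where K = "2"])
  fix \<epsilon> :: real assume e: "0 < \<epsilon>"
  obtain I b where I: "avg_family I b" "osc_le (lavg I b f) \<epsilon>" using lavg_ex[OF assms(1) e] by blast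
  have "\<And>i. i \<in> I \<Longrightarrow> b i \<in> carrier G" using I by (auto simp: avg_family_def)
  then have *: "lavg I b (\<lambda>x. f (x \<otimes> g)) x = lavg I b f (x \<otimes> g)" if "x \<in> carrier G" for x
    using that assms(2) by (simp add: lavg_def m_assoc)
  have "cmod (lavg I b (\<lambda>x. f (x \<otimes> g)) (inv g) - mean (\<lambda>x. f (x \<otimes> g))) \<le> \<epsilon>"
    using I(2) assms * by (intro mean_lavg unif_cont_right I(1)) (auto simp: osc_le_def)
  moreover have "cmod (lavg I b f \<one> - mean f) \<le> \<epsilon>" using mean_lavg[OF assms(1) I] by simp
  ultimately show "cmod (mean (\<lambda>x. f (x \<otimes> g)) - mean f) \<le> 2 * \<epsilon>"
    using norm_triangle_ineq4[of "lavg I b f \<one> - mean f" "lavg I b f \<one> - mean (\<lambda>x. f (x \<otimes> g))"] *[of "inv g"] assms(2)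
    by simp
qed

text \<open>By total boundedness finitely many right translates of \<open>f\<close> add up to at
  least half of \<open>f z\<close> at every point. Since translates have equal means,
  \<open>card A\<close> times the mean of \<open>f\<close> is at least that amount. This makes the
  inner product definite.\<close>

lemma mean_pos:
  assumes f: "unif_cont f" and nn: "\<And>x. x \<in> carrier G \<Longrightarrow> f x \<in> \<real>\<^sub>\<ge>\<^sub>0"
    and z: "z \<in> carrier G" "f z \<noteq> 0"
  shows "0 < Re (mean f)"
proof -
  define r where "r = Re (f z)"
  have Re: "0 \<le> Re (f x)" "Im (f x) = 0" if "x \<in> carrier G" for x
    using nn[OF that] by (auto simp: complex_nonneg_Reals_iff)
  have r: "0 < r" using Re[OF z(1)] z(2) by (auto simp: r_def complex_eq_iff)
  then obtain N where N: "openin T N" "\<one> \<in> N" "\<forall>x\<in>N. near f (r / 2) x \<one>"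
    using f unfolding unif_cont_def by (meson half_gt_zero)
  obtain A where A: "finite A" "A \<subseteq> carrier G" "\<forall>x\<in>carrier G. \<exists>a\<in>A. inv a \<otimes> x \<in> N"
    using finite_cover[OF N(1,2)] by blast
  \<comment> \<open>If \<open>x\<close> lies in the translate of \<open>N\<close> around
    \<open>a\<close>, then \<open>x \<otimes> (inv a \<otimes> z)\<close> is close to
    \<open>z\<close>, so the summand belonging to \<open>a\<close> alone compensates the subtracted
    constant.\<close>
  define h where "h x = (\<Sum>a\<in>A. f (x \<otimes> (inv a \<otimes> z))) - complex_of_real (r / 2)" for x
  have uA: "unif_cont (\<lambda>x. f (x \<otimes> (inv a \<otimes> z)))" if "a \<in> A" for a
    using that A(2) z(1) by (intro unif_cont_right f) auto
  have u: "unif_cont h" unfolding h_def using uA A(1) by (intro unif_cont_diff unif_cont_sum) auto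
  have "h x \<in> \<real>\<^sub>\<ge>\<^sub>0" if x: "x \<in> carrier G" for x
  proof -
    obtain a where a: "a \<in> A" "inv a \<otimes> x \<in> N" using A(3) x by blast
    then have aG: "a \<in> carrier G" using A(2) by blast
    have "near f (r / 2) x a" using near_cancel_left[OF N(3)[rule_format, OF a(2)] x aG] .
    from nearD[OF this one_closed, of "inv a \<otimes> z"]
    have "cmod (f (x \<otimes> (inv a \<otimes> z)) - f z) \<le> r / 2"
      using x aG z(1) by (simp add: m_assoc[symmetric])
    then have "r / 2 \<le> Re (f (x \<otimes> (inv a \<otimes> z)))"
      using abs_Re_le_cmod[of "f (x \<otimes> (inv a \<otimes> z)) - f z"] by (simp add: r_def)
    also have "\<dots> \<le> (\<Sum>a\<in>A. Re (f (x \<otimes> (inv a \<otimes> z))))"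
      using A a(1) x z(1) Re by (intro member_le_sum) auto
    finally have "0 \<le> Re (h x)" by (simp add: h_def)
    moreover have "Im (h x) = 0" using A x z(1) Re by (auto simp: h_def intro!: sum.neutral)
    ultimately show ?thesis by (simp add: complex_nonneg_Reals_iff)
  qed
  then have "mean h \<in> \<real>\<^sub>\<ge>\<^sub>0" by (rule mean_nonneg[OF u])
  moreover have "mean h = of_nat (card A) * mean f - complex_of_real (r / 2)"
  proof -
    have "mean h = (\<Sum>a\<in>A. mean (\<lambda>x. f (x \<otimes> (inv a \<otimes> z)))) - mean (\<lambda>_. complex_of_real (r / 2))"
      unfolding h_def using A(1) uA by (simp add: mean_diff mean_sum unif_cont_sum)
    also have "(\<Sum>a\<in>A. mean (\<lambda>x. f (x \<otimes> (inv a \<otimes> z)))) = (\<Sum>a\<in>A. mean f)"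
      using A(2) z(1) by (intro sum.cong mean_right f) auto
    finally show ?thesis by simp
  qed
  ultimately have "r / 2 \<le> of_nat (card A) * Re (mean f)" by (simp add: complex_nonneg_Reals_iff)
  then have "0 < of_nat (card A) * Re (mean f)" using r by linarith
  then show ?thesis by (auto simp: zero_less_mult_iff)
qed

lemma near_mean:
  assumes "\<And>y. y \<in> carrier G \<Longrightarrow> near (\<lambda>x. F x y) \<epsilon> u v" "\<And>x. x \<in> carrier G \<Longrightarrow> unif_cont (F x)"
    and "u \<in> carrier G" "v \<in> carrier G"
  shows "near (\<lambda>x. mean (F x)) \<epsilon> u v"
  unfolding near_def
proof (intro ballI)
  fix s t assume st: "s \<in> carrier G" "t \<in> carrier G"
  have uc: "unif_cont (F (s \<otimes> u \<otimes> t))" "unif_cont (F (s \<otimes> v \<otimes> t))" using st assms by auto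
  have "cmod (mean (\<lambda>y. F (s \<otimes> u \<otimes> t) y - F (s \<otimes> v \<otimes> t) y)) \<le> \<epsilon>"
    using nearD[OF assms(1)] st by (intro mean_bound unif_cont_diff uc) auto
  then show "cmod (mean (F (s \<otimes> u \<otimes> t)) - mean (F (s \<otimes> v \<otimes> t))) \<le> \<epsilon>" using mean_diff[OF uc] by simp
qed

text \<open>Fubini for the mean: by equicontinuity one finite average in the second variable
  approximates \<open>mean (F x)\<close> for all \<open>x\<close> simultaneously, and a finite
  average commutes with the mean in the first variable by linearity.\<close>

lemma mean_swap:
  assumes equi: "\<And>\<epsilon>. 0 < \<epsilon> \<Longrightarrow> \<exists>N. openin T N \<and> \<one> \<in> N \<and>
      (\<forall>u\<in>N. \<forall>z\<in>carrier G. near (F z) \<epsilon> u \<one> \<and> near (\<lambda>x. F x z) \<epsilon> u \<one>)"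
    and bdd: "\<And>x y. x \<in> carrier G \<Longrightarrow> y \<in> carrier G \<Longrightarrow> cmod (F x y) \<le> B"
  shows "mean (\<lambda>x. mean (F x)) = mean (\<lambda>y. mean (\<lambda>x. F x y))"
proof (rule eq_if_close[where K = "2"])
  fix \<epsilon> :: real assume e: "0 < \<epsilon>"
  have uc1: "unif_cont (F x)" if "x \<in> carrier G" for x
  proof (rule unif_contI)
    fix \<epsilon> :: real assume "0 < \<epsilon>"
    from equi[OF this] show "\<exists>N. openin T N \<and> \<one> \<in> N \<and> (\<forall>u\<in>N. near (F x) \<epsilon> u \<one>)" using that by blast
  qed
  have uc2: "unif_cont (\<lambda>x. F x y)" if "y \<in> carrier G" for y
  proof (rule unif_contI)
    fix \<epsilon> :: real assume "0 < \<epsilon>"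
    from equi[OF this] show "\<exists>N. openin T N \<and> \<one> \<in> N \<and> (\<forall>u\<in>N. near (\<lambda>x. F x y) \<epsilon> u \<one>)" using that by blast
  qed
  let ?M = "\<lambda>y. mean (\<lambda>x. F x y)" and ?M' = "\<lambda>x. mean (F x)"
  \<comment> \<open>Including the partial mean \<open>?M\<close> in the family makes the same
    average approximate the outer mean on the other side of the equation.\<close>
  let ?F = "insert ?M (F ` carrier G)"
  have "\<exists>N. openin T N \<and> \<one> \<in> N \<and> (\<forall>x\<in>N. near ?M' \<epsilon> x \<one> \<and> (\<forall>f\<in>?F. near f \<epsilon> x \<one>))" if e: "0 < \<epsilon>" for \<epsilon>
  proof -
    obtain N where N: "openin T N" "\<one> \<in> N"
      "\<forall>u\<in>N. \<forall>z\<in>carrier G. near (F z) \<epsilon> u \<one> \<and> near (\<lambda>x. F x z) \<epsilon> u \<one>"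
      using equi[OF e] by blast
    have "near ?M \<epsilon> u \<one>" if u: "u \<in> N" for u
      by (rule near_mean[OF _ uc2 openin_carrier[OF N(1) u] one_closed]) (use N(3) u in blast)+
    moreover have "near ?M' \<epsilon> u \<one>" if u: "u \<in> N" for u
      by (rule near_mean[OF _ uc1 openin_carrier[OF N(1) u] one_closed]) (use N(3) u in blast)+
    ultimately show ?thesis using N by (intro exI[of _ N]) auto
  qed
  note equi' = this
  have uM': "unif_cont ?M'"
  proof (rule unif_contI)
    fix \<epsilon> :: real assume "0 < \<epsilon>"
    from equi'[OF this] show "\<exists>N. openin T N \<and> \<one> \<in> N \<and> (\<forall>x\<in>N. near ?M' \<epsilon> x \<one>)" by blast
  qed
  have "\<exists>I b. avg_family I b \<and> (\<forall>f\<in>?F. \<forall>x\<in>carrier G. cmod (ravg I b f x - mean f) \<le> \<epsilon>)"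
  proof (rule mean_family[OF _ _ e])
    show "\<exists>N. openin T N \<and> \<one> \<in> N \<and> (\<forall>f\<in>?F. \<forall>x\<in>N. near f \<epsilon> x \<one>)" if "0 < \<epsilon>" for \<epsilon>
      using equi'[OF that] by blast
    show "osc_le f (2 * B)" if f: "f \<in> ?F" for f
    proof (rule osc_leI)
      fix y assume y: "y \<in> carrier G"
      show "cmod (f y) \<le> B"
      proof (cases "f = ?M")
        case True
        then show ?thesis using mean_bound[OF uc2[OF y] bdd[OF _ y]] by simp
      next
        case False
        then show ?thesis using f y bdd by auto
      qed
    qed
  qed
  then obtain I b where I: "avg_family I b" "\<forall>f\<in>?F. \<forall>x\<in>carrier G. cmod (ravg I b f x - mean f) \<le> \<epsilon>"
    by (elim exE conjE) (rule that)
  have bG: "\<And>i. i \<in> I \<Longrightarrow> b i \<in> carrier G" and I': "finite I" "card I > 0" using I(1) by (auto simp: avg_family_def card_gt_0_iff)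
  have ur: "unif_cont (\<lambda>x. ravg I b (F x) \<one>)"
    unfolding ravg_def divide_inverse mult.commute[of _ "inverse _"]
    using bG I' by (intro unif_cont_cmult unif_cont_sum) (auto intro!: uc2)
  have "mean (\<lambda>x. ravg I b (F x) \<one>) = ravg I b ?M \<one>"
    unfolding ravg_def divide_inverse mult.commute[of _ "inverse _"]
    using bG I' uc2 by (simp add: mean_cmult mean_sum unif_cont_sum)
  moreover have "cmod (mean (\<lambda>x. ravg I b (F x) \<one> - mean (F x))) \<le> \<epsilon>"
    using I(2) by (intro mean_bound unif_cont_diff ur uM') auto
  ultimately have "cmod (ravg I b ?M \<one> - mean ?M') \<le> \<epsilon>"
    using mean_diff[OF ur uM'] by simp
  moreover have "cmod (ravg I b ?M \<one> - mean ?M) \<le> \<epsilon>" using I(2) by simp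
  ultimately show "cmod (mean ?M' - mean ?M) \<le> 2 * \<epsilon>"
    using norm_triangle_ineq4[of "ravg I b ?M \<one> - mean ?M" "ravg I b ?M \<one> - mean ?M'"] by simp
qed

end

section \<open>Inner product spaces of functions\<close>

definition sc :: "complex \<Rightarrow> ('a \<Rightarrow> complex) \<Rightarrow> 'a \<Rightarrow> complex"
  where "sc c f = (\<lambda>x. c * f x)"

lemma sc_apply [simp]: "sc c f x = c * f x"
  by (simp add: sc_def)

lemma sc_simps [simp]: "sc 0 f = 0" "sc 1 f = f" "sc c 0 = 0" "sc c (sc d f) = sc (c * d) f" "sc (- 1) f = - f"
  by (auto simp: fun_eq_iff)

lemma sc_add: "sc c (f + h) = sc c f + sc c h" and sc_add_left: "sc (c + d) f = sc c f + sc d f"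
  and sc_diff: "sc c (f - h) = sc c f - sc c h"
  by (auto simp: fun_eq_iff algebra_simps)

lemma sum_fun_apply [simp]: "(\<Sum>i\<in>I. f i) x = (\<Sum>i\<in>I. f i x)" for f :: "'i \<Rightarrow> 'a \<Rightarrow> complex"
  by (induction I rule: infinite_finite_induct) auto

text \<open>Completeness is not assumed: the uniformly continuous functions need not be complete in
  the norm of the inner product. The arguments go through finite orthonormal families
  instead.\<close>

locale function_inner_space =
  fixes X :: "('a \<Rightarrow> complex) set" and ip :: "('a \<Rightarrow> complex) \<Rightarrow> ('a \<Rightarrow> complex) \<Rightarrow> complex"
  assumes X_zero: "0 \<in> X"
    and X_add: "f \<in> X \<Longrightarrow> h \<in> X \<Longrightarrow> f + h \<in> X"
    and X_sc: "f \<in> X \<Longrightarrow> sc c f \<in> X"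
    and ip_add: "\<lbrakk>f \<in> X; f' \<in> X; h \<in> X\<rbrakk> \<Longrightarrow> ip (f + f') h = ip f h + ip f' h"
    and ip_sc: "\<lbrakk>f \<in> X; h \<in> X\<rbrakk> \<Longrightarrow> ip (sc c f) h = c * ip f h"
    and ip_commute: "\<lbrakk>f \<in> X; h \<in> X\<rbrakk> \<Longrightarrow> ip f h = cnj (ip h f)"
    and ip_pos: "\<lbrakk>f \<in> X; f \<noteq> 0\<rbrakk> \<Longrightarrow> 0 < Re (ip f f)"
begin

definition nrm :: "('a \<Rightarrow> complex) \<Rightarrow> real"
  where "nrm f = sqrt (Re (ip f f))"

lemma X_diff: "f \<in> X \<Longrightarrow> h \<in> X \<Longrightarrow> f - h \<in> X"
  using X_add[of f "sc (-1) h"] X_sc[of h "-1"] by simp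

lemma X_sum: "(\<And>i. i \<in> I \<Longrightarrow> f i \<in> X) \<Longrightarrow> (\<Sum>i\<in>I. f i) \<in> X"
  by (induction I rule: infinite_finite_induct) (simp_all add: X_zero X_add)

lemma ip_zero: "f \<in> X \<Longrightarrow> ip 0 f = 0" "f \<in> X \<Longrightarrow> ip f 0 = 0"
  using ip_sc[of f f 0] ip_commute[of f 0] X_zero by simp_all

lemma ip_diff: "\<lbrakk>f \<in> X; f' \<in> X; h \<in> X\<rbrakk> \<Longrightarrow> ip (f - f') h = ip f h - ip f' h"
  using ip_add[of f "sc (-1) f'" h] ip_sc[of f' h "-1"] X_sc[of f' "-1"] by simp

lemma ip_add_right: "\<lbrakk>f \<in> X; f' \<in> X; h \<in> X\<rbrakk> \<Longrightarrow> ip h (f + f') = ip h f + ip h f'"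
  using ip_commute[of h "f + f'"] ip_commute[of h f] ip_commute[of h f'] ip_add[of f f' h] X_add by simp

lemma ip_diff_right: "\<lbrakk>f \<in> X; f' \<in> X; h \<in> X\<rbrakk> \<Longrightarrow> ip h (f - f') = ip h f - ip h f'"
  using ip_commute[of h "f - f'"] ip_commute[of h f] ip_commute[of h f'] ip_diff[of f f' h] X_diff by simp

lemma ip_sc_right: "\<lbrakk>f \<in> X; h \<in> X\<rbrakk> \<Longrightarrow> ip h (sc c f) = cnj c * ip h f"
  using ip_commute[of h "sc c f"] ip_commute[of h f] ip_sc[of f h c] X_sc by simp

lemma ip_sum: "(\<And>i. i \<in> I \<Longrightarrow> f i \<in> X) \<Longrightarrow> h \<in> X \<Longrightarrow> ip (\<Sum>i\<in>I. f i) h = (\<Sum>i\<in>I. ip (f i) h)"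
  by (induction I rule: infinite_finite_induct) (simp_all add: ip_zero ip_add X_sum)

lemma ip_sum_right: "(\<And>i. i \<in> I \<Longrightarrow> f i \<in> X) \<Longrightarrow> h \<in> X \<Longrightarrow> ip h (\<Sum>i\<in>I. f i) = (\<Sum>i\<in>I. ip h (f i))"
  by (induction I rule: infinite_finite_induct) (simp_all add: ip_zero ip_add_right X_sum)

lemma Re_ip_nonneg: "f \<in> X \<Longrightarrow> 0 \<le> Re (ip f f)"
  using ip_pos[of f] ip_zero[OF X_zero] by (cases "f = 0") auto

lemma ip_self: "f \<in> X \<Longrightarrow> ip f f = complex_of_real ((nrm f)\<^sup>2)"
proof -
  assume f: "f \<in> X"
  then have "Im (ip f f) = 0" using ip_commute[of f f] by (simp add: complex_eq_iff)
  then show ?thesis using Re_ip_nonneg[OF f] by (simp add: nrm_def complex_eq_iff)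
qed

lemma nrm_nonneg: "f \<in> X \<Longrightarrow> 0 \<le> nrm f"
  using Re_ip_nonneg by (simp add: nrm_def)

lemma nrm_zero [simp]: "nrm 0 = 0"
  using ip_zero[OF X_zero] by (simp add: nrm_def)

lemma nrm_eq_zero: "f \<in> X \<Longrightarrow> nrm f = 0 \<longleftrightarrow> f = 0"
  using ip_pos[of f] ip_zero[OF X_zero] by (cases "f = 0") (auto simp: nrm_def)

lemma nrm_pos: "f \<in> X \<Longrightarrow> f \<noteq> 0 \<Longrightarrow> 0 < nrm f"
  using ip_pos[of f] by (simp add: nrm_def)

lemma nrm_sc: "f \<in> X \<Longrightarrow> nrm (sc c f) = cmod c * nrm f"
proof -
  assume f: "f \<in> X"
  have "ip (sc c f) (sc c f) = (c * cnj c) * ip f f"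
    using f by (simp add: ip_sc ip_sc_right X_sc)
  also have "\<dots> = complex_of_real ((cmod c)\<^sup>2 * (nrm f)\<^sup>2)"
    by (simp only: ip_self[OF f] complex_norm_square[symmetric] of_real_mult)
  finally show ?thesis
    using nrm_nonneg[OF f] unfolding nrm_def[of "sc c f"] by (simp add: real_sqrt_mult)
qed

lemma nrm_minus: "f \<in> X \<Longrightarrow> nrm (- f) = nrm f"
  using nrm_sc[of f "-1"] by simp

lemma pythagoras:
  assumes "f \<in> X" "h \<in> X" "ip f h = 0"
  shows "(nrm (f + h))\<^sup>2 = (nrm f)\<^sup>2 + (nrm h)\<^sup>2"
proof -
  have "ip h f = 0" using ip_commute[of h f] assms by simp
  then have "ip (f + h) (f + h) = ip f f + ip h h"
    using assms by (simp add: ip_add ip_add_right X_add)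
  then show ?thesis
    using assms by (simp add: ip_self X_add flip: of_real_add of_real_power)
qed

section \<open>Orthonormal families, projections and Bessel's inequality\<close>

definition orthonormal :: "(nat \<Rightarrow> 'a \<Rightarrow> complex) \<Rightarrow> nat \<Rightarrow> bool"
  where "orthonormal e n \<longleftrightarrow> (\<forall>i<n. e i \<in> X) \<and> (\<forall>i<n. \<forall>j<n. ip (e i) (e j) = (if i = j then 1 else 0))"

definition proj :: "(nat \<Rightarrow> 'a \<Rightarrow> complex) \<Rightarrow> nat \<Rightarrow> ('a \<Rightarrow> complex) \<Rightarrow> 'a \<Rightarrow> complex"
  where "proj e n f = (\<Sum>i<n. sc (ip f (e i)) (e i))"

lemma orthonormalD:
  "orthonormal e n \<Longrightarrow> i < n \<Longrightarrow> e i \<in> X"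
  "orthonormal e n \<Longrightarrow> i < n \<Longrightarrow> j < n \<Longrightarrow> ip (e i) (e j) = (if i = j then 1 else 0)"
  unfolding orthonormal_def by blast+

lemma orthonormal_nrm: "orthonormal e n \<Longrightarrow> i < n \<Longrightarrow> nrm (e i) = 1"
  by (simp add: nrm_def orthonormalD)

lemma comb_in_X: "orthonormal e n \<Longrightarrow> (\<Sum>i<n. sc (c i) (e i)) \<in> X"
  by (intro X_sum X_sc) (simp add: orthonormalD)

lemma proj_in_X: "orthonormal e n \<Longrightarrow> proj e n f \<in> X"
  unfolding proj_def by (rule comb_in_X)

lemma ip_comb:
  assumes "orthonormal e n" "j < n"
  shows "ip (\<Sum>i<n. sc (c i) (e i)) (e j) = c j"
proof -
  have "ip (\<Sum>i<n. sc (c i) (e i)) (e j) = (\<Sum>i<n. c i * ip (e i) (e j))"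
    using assms by (subst ip_sum) (auto simp: orthonormalD X_sc ip_sc)
  also have "\<dots> = (\<Sum>i<n. if i = j then c i else 0)"
    using assms by (intro sum.cong) (auto simp: orthonormalD)
  finally show ?thesis using assms(2) by simp
qed

lemma ip_proj:
  "orthonormal e n \<Longrightarrow> j < n \<Longrightarrow> ip (proj e n f) (e j) = ip f (e j)"
  unfolding proj_def by (rule ip_comb)

lemma ip_residual_e:
  assumes "orthonormal e n" "j < n" "f \<in> X"
  shows "ip (f - proj e n f) (e j) = 0"
  using assms by (simp add: ip_diff proj_in_X orthonormalD ip_proj)

lemma ip_orth_comb:
  assumes "orthonormal e n" "r \<in> X" "\<And>j. j < n \<Longrightarrow> ip r (e j) = 0"
  shows "ip r (\<Sum>i<n. sc (c i) (e i)) = 0"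
  using assms by (subst ip_sum_right) (auto simp: orthonormalD X_sc ip_sc_right)

lemma nrm_comb:
  assumes "orthonormal e n"
  shows "(nrm (\<Sum>i<n. sc (c i) (e i)))\<^sup>2 = (\<Sum>i<n. (cmod (c i))\<^sup>2)"
proof -
  let ?p = "\<Sum>i<n. sc (c i) (e i)"
  have "ip ?p ?p = (\<Sum>i<n. ip ?p (sc (c i) (e i)))"
    by (rule ip_sum_right) (use assms in \<open>auto simp: orthonormalD X_sc comb_in_X\<close>)
  also have "\<dots> = (\<Sum>i<n. cnj (c i) * ip ?p (e i))"
    using assms by (intro sum.cong) (auto simp: orthonormalD ip_sc_right comb_in_X)
  also have "\<dots> = (\<Sum>i<n. complex_of_real ((cmod (c i))\<^sup>2))"
    by (intro sum.cong refl) (simp only: lessThan_iff ip_comb[OF assms] complex_norm_square mult.commute)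
  finally have "complex_of_real ((nrm ?p)\<^sup>2) = complex_of_real (\<Sum>i<n. (cmod (c i))\<^sup>2)"
    using ip_self[OF comb_in_X[OF assms]] by simp
  then show ?thesis by (simp only: of_real_eq_iff)
qed

lemma nrm_residual:
  assumes "orthonormal e n" "f \<in> X"
  shows "(nrm f)\<^sup>2 = (nrm (proj e n f))\<^sup>2 + (nrm (f - proj e n f))\<^sup>2"
proof -
  let ?r = "f - proj e n f"
  have r: "?r \<in> X" using assms by (simp add: X_diff proj_in_X)
  have "ip ?r (proj e n f) = 0"
    unfolding proj_def[of e n f] by (rule ip_orth_comb[OF assms(1)])
      (use assms r ip_residual_e in \<open>auto simp: proj_def\<close>)
  then have "(nrm (?r + proj e n f))\<^sup>2 = (nrm ?r)\<^sup>2 + (nrm (proj e n f))\<^sup>2"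
    by (intro pythagoras r proj_in_X assms(1))
  then show ?thesis by simp
qed

lemma bessel:
  assumes "orthonormal e n" "f \<in> X"
  shows "(\<Sum>i<n. (cmod (ip f (e i)))\<^sup>2) \<le> (nrm f)\<^sup>2"
  using nrm_residual[OF assms] nrm_comb[OF assms(1), of "\<lambda>i. ip f (e i)"] by (simp add: proj_def)

lemma nrm_proj_le:
  assumes "orthonormal e n" "f \<in> X"
  shows "nrm (proj e n f) \<le> nrm f"
  by (rule power2_le_imp_le[OF _ nrm_nonneg[OF assms(2)]]) (simp add: nrm_residual[OF assms])

lemma nrm_residual_le:
  assumes "orthonormal e n" "f \<in> X"
  shows "nrm (f - proj e n f) \<le> nrm f"
  by (rule power2_le_imp_le[OF _ nrm_nonneg[OF assms(2)]]) (simp add: nrm_residual[OF assms])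

lemma ip_normalized:
  assumes "f \<in> X" "f \<noteq> 0"
  shows "ip (sc (1 / nrm f) f) (sc (1 / nrm f) f) = 1"
  using assms nrm_pos[OF assms] by (simp only: ip_self[OF X_sc] nrm_sc) (simp add: norm_divide)

text \<open>Bessel's inequality for the family that consists of the single normalized vector
  \<open>h\<close>.\<close>

lemma cauchy_schwarz:
  assumes "f \<in> X" "h \<in> X"
  shows "cmod (ip f h) \<le> nrm f * nrm h"
proof (cases "h = 0")
  case True
  then show ?thesis using assms by (simp add: ip_zero)
next
  case False
  then have p: "0 < nrm h" using assms(2) nrm_pos by blast
  let ?e = "\<lambda>_::nat. sc (1 / nrm h) h"
  have "orthonormal ?e 1"
    using assms(2) False ip_normalized[of h] by (simp add: orthonormal_def X_sc)
  from bessel[OF this assms(1)] have "(cmod (ip f h) / nrm h)\<^sup>2 \<le> (nrm f)\<^sup>2"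
    using assms p by (simp add: ip_sc_right X_sc norm_mult norm_divide)
  then have "cmod (ip f h) / nrm h \<le> nrm f"
    using nrm_nonneg[OF assms(1)] by (rule power2_le_imp_le)
  then show ?thesis using p by (simp add: field_simps)
qed

lemma nrm_triangle:
  assumes "f \<in> X" "h \<in> X"
  shows "nrm (f + h) \<le> nrm f + nrm h"
proof (rule power2_le_imp_le)
  have "ip (f + h) (f + h) = ip f f + ip h h + (ip f h + cnj (ip f h))"
    using assms ip_commute[of h f] by (simp add: ip_add ip_add_right X_add)
  then have "Re (ip (f + h) (f + h)) = (nrm f)\<^sup>2 + (nrm h)\<^sup>2 + 2 * Re (ip f h)"
    using assms by (simp add: ip_self)
  moreover have "Re (ip f h) \<le> nrm f * nrm h"
    using complex_Re_le_cmod[of "ip f h"] cauchy_schwarz[OF assms] by linarith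
  ultimately show "(nrm (f + h))\<^sup>2 \<le> (nrm f + nrm h)\<^sup>2"
    using assms Re_ip_nonneg[of "f + h"] X_add unfolding nrm_def[of "f + h"]
    by (simp add: power2_sum)
  show "0 \<le> nrm f + nrm h" using assms nrm_nonneg by simp
qed

lemma nrm_triangle_diff: "f \<in> X \<Longrightarrow> h \<in> X \<Longrightarrow> nrm (f - h) \<le> nrm f + nrm h"
  using nrm_triangle[of f "sc (-1) h"] X_sc[of h "-1"] nrm_sc[of h "-1"] by simp

lemma nrm_diff_commute: "f \<in> X \<Longrightarrow> h \<in> X \<Longrightarrow> nrm (f - h) = nrm (h - f)"
  using nrm_minus[of "h - f"] X_diff by simp

lemma nrm_triangle_sum_list:
  "set fs \<subseteq> X \<Longrightarrow> sum_list fs \<in> X \<and> nrm (sum_list fs) \<le> (\<Sum>f\<leftarrow>fs. nrm f)"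
proof (induction fs)
  case (Cons f fs)
  then have "f \<in> X" "sum_list fs \<in> X" "nrm (sum_list fs) \<le> (\<Sum>f\<leftarrow>fs. nrm f)" by simp_all
  then have "f + sum_list fs \<in> X" "nrm (f + sum_list fs) \<le> nrm f + (\<Sum>f\<leftarrow>fs. nrm f)"
    using nrm_triangle[of f "sum_list fs"] by (auto intro: X_add)
  then show ?case by (simp only: sum_list.Cons list.map)
qed (simp add: X_zero)

section \<open>Finite-dimensional subspaces\<close>

definition subsp :: "('a \<Rightarrow> complex) set \<Rightarrow> bool"
  where "subsp W \<longleftrightarrow> W \<subseteq> X \<and> 0 \<in> W \<and> (\<forall>f\<in>W. \<forall>h\<in>W. f + h \<in> W) \<and> (\<forall>c. \<forall>f\<in>W. sc c f \<in> W)"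

lemma subspD:
  assumes "subsp W"
  shows "f \<in> W \<Longrightarrow> f \<in> X" "0 \<in> W" "f \<in> W \<Longrightarrow> h \<in> W \<Longrightarrow> f + h \<in> W" "f \<in> W \<Longrightarrow> sc c f \<in> W"
  using assms unfolding subsp_def by blast+

lemma subsp_diff: "subsp W \<Longrightarrow> f \<in> W \<Longrightarrow> h \<in> W \<Longrightarrow> f - h \<in> W"
  using subspD(3)[of W f "sc (-1) h"] subspD(4)[of W h "-1"] by simp

lemma subsp_sum: "subsp W \<Longrightarrow> (\<And>i. i \<in> I \<Longrightarrow> f i \<in> W) \<Longrightarrow> (\<Sum>i\<in>I. f i) \<in> W"
  by (induction I rule: infinite_finite_induct) (simp_all add: subspD)

text \<open>Stating the spanning property through \<open>proj\<close> gives coordinates at once and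
  needs no separate notion of span or dimension.\<close>

definition basis :: "('a \<Rightarrow> complex) set \<Rightarrow> (nat \<Rightarrow> 'a \<Rightarrow> complex) \<Rightarrow> nat \<Rightarrow> bool"
  where "basis W e n \<longleftrightarrow> subsp W \<and> orthonormal e n \<and> (\<forall>i<n. e i \<in> W) \<and> (\<forall>f\<in>W. proj e n f = f)"

lemma basisD:
  assumes "basis W e n"
  shows "subsp W" "orthonormal e n" "i < n \<Longrightarrow> e i \<in> W" "f \<in> W \<Longrightarrow> proj e n f = f"
  using assms unfolding basis_def by blast+

lemma proj_in: "basis W e n \<Longrightarrow> proj e n f \<in> W"
  unfolding proj_def by (intro subsp_sum) (auto simp: basisD subspD)

lemma orthonormal_extend:
  assumes "orthonormal e n" "r \<in> X" "r \<noteq> 0" "\<And>i. i < n \<Longrightarrow> ip r (e i) = 0"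
  shows "orthonormal (e(n := sc (1 / nrm r) r)) (Suc n)"
proof -
  have p: "0 < nrm r" using assms nrm_pos by blast
  let ?u = "sc (1 / nrm r) r"
  have u: "?u \<in> X" using assms(2) by (rule X_sc)
  have uu: "ip ?u ?u = 1"
    using ip_normalized[OF assms(2,3)] .
  have ue: "ip ?u (e i) = 0" "ip (e i) ?u = 0" if "i < n" for i
  proof -
    show *: "ip ?u (e i) = 0" using assms that orthonormalD(1) by (simp add: ip_sc)
    show "ip (e i) ?u = 0" using ip_commute[of "e i" ?u] * u that assms(1) orthonormalD(1) by simp
  qed
  show ?thesis
    unfolding orthonormal_def using u uu ue orthonormalD[OF assms(1)] by (auto simp: less_Suc_eq)
qed

text \<open>Take a longest orthonormal family in \<open>W\<close>. If a vector of \<open>W\<close>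
  were not its own projection, the normalized residual would prolong the family.\<close>

lemma bounded_basis:
  assumes W: "subsp W" and N: "\<And>e n. orthonormal e n \<Longrightarrow> (\<And>i. i < n \<Longrightarrow> e i \<in> W) \<Longrightarrow> n \<le> N"
  shows "\<exists>e n. basis W e n \<and> n \<le> N"
proof -
  let ?P = "\<lambda>n. \<exists>e. orthonormal e n \<and> (\<forall>i<n. e i \<in> W)"
  have "?P 0" by (simp add: orthonormal_def)
  moreover have "\<forall>n. ?P n \<longrightarrow> n \<le> N" using N by blast
  ultimately obtain n where n: "?P n" "\<forall>m. ?P m \<longrightarrow> m \<le> n"
    using Nat.ex_has_greatest_nat[of ?P 0 N] by blast
  then obtain e where e: "orthonormal e n" "\<forall>i<n. e i \<in> W" by blast
  have eW: "proj e n f \<in> W" for f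
    unfolding proj_def using W e(2) by (intro subsp_sum) (auto simp: subspD)
  have "proj e n f = f" if f: "f \<in> W" for f
  proof (rule ccontr)
    assume "proj e n f \<noteq> f"
    then have r: "f - proj e n f \<noteq> 0" by auto
    have rW: "f - proj e n f \<in> W" using subsp_diff[OF W f eW] .
    have fX: "f \<in> X" using W f subspD by blast
    let ?e = "e(n := sc (1 / nrm (f - proj e n f)) (f - proj e n f))"
    have "orthonormal ?e (Suc n)"
      by (rule orthonormal_extend[OF e(1) subspD(1)[OF W rW] r ip_residual_e[OF e(1) _ fX]])
    moreover have "\<forall>i<Suc n. ?e i \<in> W" using e(2) subspD(4)[OF W rW] by (auto simp: less_Suc_eq)
    ultimately have "?P (Suc n)" by blast
    then show False using n(2) by fastforce
  qed
  then have "basis W e n" using W e unfolding basis_def by blast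
  then show ?thesis using N e by blast
qed

text \<open>Double counting of the squared moduli of \<open>ip (h j) (e i)\<close>: for fixed
  \<open>j\<close> they add up to 1 because \<open>h j\<close> lies in \<open>W\<close>, and for
  fixed \<open>i\<close> they add up to at most 1 by Bessel's inequality.\<close>

lemma basis_max:
  assumes "basis W e n" "orthonormal h m" "\<And>i. i < m \<Longrightarrow> h i \<in> W"
  shows "m \<le> n"
proof -
  have e: "orthonormal e n" using assms(1) basisD by blast
  have 1: "(\<Sum>i<n. (cmod (ip (h j) (e i)))\<^sup>2) = 1" if "j < m" for j
    using nrm_comb[OF e, of "\<lambda>i. ip (h j) (e i)"] basisD(4)[OF assms(1) assms(3)[OF that]]
      orthonormal_nrm[OF assms(2) that] by (simp add: proj_def)
  have "real m = (\<Sum>j<m. \<Sum>i<n. (cmod (ip (h j) (e i)))\<^sup>2)" by (simp add: 1)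
  also have "\<dots> = (\<Sum>i<n. \<Sum>j<m. (cmod (ip (e i) (h j)))\<^sup>2)"
    using orthonormalD(1)[OF e] orthonormalD(1)[OF assms(2)]
    by (subst sum.swap) (auto intro!: sum.cong simp: ip_commute[of "h _" "e _"])
  also have "\<dots> \<le> (\<Sum>i<n. 1)"
  proof (rule sum_mono)
    fix i assume "i \<in> {..<n}"
    then show "(\<Sum>j<m. (cmod (ip (e i) (h j)))\<^sup>2) \<le> 1"
      using bessel[OF assms(2), of "e i"] orthonormalD(1)[OF e] orthonormal_nrm[OF e] by simp
  qed
  finally show ?thesis by simp
qed

lemma ip_basis_orth:
  assumes "basis W e n" "r \<in> X" "\<And>i. i < n \<Longrightarrow> ip r (e i) = 0" "u \<in> W"
  shows "ip r u = 0"
  using ip_orth_comb[OF basisD(2)[OF assms(1)] assms(2,3), of "\<lambda>i. ip u (e i)"] basisD(4)[OF assms(1,4)]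
  by (simp add: proj_def)

lemma ip_residual:
  assumes "basis W e n" "f \<in> X" "u \<in> W"
  shows "ip (f - proj e n f) u = 0"
proof (rule ip_basis_orth[OF assms(1) _ _ assms(3)])
  show "f - proj e n f \<in> X" by (intro X_diff assms(2) proj_in_X basisD(2)[OF assms(1)])
  show "ip (f - proj e n f) (e i) = 0" if "i < n" for i
    by (rule ip_residual_e[OF basisD(2)[OF assms(1)] that assms(2)])
qed

lemma proj_eqI:
  assumes "basis W e n" "f \<in> X" "p \<in> W" "\<And>u. u \<in> W \<Longrightarrow> ip (f - p) u = 0"
  shows "proj e n f = p"
proof -
  have "ip f (e i) = ip p (e i)" if "i < n" for i
    using assms(4)[OF basisD(3)[OF assms(1) that]] assms(2,3) basisD(1,3)[OF assms(1)] that
    by (simp add: ip_diff subspD)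
  then have "proj e n f = proj e n p" by (simp add: proj_def)
  then show ?thesis using basisD(4)[OF assms(1,3)] by simp
qed

lemma subsp_basis:
  assumes W: "basis W e n" and U: "subsp U" "U \<subseteq> W"
  shows "\<exists>b m. basis U b m \<and> m \<le> n"
  by (rule bounded_basis[OF U(1)], rule basis_max[OF W]) (use U(2) in blast)+

lemma basis_zero: "basis W e 0 \<Longrightarrow> W = {0}"
  using basisD[of W e 0] subspD(2)[of W] by (auto simp: proj_def)

section \<open>Families of operators closed under adjoints and their minimal invariant
  spaces\<close>

definition op_family :: "(('a \<Rightarrow> complex) \<Rightarrow> 'a \<Rightarrow> complex) set \<Rightarrow> bool"
  where "op_family \<Gamma> \<longleftrightarrow> (\<forall>\<gamma>\<in>\<Gamma>. (\<forall>f\<in>X. \<gamma> f \<in> X) \<and> (\<forall>f\<in>X. \<forall>h\<in>X. \<gamma> (f + h) = \<gamma> f + \<gamma> h) \<and>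
    (\<exists>\<gamma>'\<in>\<Gamma>. \<forall>f\<in>X. \<forall>h\<in>X. ip (\<gamma> f) h = ip f (\<gamma>' h)))"

definition invariant :: "(('a \<Rightarrow> complex) \<Rightarrow> 'a \<Rightarrow> complex) set \<Rightarrow> ('a \<Rightarrow> complex) set \<Rightarrow> bool"
  where "invariant \<Gamma> U \<longleftrightarrow> (\<forall>\<gamma>\<in>\<Gamma>. \<forall>f\<in>U. \<gamma> f \<in> U)"

definition minimal_invariant :: "(('a \<Rightarrow> complex) \<Rightarrow> 'a \<Rightarrow> complex) set \<Rightarrow> ('a \<Rightarrow> complex) set \<Rightarrow> bool"
  where "minimal_invariant \<Gamma> U \<longleftrightarrow> U \<noteq> {0} \<and> invariant \<Gamma> U \<and> (\<exists>e n. basis U e n) \<and>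
    (\<forall>V. subsp V \<longrightarrow> V \<subseteq> U \<longrightarrow> invariant \<Gamma> V \<longrightarrow> V = {0} \<or> V = U)"

lemma op_familyD:
  assumes "op_family \<Gamma>" "\<gamma> \<in> \<Gamma>"
  shows "f \<in> X \<Longrightarrow> \<gamma> f \<in> X" "f \<in> X \<Longrightarrow> h \<in> X \<Longrightarrow> \<gamma> (f + h) = \<gamma> f + \<gamma> h"
    "\<exists>\<gamma>'\<in>\<Gamma>. \<forall>f\<in>X. \<forall>h\<in>X. ip (\<gamma> f) h = ip f (\<gamma>' h)"
  using assms unfolding op_family_def by blast+

lemma op_diff:
  assumes "op_family \<Gamma>" "\<gamma> \<in> \<Gamma>" "f \<in> X" "h \<in> X"
  shows "\<gamma> (f - h) = \<gamma> f - \<gamma> h"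
  using op_familyD(2)[OF assms(1,2) X_diff[OF assms(3,4)] assms(4)] by (simp add: algebra_simps)

lemma invariantD: "invariant \<Gamma> U \<Longrightarrow> \<gamma> \<in> \<Gamma> \<Longrightarrow> f \<in> U \<Longrightarrow> \<gamma> f \<in> U"
  unfolding invariant_def by blast

text \<open>The adjoint of \<open>\<gamma>\<close> belongs to the family and preserves
  \<open>U\<close>, so orthogonality to \<open>U\<close> survives. Orthogonal complements of
  invariant spaces are therefore invariant.\<close>

lemma op_orth:
  assumes "op_family \<Gamma>" "invariant \<Gamma> U" "U \<subseteq> X" "\<gamma> \<in> \<Gamma>" "f \<in> X" "\<And>u. u \<in> U \<Longrightarrow> ip f u = 0" "u \<in> U"
  shows "ip (\<gamma> f) u = 0"
proof -
  obtain \<gamma>' where "\<gamma>' \<in> \<Gamma>" "\<forall>f\<in>X. \<forall>h\<in>X. ip (\<gamma> f) h = ip f (\<gamma>' h)"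
    using op_familyD(3)[OF assms(1,4)] by blast
  moreover from this have "\<gamma>' u \<in> U" using invariantD[OF assms(2)] assms(7) by blast
  moreover have "u \<in> X" using assms(3,7) by blast
  ultimately show ?thesis using assms(5,6) by simp
qed

text \<open>An operator of the family maps \<open>U\<close> to itself and the complement of
  \<open>U\<close> to itself, so it respects the splitting of \<open>f\<close> into projection and
  residual.\<close>

lemma proj_commute:
  assumes \<Gamma>: "op_family \<Gamma>" "invariant \<Gamma> U" "\<gamma> \<in> \<Gamma>" and U: "basis U e n" and f: "f \<in> X"
  shows "proj e n (\<gamma> f) = \<gamma> (proj e n f)"
proof (rule proj_eqI[OF U])
  have p: "proj e n f \<in> U" "proj e n f \<in> X" using proj_in[OF U] subspD(1)[OF basisD(1)[OF U]] by blast+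
  show "\<gamma> f \<in> X" using op_familyD(1)[OF \<Gamma>(1,3) f] .
  show "\<gamma> (proj e n f) \<in> U" using invariantD[OF \<Gamma>(2,3)] p by blast
  fix u assume u: "u \<in> U"
  have "ip (\<gamma> (f - proj e n f)) u = 0"
    by (rule op_orth[OF \<Gamma>(1,2) _ \<Gamma>(3) X_diff[OF f p(2)] ip_residual[OF U f] u])
      (use subspD(1)[OF basisD(1)[OF U]] in blast)
  then show "ip (\<gamma> f - \<gamma> (proj e n f)) u = 0" using op_diff[OF \<Gamma>(1,3) f p(2)] by simp
qed

lemma orthonormal_concat:
  assumes a: "orthonormal a p" and b: "orthonormal b q"
    and ab: "\<And>i j. i < p \<Longrightarrow> j < q \<Longrightarrow> ip (b j) (a i) = 0"
  shows "orthonormal (\<lambda>i. if i < p then a i else b (i - p)) (p + q)"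
proof -
  have ba: "ip (a i) (b j) = 0" if "i < p" "j < q" for i j
    using ip_commute[of "a i" "b j"] ab[OF that] that orthonormalD(1)[OF a] orthonormalD(1)[OF b] by simp
  show ?thesis
    unfolding orthonormal_def
    using orthonormalD[OF a] orthonormalD[OF b] ab ba by (auto simp: not_less)
qed

text \<open>Complete reducibility, by strong induction on the dimension, with a quantitative
  addition: projections to invariant spaces commute with the operators and do not increase norms, so
  no component is displaced further than \<open>\<psi>\<close> itself. The bound on the number of
  components is needed to find one that is not small.\<close>

lemma decomposition:
  assumes \<Gamma>: "op_family \<Gamma>" and "basis W e n" "invariant \<Gamma> W" "\<psi> \<in> W"
  shows "\<exists>ps. length ps \<le> n \<and> \<psi> = sum_list (map snd ps) \<and> (\<forall>(U, \<phi>)\<in>set ps. minimal_invariant \<Gamma> U \<and>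
    U \<subseteq> W \<and> \<phi> \<in> U \<and> (\<forall>\<gamma>\<in>\<Gamma>. nrm (\<gamma> \<phi> - \<phi>) \<le> nrm (\<gamma> \<psi> - \<psi>)))"
  using assms(2-4)
proof (induction n arbitrary: W e \<psi> rule: less_induct)
  case (less n)
  note W = \<open>basis W e n\<close>
  have sW: "subsp W" using basisD(1)[OF W] .
  note WX = subspD(1)[OF sW]
  consider "W = {0}" | "minimal_invariant \<Gamma> W" |
    U where "subsp U" "U \<subseteq> W" "invariant \<Gamma> U" "U \<noteq> {0}" "U \<noteq> W"
    using W \<open>invariant \<Gamma> W\<close> unfolding minimal_invariant_def by blast
  then show ?case
  proof cases
    case 1
    then show ?thesis using \<open>\<psi> \<in> W\<close> by (intro exI[of _ "[]"]) simp
  next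
    case 2
    then have "W \<noteq> {0}" by (simp add: minimal_invariant_def)
    then have "n \<noteq> 0" using basis_zero W by auto
    then show ?thesis using 2 \<open>\<psi> \<in> W\<close> by (intro exI[of _ "[(W, \<psi>)]"]) simp
  next
    case (3 U)
    obtain a p where U: "basis U a p" "p \<le> n" using subsp_basis[OF W 3(1,2)] by blast
    define V where "V = {f \<in> W. \<forall>u\<in>U. ip f u = 0}"
    have UX: "u \<in> U \<Longrightarrow> u \<in> X" for u using subspD(1)[OF 3(1)] .
    have V: "subsp V"
      unfolding subsp_def V_def using subspD[OF sW] UX by (auto simp: ip_zero ip_add ip_sc)
    have VW: "V \<subseteq> W" by (auto simp: V_def)
    have VI: "invariant \<Gamma> V"
      unfolding invariant_def
    proof (intro ballI)
      fix \<gamma> f assume g: "\<gamma> \<in> \<Gamma>" and f: "f \<in> V"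
      have "ip (\<gamma> f) u = 0" if "u \<in> U" for u
        by (rule op_orth[OF \<Gamma> 3(3) _ g _ _ that]) (use f UX WX in \<open>auto simp: V_def\<close>)
      then show "\<gamma> f \<in> V" using f invariantD[OF \<open>invariant \<Gamma> W\<close> g] by (simp add: V_def)
    qed
    obtain b q where Vb: "basis V b q" using subsp_basis[OF W V VW] by blast
    have "ip (b j) (a i) = 0" if "i < p" "j < q" for i j
      using basisD(3)[OF Vb that(2)] basisD(3)[OF U(1) that(1)] by (simp add: V_def)
    then have "orthonormal (\<lambda>i. if i < p then a i else b (i - p)) (p + q)"
      by (intro orthonormal_concat basisD(2)[OF U(1)] basisD(2)[OF Vb])
    then have pq: "p + q \<le> n"
      by (rule basis_max[OF W]) (use basisD(3)[OF Vb] basisD(3)[OF U(1)] 3(2) VW in auto)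
    have res: "f - proj a p f \<in> V" if "f \<in> W" for f
      using subsp_diff[OF sW that] proj_in[OF U(1)] 3(2) ip_residual[OF U(1) WX[OF that]]
      by (auto simp: V_def)
    \<comment> \<open>Both dimensions are positive and their sum is at most \<open>n\<close>, so the
      induction hypothesis applies to each part and the numbers of components add up
      correctly.\<close>
    have "p \<noteq> 0" using basis_zero U(1) 3(4) by auto
    moreover have "q \<noteq> 0"
    proof
      assume "q = 0"
      then have "V = {0}" using basis_zero Vb by simp
      then have "f = proj a p f" if "f \<in> W" for f using res[OF that] by simp
      then have "W \<subseteq> U" using proj_in[OF U(1)] by (metis subsetI)
      then show False using 3(2,5) by blast
    qed
    ultimately have lt: "p < n" "q < n" using pq by auto
    let ?\<phi> = "proj a p \<psi>" and ?\<rho> = "\<psi> - proj a p \<psi>"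
    have \<psi>X: "\<psi> \<in> X" using WX less.prems(3) by blast
    have pX: "?\<phi> \<in> X" using UX proj_in[OF U(1)] by blast
    have le: "nrm (\<gamma> ?\<phi> - ?\<phi>) \<le> nrm (\<gamma> \<psi> - \<psi>)" "nrm (\<gamma> ?\<rho> - ?\<rho>) \<le> nrm (\<gamma> \<psi> - \<psi>)" if g: "\<gamma> \<in> \<Gamma>" for \<gamma>
    proof -
      have gX: "\<gamma> \<psi> \<in> X" using op_familyD(1)[OF \<Gamma> g \<psi>X] .
      have eq: "proj a p (\<gamma> \<psi> - \<psi>) = \<gamma> ?\<phi> - ?\<phi>"
      proof -
        have "proj a p (\<gamma> \<psi> - \<psi>) = proj a p (\<gamma> \<psi>) - proj a p \<psi>"
          using gX \<psi>X orthonormalD(1)[OF basisD(2)[OF U(1)]]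
          by (simp add: proj_def ip_diff fun_eq_iff algebra_simps sum_subtractf)
        then show ?thesis using proj_commute[OF \<Gamma> 3(3) g U(1) \<psi>X] by simp
      qed
      show "nrm (\<gamma> ?\<phi> - ?\<phi>) \<le> nrm (\<gamma> \<psi> - \<psi>)"
        using nrm_proj_le[OF basisD(2)[OF U(1)] X_diff[OF gX \<psi>X]] by (simp add: eq)
      \<comment> \<open>The displacement of the residual is the residual of the
        displacement.\<close>
      have eq2: "\<gamma> ?\<rho> - ?\<rho> = (\<gamma> \<psi> - \<psi>) - proj a p (\<gamma> \<psi> - \<psi>)"
        unfolding eq op_diff[OF \<Gamma> g \<psi>X pX] by (simp add: algebra_simps)
      show "nrm (\<gamma> ?\<rho> - ?\<rho>) \<le> nrm (\<gamma> \<psi> - \<psi>)"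
        unfolding eq2 by (rule nrm_residual_le[OF basisD(2)[OF U(1)] X_diff[OF gX \<psi>X]])
    qed
    obtain ps where ps: "length ps \<le> p" "?\<phi> = sum_list (map snd ps)" "\<forall>(U', \<phi>)\<in>set ps. minimal_invariant \<Gamma> U' \<and>
        U' \<subseteq> U \<and> \<phi> \<in> U' \<and> (\<forall>\<gamma>\<in>\<Gamma>. nrm (\<gamma> \<phi> - \<phi>) \<le> nrm (\<gamma> ?\<phi> - ?\<phi>))"
      using less.IH[OF lt(1) U(1) 3(3) proj_in[OF U(1), of \<psi>]] by (elim exE conjE) (rule that)
    obtain qs where qs: "length qs \<le> q" "?\<rho> = sum_list (map snd qs)" "\<forall>(U', \<phi>)\<in>set qs. minimal_invariant \<Gamma> U' \<and>
        U' \<subseteq> V \<and> \<phi> \<in> U' \<and> (\<forall>\<gamma>\<in>\<Gamma>. nrm (\<gamma> \<phi> - \<phi>) \<le> nrm (\<gamma> ?\<rho> - ?\<rho>))"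
      using less.IH[OF lt(2) Vb VI res[OF less.prems(3)]] by (elim exE conjE) (rule that)
    show ?thesis
    proof (intro exI[of _ "ps @ qs"] conjI)
      show "length (ps @ qs) \<le> n" using ps(1) qs(1) pq by simp
      show "\<psi> = sum_list (map snd (ps @ qs))" by (simp flip: ps(2) qs(2))
      show "\<forall>(U, \<phi>)\<in>set (ps @ qs). minimal_invariant \<Gamma> U \<and> U \<subseteq> W \<and> \<phi> \<in> U \<and>
          (\<forall>\<gamma>\<in>\<Gamma>. nrm (\<gamma> \<phi> - \<phi>) \<le> nrm (\<gamma> \<psi> - \<psi>))"
      proof
        fix u assume u: "u \<in> set (ps @ qs)"
        obtain U' \<phi> where u': "u = (U', \<phi>)" by (cases u)
        have "minimal_invariant \<Gamma> U' \<and> U' \<subseteq> W \<and> \<phi> \<in> U' \<and> (\<forall>\<gamma>\<in>\<Gamma>. nrm (\<gamma> \<phi> - \<phi>) \<le> nrm (\<gamma> \<psi> - \<psi>))"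
        proof (cases "u \<in> set ps")
          case True
          note * = bspec[OF ps(3) True, unfolded u' prod.case]
          have "nrm (\<gamma> \<phi> - \<phi>) \<le> nrm (\<gamma> \<psi> - \<psi>)" if "\<gamma> \<in> \<Gamma>" for \<gamma>
            using * le(1)[OF that] that order_trans by blast
          then show ?thesis using * 3(2) by blast
        next
          case False
          then have "u \<in> set qs" using u by simp
          note * = bspec[OF qs(3) this, unfolded u' prod.case]
          have "nrm (\<gamma> \<phi> - \<phi>) \<le> nrm (\<gamma> \<psi> - \<psi>)" if "\<gamma> \<in> \<Gamma>" for \<gamma>
            using * le(2)[OF that] that order_trans by blast
          then show ?thesis using * VW by blast
        qed
        then show "case u of (U, \<phi>) \<Rightarrow> minimal_invariant \<Gamma> U \<and> U \<subseteq> W \<and> \<phi> \<in> U \<and>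
          (\<forall>\<gamma>\<in>\<Gamma>. nrm (\<gamma> \<phi> - \<phi>) \<le> nrm (\<gamma> \<psi> - \<psi>))"
          unfolding u' prod.case .
      qed
    qed
  qed
qed

end

section \<open>The translation operators and convolution\<close>

context totally_bounded_group
begin

text \<open>Vanishing off the carrier makes equality of functions the same as equality on the group;
  without it the inner product could not be definite.\<close>

definition UC :: "('a \<Rightarrow> complex) set"
  where "UC = {f. unif_cont f \<and> (\<forall>x. x \<notin> carrier G \<longrightarrow> f x = 0)}"

definition ip :: "('a \<Rightarrow> complex) \<Rightarrow> ('a \<Rightarrow> complex) \<Rightarrow> complex"
  where "ip f h = mean (\<lambda>x. f x * cnj (h x))"

lemma UC_unif_cont: "f \<in> UC \<Longrightarrow> unif_cont f" and UC_zero: "f \<in> UC \<Longrightarrow> x \<notin> carrier G \<Longrightarrow> f x = 0"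
  by (simp_all add: UC_def)

lemma UC_eqI: "f \<in> UC \<Longrightarrow> h \<in> UC \<Longrightarrow> (\<And>x. x \<in> carrier G \<Longrightarrow> f x = h x) \<Longrightarrow> f = h"
  by (rule ext) (metis UC_zero)

lemma unif_cont_ip: "f \<in> UC \<Longrightarrow> h \<in> UC \<Longrightarrow> unif_cont (\<lambda>x. f x * cnj (h x))"
  by (intro unif_cont_mult unif_cont_cnj UC_unif_cont)

sublocale function_inner_space UC ip
proof
  show "0 \<in> UC" using unif_cont_const[of 0] by (simp add: UC_def zero_fun_def)
  show "f + h \<in> UC" if "f \<in> UC" "h \<in> UC" for f h
    using that unif_cont_add[of f h] by (simp add: UC_def plus_fun_def)
  show "sc c f \<in> UC" if "f \<in> UC" for f c
    using that unif_cont_cmult[of f c] by (simp add: UC_def sc_def)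
  show "ip (f + f') h = ip f h + ip f' h" if "f \<in> UC" "f' \<in> UC" "h \<in> UC" for f f' h
    using mean_add[OF unif_cont_ip[OF that(1,3)] unif_cont_ip[OF that(2,3)]] by (simp add: ip_def algebra_simps)
  show "ip (sc c f) h = c * ip f h" if "f \<in> UC" "h \<in> UC" for f h c
    using mean_cmult[OF unif_cont_ip[OF that], of c] by (simp add: ip_def algebra_simps)
  show "ip f h = cnj (ip h f)" if "f \<in> UC" "h \<in> UC" for f h
    using mean_cnj[OF unif_cont_ip[OF that(2,1)]] by (simp add: ip_def mult.commute)
  show "0 < Re (ip f f)" if f: "f \<in> UC" and f0: "f \<noteq> 0" for f
  proof -
    obtain z where "f z \<noteq> 0" using f0 by (auto simp: fun_eq_iff)
    then have z: "z \<in> carrier G" "f z * cnj (f z) \<noteq> 0" using UC_zero[OF f] by auto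
    have "f x * cnj (f x) \<in> \<real>\<^sub>\<ge>\<^sub>0" for x
      by (simp add: complex_nonneg_Reals_iff)
    then show ?thesis unfolding ip_def by (intro mean_pos[OF unif_cont_ip[OF f f] _ z])
  qed
qed

lemma UC_bounded: "f \<in> UC \<Longrightarrow> \<exists>B\<ge>0. \<forall>x\<in>carrier G. cmod (f x) \<le> B"
  by (rule unif_cont_bounded) (rule UC_unif_cont)

text \<open>The mean is normalized, so uniform bounds become norm bounds.\<close>

lemma nrm_le:
  assumes "f \<in> UC" "\<And>x. x \<in> carrier G \<Longrightarrow> cmod (f x) \<le> B"
  shows "nrm f \<le> B"
proof -
  have B: "0 \<le> B" using order_trans[OF norm_ge_zero assms(2)[OF one_closed]] .
  have "cmod (ip f f) \<le> B * B"
    unfolding ip_def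
    by (rule mean_bound[OF unif_cont_ip[OF assms(1,1)]])
      (simp only: norm_mult complex_mod_cnj mult_mono assms(2) B norm_ge_zero)
  then have "(nrm f)\<^sup>2 \<le> B\<^sup>2" using ip_self[OF assms(1)] by (simp add: power2_eq_square norm_mult)
  then show ?thesis by (rule power2_le_imp_le[OF _ B])
qed

definition zero_ext :: "('a \<Rightarrow> complex) \<Rightarrow> 'a \<Rightarrow> complex"
  where "zero_ext f x = (if x \<in> carrier G then f x else 0)"

lemma zero_ext_simps [simp]: "x \<in> carrier G \<Longrightarrow> zero_ext f x = f x" "x \<notin> carrier G \<Longrightarrow> zero_ext f x = 0"
  by (simp_all add: zero_ext_def)

lemma zero_ext_UC: "unif_cont f \<Longrightarrow> zero_ext f \<in> UC"
  unfolding UC_def using unif_cont_cong[of f "zero_ext f"] by simp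

definition ltr :: "'a \<Rightarrow> ('a \<Rightarrow> complex) \<Rightarrow> 'a \<Rightarrow> complex"
  where "ltr g f = zero_ext (\<lambda>x. f (inv g \<otimes> x))"

definition rtr :: "'a \<Rightarrow> ('a \<Rightarrow> complex) \<Rightarrow> 'a \<Rightarrow> complex"
  where "rtr g f = zero_ext (\<lambda>x. f (x \<otimes> g))"

lemma ltr_apply [simp]: "x \<in> carrier G \<Longrightarrow> ltr g f x = f (inv g \<otimes> x)"
  and rtr_apply [simp]: "x \<in> carrier G \<Longrightarrow> rtr g f x = f (x \<otimes> g)"
  by (simp_all add: ltr_def rtr_def)

lemma ltr_outside [simp]: "x \<notin> carrier G \<Longrightarrow> ltr g f x = 0"
  and rtr_outside [simp]: "x \<notin> carrier G \<Longrightarrow> rtr g f x = 0"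
  by (simp_all add: ltr_def rtr_def)

lemma ltr_UC: "f \<in> UC \<Longrightarrow> g \<in> carrier G \<Longrightarrow> ltr g f \<in> UC"
  unfolding ltr_def by (intro zero_ext_UC unif_cont_left UC_unif_cont inv_closed)

lemma rtr_UC: "f \<in> UC \<Longrightarrow> g \<in> carrier G \<Longrightarrow> rtr g f \<in> UC"
  unfolding rtr_def by (intro zero_ext_UC unif_cont_right UC_unif_cont)

lemma ltr_add: "ltr g (f + h) = ltr g f + ltr g h" and rtr_add: "rtr g (f + h) = rtr g f + rtr g h"
  and ltr_sc: "ltr g (sc c f) = sc c (ltr g f)" and rtr_sc: "rtr g (sc c f) = sc c (rtr g f)"
  and ltr_diff: "ltr g (f - h) = ltr g f - ltr g h" and rtr_diff: "rtr g (f - h) = rtr g f - rtr g h"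
  by (auto simp: fun_eq_iff ltr_def rtr_def zero_ext_def)

lemma ltr_ltr: "g \<in> carrier G \<Longrightarrow> h \<in> carrier G \<Longrightarrow> ltr g (ltr h f) = ltr (g \<otimes> h) f"
  by (auto simp: fun_eq_iff ltr_def zero_ext_def inv_mult_group m_assoc)

lemma ltr_one: "f \<in> UC \<Longrightarrow> ltr \<one> f = f"
  by (auto simp: fun_eq_iff ltr_def zero_ext_def UC_zero)

lemma ip_ltr:
  assumes "f \<in> UC" "h \<in> UC" "g \<in> carrier G"
  shows "ip (ltr g f) h = ip f (ltr (inv g) h)"
proof -
  have u: "unif_cont (\<lambda>x. ltr g f x * cnj (h x))" using assms by (intro unif_cont_ip ltr_UC)
  have "mean (\<lambda>x. ltr g f (g \<otimes> x) * cnj (h (g \<otimes> x))) = ip (ltr g f) h"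
    unfolding ip_def using mean_left[OF u assms(3)] .
  moreover have "mean (\<lambda>x. ltr g f (g \<otimes> x) * cnj (h (g \<otimes> x))) = ip f (ltr (inv g) h)"
    unfolding ip_def
    by (rule mean_cong[OF unif_cont_left[OF u assms(3)]]) (use assms in \<open>simp add: m_assoc[symmetric]\<close>)
  ultimately show ?thesis by simp
qed

lemma ip_rtr:
  assumes "f \<in> UC" "h \<in> UC" "g \<in> carrier G"
  shows "ip (rtr g f) h = ip f (rtr (inv g) h)"
proof -
  have u: "unif_cont (\<lambda>x. rtr g f x * cnj (h x))" using assms by (intro unif_cont_ip rtr_UC)
  have "mean (\<lambda>x. rtr g f (x \<otimes> inv g) * cnj (h (x \<otimes> inv g))) = ip (rtr g f) h"
    unfolding ip_def using mean_right[OF u inv_closed[OF assms(3)]] .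
  moreover have "mean (\<lambda>x. rtr g f (x \<otimes> inv g) * cnj (h (x \<otimes> inv g))) = ip f (rtr (inv g) h)"
    unfolding ip_def
    by (rule mean_cong[OF unif_cont_right[OF u inv_closed[OF assms(3)]]]) (use assms in \<open>simp add: m_assoc\<close>)
  ultimately show ?thesis by simp
qed

lemma ip_ltr_ltr:
  assumes "f \<in> UC" "h \<in> UC" "g \<in> carrier G"
  shows "ip (ltr g f) (ltr g h) = ip f h"
  using ip_ltr[OF assms(1) ltr_UC[OF assms(2,3)] assms(3)] assms by (simp add: ltr_ltr ltr_one)

lemma nrm_ltr: "f \<in> UC \<Longrightarrow> g \<in> carrier G \<Longrightarrow> nrm (ltr g f) = nrm f"
  unfolding nrm_def by (simp add: ip_ltr_ltr)

abbreviation left_ops :: "(('a \<Rightarrow> complex) \<Rightarrow> 'a \<Rightarrow> complex) set"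
  where "left_ops \<equiv> ltr ` carrier G"

abbreviation two_sided_ops :: "(('a \<Rightarrow> complex) \<Rightarrow> 'a \<Rightarrow> complex) set"
  where "two_sided_ops \<equiv> ltr ` carrier G \<union> rtr ` carrier G"

lemma op_family_left: "op_family left_ops"
  unfolding op_family_def
proof (intro ballI conjI)
  fix \<gamma> assume "\<gamma> \<in> left_ops"
  then obtain g where g: "g \<in> carrier G" "\<gamma> = ltr g" by blast
  show "\<gamma> f \<in> UC" if "f \<in> UC" for f using g ltr_UC that by simp
  show "\<gamma> (f + h) = \<gamma> f + \<gamma> h" for f h using g ltr_add by simp
  show "\<exists>\<gamma>'\<in>left_ops. \<forall>f\<in>UC. \<forall>h\<in>UC. ip (\<gamma> f) h = ip f (\<gamma>' h)"
    by (rule bexI[of _ "ltr (inv g)"]) (use g ip_ltr in auto)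
qed

lemma op_family_two_sided: "op_family two_sided_ops"
  unfolding op_family_def
proof (intro ballI)
  fix \<gamma> assume "\<gamma> \<in> two_sided_ops"
  then consider g where "g \<in> carrier G" "\<gamma> = ltr g" | g where "g \<in> carrier G" "\<gamma> = rtr g" by blast
  then show "(\<forall>f\<in>UC. \<gamma> f \<in> UC) \<and> (\<forall>f\<in>UC. \<forall>h\<in>UC. \<gamma> (f + h) = \<gamma> f + \<gamma> h) \<and>
      (\<exists>\<gamma>'\<in>two_sided_ops. \<forall>f\<in>UC. \<forall>h\<in>UC. ip (\<gamma> f) h = ip f (\<gamma>' h))"
  proof cases
    case (1 g)
    have "\<exists>\<gamma>'\<in>two_sided_ops. \<forall>f\<in>UC. \<forall>h\<in>UC. ip (\<gamma> f) h = ip f (\<gamma>' h)"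
      by (rule bexI[of _ "ltr (inv g)"]) (use 1 ip_ltr in auto)
    then show ?thesis using 1 ltr_UC ltr_add by simp
  next
    case (2 g)
    have "\<exists>\<gamma>'\<in>two_sided_ops. \<forall>f\<in>UC. \<forall>h\<in>UC. ip (\<gamma> f) h = ip f (\<gamma>' h)"
      by (rule bexI[of _ "rtr (inv g)"]) (use 2 ip_rtr in auto)
    then show ?thesis using 2 rtr_UC rtr_add by simp
  qed
qed

text \<open>If \<open>k (inv x) = cnj (k x)\<close>, the value at \<open>x\<close> is the mean over
  \<open>y\<close> of \<open>f y * k (inv y \<otimes> x)\<close>, the usual convolution. Writing it
  as an inner product with a translate makes Cauchy-Schwarz give a uniform bound.\<close>

definition conv :: "('a \<Rightarrow> complex) \<Rightarrow> ('a \<Rightarrow> complex) \<Rightarrow> 'a \<Rightarrow> complex"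
  where "conv k f = zero_ext (\<lambda>x. ip f (ltr x k))"

text \<open>The trace-like condition lets convolution commute with right translations as well as
  left ones; the condition at inverses makes it self-adjoint.\<close>

definition central_kernel :: "('a \<Rightarrow> complex) \<Rightarrow> bool"
  where "central_kernel k \<longleftrightarrow> k \<in> UC \<and> (\<forall>x\<in>carrier G. \<forall>y\<in>carrier G. k (x \<otimes> y) = k (y \<otimes> x)) \<and>
    (\<forall>x\<in>carrier G. k (inv x) = cnj (k x))"

lemma conv_apply: "x \<in> carrier G \<Longrightarrow> conv k f x = ip f (ltr x k)"
  by (simp add: conv_def)

lemma conv_bound:
  assumes "f \<in> UC" "k \<in> UC" "x \<in> carrier G"
  shows "cmod (conv k f x) \<le> nrm f * nrm k"
  using cauchy_schwarz[OF assms(1) ltr_UC[OF assms(2,3)]] assms by (simp add: conv_apply nrm_ltr)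

text \<open>Convolution inherits the modulus of continuity of the kernel, multiplied by the norm of
  \<open>f\<close>. The image of the unit ball is thus equicontinuous, the source of
  compactness.\<close>

lemma near_conv:
  assumes "f \<in> UC" "k \<in> UC" "near k \<epsilon> u \<one>" "u \<in> carrier G"
  shows "near (conv k f) (nrm f * \<epsilon>) u \<one>"
  unfolding near_def
proof (intro ballI)
  fix s t assume st: "s \<in> carrier G" "t \<in> carrier G"
  let ?a = "s \<otimes> u \<otimes> t" and ?b = "s \<otimes> \<one> \<otimes> t"
  have ab: "?a \<in> carrier G" "?b \<in> carrier G" using st assms(4) by auto
  have UC: "ltr ?a k \<in> UC" "ltr ?b k \<in> UC" using ab assms(2) ltr_UC by auto
  have "nrm (ltr ?a k - ltr ?b k) \<le> \<epsilon>"
  proof (rule nrm_le[OF X_diff[OF UC]])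
    fix x assume x: "x \<in> carrier G"
    have "cmod (k (inv t \<otimes> inv u \<otimes> (inv s \<otimes> x)) - k (inv t \<otimes> \<one> \<otimes> (inv s \<otimes> x))) \<le> \<epsilon>"
      by (rule nearD[OF near_inv[OF assms(3,4)]]) (use st x in auto)
    then show "cmod ((ltr ?a k - ltr ?b k) x) \<le> \<epsilon>"
      using st x assms(4) by (simp add: inv_mult_group m_assoc)
  qed
  then have "nrm f * nrm (ltr ?a k - ltr ?b k) \<le> nrm f * \<epsilon>"
    by (intro mult_left_mono nrm_nonneg assms(1))
  moreover have "conv k f ?a - conv k f ?b = ip f (ltr ?a k - ltr ?b k)"
    using ab assms(1) UC by (simp add: conv_apply ip_diff_right)
  ultimately show "cmod (conv k f ?a - conv k f ?b) \<le> nrm f * \<epsilon>"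
    using cauchy_schwarz[OF assms(1) X_diff[OF UC]] by simp
qed

lemma conv_UC:
  assumes "f \<in> UC" "k \<in> UC"
  shows "conv k f \<in> UC"
proof -
  have "unif_cont (conv k f)"
  proof (rule unif_cont_dominated1[OF UC_unif_cont[OF assms(2)]])
    fix \<epsilon> :: real assume e: "0 < \<epsilon>"
    let ?d = "\<epsilon> / (nrm f + 1)"
    have n: "0 \<le> nrm f" using nrm_nonneg assms(1) .
    have le: "nrm f * ?d \<le> \<epsilon>" using e n by (simp add: field_simps)
    have "near (conv k f) \<epsilon> x \<one>" if "x \<in> carrier G" "near k ?d x \<one>" for x
      by (rule near_mono[OF near_conv[OF assms that(2,1)] le])
    moreover have "0 < ?d" using e n by simp
    ultimately show "\<exists>\<delta>>0. \<forall>x\<in>carrier G. near k \<delta> x \<one> \<longrightarrow> near (conv k f) \<epsilon> x \<one>" by blast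
  qed
  then show ?thesis by (simp add: UC_def conv_def)
qed

lemma conv_add: "f \<in> UC \<Longrightarrow> h \<in> UC \<Longrightarrow> k \<in> UC \<Longrightarrow> conv k (f + h) = conv k f + conv k h"
  by (rule UC_eqI) (simp_all add: conv_UC X_add conv_apply ip_add ltr_UC)

lemma conv_sc: "f \<in> UC \<Longrightarrow> k \<in> UC \<Longrightarrow> conv k (sc c f) = sc c (conv k f)"
  by (rule UC_eqI) (simp_all add: conv_UC X_sc conv_apply ip_sc ltr_UC)

lemma conv_diff: "f \<in> UC \<Longrightarrow> h \<in> UC \<Longrightarrow> k \<in> UC \<Longrightarrow> conv k (f - h) = conv k f - conv k h"
  by (rule UC_eqI) (simp_all add: conv_UC X_diff conv_apply ip_diff ltr_UC)

lemma nrm_conv: "f \<in> UC \<Longrightarrow> k \<in> UC \<Longrightarrow> nrm (conv k f) \<le> nrm k * nrm f"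
  by (rule nrm_le[OF conv_UC]) (simp_all add: conv_bound mult.commute)

lemma conv_ltr:
  assumes "f \<in> UC" "k \<in> UC" "g \<in> carrier G"
  shows "conv k (ltr g f) = ltr g (conv k f)"
  by (rule UC_eqI) (use assms in \<open>simp_all add: conv_UC ltr_UC conv_apply ip_ltr ltr_ltr\<close>)

text \<open>For a central kernel the right translate of \<open>ltr x k\<close> by
  \<open>inv g\<close> is the left translate \<open>ltr (x \<otimes> g) k\<close>, so moving the
  operator to the other side of the inner product shifts the argument \<open>x\<close> to
  \<open>x \<otimes> g\<close>.\<close>

lemma conv_rtr:
  assumes "f \<in> UC" "central_kernel k" "g \<in> carrier G"
  shows "conv k (rtr g f) = rtr g (conv k f)"
proof (rule UC_eqI)
  have k: "k \<in> UC" using assms(2) by (simp add: central_kernel_def)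
  show "conv k (rtr g f) \<in> UC" "rtr g (conv k f) \<in> UC" using assms k by (simp_all add: conv_UC rtr_UC)
  fix x assume x: "x \<in> carrier G"
  have "rtr (inv g) (ltr x k) = ltr (x \<otimes> g) k"
  proof (rule UC_eqI)
    show "rtr (inv g) (ltr x k) \<in> UC" "ltr (x \<otimes> g) k \<in> UC" using assms x k by (simp_all add: rtr_UC ltr_UC)
    fix y assume y: "y \<in> carrier G"
    have "k (inv x \<otimes> y \<otimes> inv g) = k (inv g \<otimes> (inv x \<otimes> y))"
      using assms x y unfolding central_kernel_def by simp
    then show "rtr (inv g) (ltr x k) y = ltr (x \<otimes> g) k y"
      using assms x y by (simp add: inv_mult_group m_assoc)
  qed
  then show "conv k (rtr g f) x = rtr g (conv k f) x"
    using assms x k by (simp add: conv_apply ip_rtr ltr_UC)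
qed

text \<open>Both sides are iterated means of one function \<open>F\<close> of two variables, taken
  in opposite orders; the behaviour of the kernel at inverses identifies the inner means.\<close>

lemma conv_symmetric:
  assumes f: "f \<in> UC" and h: "h \<in> UC" and k: "central_kernel k"
  shows "ip (conv k f) h = ip f (conv k h)"
proof -
  have kU: "k \<in> UC" and kinv: "\<And>x. x \<in> carrier G \<Longrightarrow> k (inv x) = cnj (k x)"
    using k by (simp_all add: central_kernel_def)
  obtain A where A: "0 \<le> A" "\<And>x. x \<in> carrier G \<Longrightarrow> cmod (f x) \<le> A" using UC_bounded[OF f] by auto
  obtain B where B: "0 \<le> B" "\<And>x. x \<in> carrier G \<Longrightarrow> cmod (h x) \<le> B" using UC_bounded[OF h] by auto
  obtain C where C: "0 \<le> C" "\<And>x. x \<in> carrier G \<Longrightarrow> cmod (k x) \<le> C" using UC_bounded[OF kU] by auto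
  define F where "F x y = f y * k (inv y \<otimes> x) * cnj (h x)" for x y
  have bnd: "cmod (F x y) \<le> A * C * B" if "x \<in> carrier G" "y \<in> carrier G" for x y
    unfolding F_def norm_mult complex_mod_cnj using A B C that by (intro mult_mono) auto
  \<comment> \<open>Equicontinuity in each variable. Two of the three factors of \<open>F\<close>
    vary in either case, so the difference is split into one difference for each factor and
    estimated with the bounds \<open>A\<close>, \<open>B\<close>, \<open>C\<close>.\<close>
  have near1: "near (F z) ((\<epsilon> * C + A * \<epsilon>) * B) u \<one>" and near2: "near (\<lambda>x. F x z) (A * (\<epsilon> * B + C * \<epsilon>)) u \<one>"
    if nf: "near f \<epsilon> u \<one>" and nh: "near h \<epsilon> u \<one>" and nk: "near k \<epsilon> u \<one>" and u: "u \<in> carrier G" and z: "z \<in> carrier G"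
    for \<epsilon> u z
  proof -
    have e: "0 \<le> \<epsilon>" using order_trans[OF norm_ge_zero nearD[OF nf one_closed one_closed]] .
    show "near (F z) ((\<epsilon> * C + A * \<epsilon>) * B) u \<one>"
      unfolding near_def
    proof (intro ballI)
      fix s t assume st: "s \<in> carrier G" "t \<in> carrier G"
      let ?p = "s \<otimes> u \<otimes> t" and ?q = "s \<otimes> \<one> \<otimes> t"
      have pq: "?p \<in> carrier G" "?q \<in> carrier G" using st u by auto
      have 1: "cmod (f ?p - f ?q) \<le> \<epsilon>" by (rule nearD[OF nf st])
      have "cmod (k (inv t \<otimes> inv u \<otimes> (inv s \<otimes> z)) - k (inv t \<otimes> \<one> \<otimes> (inv s \<otimes> z))) \<le> \<epsilon>"
        by (rule nearD[OF near_inv[OF nk u]]) (use st z in auto)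
      then have 2: "cmod (k (inv ?p \<otimes> z) - k (inv ?q \<otimes> z)) \<le> \<epsilon>"
        using st z u by (simp add: inv_mult_group m_assoc)
      have "cmod ((f ?p - f ?q) * k (inv ?p \<otimes> z)) \<le> \<epsilon> * C" "cmod (f ?q * (k (inv ?p \<otimes> z) - k (inv ?q \<otimes> z))) \<le> A * \<epsilon>"
        unfolding norm_mult using 1 2 A C pq z e by (simp_all add: mult_mono)
      then have "cmod ((f ?p - f ?q) * k (inv ?p \<otimes> z) + f ?q * (k (inv ?p \<otimes> z) - k (inv ?q \<otimes> z))) \<le> \<epsilon> * C + A * \<epsilon>"
        using norm_triangle_ineq order_trans add_mono by (meson norm_add_rule_thm)
      then have 3: "cmod (f ?p * k (inv ?p \<otimes> z) - f ?q * k (inv ?q \<otimes> z)) \<le> \<epsilon> * C + A * \<epsilon>"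
        by (simp add: algebra_simps)
      have "F z ?p - F z ?q = (f ?p * k (inv ?p \<otimes> z) - f ?q * k (inv ?q \<otimes> z)) * cnj (h z)"
        by (simp add: F_def left_diff_distrib)
      then show "cmod (F z ?p - F z ?q) \<le> (\<epsilon> * C + A * \<epsilon>) * B"
        using 3 B(2)[OF z] e A C by (simp add: norm_mult mult_mono)
    qed
    show "near (\<lambda>x. F x z) (A * (\<epsilon> * B + C * \<epsilon>)) u \<one>"
      unfolding near_def
    proof (intro ballI)
      fix s t assume st: "s \<in> carrier G" "t \<in> carrier G"
      let ?p = "s \<otimes> u \<otimes> t" and ?q = "s \<otimes> \<one> \<otimes> t"
      have pq: "?p \<in> carrier G" "?q \<in> carrier G" using st u by auto
      have 1: "cmod (cnj (h ?p) - cnj (h ?q)) \<le> \<epsilon>"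
        using nearD[OF nh st] by (simp flip: complex_cnj_diff)
      have "cmod (k ((inv z \<otimes> s) \<otimes> u \<otimes> t) - k ((inv z \<otimes> s) \<otimes> \<one> \<otimes> t)) \<le> \<epsilon>"
        by (rule nearD[OF nk]) (use st z in auto)
      then have 2: "cmod (k (inv z \<otimes> ?p) - k (inv z \<otimes> ?q)) \<le> \<epsilon>"
        using st z u by (simp add: m_assoc)
      have "cmod ((k (inv z \<otimes> ?p) - k (inv z \<otimes> ?q)) * cnj (h ?p)) \<le> \<epsilon> * B" "cmod (k (inv z \<otimes> ?q) * (cnj (h ?p) - cnj (h ?q))) \<le> C * \<epsilon>"
        unfolding norm_mult complex_mod_cnj using 1 2 B C pq z e by (simp_all add: mult_mono)
      then have "cmod ((k (inv z \<otimes> ?p) - k (inv z \<otimes> ?q)) * cnj (h ?p) + k (inv z \<otimes> ?q) * (cnj (h ?p) - cnj (h ?q))) \<le> \<epsilon> * B + C * \<epsilon>"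
        by (meson norm_add_rule_thm)
      then have 3: "cmod (k (inv z \<otimes> ?p) * cnj (h ?p) - k (inv z \<otimes> ?q) * cnj (h ?q)) \<le> \<epsilon> * B + C * \<epsilon>"
        by (simp add: algebra_simps)
      have "F ?p z - F ?q z = f z * (k (inv z \<otimes> ?p) * cnj (h ?p) - k (inv z \<otimes> ?q) * cnj (h ?q))"
        by (simp add: F_def algebra_simps)
      then show "cmod (F ?p z - F ?q z) \<le> A * (\<epsilon> * B + C * \<epsilon>)"
        using mult_mono[OF A(2)[OF z] 3 A(1) norm_ge_zero] by (simp add: norm_mult)
    qed
  qed
  have swap: "mean (\<lambda>x. mean (F x)) = mean (\<lambda>y. mean (\<lambda>x. F x y))"
  proof (rule mean_swap[OF _ bnd])
    fix \<epsilon> :: real assume e: "0 < \<epsilon>"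
    \<comment> \<open>\<open>K\<close> dominates the constants of \<open>near1\<close> and of
      \<open>near2\<close>, so one \<delta> serves both variables; the summand 1 keeps
      \<open>K\<close> positive when the bounds vanish.\<close>
    define K where "K = (C + A) * B + A * (B + C) + 1"
    have K: "0 < K" using A(1) B(1) C(1) by (simp add: K_def add_nonneg_pos)
    define \<delta> where "\<delta> = \<epsilon> / K"
    have d: "0 < \<delta>" "\<delta> * K = \<epsilon>" using e K by (simp_all add: \<delta>_def)
    have "(C + A) * B \<le> K" "A * (B + C) \<le> K" using A(1) B(1) C(1) by (simp_all add: K_def add_nonneg_nonneg)
    then have "\<delta> * ((C + A) * B) \<le> \<epsilon>" "\<delta> * (A * (B + C)) \<le> \<epsilon>" using d mult_left_mono[of _ K \<delta>] by auto
    then have le: "(\<delta> * C + A * \<delta>) * B \<le> \<epsilon>" "A * (\<delta> * B + C * \<delta>) \<le> \<epsilon>" by (simp_all add: algebra_simps)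
    have "\<exists>N. openin T N \<and> \<one> \<in> N \<and> (\<forall>p\<in>{f, h, k}. \<forall>x\<in>N. near p \<delta> x \<one>)"
      by (rule common_nbhd) (use f h kU UC_unif_cont d(1) in auto)
    then obtain N where N: "openin T N" "\<one> \<in> N" "\<forall>p\<in>{f, h, k}. \<forall>x\<in>N. near p \<delta> x \<one>" by blast
    have "near (F z) \<epsilon> u \<one> \<and> near (\<lambda>x. F x z) \<epsilon> u \<one>" if u: "u \<in> N" and z: "z \<in> carrier G" for u z
    proof -
      have *: "near f \<delta> u \<one>" "near h \<delta> u \<one>" "near k \<delta> u \<one>" "u \<in> carrier G"
        using N(3) u openin_carrier[OF N(1) u] by auto
      show ?thesis using near_mono[OF near1[OF * z] le(1)] near_mono[OF near2[OF * z] le(2)] by blast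
    qed
    then show "\<exists>N. openin T N \<and> \<one> \<in> N \<and> (\<forall>u\<in>N. \<forall>z\<in>carrier G. near (F z) \<epsilon> u \<one> \<and> near (\<lambda>x. F x z) \<epsilon> u \<one>)"
      using N(1,2) by blast
  qed
  have kswap: "k (inv y \<otimes> x) = cnj (k (inv x \<otimes> y))" if "x \<in> carrier G" "y \<in> carrier G" for x y
    using kinv[of "inv x \<otimes> y"] that by (simp add: inv_mult_group)
  have "mean (F x) = conv k f x * cnj (h x)" if x: "x \<in> carrier G" for x
  proof -
    have u: "unif_cont (\<lambda>y. f y * cnj (ltr x k y))" by (rule unif_cont_ip[OF f ltr_UC[OF kU x]])
    have "mean (F x) = mean (\<lambda>y. cnj (h x) * (f y * cnj (ltr x k y)))"
    proof (rule mean_cong[OF unif_cont_cmult[OF u], symmetric])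
      fix y assume y: "y \<in> carrier G"
      show "cnj (h x) * (f y * cnj (ltr x k y)) = F x y"
        unfolding F_def kswap[OF x y] using y by simp
    qed
    also have "\<dots> = cnj (h x) * ip f (ltr x k)" unfolding ip_def by (rule mean_cmult[OF u])
    finally show ?thesis using x by (simp add: conv_apply)
  qed
  then have L: "ip (conv k f) h = mean (\<lambda>x. mean (F x))"
    unfolding ip_def[of "conv k f"] by (intro mean_cong unif_cont_ip conv_UC f h kU) simp
  have "mean (\<lambda>x. F x y) = f y * cnj (conv k h y)" if y: "y \<in> carrier G" for y
  proof -
    have u: "unif_cont (\<lambda>x. ltr y k x * cnj (h x))" by (rule unif_cont_ip[OF ltr_UC[OF kU y] h])
    have "mean (\<lambda>x. F x y) = mean (\<lambda>x. f y * (ltr y k x * cnj (h x)))"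
      by (rule mean_cong[OF unif_cont_cmult[OF u], symmetric]) (use y in \<open>simp add: F_def\<close>)
    also have "\<dots> = f y * ip (ltr y k) h" unfolding ip_def by (rule mean_cmult[OF u])
    also have "ip (ltr y k) h = cnj (conv k h y)"
      using ip_commute[OF ltr_UC[OF kU y] h] y by (simp add: conv_apply)
    finally show ?thesis .
  qed
  then have R: "ip f (conv k h) = mean (\<lambda>y. mean (\<lambda>x. F x y))"
    unfolding ip_def[of f] by (intro mean_cong unif_cont_ip conv_UC f h kU) simp
  show ?thesis using L R swap by simp
qed

end

section \<open>Finite-dimensional translation-invariant spaces\<close>

locale countable_totally_bounded_group = totally_bounded_group +
  assumes countable_carrier: "countable (carrier G)"

text \<open>A maximal orthonormal family of eigenfunctions of \<open>k * (k * f)\<close> with eigenvalues at least \<open>\<epsilon>\<^sup>2\<close>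
  is finite by Bessel's inequality; its span \<open>V\<close> is translation invariant, and \<open>\<parallel>k * f\<parallel> \<le> \<epsilon> \<parallel>f\<parallel>\<close>
  on the orthogonal complement of \<open>V\<close>, since otherwise compactness of convolution
  would produce another eigenfunction there. Squaring the convolution makes it a positive operator.\<close>

context totally_bounded_group
begin

definition eigen :: "('a \<Rightarrow> complex) \<Rightarrow> real \<Rightarrow> ('a \<Rightarrow> complex) \<Rightarrow> bool"
  where "eigen k \<mu> f \<longleftrightarrow> f \<in> UC \<and> conv k (conv k f) = sc (complex_of_real \<mu>) f"

definition eigen_family :: "('a \<Rightarrow> complex) \<Rightarrow> real \<Rightarrow> (nat \<Rightarrow> 'a \<Rightarrow> complex) \<Rightarrow> nat \<Rightarrow> bool"
  where "eigen_family k c e n \<longleftrightarrow> orthonormal e n \<and> (\<forall>i<n. \<exists>\<mu>\<ge>c. eigen k \<mu> (e i))"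

text \<open>A Hilbert-Schmidt estimate. At each point \<open>x\<close> the values of the functions
  \<open>conv k (e i)\<close> are coefficients of \<open>ltr x k\<close>, so their squares add up to
  at most the squared norm of \<open>k\<close>; taking means bounds the sum of the squared norms of
  the \<open>conv k (e i)\<close>. Each of these equals the eigenvalue and is at least
  \<open>c\<close>.\<close>

lemma eigen_family_bound:
  assumes k: "central_kernel k" and e: "eigen_family k c e n"
  shows "n * c \<le> (nrm k)\<^sup>2"
proof -
  have kU: "k \<in> UC" using k by (simp add: central_kernel_def)
  have on: "orthonormal e n" using e by (simp add: eigen_family_def)
  note eU = orthonormalD(1)[OF on]
  have sq: "c \<le> (nrm (conv k (e i)))\<^sup>2" if i: "i < n" for i
  proof -
    obtain \<mu> where \<mu>: "\<mu> \<ge> c" "eigen k \<mu> (e i)" using e i by (auto simp: eigen_family_def)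
    have "ip (conv k (e i)) (conv k (e i)) = ip (conv k (conv k (e i))) (e i)"
      using conv_symmetric[OF conv_UC[OF eU[OF i] kU] eU[OF i] k] by simp
    also have "\<dots> = complex_of_real \<mu>"
      using \<mu>(2) eU[OF i] orthonormalD(2)[OF on i i] by (simp add: eigen_def ip_sc)
    finally have "complex_of_real ((nrm (conv k (e i)))\<^sup>2) = complex_of_real \<mu>"
      using ip_self[OF conv_UC[OF eU[OF i] kU]] by simp
    then show ?thesis using \<mu>(1) by (simp only: of_real_eq_iff)
  qed
  have uc: "unif_cont (\<lambda>x. conv k (e i) x * cnj (conv k (e i) x))" if "i < n" for i
    by (intro unif_cont_ip conv_UC eU that kU)
  define S where "S x = (\<Sum>i<n. conv k (e i) x * cnj (conv k (e i) x))" for x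
  have uS: "unif_cont S" unfolding S_def using uc by (intro unif_cont_sum) auto
  have "cmod (S x) \<le> (nrm k)\<^sup>2" if x: "x \<in> carrier G" for x
  proof -
    have "S x = (\<Sum>i<n. complex_of_real ((cmod (ip (ltr x k) (e i)))\<^sup>2))"
      unfolding S_def
    proof (rule sum.cong[OF refl])
      fix i assume "i \<in> {..<n}"
      then have "conv k (e i) x = cnj (ip (ltr x k) (e i))"
        using x ip_commute[OF eU ltr_UC[OF kU x]] by (simp add: conv_apply)
      then show "conv k (e i) x * cnj (conv k (e i) x) = complex_of_real ((cmod (ip (ltr x k) (e i)))\<^sup>2)"
        by (simp only: complex_norm_square complex_cnj_cnj mult.commute)
    qed
    then have eq: "S x = complex_of_real (\<Sum>i<n. (cmod (ip (ltr x k) (e i)))\<^sup>2)" by simp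
    have "(\<Sum>i<n. (cmod (ip (ltr x k) (e i)))\<^sup>2) \<le> (nrm k)\<^sup>2"
      using bessel[OF on ltr_UC[OF kU x]] nrm_ltr[OF kU x] by simp
    then show ?thesis unfolding eq norm_of_real by (simp add: sum_nonneg)
  qed
  then have "cmod (mean S) \<le> (nrm k)\<^sup>2" by (rule mean_bound[OF uS])
  moreover have "mean S = complex_of_real (\<Sum>i<n. (nrm (conv k (e i)))\<^sup>2)"
  proof -
    have "mean S = (\<Sum>i<n. ip (conv k (e i)) (conv k (e i)))"
      unfolding S_def ip_def using uc by (intro mean_sum) auto
    then show ?thesis by (simp add: ip_self conv_UC eU kU)
  qed
  ultimately have "(\<Sum>i<n. (nrm (conv k (e i)))\<^sup>2) \<le> (nrm k)\<^sup>2"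
    by (simp only: norm_of_real)
  moreover have "(\<Sum>i<n. c) \<le> (\<Sum>i<n. (nrm (conv k (e i)))\<^sup>2)" by (intro sum_mono sq) simp
  ultimately show ?thesis by simp
qed

lemma maximal_eigen_family:
  assumes k: "central_kernel k" and c: "0 < c"
  obtains e n where "eigen_family k c e n" "\<And>e'. \<not> eigen_family k c e' (Suc n)"
proof -
  let ?P = "\<lambda>n. \<exists>e. eigen_family k c e n"
  obtain N :: nat where N: "(nrm k)\<^sup>2 / c \<le> N" using real_arch_simple by blast
  have "?P 0" by (simp add: eigen_family_def orthonormal_def)
  moreover have "\<forall>n. ?P n \<longrightarrow> n \<le> N"
  proof (intro allI impI)
    fix n assume "?P n"
    then have "n * c \<le> (nrm k)\<^sup>2" using eigen_family_bound[OF k] by blast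
    then have "real n \<le> (nrm k)\<^sup>2 / c" using c by (simp add: field_simps)
    then show "n \<le> N" using N by linarith
  qed
  ultimately obtain n where n: "?P n" "\<forall>m. ?P m \<longrightarrow> m \<le> n"
    using Nat.ex_has_greatest_nat[of ?P 0 N] by blast
  have "\<not> eigen_family k c e' (Suc n)" for e' using n(2) by fastforce
  then show ?thesis using n(1) that by blast
qed

lemma eigen_diff: "\<lbrakk>eigen k \<mu> f; eigen k \<mu> h; k \<in> UC\<rbrakk> \<Longrightarrow> eigen k \<mu> (f - h)"
  by (simp add: eigen_def X_diff conv_diff conv_UC sc_diff)

lemma eigen_sc: "\<lbrakk>eigen k \<mu> f; k \<in> UC\<rbrakk> \<Longrightarrow> eigen k \<mu> (sc c f)"
  by (simp add: eigen_def X_sc conv_sc conv_UC mult.commute)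

lemma eigen_zero: "k \<in> UC \<Longrightarrow> eigen k \<mu> 0"
  using conv_sc[OF X_zero, of k 0] by (simp add: eigen_def X_zero)

lemma eigen_add: "\<lbrakk>eigen k \<mu> f; eigen k \<mu> h; k \<in> UC\<rbrakk> \<Longrightarrow> eigen k \<mu> (f + h)"
  by (simp add: eigen_def X_add conv_add conv_UC sc_add)

lemma eigen_sum: "\<lbrakk>\<And>i. i \<in> I \<Longrightarrow> eigen k \<mu> (f i); k \<in> UC\<rbrakk> \<Longrightarrow> eigen k \<mu> (\<Sum>i\<in>I. f i)"
proof (induction I rule: infinite_finite_induct)
  case (insert i I)
  have "eigen k \<mu> (f i + (\<Sum>i\<in>I. f i))"
    by (rule eigen_add[OF _ insert.IH]) (use insert.prems in blast)+
  then show ?case unfolding sum.insert[OF insert.hyps] .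
qed (simp_all add: eigen_zero)

text \<open>Eigenfunctions with different eigenvalues are orthogonal, so the projection of
  \<open>v\<close> only involves members of the family with eigenvalue \<mu>. The residual is again
  an eigenfunction for \<mu> and would prolong the family if it were not zero.\<close>

lemma eigen_in_span:
  assumes k: "central_kernel k" and e: "eigen_family k c e n" and max: "\<And>e'. \<not> eigen_family k c e' (Suc n)"
    and v: "eigen k \<mu> v" "c \<le> \<mu>"
  shows "proj e n v = v"
proof (rule ccontr)
  assume "proj e n v \<noteq> v"
  then have r0: "v - proj e n v \<noteq> 0" by auto
  have kU: "k \<in> UC" using k by (simp add: central_kernel_def)
  have on: "orthonormal e n" using e by (simp add: eigen_family_def)
  have vU: "v \<in> UC" using v by (simp add: eigen_def)
  have "eigen k \<mu> (sc (ip v (e i)) (e i))" if i: "i < n" for i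
  proof -
    obtain \<mu>' where \<mu>': "eigen k \<mu>' (e i)" using e i by (auto simp: eigen_family_def)
    have eU: "e i \<in> UC" by (rule orthonormalD(1)[OF on i])
    have "ip (conv k (conv k v)) (e i) = ip v (conv k (conv k (e i)))"
      using conv_symmetric[OF conv_UC[OF vU kU] eU k] conv_symmetric[OF vU conv_UC[OF eU kU] k] by simp
    then have "complex_of_real \<mu> * ip v (e i) = complex_of_real \<mu>' * ip v (e i)"
      using v \<mu>' vU eU by (simp add: eigen_def ip_sc ip_sc_right)
    then consider "ip v (e i) = 0" | "\<mu> = \<mu>'" by auto
    then show ?thesis by cases (simp_all add: eigen_zero kU eigen_sc \<mu>')
  qed
  then have r: "eigen k \<mu> (v - proj e n v)"
    unfolding proj_def by (intro eigen_diff v eigen_sum kU) auto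
  then have rU: "v - proj e n v \<in> UC" by (simp add: eigen_def)
  let ?e = "e(n := sc (1 / nrm (v - proj e n v)) (v - proj e n v))"
  have "eigen_family k c ?e (Suc n)"
    unfolding eigen_family_def
  proof (intro conjI allI impI)
    show "orthonormal ?e (Suc n)" by (rule orthonormal_extend[OF on rU r0 ip_residual_e[OF on _ vU]])
    fix i assume i: "i < Suc n"
    show "\<exists>\<mu>\<ge>c. eigen k \<mu> (?e i)"
    proof (cases "i = n")
      case True
      then show ?thesis using eigen_sc[OF r kU] v(2) by auto
    next
      case False
      then show ?thesis using e i by (simp add: eigen_family_def)
    qed
  qed
  then show False using max by blast
qed

text \<open>On a totally bounded group equicontinuity upgrades pointwise to uniform convergence:
  convergence at finitely many centres controls all points.\<close>

lemma limit_in_UC: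
  assumes f: "\<And>n. f n \<in> UC" and equi: "\<And>\<epsilon>. 0 < \<epsilon> \<Longrightarrow> \<exists>N. openin T N \<and> \<one> \<in> N \<and> (\<forall>n. \<forall>u\<in>N. near (f n) \<epsilon> u \<one>)"
    and lim: "\<And>x. x \<in> carrier G \<Longrightarrow> (\<lambda>n. f n x) \<longlonglongrightarrow> l x"
  shows "zero_ext l \<in> UC" "0 < \<epsilon> \<Longrightarrow> \<exists>n0. \<forall>n\<ge>n0. \<forall>x\<in>carrier G. cmod (f n x - l x) \<le> \<epsilon>"
proof -
  have near_l: "near l \<epsilon> u \<one>" if "\<And>n. near (f n) \<epsilon> u \<one>" "u \<in> carrier G" for \<epsilon> u
    unfolding near_def
  proof (intro ballI)
    fix s t assume st: "s \<in> carrier G" "t \<in> carrier G"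
    have "(\<lambda>n. cmod (f n (s \<otimes> u \<otimes> t) - f n (s \<otimes> \<one> \<otimes> t))) \<longlonglongrightarrow> cmod (l (s \<otimes> u \<otimes> t) - l (s \<otimes> \<one> \<otimes> t))"
      by (intro tendsto_intros lim) (use st that(2) in auto)
    then show "cmod (l (s \<otimes> u \<otimes> t) - l (s \<otimes> \<one> \<otimes> t)) \<le> \<epsilon>"
      by (rule LIMSEQ_le_const2) (use nearD[OF that(1) st] in blast)
  qed
  have ul: "unif_cont l"
  proof (rule unif_contI)
    fix \<epsilon> :: real assume "0 < \<epsilon>"
    from equi[OF this] obtain N where N: "openin T N" "\<one> \<in> N" "\<forall>n. \<forall>u\<in>N. near (f n) \<epsilon> u \<one>" by blast
    have "near l \<epsilon> u \<one>" if "u \<in> N" for u using near_l N(3) that openin_carrier[OF N(1) that] by blast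
    then show "\<exists>N. openin T N \<and> \<one> \<in> N \<and> (\<forall>x\<in>N. near l \<epsilon> x \<one>)" using N(1,2) by blast
  qed
  then show "zero_ext l \<in> UC" by (rule zero_ext_UC)
  assume e: "0 < \<epsilon>"
  then have e3: "0 < \<epsilon> / 3" by simp
  from equi[OF e3] obtain N where N: "openin T N" "\<one> \<in> N" "\<forall>n. \<forall>u\<in>N. near (f n) (\<epsilon> / 3) u \<one>" by blast
  have nl: "near l (\<epsilon> / 3) u \<one>" if "u \<in> N" for u using near_l N(3) that openin_carrier[OF N(1) that] by blast
  obtain A where A: "finite A" "A \<subseteq> carrier G" "\<forall>x\<in>carrier G. \<exists>a\<in>A. inv a \<otimes> x \<in> N"
    using finite_cover[OF N(1,2)] by blast
  have "\<forall>\<^sub>F n in sequentially. \<forall>a\<in>A. cmod (f n a - l a) < \<epsilon> / 3"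
  proof (intro eventually_ball_finite A(1) ballI)
    fix a assume "a \<in> A"
    then have "(\<lambda>n. f n a) \<longlonglongrightarrow> l a" using lim A(2) by blast
    then show "\<forall>\<^sub>F n in sequentially. cmod (f n a - l a) < \<epsilon> / 3"
      by (drule_tac tendstoD[OF _ e3]) (simp only: dist_norm)
  qed
  then obtain n0 where n0: "\<forall>n\<ge>n0. \<forall>a\<in>A. cmod (f n a - l a) < \<epsilon> / 3"
    unfolding eventually_sequentially by blast
  have "cmod (f n x - l x) \<le> \<epsilon>" if n: "n \<ge> n0" and x: "x \<in> carrier G" for n x
  proof -
    obtain a where a: "a \<in> A" "inv a \<otimes> x \<in> N" using A(3) x by blast
    then have aG: "a \<in> carrier G" using A(2) by blast
    have "near (f n) (\<epsilon> / 3) x a" by (rule near_cancel_left) (use N(3) a x aG in auto)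
    then have 1: "cmod (f n x - f n a) \<le> \<epsilon> / 3" using nearD1 x aG by blast
    have "near l (\<epsilon> / 3) x a" by (rule near_cancel_left[OF nl[OF a(2)] x aG])
    then have 2: "cmod (l x - l a) \<le> \<epsilon> / 3" using nearD1 x aG by blast
    have 3: "cmod (f n a - l a) < \<epsilon> / 3" using n0 n a(1) by blast
    have "f n x - l x = (f n x - f n a) + (f n a - l a) - (l x - l a)" by simp
    then have "cmod (f n x - l x) \<le> cmod (f n x - f n a) + cmod (f n a - l a) + cmod (l x - l a)"
      by (metis norm_triangle_ineq4 norm_triangle_ineq add_right_mono order_trans)
    then show ?thesis using 1 2 3 by linarith
  qed
  then show "\<exists>n0. \<forall>n\<ge>n0. \<forall>x\<in>carrier G. cmod (f n x - l x) \<le> \<epsilon>" by blast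
qed

end

context countable_totally_bounded_group
begin

text \<open>The images are uniformly bounded and, by \<open>near_conv\<close>, equicontinuous. On a
  countable carrier a diagonal subsequence converges at every point, and equicontinuity makes the
  convergence uniform.\<close>

lemma conv_compact:
  assumes f: "\<And>n. f n \<in> UC" "\<And>n. nrm (f n) \<le> 1" and k: "k \<in> UC"
  obtains g r where "g \<in> UC" "strict_mono (r :: nat \<Rightarrow> nat)" "(\<lambda>n. nrm (g - conv k (f (r n)))) \<longlonglongrightarrow> 0"
proof -
  have cU: "conv k (f n) \<in> UC" for n using conv_UC f k by blast
  have "cmod (conv k (f n) x) \<le> nrm k" if "x \<in> carrier G" for n x
    using order_trans[OF conv_bound[OF f(1) k that] mult_right_mono[OF f(2) nrm_nonneg[OF k]]] by simp
  then obtain r where r: "strict_mono (r :: nat \<Rightarrow> nat)" "\<And>x. x \<in> carrier G \<Longrightarrow> \<exists>l. (\<lambda>n. conv k (f (r n)) x) \<longlonglongrightarrow> l"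
    using function_convergent_subsequence[OF countable_carrier, of "\<lambda>n. conv k (f n)" "nrm k"] by blast
  define l where "l x = lim (\<lambda>n. conv k (f (r n)) x)" for x
  have lim: "(\<lambda>n. conv k (f (r n)) x) \<longlonglongrightarrow> l x" if "x \<in> carrier G" for x
    unfolding l_def using r(2)[OF that] by (simp add: convergent_def convergent_LIMSEQ_iff[symmetric])
  have equi: "\<exists>N. openin T N \<and> \<one> \<in> N \<and> (\<forall>n. \<forall>u\<in>N. near (conv k (f (r n))) \<epsilon> u \<one>)" if e: "0 < \<epsilon>" for \<epsilon>
  proof -
    obtain N where N: "openin T N" "\<one> \<in> N" "\<forall>u\<in>N. near k \<epsilon> u \<one>"
      using UC_unif_cont[OF k] e unfolding unif_cont_def by blast
    have "near (conv k (f (r n))) \<epsilon> u \<one>" if u: "u \<in> N" for n u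
    proof (rule near_mono[OF near_conv[OF f(1) k]])
      show "near k \<epsilon> u \<one>" using N(3) u by blast
      show "u \<in> carrier G" by (rule openin_carrier[OF N(1) u])
      show "nrm (f (r n)) * \<epsilon> \<le> \<epsilon>" using mult_right_mono[OF f(2), of \<epsilon>] e by simp
    qed
    then show ?thesis using N(1,2) by blast
  qed
  note L = limit_in_UC[of "\<lambda>n. conv k (f (r n))", OF cU equi lim]
  have "(\<lambda>n. nrm (zero_ext l - conv k (f (r n)))) \<longlonglongrightarrow> 0"
  proof (rule metric_LIMSEQ_I)
    fix \<epsilon> :: real assume e: "0 < \<epsilon>"
    then obtain n0 where n0: "\<forall>n\<ge>n0. \<forall>x\<in>carrier G. cmod (conv k (f (r n)) x - l x) \<le> \<epsilon> / 2"
      using L(2)[of "\<epsilon> / 2"] by auto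
    have "nrm (zero_ext l - conv k (f (r n))) \<le> \<epsilon> / 2" if "n \<ge> n0" for n
      by (rule nrm_le) (use L(1) cU X_diff n0 that in \<open>auto simp: norm_minus_commute\<close>)
    moreover have "0 \<le> nrm (zero_ext l - conv k (f (r n)))" for n
      by (intro nrm_nonneg X_diff L(1) cU)
    ultimately have "dist (nrm (zero_ext l - conv k (f (r n)))) 0 < \<epsilon>" if "n \<ge> n0" for n
      using that e by (fastforce simp: dist_real_def)
    then show "\<exists>n0. \<forall>n\<ge>n0. dist (nrm (zero_ext l - conv k (f (r n)))) 0 < \<epsilon>" by blast
  qed
  then show ?thesis using that L(1) r(1) by blast
qed

lemma conv_small_on_complement:
  assumes k: "central_kernel k" and \<epsilon>: "0 < \<epsilon>"
    and e: "eigen_family k (\<epsilon>\<^sup>2) e n" and max: "\<And>e'. \<not> eigen_family k (\<epsilon>\<^sup>2) e' (Suc n)"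
    and f: "f \<in> UC" "\<And>i. i < n \<Longrightarrow> ip f (e i) = 0"
  shows "nrm (conv k f) \<le> \<epsilon> * nrm f"
proof (rule ccontr)
  assume contra: "\<not> ?thesis"
  have kU: "k \<in> UC" using k by (simp add: central_kernel_def)
  have on: "orthonormal e n" using e by (simp add: eigen_family_def)
  note eU = orthonormalD(1)[OF on]
  define S where "S = {f \<in> UC. \<forall>i<n. ip f (e i) = 0}"
  have SU: "f \<in> S \<Longrightarrow> f \<in> UC" for f by (simp add: S_def)
  have Ssc: "f \<in> S \<Longrightarrow> sc c f \<in> S" for c f using eU by (simp add: S_def X_sc ip_sc)
  have SconvS: "conv k f \<in> S" if f: "f \<in> S" for f
  proof -
    have "ip (conv k f) (e i) = 0" if i: "i < n" for i
    proof -
      obtain \<mu> where \<mu>: "\<mu> \<ge> \<epsilon>\<^sup>2" "eigen k \<mu> (e i)" using e i by (auto simp: eigen_family_def)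
      have cU: "conv k (e i) \<in> UC" by (rule conv_UC[OF eU[OF i] kU])
      have "eigen k \<mu> (conv k (e i))"
        using \<mu>(2) cU conv_sc[OF eU[OF i] kU] by (simp add: eigen_def)
      then have p: "proj e n (conv k (e i)) = conv k (e i)" by (rule eigen_in_span[OF k e max _ \<mu>(1)])
      have "ip f (proj e n (conv k (e i))) = 0"
        unfolding proj_def using f by (intro ip_orth_comb on) (auto simp: S_def)
      then show ?thesis unfolding p using conv_symmetric[OF SU[OF f] eU[OF i] k] by simp
    qed
    then show ?thesis using conv_UC[OF SU[OF f] kU] by (simp add: S_def)
  qed
  define R where "R = {nrm (conv k h) | h. h \<in> S \<and> nrm h \<le> 1}"
  have zS: "0 \<in> S" using eU by (simp add: S_def X_zero ip_zero)
  have R0: "R \<noteq> {}" unfolding R_def using zS by force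
  have Rb: "bdd_above R"
  proof (rule bdd_aboveI[of _ "nrm k"])
    fix x assume "x \<in> R"
    then obtain h where h: "h \<in> S" "nrm h \<le> 1" "x = nrm (conv k h)" by (auto simp: R_def)
    show "x \<le> nrm k"
      using nrm_conv[OF SU[OF h(1)] kU] mult_left_mono[OF h(2) nrm_nonneg[OF kU]] h(3) by simp
  qed
  \<comment> \<open>The operator norm of \<open>conv k\<close> on the complement \<open>S\<close> of
    the family, which \<open>conv k\<close> preserves.\<close>
  define \<tau> where "\<tau> = Sup R"
  have le_\<tau>: "nrm (conv k h) \<le> \<tau> * nrm h" if h: "h \<in> S" for h
  proof (cases "h = 0")
    case True
    then show ?thesis using conv_sc[OF X_zero kU, of 0] by simp
  next
    case False
    then have p: "0 < nrm h" using nrm_pos SU[OF h] by blast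
    let ?u = "sc (1 / nrm h) h"
    have "nrm ?u = 1" using p nrm_sc[OF SU[OF h]] by (simp add: norm_divide)
    then have "nrm (conv k ?u) \<in> R" using Ssc[OF h] by (force simp: R_def)
    then have "nrm (conv k ?u) \<le> \<tau>" unfolding \<tau>_def by (rule cSup_upper[OF _ Rb])
    moreover have "nrm (conv k ?u) = nrm (conv k h) / nrm h"
      using p nrm_sc[OF conv_UC[OF SU[OF h] kU]] conv_sc[OF SU[OF h] kU] by (simp add: norm_divide)
    then have "nrm (conv k h) = nrm (conv k ?u) * nrm h" using p by simp
    ultimately show ?thesis using p by (simp add: mult_right_mono)
  qed
  have fS: "f \<in> S" using f by (simp add: S_def)
  have f0: "0 < nrm f"
  proof (rule ccontr)
    assume "\<not> 0 < nrm f"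
    then have "nrm f = 0" using nrm_nonneg[OF f(1)] by simp
    then show False using le_\<tau>[OF fS] contra by simp
  qed
  \<comment> \<open>The assumed violation of the bound pushes \<tau> above \<epsilon>, so that an
    eigenfunction with eigenvalue \<open>\<tau>\<^sup>2\<close> will fall under
    \<open>eigen_in_span\<close>.\<close>
  have "\<epsilon> * nrm f < \<tau> * nrm f" using le_\<tau>[OF fS] contra by linarith
  then have \<tau>: "\<epsilon> < \<tau>" "0 < \<tau>" using f0 \<epsilon> by auto
  have "\<exists>h. h \<in> S \<and> nrm h \<le> 1 \<and> \<tau> - 1 / real (Suc m) < nrm (conv k h)" for m
  proof -
    have "\<tau> - 1 / real (Suc m) < Sup R" by (simp add: \<tau>_def)
    then obtain x where "x \<in> R" "\<tau> - 1 / real (Suc m) < x" using less_cSupD[OF R0] by blast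
    then show ?thesis by (auto simp: R_def)
  qed
  then have "\<exists>h. \<forall>m. h m \<in> S \<and> nrm (h m) \<le> 1 \<and> \<tau> - 1 / real (Suc m) < nrm (conv k (h m))" by metis
  then obtain h where h: "\<And>m. h m \<in> S" "\<And>m. nrm (h m) \<le> 1" "\<And>m. \<tau> - 1 / real (Suc m) < nrm (conv k (h m))"
    by blast
  have hU: "h m \<in> UC" for m using SU h(1) by blast
  have lim_h: "(\<lambda>m. nrm (conv k (h m))) \<longlonglongrightarrow> \<tau>"
  proof (rule tendsto_sandwich)
    have "nrm (conv k (h m)) \<le> \<tau>" for m
      using le_\<tau>[OF h(1)] mult_left_mono[OF h(2), of \<tau>] \<tau>(2) by (smt (verit))
    then show "\<forall>\<^sub>F m in sequentially. nrm (conv k (h m)) \<le> \<tau>" by simp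
    show "\<forall>\<^sub>F m in sequentially. \<tau> - 1 / real (Suc m) \<le> nrm (conv k (h m))"
      by (intro always_eventually allI less_imp_le h(3))
    show "(\<lambda>m. \<tau> - 1 / real (Suc m)) \<longlonglongrightarrow> \<tau>"
      using tendsto_diff[OF tendsto_const[of \<tau>] LIMSEQ_inverse_real_of_nat] by (simp add: inverse_eq_divide)
  qed simp
  let ?d = "\<lambda>m. conv k (conv k (h m)) - sc (\<tau>\<^sup>2) (h m)"
  have dU: "?d m \<in> UC" for m by (intro X_diff X_sc conv_UC hU kU)
  \<comment> \<open>Expand the square. By self-adjointness the mixed terms are
    \<open>\<tau>\<^sup>2\<close> times the squared norm of \<open>conv k (h m)\<close>, and the
    definition of \<tau> bounds the squared norm of the double convolution by the same product. A
    maximizing sequence therefore satisfies the eigenvalue equation in the limit.\<close>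
  have d2: "(nrm (?d m))\<^sup>2 \<le> \<tau>\<^sup>2 * (\<tau>\<^sup>2 - (nrm (conv k (h m)))\<^sup>2)" for m
  proof -
    let ?a = "conv k (conv k (h m))" and ?b = "sc (complex_of_real (\<tau>\<^sup>2)) (h m)"
    have aU: "?a \<in> UC" "?b \<in> UC" "conv k (h m) \<in> UC" by (intro X_sc conv_UC hU kU)+
    have ab: "ip ?a ?b = complex_of_real (\<tau>\<^sup>2 * (nrm (conv k (h m)))\<^sup>2)"
      using conv_symmetric[OF aU(3) hU k] ip_self[OF aU(3)] aU hU by (simp add: ip_sc_right)
    then have ba: "ip ?b ?a = complex_of_real (\<tau>\<^sup>2 * (nrm (conv k (h m)))\<^sup>2)"
      using ip_commute[OF aU(2,1)] by (simp only: complex_cnj_complex_of_real)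
    have "ip (?a - ?b) (?a - ?b) = ip ?a ?a - ip ?b ?a - (ip ?a ?b - ip ?b ?b)"
      using aU by (simp add: ip_diff ip_diff_right X_diff)
    then have "complex_of_real ((nrm (?d m))\<^sup>2) = complex_of_real ((nrm ?a)\<^sup>2 - 2 * (\<tau>\<^sup>2 * (nrm (conv k (h m)))\<^sup>2) + (nrm ?b)\<^sup>2)"
      using ip_self[OF dU[of m]] ip_self[OF aU(1)] ip_self[OF aU(2)] ab ba by (simp add: algebra_simps)
    then have eq: "(nrm (?d m))\<^sup>2 = (nrm ?a)\<^sup>2 - 2 * (\<tau>\<^sup>2 * (nrm (conv k (h m)))\<^sup>2) + (nrm ?b)\<^sup>2"
      by (simp only: of_real_eq_iff)
    have "(nrm ?a)\<^sup>2 \<le> (\<tau> * nrm (conv k (h m)))\<^sup>2"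
      by (rule power_mono[OF le_\<tau>[OF SconvS[OF h(1)]] nrm_nonneg[OF aU(1)]])
    moreover have "nrm ?b \<le> \<tau>\<^sup>2"
      using nrm_sc[OF hU, of "complex_of_real (\<tau>\<^sup>2)"] mult_left_mono[OF h(2), of "\<tau>\<^sup>2" m] by (simp add: norm_power)
    then have "(nrm ?b)\<^sup>2 \<le> (\<tau>\<^sup>2)\<^sup>2" by (rule power_mono[OF _ nrm_nonneg[OF aU(2)]])
    ultimately show ?thesis unfolding eq by (simp add: power_mult_distrib power2_eq_square algebra_simps)
  qed
  have "(\<lambda>m. \<tau>\<^sup>2 * (\<tau>\<^sup>2 - (nrm (conv k (h m)))\<^sup>2)) \<longlonglongrightarrow> \<tau>\<^sup>2 * (\<tau>\<^sup>2 - \<tau>\<^sup>2)"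
    by (intro tendsto_intros lim_h)
  then have "(\<lambda>m. \<tau>\<^sup>2 * (\<tau>\<^sup>2 - (nrm (conv k (h m)))\<^sup>2)) \<longlonglongrightarrow> 0" by simp
  then have "(\<lambda>m. (nrm (?d m))\<^sup>2) \<longlonglongrightarrow> 0"
    by (rule Lim_null_comparison[rotated]) (use d2 in simp)
  then have "(\<lambda>m. sqrt ((nrm (?d m))\<^sup>2)) \<longlonglongrightarrow> sqrt 0" by (rule tendsto_real_sqrt)
  then have lim_d: "(\<lambda>m. nrm (?d m)) \<longlonglongrightarrow> 0" using nrm_nonneg[OF dU] by simp
  \<comment> \<open>Compactness makes a subsequence of \<open>conv k (h m)\<close> converge, not of
    \<open>h m\<close>. The limit satisfies the eigenvalue equation because the approximate equation
    can be convolved once more.\<close>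
  obtain g r where g: "g \<in> UC" "strict_mono (r :: nat \<Rightarrow> nat)" "(\<lambda>m. nrm (g - conv k (h (r m)))) \<longlonglongrightarrow> 0"
    by (rule conv_compact[OF hU h(2) kU])
  have cU: "conv k (h m) \<in> UC" for m by (rule conv_UC[OF hU kU])
  define K where "K = nrm k"
  have K0: "0 \<le> K" unfolding K_def by (rule nrm_nonneg[OF kU])
  have "nrm (conv k (conv k g) - sc (\<tau>\<^sup>2) g) \<le> 0"
  proof (rule LIMSEQ_le_const)
    show "(\<lambda>m. (K * K + \<tau>\<^sup>2) * nrm (g - conv k (h (r m))) + K * nrm (?d (r m))) \<longlonglongrightarrow> 0"
      using tendsto_add[OF tendsto_mult_left[OF g(3)] tendsto_mult_left[OF LIMSEQ_subseq_LIMSEQ[OF lim_d g(2)]]]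
      by (simp add: o_def)
    have "nrm (conv k (conv k g) - sc (\<tau>\<^sup>2) g) \<le> (K * K + \<tau>\<^sup>2) * nrm (g - conv k (h m)) + K * nrm (?d m)" for m
    proof -
      let ?y = "g - conv k (h m)"
      have yU: "?y \<in> UC" by (intro X_diff g(1) cU)
      have gen: "a - t = (a - b) + ((b - s) - (t - s))" for a b s t :: "'a \<Rightarrow> complex" by simp
      have e1: "conv k (conv k ?y) = conv k (conv k g) - conv k (conv k (conv k (h m)))"
        by (simp only: conv_diff[OF g(1) cU kU] conv_diff[OF conv_UC[OF g(1) kU] conv_UC[OF cU kU] kU])
      have e2: "conv k (?d m) = conv k (conv k (conv k (h m))) - sc (\<tau>\<^sup>2) (conv k (h m))"
        by (simp only: conv_diff[OF conv_UC[OF cU kU] X_sc[OF hU] kU] conv_sc[OF hU kU])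
      have "conv k (conv k g) - sc (\<tau>\<^sup>2) g = conv k (conv k ?y) + (conv k (?d m) - sc (\<tau>\<^sup>2) ?y)"
        unfolding e1 e2 sc_diff by (rule gen)
      moreover have "nrm (conv k (conv k ?y) + (conv k (?d m) - sc (\<tau>\<^sup>2) ?y))
          \<le> nrm (conv k (conv k ?y)) + (nrm (conv k (?d m)) + nrm (sc (\<tau>\<^sup>2) ?y))"
        by (rule order_trans[OF nrm_triangle add_left_mono[OF nrm_triangle_diff]])
          (intro X_diff X_sc conv_UC yU dU kU)+
      ultimately have "nrm (conv k (conv k g) - sc (\<tau>\<^sup>2) g)
          \<le> nrm (conv k (conv k ?y)) + (nrm (conv k (?d m)) + nrm (sc (\<tau>\<^sup>2) ?y))"
        by (simp only:)
      also have "\<dots> \<le> K * K * nrm ?y + (K * nrm (?d m) + \<tau>\<^sup>2 * nrm ?y)"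
      proof (intro add_mono)
        show "nrm (conv k (conv k ?y)) \<le> K * K * nrm ?y"
          using nrm_conv[OF conv_UC[OF yU kU] kU] mult_left_mono[OF nrm_conv[OF yU kU] K0]
          unfolding K_def by (simp add: mult.assoc)
        show "nrm (conv k (?d m)) \<le> K * nrm (?d m)" unfolding K_def by (rule nrm_conv[OF dU kU])
        show "nrm (sc (\<tau>\<^sup>2) ?y) \<le> \<tau>\<^sup>2 * nrm ?y" using nrm_sc[OF yU, of "\<tau>\<^sup>2"] by (simp add: norm_power)
      qed
      finally show ?thesis by (simp add: algebra_simps)
    qed
    then show "\<exists>N. \<forall>m\<ge>N. nrm (conv k (conv k g) - sc (\<tau>\<^sup>2) g)
        \<le> (K * K + \<tau>\<^sup>2) * nrm (g - conv k (h (r m))) + K * nrm (?d (r m))" by blast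
  qed
  moreover have zU: "conv k (conv k g) - sc (\<tau>\<^sup>2) g \<in> UC" by (intro X_diff X_sc conv_UC g(1) kU)
  ultimately have "conv k (conv k g) - sc (\<tau>\<^sup>2) g = 0" using nrm_eq_zero[OF zU] nrm_nonneg[OF zU] by linarith
  then have "eigen k (\<tau>\<^sup>2) g" using g(1) by (simp add: eigen_def)
  moreover have "\<epsilon>\<^sup>2 \<le> \<tau>\<^sup>2" using \<tau> \<epsilon> by (intro power_mono) auto
  \<comment> \<open>As an eigenfunction \<open>g\<close> lies in the span of the family; as a limit
    of elements of \<open>S\<close> it is orthogonal to the family. So \<open>g\<close> vanishes,
    although the norms of \<open>conv k (h (r m))\<close> tend to the positive number
    \<tau>.\<close>
  ultimately have pg: "proj e n g = g" by (rule eigen_in_span[OF k e max])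
  have "ip g (e i) = 0" if i: "i < n" for i
  proof -
    have "cmod (ip g (e i)) \<le> 0"
    proof (rule LIMSEQ_le_const[OF g(3)])
      have "cmod (ip g (e i)) \<le> nrm (g - conv k (h (r m)))" for m
      proof -
        have "ip (conv k (h (r m))) (e i) = 0" using SconvS[OF h(1)] i by (simp add: S_def)
        then have "ip g (e i) = ip (g - conv k (h (r m))) (e i)" using g(1) cU eU[OF i] by (simp add: ip_diff)
        then show ?thesis
          using cauchy_schwarz[OF X_diff[OF g(1) cU] eU[OF i], of "r m"] orthonormal_nrm[OF on i] by simp
      qed
      then show "\<exists>N. \<forall>m\<ge>N. cmod (ip g (e i)) \<le> nrm (g - conv k (h (r m)))" by blast
    qed
    then show ?thesis by simp
  qed
  then have "proj e n g = 0" by (simp add: proj_def)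
  then have "g = 0" using pg by simp
  then have "(\<lambda>m. nrm (conv k (h (r m)))) \<longlonglongrightarrow> 0" using g(3) nrm_minus[OF cU] by simp
  moreover have "(\<lambda>m. nrm (conv k (h (r m)))) \<longlonglongrightarrow> \<tau>"
    using LIMSEQ_subseq_LIMSEQ[OF lim_h g(2)] by (simp add: o_def)
  ultimately show False using LIMSEQ_unique \<tau>(2) by fastforce
qed

end

context function_inner_space
begin

lemma proj_add: "orthonormal e n \<Longrightarrow> f \<in> X \<Longrightarrow> h \<in> X \<Longrightarrow> proj e n (f + h) = proj e n f + proj e n h"
  by (simp add: proj_def ip_add orthonormalD sc_add_left flip: sum.distrib)

lemma proj_sc: "orthonormal e n \<Longrightarrow> f \<in> X \<Longrightarrow> proj e n (sc c f) = sc c (proj e n f)"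
  by (rule ext) (simp add: proj_def ip_sc orthonormalD sum_distrib_left mult.assoc)

lemma proj_zero: "orthonormal e n \<Longrightarrow> proj e n 0 = 0"
  by (simp add: proj_def ip_zero orthonormalD)

lemma additive_in_subsp:
  assumes V: "basis V e n" and add: "\<And>f h. f \<in> X \<Longrightarrow> h \<in> X \<Longrightarrow> \<gamma> (f + h) = \<gamma> f + \<gamma> h"
    and sc: "\<And>c f. f \<in> X \<Longrightarrow> \<gamma> (sc c f) = sc c (\<gamma> f)" and e: "\<And>i. i < n \<Longrightarrow> \<gamma> (e i) \<in> W" and W: "subsp W"
    and f: "f \<in> V"
  shows "\<gamma> f \<in> W"
proof -
  note on = basisD(2)[OF V]
  have "\<gamma> (\<Sum>i<m. sc (c i) (e i)) \<in> W" if "m \<le> n" for m c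
    using that
  proof (induction m)
    case 0
    have "\<gamma> 0 = 0" using sc[OF X_zero, of 0] by simp
    show ?case unfolding lessThan_0 sum.empty \<open>\<gamma> 0 = 0\<close> by (rule subspD(2)[OF W])
  next
    case (Suc m)
    have eX: "i < Suc m \<Longrightarrow> sc (c i) (e i) \<in> X" for i
      using orthonormalD(1)[OF on, of i] Suc.prems X_sc by simp
    have "(\<Sum>i<m. sc (c i) (e i)) \<in> X" by (rule X_sum) (use eX in auto)
    moreover have "e m \<in> X" by (rule orthonormalD(1)[OF on]) (use Suc.prems in simp)
    ultimately have "\<gamma> ((\<Sum>i<m. sc (c i) (e i)) + sc (c m) (e m)) = \<gamma> (\<Sum>i<m. sc (c i) (e i)) + sc (c m) (\<gamma> (e m))"
      using add[OF _ X_sc] sc by metis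
    also have "\<dots> \<in> W"
      by (intro subspD(3)[OF W] subspD(4)[OF W] e Suc.IH) (use Suc.prems in simp_all)
    finally show ?case by (simp only: sum.lessThan_Suc)
  qed
  from this[OF order_refl] have "\<gamma> (proj e n f) \<in> W" unfolding proj_def .
  then show ?thesis using basisD(4)[OF V f] by simp
qed

end

section \<open>Continuity of translates, central kernels and orthogonality of minimal spaces\<close>

context totally_bounded_group
begin

lemma nrm_ltr_diff:
  assumes "f \<in> UC" "near f \<epsilon> u \<one>" "u \<in> carrier G" "s \<in> carrier G" "t \<in> carrier G"
  shows "nrm (ltr (s \<otimes> u \<otimes> t) f - ltr (s \<otimes> \<one> \<otimes> t) f) \<le> \<epsilon>"
proof (rule nrm_le)
  show "ltr (s \<otimes> u \<otimes> t) f - ltr (s \<otimes> \<one> \<otimes> t) f \<in> UC" using assms by (intro X_diff ltr_UC) auto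
  fix x assume x: "x \<in> carrier G"
  have "cmod (f (inv t \<otimes> inv u \<otimes> (inv s \<otimes> x)) - f (inv t \<otimes> \<one> \<otimes> (inv s \<otimes> x))) \<le> \<epsilon>"
    by (rule nearD[OF near_inv[OF assms(2,3)]]) (use assms x in auto)
  then show "cmod ((ltr (s \<otimes> u \<otimes> t) f - ltr (s \<otimes> \<one> \<otimes> t) f) x) \<le> \<epsilon>"
    using assms x by (simp add: inv_mult_group m_assoc)
qed

lemma nrm_rtr_diff:
  assumes "f \<in> UC" "near f \<epsilon> u \<one>" "u \<in> carrier G" "s \<in> carrier G" "t \<in> carrier G"
  shows "nrm (rtr (s \<otimes> u \<otimes> t) f - rtr (s \<otimes> \<one> \<otimes> t) f) \<le> \<epsilon>"
proof (rule nrm_le)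
  show "rtr (s \<otimes> u \<otimes> t) f - rtr (s \<otimes> \<one> \<otimes> t) f \<in> UC" using assms by (intro X_diff rtr_UC) auto
  fix x assume x: "x \<in> carrier G"
  have "cmod (f (x \<otimes> s \<otimes> u \<otimes> t) - f (x \<otimes> s \<otimes> \<one> \<otimes> t)) \<le> \<epsilon>"
    by (rule nearD[OF assms(2)]) (use assms x in auto)
  then show "cmod ((rtr (s \<otimes> u \<otimes> t) f - rtr (s \<otimes> \<one> \<otimes> t) f) x) \<le> \<epsilon>"
    using assms x by (simp add: m_assoc)
qed

text \<open>By the reverse triangle inequality this function inherits the modulus of continuity of
  \<open>f\<close>. With \<open>v\<close> a translate of \<open>f\<close> such functions later
  generate the topology.\<close>

lemma unif_cont_nrm_ltr:
  assumes f: "f \<in> UC" and v: "v \<in> UC"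
  shows "unif_cont (\<lambda>x. complex_of_real (nrm (ltr x f - v)))"
proof (rule unif_cont_nearI[OF UC_unif_cont[OF f]])
  fix \<epsilon> u assume u: "u \<in> carrier G" "near f \<epsilon> u \<one>"
  show "near (\<lambda>x. complex_of_real (nrm (ltr x f - v))) \<epsilon> u \<one>"
    unfolding near_def
  proof (intro ballI)
    fix s t assume st: "s \<in> carrier G" "t \<in> carrier G"
    let ?a = "ltr (s \<otimes> u \<otimes> t) f" and ?b = "ltr (s \<otimes> \<one> \<otimes> t) f"
    have ab: "?a \<in> UC" "?b \<in> UC" using st u f by (auto intro!: ltr_UC)
    have "nrm (?a - ?b) \<le> \<epsilon>" by (rule nrm_ltr_diff[OF f u(2,1) st])
    moreover have "nrm (?a - v) \<le> nrm (?a - ?b) + nrm (?b - v)"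
      using nrm_triangle[of "?a - ?b" "?b - v"] ab v by (simp add: X_diff)
    moreover have "nrm (?b - v) \<le> nrm (?a - ?b) + nrm (?a - v)"
      using nrm_triangle[of "?b - ?a" "?a - v"] nrm_diff_commute[OF ab] ab v by (simp add: X_diff)
    ultimately have "\<bar>nrm (?a - v) - nrm (?b - v)\<bar> \<le> \<epsilon>" by linarith
    then show "cmod (complex_of_real (nrm (?a - v)) - complex_of_real (nrm (?b - v))) \<le> \<epsilon>"
      by (simp only: norm_of_real of_real_diff[symmetric])
  qed
qed

lemma unif_cont_ip_rtr:
  assumes f: "f \<in> UC" and h: "h \<in> UC"
  shows "unif_cont (\<lambda>y. ip (rtr y f) h)"
proof (rule unif_cont_dominated1[OF UC_unif_cont[OF f]])
  fix \<epsilon> :: real assume e: "0 < \<epsilon>"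
  let ?d = "\<epsilon> / (nrm h + 1)"
  have n: "0 \<le> nrm h" by (rule nrm_nonneg[OF h])
  have le: "?d * nrm h \<le> \<epsilon>" using e n by (simp add: field_simps)
  have "near (\<lambda>y. ip (rtr y f) h) \<epsilon> u \<one>" if u: "u \<in> carrier G" "near f ?d u \<one>" for u
    unfolding near_def
  proof (intro ballI)
    fix s t assume st: "s \<in> carrier G" "t \<in> carrier G"
    let ?a = "rtr (s \<otimes> u \<otimes> t) f" and ?b = "rtr (s \<otimes> \<one> \<otimes> t) f"
    have ab: "?a \<in> UC" "?b \<in> UC" using st u f by (auto intro!: rtr_UC)
    have "cmod (ip (?a - ?b) h) \<le> nrm (?a - ?b) * nrm h" by (rule cauchy_schwarz[OF X_diff[OF ab] h])
    also have "\<dots> \<le> ?d * nrm h" by (rule mult_right_mono[OF nrm_rtr_diff[OF f u(2,1) st] n])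
    finally show "cmod (ip ?a h - ip ?b h) \<le> \<epsilon>" using le ab h by (simp add: ip_diff)
  qed
  moreover have "0 < ?d" using e n by simp
  ultimately show "\<exists>\<delta>>0. \<forall>x\<in>carrier G. near f \<delta> x \<one> \<longrightarrow> near (\<lambda>y. ip (rtr y f) h) \<epsilon> x \<one>" by blast
qed

text \<open>The bi-invariant pseudometric induced by \<open>f\<close>, evaluated at \<open>(z, \<one>)\<close>.\<close>

definition modulus :: "('a \<Rightarrow> complex) \<Rightarrow> 'a \<Rightarrow> real"
  where "modulus f z = (SUP p\<in>carrier G \<times> carrier G. cmod (f (fst p \<otimes> z \<otimes> snd p) - f (fst p \<otimes> \<one> \<otimes> snd p)))"

lemma modulus_le_iff:
  assumes f: "unif_cont f" and z: "z \<in> carrier G"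
  shows "modulus f z \<le> \<epsilon> \<longleftrightarrow> near f \<epsilon> z \<one>"
proof -
  obtain B where B: "\<forall>x\<in>carrier G. cmod (f x) \<le> B" using unif_cont_bounded[OF f] by blast
  then have osc: "osc_le f (2 * B)" by (intro osc_leI) blast
  have bdd: "bdd_above ((\<lambda>p. cmod (f (fst p \<otimes> z \<otimes> snd p) - f (fst p \<otimes> \<one> \<otimes> snd p))) ` (carrier G \<times> carrier G))"
    by (rule bdd_aboveI2[of _ _ "2 * B"]) (use osc z in \<open>auto simp: osc_le_def\<close>)
  have ne: "carrier G \<times> carrier G \<noteq> {}" using one_closed by blast
  show ?thesis
    unfolding modulus_def cSUP_le_iff[OF ne bdd] near_def by auto
qed

lemma near_modulus: "unif_cont f \<Longrightarrow> z \<in> carrier G \<Longrightarrow> near f (modulus f z) z \<one>"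
  using modulus_le_iff by blast

lemma modulus_nonneg: "unif_cont f \<Longrightarrow> z \<in> carrier G \<Longrightarrow> 0 \<le> modulus f z"
  using order_trans[OF norm_ge_zero nearD[OF near_modulus one_closed one_closed]] .

lemma modulus_one: "unif_cont f \<Longrightarrow> modulus f \<one> = 0"
  using modulus_le_iff[of f \<one> 0] modulus_nonneg[of f \<one>] by (simp add: near_def)

lemma modulus_inv:
  assumes "unif_cont f" "z \<in> carrier G"
  shows "modulus f (inv z) = modulus f z"
proof -
  have "modulus f (inv z) \<le> modulus f z" if "z \<in> carrier G" for z
    using near_inv[OF near_modulus] assms(1) that by (simp add: modulus_le_iff)
  from this[OF assms(2)] this[of "inv z"] show ?thesis using assms(2) by simp
qed

lemma modulus_commute:
  assumes f: "unif_cont f" and "x \<in> carrier G" "y \<in> carrier G"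
  shows "modulus f (x \<otimes> y) = modulus f (y \<otimes> x)"
proof -
  have "modulus f (y \<otimes> x) \<le> modulus f (x \<otimes> y)" if xy: "x \<in> carrier G" "y \<in> carrier G" for x y
  proof -
    have "near f (modulus f (x \<otimes> y)) (y \<otimes> (x \<otimes> y) \<otimes> inv y) (y \<otimes> \<one> \<otimes> inv y)"
      by (rule near_translate[OF near_modulus[OF f]]) (use xy in auto)
    then show ?thesis using xy by (simp add: modulus_le_iff[OF f] m_assoc)
  qed
  then show ?thesis using assms by (meson antisym)
qed

lemma near_trans: "near f a x y \<Longrightarrow> near f b y z \<Longrightarrow> near f (a + b) x z"
  unfolding near_def
proof (intro ballI)
  fix s t assume *: "\<forall>s\<in>carrier G. \<forall>t\<in>carrier G. cmod (f (s \<otimes> x \<otimes> t) - f (s \<otimes> y \<otimes> t)) \<le> a"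
    "\<forall>s\<in>carrier G. \<forall>t\<in>carrier G. cmod (f (s \<otimes> y \<otimes> t) - f (s \<otimes> z \<otimes> t)) \<le> b" "s \<in> carrier G" "t \<in> carrier G"
  then have "cmod (f (s \<otimes> x \<otimes> t) - f (s \<otimes> y \<otimes> t)) \<le> a" "cmod (f (s \<otimes> y \<otimes> t) - f (s \<otimes> z \<otimes> t)) \<le> b" by blast+
  then show "cmod (f (s \<otimes> x \<otimes> t) - f (s \<otimes> z \<otimes> t)) \<le> a + b"
    using norm_triangle_ineq[of "f (s \<otimes> x \<otimes> t) - f (s \<otimes> y \<otimes> t)" "f (s \<otimes> y \<otimes> t) - f (s \<otimes> z \<otimes> t)"] by simp
qed

lemma modulus_mult:
  assumes f: "unif_cont f" and xy: "x \<in> carrier G" "y \<in> carrier G"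
  shows "modulus f (x \<otimes> y) \<le> modulus f x + modulus f y"
proof -
  have "near f (modulus f x) (\<one> \<otimes> x \<otimes> y) (\<one> \<otimes> \<one> \<otimes> y)"
    by (rule near_translate[OF near_modulus[OF f]]) (use xy in auto)
  then have "near f (modulus f x) (x \<otimes> y) y" using xy by simp
  then have "near f (modulus f x + modulus f y) (x \<otimes> y) \<one>" by (rule near_trans[OF _ near_modulus[OF f xy(2)]])
  then show ?thesis using xy by (simp add: modulus_le_iff[OF f])
qed

text \<open>Write \<open>s \<otimes> x \<otimes> t\<close> as \<open>s \<otimes> t\<close> times a
  conjugate of \<open>x\<close>; subadditivity and conjugation invariance bound the change. A
  Lipschitz function of the modulus is therefore uniformly continuous.\<close>

lemma modulus_lipschitz:
  assumes f: "unif_cont f" and st: "s \<in> carrier G" "t \<in> carrier G" and x: "x \<in> carrier G"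
  shows "\<bar>modulus f (s \<otimes> x \<otimes> t) - modulus f (s \<otimes> \<one> \<otimes> t)\<bar> \<le> modulus f x"
proof -
  have conj: "modulus f (inv t \<otimes> (z \<otimes> t)) = modulus f z" if "z \<in> carrier G" for z
    using modulus_commute[OF f, of "inv t" "z \<otimes> t"] st that by (simp add: m_assoc)
  have *: "modulus f (s \<otimes> z \<otimes> t) \<le> modulus f (s \<otimes> t) + modulus f z" if z: "z \<in> carrier G" for z
  proof -
    have "(s \<otimes> t) \<otimes> (inv t \<otimes> (z \<otimes> t)) = s \<otimes> ((t \<otimes> inv t) \<otimes> (z \<otimes> t))"
      using st z by (simp only: m_assoc m_closed inv_closed)
    then have "s \<otimes> z \<otimes> t = (s \<otimes> t) \<otimes> (inv t \<otimes> (z \<otimes> t))" using st z by (simp add: m_assoc)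
    then show ?thesis using modulus_mult[OF f, of "s \<otimes> t" "inv t \<otimes> (z \<otimes> t)"] conj[OF z] st z by simp
  qed
  have "modulus f (s \<otimes> t) \<le> modulus f (s \<otimes> x \<otimes> t) + modulus f x"
  proof -
    have "s \<otimes> t = (s \<otimes> x \<otimes> t) \<otimes> (inv t \<otimes> (inv x \<otimes> t))"
    proof -
      have "(s \<otimes> x \<otimes> t) \<otimes> (inv t \<otimes> (inv x \<otimes> t)) = s \<otimes> (x \<otimes> ((t \<otimes> inv t) \<otimes> (inv x \<otimes> t)))"
        using st x by (simp only: m_assoc m_closed inv_closed)
      moreover have "(t \<otimes> inv t) \<otimes> (inv x \<otimes> t) = inv x \<otimes> t" using st x by simp
      moreover have "x \<otimes> (inv x \<otimes> t) = t" using st x by (simp add: m_assoc[symmetric])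
      ultimately show ?thesis by simp
    qed
    then show ?thesis
      using modulus_mult[OF f, of "s \<otimes> x \<otimes> t" "inv t \<otimes> (inv x \<otimes> t)"] conj[of "inv x"] st x modulus_inv[OF f x]
      by simp
  qed
  then show ?thesis using *[OF x] st by (simp add: abs_le_iff)
qed

text \<open>Conjugation invariance of the modulus makes this a class function. The factor 4 confines
  its support to modulus below 1/4: the convolution square then lives where the modulus is below
  1/2, and translating it by an element of modulus at least 1 makes the supports disjoint.\<close>

definition bump_kernel :: "('a \<Rightarrow> complex) \<Rightarrow> 'a \<Rightarrow> complex"
  where "bump_kernel f = zero_ext (\<lambda>z. complex_of_real (max 0 (1 - 4 * modulus f z)))"

lemma central_bump_kernel:
  assumes f: "unif_cont f"
  shows "central_kernel (bump_kernel f)"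
proof -
  have "unif_cont (\<lambda>z. complex_of_real (max 0 (1 - 4 * modulus f z)))"
  proof (rule unif_cont_dominated1[OF f])
    fix \<epsilon> :: real assume e: "0 < \<epsilon>"
    have "near (\<lambda>z. complex_of_real (max 0 (1 - 4 * modulus f z))) \<epsilon> x \<one>" if x: "x \<in> carrier G" "near f (\<epsilon> / 4) x \<one>" for x
      unfolding near_def
    proof (intro ballI)
      fix s t assume st: "s \<in> carrier G" "t \<in> carrier G"
      have "modulus f x \<le> \<epsilon> / 4" using x modulus_le_iff[OF f x(1)] by blast
      then have "\<bar>max 0 (1 - 4 * modulus f (s \<otimes> x \<otimes> t)) - max 0 (1 - 4 * modulus f (s \<otimes> \<one> \<otimes> t))\<bar> \<le> \<epsilon>"
        using modulus_lipschitz[OF f st x(1)] by linarith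
      then show "cmod (complex_of_real (max 0 (1 - 4 * modulus f (s \<otimes> x \<otimes> t)))
          - complex_of_real (max 0 (1 - 4 * modulus f (s \<otimes> \<one> \<otimes> t)))) \<le> \<epsilon>"
        by (simp only: norm_of_real of_real_diff[symmetric])
    qed
    then show "\<exists>\<delta>>0. \<forall>x\<in>carrier G. near f \<delta> x \<one> \<longrightarrow> near (\<lambda>z. complex_of_real (max 0 (1 - 4 * modulus f z))) \<epsilon> x \<one>"
      using e by (intro exI[of _ "\<epsilon> / 4"]) simp
  qed
  then have "bump_kernel f \<in> UC" unfolding bump_kernel_def by (rule zero_ext_UC)
  then show ?thesis
    unfolding central_kernel_def by (simp add: bump_kernel_def modulus_inv f modulus_commute[OF f])
qed

text \<open>Right invariance expands \<open>f (x \<otimes> y)\<close> as a sum of the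
  \<open>e i x\<close> with coefficients that depend on \<open>y\<close>; averaging over
  \<open>y\<close> against \<open>q\<close> leaves a combination of the \<open>e i\<close>.\<close>

lemma right_coeff_in:
  assumes V: "basis V e n" "invariant two_sided_ops V" and f: "f \<in> V" and q: "q \<in> UC"
  shows "zero_ext (\<lambda>x. ip (ltr (inv x) f) q) \<in> V"
proof -
  note sV = basisD(1)[OF V(1)]
  have fU: "f \<in> UC" by (rule subspD(1)[OF sV f])
  have eU: "e i \<in> UC" if "i < n" for i by (rule subspD(1)[OF sV basisD(3)[OF V(1) that]])
  define c where "c i = mean (\<lambda>y. ip (rtr y f) (e i) * cnj (q y))" for i
  have u: "unif_cont (\<lambda>y. ip (rtr y f) (e i) * cnj (q y))" if "i < n" for i
    by (intro unif_cont_mult unif_cont_ip_rtr unif_cont_cnj UC_unif_cont fU q eU that)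
  have "ip (ltr (inv x) f) q = (\<Sum>i<n. sc (c i) (e i)) x" if x: "x \<in> carrier G" for x
  proof -
    have "f (x \<otimes> y) = (\<Sum>i<n. e i x * ip (rtr y f) (e i))" if y: "y \<in> carrier G" for y
    proof -
      have "rtr y f \<in> V" by (rule invariantD[OF V(2) _ f]) (use y in auto)
      then have "proj e n (rtr y f) x = rtr y f x" using basisD(4)[OF V(1)] by simp
      then show ?thesis using x by (simp add: proj_def mult.commute)
    qed
    then have eq: "ltr (inv x) f y * cnj (q y) = (\<Sum>i<n. e i x * (ip (rtr y f) (e i) * cnj (q y)))" if "y \<in> carrier G" for y
      using x that by (simp add: sum_distrib_right mult.assoc)
    have "ip (ltr (inv x) f) q = mean (\<lambda>y. \<Sum>i<n. e i x * (ip (rtr y f) (e i) * cnj (q y)))"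
      unfolding ip_def[of "ltr (inv x) f"]
      by (rule mean_cong[OF unif_cont_ip[OF ltr_UC[OF fU inv_closed[OF x]] q] eq])
    also have "\<dots> = (\<Sum>i<n. mean (\<lambda>y. e i x * (ip (rtr y f) (e i) * cnj (q y))))"
      by (rule mean_sum) (use u unif_cont_cmult in auto)
    also have "\<dots> = (\<Sum>i<n. e i x * c i)"
      unfolding c_def by (intro sum.cong refl mean_cmult u) simp
    finally show ?thesis by (simp add: mult.commute)
  qed
  note eq = this
  have sU: "(\<Sum>i<n. sc (c i) (e i)) \<in> UC" by (intro X_sum X_sc eU) simp
  have "zero_ext (\<lambda>x. ip (ltr (inv x) f) q) = (\<Sum>i<n. sc (c i) (e i))"
  proof (rule ext)
    show "zero_ext (\<lambda>x. ip (ltr (inv x) f) q) x = (\<Sum>i<n. sc (c i) (e i)) x" for x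
      by (cases "x \<in> carrier G") (simp_all only: zero_ext_simps eq UC_zero[OF sU] simp_thms)
  qed
  also have "\<dots> \<in> V" by (intro subsp_sum[OF sV] subspD(4)[OF sV] basisD(3)[OF V(1)]) simp
  finally show ?thesis .
qed

text \<open>By minimality the orthogonal complement of \<open>V\<close> in \<open>V'\<close> is
  everything or 0. In the second case the projection to \<open>V\<close> of an element of
  \<open>V'\<close> is one of its right coefficients and hence lies in both spaces, which meet only
  in 0; so the element is orthogonal to \<open>V\<close> after all, and \<open>V'\<close> would be
  0.\<close>

lemma distinct_minimal_orthogonal:
  assumes V: "minimal_invariant two_sided_ops V" and V': "minimal_invariant two_sided_ops V'" and ne: "V \<noteq> V'"
    and f: "f \<in> V'" and h: "h \<in> V"
  shows "ip f h = 0"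
proof -
  note D = V[unfolded minimal_invariant_def] and D' = V'[unfolded minimal_invariant_def]
  obtain e n where e: "basis V e n" using D by blast
  obtain e' n' where e': "basis V' e' n'" using D' by blast
  note sV = basisD(1)[OF e] and sV' = basisD(1)[OF e']
  define U where "U = {f \<in> V'. \<forall>h\<in>V. ip f h = 0}"
  have "subsp U"
    unfolding subsp_def U_def using subspD[OF sV] subspD[OF sV'] by (auto simp: ip_zero ip_add ip_sc)
  moreover have "invariant two_sided_ops U"
    unfolding invariant_def
  proof (intro ballI)
    fix \<gamma> f assume g: "\<gamma> \<in> two_sided_ops" and f: "f \<in> U"
    have "ip (\<gamma> f) h = 0" if "h \<in> V" for h
      by (rule op_orth[OF op_family_two_sided _ _ g _ _ that])
        (use D f subspD(1)[OF sV] subspD(1)[OF sV'] in \<open>auto simp: U_def\<close>)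
    moreover have "\<gamma> f \<in> V'" by (rule invariantD[OF _ g]) (use D' f in \<open>auto simp: U_def\<close>)
    ultimately show "\<gamma> f \<in> U" by (simp add: U_def)
  qed
  moreover have "U \<subseteq> V'" by (auto simp: U_def)
  ultimately consider "U = {0}" | "U = V'" using D' by blast
  then show ?thesis
  proof cases
    case 2
    then show ?thesis using f h by (auto simp: U_def)
  next
    case 1
    have "subsp (V \<inter> V')" unfolding subsp_def using subspD[OF sV] subspD[OF sV'] by auto
    moreover have "invariant two_sided_ops (V \<inter> V')" using D D' unfolding invariant_def by blast
    ultimately have "V \<inter> V' = {0} \<or> V \<inter> V' = V" "V \<inter> V' = {0} \<or> V \<inter> V' = V'" using D D' by blast+
    then have int: "V \<inter> V' = {0}" using ne by blast
    have "f = 0" if f: "f \<in> V'" for f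
    proof -
      have fU: "f \<in> UC" by (rule subspD(1)[OF sV' f])
      have eU: "e i \<in> UC" if "i < n" for i by (rule orthonormalD(1)[OF basisD(2)[OF e] that])
      \<comment> \<open>Pairing with \<open>q\<close> evaluates the projection to \<open>V\<close>
        at the identity.\<close>
      define q where "q = (\<Sum>i<n. sc (cnj (e i \<one>)) (e i))"
      have qU: "q \<in> UC" unfolding q_def by (intro X_sum X_sc eU) simp
      have pV: "proj e n f \<in> V" by (rule proj_in[OF e])
      have "proj e n f x = ip (ltr (inv x) f) q" if x: "x \<in> carrier G" for x
      proof -
        have "proj e n f x = ltr (inv x) (proj e n f) \<one>" using x by simp
        also have "\<dots> = proj e n (ltr (inv x) f) \<one>"
          by (subst proj_commute[OF op_family_two_sided _ _ e fU]) (use D x in auto)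
        also have "\<dots> = (\<Sum>i<n. ip (ltr (inv x) f) (sc (cnj (e i \<one>)) (e i)))"
          using eU ltr_UC[OF fU inv_closed[OF x]] by (simp add: proj_def ip_sc_right mult.commute)
        also have "\<dots> = ip (ltr (inv x) f) q"
          unfolding q_def by (rule ip_sum_right[symmetric]) (use eU X_sc ltr_UC[OF fU inv_closed[OF x]] in auto)
        finally show ?thesis .
      qed
      then have "proj e n f = zero_ext (\<lambda>x. ip (ltr (inv x) f) q)"
        using UC_zero[OF subspD(1)[OF sV pV]] by (intro ext) (simp add: zero_ext_def)
      also have "\<dots> \<in> V'" by (rule right_coeff_in[OF e' _ f qU]) (use D' in blast)
      finally have p0: "proj e n f = 0" using pV int by blast
      have "f \<in> U" unfolding U_def using f ip_residual[OF e fU] p0 by simp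
      then show "f = 0" using 1 by blast
    qed
    then have "f = 0" using f by blast
    then show ?thesis using subspD(1)[OF sV h] by (simp add: ip_zero)
  qed
qed

end

text \<open>\<open>bump\<close> is what the Urysohn functions of the compact group leave behind on
  the subgroup. Through it the uniformly continuous functions detect the topology.\<close>

locale countable_precompact_group = countable_totally_bounded_group +
  assumes bump: "\<lbrakk>openin T N; \<one> \<in> N\<rbrakk> \<Longrightarrow> \<exists>f. unif_cont f \<and> f \<one> = 1 \<and> (\<forall>x\<in>carrier G - N. f x = 0)"
begin

text \<open>Convolution with a central kernel commutes with translations from both sides, so a
  translate of an eigenfunction has the same eigenvalue and, by maximality of the family, stays in
  its span \<open>V\<close>.\<close>

lemma eigen_span:
  assumes k: "central_kernel k" and \<epsilon>: "0 < \<epsilon>"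
  obtains V e n where "basis V e n" "invariant two_sided_ops V" "\<And>f. f \<in> V \<Longrightarrow> conv k f \<in> V"
    "\<And>f. f \<in> UC \<Longrightarrow> nrm (conv k (f - proj e n f)) \<le> \<epsilon> * nrm f"
proof -
  have kU: "k \<in> UC" using k by (simp add: central_kernel_def)
  obtain e n where e: "eigen_family k (\<epsilon>\<^sup>2) e n" and max: "\<And>e'. \<not> eigen_family k (\<epsilon>\<^sup>2) e' (Suc n)"
    by (rule maximal_eigen_family[OF k, of "\<epsilon>\<^sup>2"]) (use \<epsilon> in auto)
  have on: "orthonormal e n" using e by (simp add: eigen_family_def)
  note eU = orthonormalD(1)[OF on]
  define V where "V = {f \<in> UC. proj e n f = f}"
  have eig: "v \<in> V" if "eigen k \<mu> v" "\<epsilon>\<^sup>2 \<le> \<mu>" for \<mu> v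
    using eigen_in_span[OF k e max that] that(1) by (simp add: V_def eigen_def)
  have eV: "e i \<in> V" if i: "i < n" for i
    using e i eig unfolding eigen_family_def by blast
  have sV: "subsp V"
    unfolding subsp_def V_def by (auto simp: X_zero X_add X_sc proj_add proj_sc proj_zero on)
  have V: "basis V e n" unfolding basis_def using sV on eV by (auto simp: V_def)
  have conv_e: "conv k (e i) \<in> V" "ltr g (e i) \<in> V" "rtr g (e i) \<in> V" if i: "i < n" and g: "g \<in> carrier G" for i g
  proof -
    obtain \<mu> where \<mu>: "\<mu> \<ge> \<epsilon>\<^sup>2" "eigen k \<mu> (e i)" using e i by (auto simp: eigen_family_def)
    have cU: "conv k (e i) \<in> UC" by (rule conv_UC[OF eU[OF i] kU])
    have "eigen k \<mu> (conv k (e i))" using \<mu>(2) cU conv_sc[OF eU[OF i] kU] by (simp add: eigen_def)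
    then show "conv k (e i) \<in> V" using eig \<mu>(1) by blast
    have "eigen k \<mu> (ltr g (e i))"
      using \<mu>(2) eU[OF i] cU kU g by (simp add: eigen_def ltr_UC conv_ltr ltr_sc)
    then show "ltr g (e i) \<in> V" using eig \<mu>(1) by blast
    have "eigen k \<mu> (rtr g (e i))"
      using \<mu>(2) eU[OF i] cU k g by (simp add: eigen_def rtr_UC conv_rtr rtr_sc)
    then show "rtr g (e i) \<in> V" using eig \<mu>(1) by blast
  qed
  have "conv k f \<in> V" if f: "f \<in> V" for f
  proof (rule additive_in_subsp[OF V _ _ _ sV f])
    show "conv k (f + h) = conv k f + conv k h" if "f \<in> UC" "h \<in> UC" for f h by (rule conv_add[OF that kU])
    show "conv k (sc c f) = sc c (conv k f)" if "f \<in> UC" for c f by (rule conv_sc[OF that kU])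
    show "conv k (e i) \<in> V" if "i < n" for i by (rule conv_e(1)[OF that one_closed])
  qed
  moreover have "ltr g f \<in> V" if f: "f \<in> V" and g: "g \<in> carrier G" for f g
  proof (rule additive_in_subsp[OF V _ _ _ sV f])
    show "ltr g (f + h) = ltr g f + ltr g h" if "f \<in> UC" "h \<in> UC" for f h by (rule ltr_add)
    show "ltr g (sc c f) = sc c (ltr g f)" if "f \<in> UC" for c f by (rule ltr_sc)
    show "ltr g (e i) \<in> V" if "i < n" for i by (rule conv_e(2)[OF that g])
  qed
  moreover have "rtr g f \<in> V" if f: "f \<in> V" and g: "g \<in> carrier G" for f g
  proof (rule additive_in_subsp[OF V _ _ _ sV f])
    show "rtr g (f + h) = rtr g f + rtr g h" if "f \<in> UC" "h \<in> UC" for f h by (rule rtr_add)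
    show "rtr g (sc c f) = sc c (rtr g f)" if "f \<in> UC" for c f by (rule rtr_sc)
    show "rtr g (e i) \<in> V" if "i < n" for i by (rule conv_e(3)[OF that g])
  qed
  ultimately have "invariant two_sided_ops V" "\<And>f. f \<in> V \<Longrightarrow> conv k f \<in> V" unfolding invariant_def by blast+
  moreover have "nrm (conv k (f - proj e n f)) \<le> \<epsilon> * nrm f" if f: "f \<in> UC" for f
  proof -
    have "nrm (conv k (f - proj e n f)) \<le> \<epsilon> * nrm (f - proj e n f)"
      by (rule conv_small_on_complement[OF k \<epsilon> e max X_diff[OF f proj_in_X[OF on]] ip_residual_e[OF on _ f]])
    also have "\<dots> \<le> \<epsilon> * nrm f" using nrm_residual_le[OF on f] \<epsilon> by simp
    finally show ?thesis .
  qed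
  ultimately show ?thesis using that V by blast
qed

text \<open>For \<open>g\<close> outside \<open>N\<close> the bump square \<open>h\<close> and its
  translate have disjoint supports, hence are orthogonal, and \<open>h\<close> is displaced by at
  least its own norm. A good approximation \<open>\<psi>\<close> of \<open>h\<close> in a
  finite-dimensional invariant space is then still displaced by a definite amount.\<close>

lemma separating_subspace:
  assumes N: "openin T N" "\<one> \<in> N"
  obtains V e n \<psi> \<delta> where "basis V e n" "invariant two_sided_ops V" "\<psi> \<in> V" "0 < \<delta>"
    "\<And>g. g \<in> carrier G \<Longrightarrow> nrm (ltr g \<psi> - \<psi>) < \<delta> \<Longrightarrow> g \<in> N"
proof -
  obtain f where f: "unif_cont f" "f \<one> = 1" "\<forall>x\<in>carrier G - N. f x = 0" using bump[OF N] by blast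
  define k where "k = bump_kernel f"
  have k: "central_kernel k" unfolding k_def by (rule central_bump_kernel[OF f(1)])
  then have kU: "k \<in> UC" by (simp add: central_kernel_def)
  have mod1: "1 \<le> modulus f g" if "g \<in> carrier G" "g \<notin> N" for g
    using nearD1[OF near_modulus[OF f(1) that(1)]] f(2,3) that by (simp add: norm_minus_commute)
  have k0: "k x = 0" if "x \<in> carrier G" "1 / 4 \<le> modulus f x" for x
    using that by (simp add: k_def bump_kernel_def max_def)
  have k1: "k \<one> = 1" by (simp add: k_def bump_kernel_def modulus_one f(1))
  have kn: "0 < nrm k" by (rule nrm_pos[OF kU]) (use k1 in force)
  \<comment> \<open>\<open>eigen_span\<close> controls errors only after a convolution with
    \<open>k\<close>, so the function to be approximated must itself be such a convolution.\<close>
  define h where "h = conv k k"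
  have hU: "h \<in> UC" unfolding h_def by (rule conv_UC[OF kU kU])
  have h0: "h x = 0" if x: "x \<in> carrier G" "1 / 2 \<le> modulus f x" for x
  proof -
    have "k y * cnj (ltr x k y) = 0" if y: "y \<in> carrier G" for y
    proof (rule ccontr)
      assume "k y * cnj (ltr x k y) \<noteq> 0"
      then have "k y \<noteq> 0" "k (inv x \<otimes> y) \<noteq> 0" using x y by auto
      then have "\<not> 1 / 4 \<le> modulus f y" "\<not> 1 / 4 \<le> modulus f (inv x \<otimes> y)"
        using k0[OF y] k0[of "inv x \<otimes> y"] x y by auto
      moreover have "modulus f x \<le> modulus f y + modulus f (inv x \<otimes> y)"
      proof -
        have "x = y \<otimes> inv (inv x \<otimes> y)" using x y by (simp add: inv_mult_group m_assoc[symmetric])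
        then have "modulus f x \<le> modulus f y + modulus f (inv (inv x \<otimes> y))"
          using modulus_mult[OF f(1), of y "inv (inv x \<otimes> y)"] x y by simp
        then show ?thesis using modulus_inv[OF f(1), of "inv x \<otimes> y"] x y by simp
      qed
      ultimately show False using x(2) by linarith
    qed
    then have "ip k (ltr x k) = 0" unfolding ip_def by (rule mean_eq_const)
    then show ?thesis using x by (simp add: h_def conv_apply)
  qed
  have "h \<one> = ip k k" using kU by (simp add: h_def conv_apply ltr_one)
  then have "h \<one> \<noteq> 0" using ip_self[OF kU] kn by simp
  then have hn: "0 < nrm h" by (intro nrm_pos hU) force
  \<comment> \<open>This gives an approximation error of at most a quarter of the norm of
    \<open>h\<close>. The error occurs twice, for \<open>\<psi>\<close> and for its translate, which
    leaves half the norm as the displacement of \<open>\<psi>\<close>.\<close>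
  define \<epsilon> where "\<epsilon> = nrm h / (4 * nrm k)"
  have \<epsilon>: "0 < \<epsilon>" "\<epsilon> * nrm k = nrm h / 4" using hn kn by (simp_all add: \<epsilon>_def)
  obtain V e n where V: "basis V e n" "invariant two_sided_ops V" "\<And>f. f \<in> V \<Longrightarrow> conv k f \<in> V"
    "\<And>f. f \<in> UC \<Longrightarrow> nrm (conv k (f - proj e n f)) \<le> \<epsilon> * nrm f"
    by (rule eigen_span[OF k \<epsilon>(1)]) (rule that)
  define \<psi> where "\<psi> = conv k (proj e n k)"
  have \<psi>V: "\<psi> \<in> V" unfolding \<psi>_def by (rule V(3)[OF proj_in[OF V(1)]])
  have \<psi>U: "\<psi> \<in> UC" by (rule subspD(1)[OF basisD(1)[OF V(1)] \<psi>V])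
  have pU: "proj e n k \<in> UC" by (rule proj_in_X[OF basisD(2)[OF V(1)]])
  have "h - \<psi> = conv k (k - proj e n k)" unfolding h_def \<psi>_def by (rule conv_diff[OF kU pU kU, symmetric])
  then have close: "nrm (h - \<psi>) \<le> nrm h / 4" using V(4)[OF kU] \<epsilon>(2) by simp
  have "g \<in> N" if g: "g \<in> carrier G" and small: "nrm (ltr g \<psi> - \<psi>) < nrm h / 2" for g
  proof (rule ccontr)
    assume "g \<notin> N"
    then have m: "1 \<le> modulus f g" using mod1 g by blast
    have gh: "ltr g h \<in> UC" by (rule ltr_UC[OF hU g])
    have "h x * cnj (ltr g h x) = 0" if x: "x \<in> carrier G" for x
    proof (rule ccontr)
      assume "h x * cnj (ltr g h x) \<noteq> 0"
      then have "h x \<noteq> 0" "h (inv g \<otimes> x) \<noteq> 0" using x g by auto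
      then have "\<not> 1 / 2 \<le> modulus f x" "\<not> 1 / 2 \<le> modulus f (inv g \<otimes> x)"
        using h0[OF x] h0[of "inv g \<otimes> x"] x g by auto
      moreover have "modulus f g \<le> modulus f x + modulus f (inv g \<otimes> x)"
      proof -
        have "g = x \<otimes> inv (inv g \<otimes> x)" using x g by (simp add: inv_mult_group m_assoc[symmetric])
        then have "modulus f g \<le> modulus f x + modulus f (inv (inv g \<otimes> x))"
          using modulus_mult[OF f(1), of x "inv (inv g \<otimes> x)"] x g by simp
        then show ?thesis using modulus_inv[OF f(1), of "inv g \<otimes> x"] x g by simp
      qed
      ultimately show False using m by linarith
    qed
    then have "ip h (ltr g h) = 0" unfolding ip_def by (rule mean_eq_const)
    then have "ip h (sc (-1) (ltr g h)) = 0" using ip_sc_right[OF gh hU, of "-1"] by simp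
    from pythagoras[OF hU X_sc[OF gh] this]
    have "(nrm h)\<^sup>2 \<le> (nrm (h - ltr g h))\<^sup>2" by simp
    then have 1: "nrm h \<le> nrm (h - ltr g h)" by (rule power2_le_imp_le[OF _ nrm_nonneg[OF X_diff[OF hU gh]]])
    have g\<psi>: "ltr g \<psi> \<in> UC" by (rule ltr_UC[OF \<psi>U g])
    have gen: "a - b = ((a - c) - (b - d)) - (d - c)" for a b c d :: "'a \<Rightarrow> complex" by simp
    have "nrm (h - ltr g h) \<le> nrm ((h - \<psi>) - (ltr g h - ltr g \<psi>)) + nrm (ltr g \<psi> - \<psi>)"
      unfolding gen[of h "ltr g h" \<psi> "ltr g \<psi>"] by (intro nrm_triangle_diff X_diff hU gh \<psi>U g\<psi>)
    moreover have "nrm ((h - \<psi>) - (ltr g h - ltr g \<psi>)) \<le> nrm (h - \<psi>) + nrm (ltr g h - ltr g \<psi>)"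
      by (intro nrm_triangle_diff X_diff hU gh \<psi>U g\<psi>)
    moreover have "nrm (ltr g h - ltr g \<psi>) = nrm (h - \<psi>)"
      using nrm_ltr[OF X_diff[OF hU \<psi>U] g] by (simp only: ltr_diff)
    ultimately show False using 1 small close by linarith
  qed
  then show ?thesis using that V(1,2) \<psi>V hn by (meson half_gt_zero)
qed

end

section \<open>Countably many minimal spaces force metrizability\<close>

text \<open>Evaluation at the functions embeds \<open>X\<close> into a countable product of lines.
  Injectivity comes from the Hausdorff property together with \<open>sep\<close>, and
  \<open>sep\<close> places a cylinder over finitely many coordinates inside the image of each open
  set.\<close>

lemma metrizable_space_if_countable_functions:
  fixes X :: "'a topology" and \<F> :: "('a \<Rightarrow> real) set"
  assumes haus: "Hausdorff_space X" and count: "countable \<F>"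
    and cont: "\<And>f. f \<in> \<F> \<Longrightarrow> continuous_map X euclideanreal f"
    and sep: "\<And>U a. openin X U \<Longrightarrow> a \<in> U \<Longrightarrow> \<exists>F \<eta>. finite F \<and> F \<subseteq> \<F> \<and> 0 < (\<eta>::real) \<and>
      (\<forall>x\<in>topspace X. (\<forall>f\<in>F. \<bar>f x - f a\<bar> < \<eta>) \<longrightarrow> x \<in> U)"
  shows "metrizable_space X"
proof -
  define P where "P = product_topology (\<lambda>_::'a \<Rightarrow> real. euclideanreal) \<F>"
  define \<Phi> where "\<Phi> x = (\<lambda>f\<in>\<F>. f x)" for x :: 'a
  let ?S = "\<Phi> ` topspace X"
  have \<Phi>: "\<Phi> x f = f x" if "f \<in> \<F>" for x f using that by (simp add: \<Phi>_def)
  have contP: "continuous_map X P \<Phi>"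
    unfolding P_def continuous_map_componentwise
  proof (intro conjI ballI)
    show "\<Phi> ` topspace X \<subseteq> extensional \<F>" by (auto simp: \<Phi>_def)
    show "continuous_map X euclideanreal (\<lambda>x. \<Phi> x f)" if "f \<in> \<F>" for f
      using cont[OF that] that by (simp add: \<Phi>_def)
  qed
  have inj: "inj_on \<Phi> (topspace X)"
  proof (rule inj_onI, rule ccontr)
    fix x y assume xy: "x \<in> topspace X" "y \<in> topspace X" "\<Phi> x = \<Phi> y" "x \<noteq> y"
    then obtain U V where U: "openin X U" "x \<in> U" "openin X V" "y \<in> V" "disjnt U V"
      using haus unfolding Hausdorff_space_def by blast
    from sep[OF U(1,2)] obtain F \<eta> where F: "F \<subseteq> \<F>" "0 < \<eta>"
      "\<forall>z\<in>topspace X. (\<forall>f\<in>F. \<bar>f z - f x\<bar> < \<eta>) \<longrightarrow> z \<in> U" by blast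
    have "\<bar>f y - f x\<bar> < \<eta>" if "f \<in> F" for f
    proof -
      have "f y = f x" using \<Phi>[of f x] \<Phi>[of f y] xy(3) F(1) that by auto
      then show ?thesis using F(2) by simp
    qed
    then have "y \<in> U" using F(3) xy(2) by blast
    then show False using U(4,5) by (auto simp: disjnt_iff)
  qed
  have op: "open_map X (subtopology P ?S) \<Phi>"
    unfolding open_map_def
  proof (intro allI impI)
    fix U assume U: "openin X U"
    then have UX: "U \<subseteq> topspace X" by (rule openin_subset)
    show "openin (subtopology P ?S) (\<Phi> ` U)"
    proof (subst openin_subopen, intro ballI)
      fix y assume "y \<in> \<Phi> ` U"
      then obtain a where a: "a \<in> U" "y = \<Phi> a" by blast
      from sep[OF U a(1)] obtain F \<eta> where F: "finite F" "F \<subseteq> \<F>" "0 < \<eta>"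
        "\<forall>z\<in>topspace X. (\<forall>f\<in>F. \<bar>f z - f a\<bar> < \<eta>) \<longrightarrow> z \<in> U" by blast
      define W where "W = (\<Inter>f\<in>F. {z \<in> topspace P. z f \<in> ball (f a) \<eta>}) \<inter> topspace P"
      have W: "openin P W"
        unfolding W_def
      proof (rule openin_INT[OF F(1)])
        fix f assume "f \<in> F"
        then have "continuous_map P euclideanreal (\<lambda>z. z f)"
          unfolding P_def using F(2) by (intro continuous_map_product_projection) blast
        then show "openin P {z \<in> topspace P. z f \<in> ball (f a) \<eta>}"
          by (rule openin_continuous_map_preimage) simp
      qed
      have aX: "a \<in> topspace X" using a(1) UX by blast
      have "\<Phi> a \<in> topspace P" using continuous_map_image_subset_topspace[OF contP] aX by blast
      then have "y \<in> W" using a(2) F(2,3) \<Phi> by (auto simp: W_def)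
      moreover have "W \<inter> ?S \<subseteq> \<Phi> ` U"
      proof
        fix w assume "w \<in> W \<inter> ?S"
        then obtain z where z: "z \<in> topspace X" "w = \<Phi> z" "\<Phi> z \<in> W" by blast
        have "\<bar>f z - f a\<bar> < \<eta>" if f: "f \<in> F" for f
        proof -
          have "\<Phi> z f \<in> ball (f a) \<eta>" using z(3) f by (auto simp: W_def)
          then show ?thesis using \<Phi>[of f z] F(2) f by (auto simp: dist_real_def)
        qed
        then show "w \<in> \<Phi> ` U" using F(4) z by blast
      qed
      ultimately show "\<exists>V. openin (subtopology P ?S) V \<and> y \<in> V \<and> V \<subseteq> \<Phi> ` U"
        using W aX a(2) by (intro exI[of _ "W \<inter> ?S"]) (auto simp: openin_subtopology)
    qed
  qed
  have "topspace (subtopology P ?S) = ?S"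
    using continuous_map_image_subset_topspace[OF contP] by auto
  then have "homeomorphic_map X (subtopology P ?S) \<Phi>"
    by (intro bijective_open_imp_homeomorphic_map op inj) (use contP in \<open>auto simp: continuous_map_in_subtopology\<close>)
  then have "X homeomorphic_space subtopology P ?S" by (rule homeomorphic_map_imp_homeomorphic_space)
  moreover have "metrizable_space P"
    unfolding P_def metrizable_space_product_topology
    using count by (auto simp: metrizable_space_euclidean intro: countable_subset)
  ultimately show ?thesis
    using homeomorphic_metrizable_space metrizable_space_subtopology by blast
qed

context countable_precompact_group
begin

text \<open>Replaces the separating vector, which depends on \<open>N\<close>, by basis vectors of
  minimal spaces chosen once and for all, so that countably many spaces yield countably many
  functions.\<close>

lemma minimal_separation:
  assumes N: "openin T N" "\<one> \<in> N"
    and B: "\<forall>V. minimal_invariant two_sided_ops V \<longrightarrow> basis V (b V) (dm V)"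
  shows "\<exists>K \<eta>. finite K \<and> 0 < \<eta> \<and> (\<forall>(V, i)\<in>K. minimal_invariant two_sided_ops V \<and> i < dm V) \<and>
    (\<forall>g\<in>carrier G. (\<forall>(V, i)\<in>K. nrm (ltr g (b V i) - b V i) < \<eta>) \<longrightarrow> g \<in> N)"
proof -
  obtain W e n \<psi> \<delta> where W: "basis W e n" "invariant two_sided_ops W" "\<psi> \<in> W" "0 < \<delta>"
    "\<And>g. g \<in> carrier G \<Longrightarrow> nrm (ltr g \<psi> - \<psi>) < \<delta> \<Longrightarrow> g \<in> N"
    by (rule separating_subspace[OF N]) (rule that)
  obtain ps where ps: "\<psi> = sum_list (map snd ps)" "\<forall>(U, \<phi>)\<in>set ps. minimal_invariant two_sided_ops U \<and>
    U \<subseteq> W \<and> \<phi> \<in> U \<and> (\<forall>\<gamma>\<in>two_sided_ops. nrm (\<gamma> \<phi> - \<phi>) \<le> nrm (\<gamma> \<psi> - \<psi>))"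
    using decomposition[OF op_family_two_sided W(1,2,3)] by (elim exE conjE) (rule that)
  have psD: "minimal_invariant two_sided_ops U" "\<phi> \<in> U" if "(U, \<phi>) \<in> set ps" for U \<phi>
    using bspec[OF ps(2) that] by auto
  define K where "K = (\<Union>(U, \<phi>)\<in>set ps. {U} \<times> {..<dm U})"
  define M where "M = (\<Sum>p\<leftarrow>ps. \<Sum>i<dm (fst p). cmod (ip (snd p) (b (fst p) i)))"
  have M: "0 \<le> M" unfolding M_def by (intro sum_list_nonneg) (auto intro: sum_nonneg)
  \<comment> \<open>\<open>M\<close> is the sum of the moduli of all coordinates of the components
    of \<open>\<psi>\<close>. If each basis vector moves by less than \<eta>, then
    \<open>\<psi>\<close> moves by at most M \<eta>, which is below \<delta>.\<close>
  define \<eta> where "\<eta> = \<delta> / (M + 1)"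
  have \<eta>: "0 < \<eta>" "M * \<eta> < \<delta>" using W(4) M by (simp_all add: \<eta>_def field_simps)
  have "g \<in> N" if g: "g \<in> carrier G" and small: "\<forall>(V, i)\<in>K. nrm (ltr g (b V i) - b V i) < \<eta>" for g
  proof (rule W(5)[OF g])
    have step: "ltr g \<phi> - \<phi> \<in> UC \<and> nrm (ltr g \<phi> - \<phi>) \<le> (\<Sum>i<dm U. cmod (ip \<phi> (b U i))) * \<eta>" if p: "(U, \<phi>) \<in> set ps" for U \<phi>
    proof -
      note bU = B[rule_format, OF psD(1)[OF p]]
      have eU: "b U i \<in> UC" if "i < dm U" for i by (rule orthonormalD(1)[OF basisD(2)[OF bU] that])
      have fU: "\<phi> \<in> UC" by (rule subspD(1)[OF basisD(1)[OF bU] psD(2)[OF p]])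
      have dU: "ltr g (b U i) - b U i \<in> UC" if "i < dm U" for i by (intro X_diff ltr_UC eU that g)
      have part: "ltr g (\<Sum>i<m. sc (c i) (b U i)) - (\<Sum>i<m. sc (c i) (b U i)) \<in> UC \<and>
          nrm (ltr g (\<Sum>i<m. sc (c i) (b U i)) - (\<Sum>i<m. sc (c i) (b U i))) \<le> (\<Sum>i<m. cmod (c i)) * \<eta>"
        if "m \<le> dm U" for m c
        using that
      proof (induction m)
        case 0
        have "ltr g (\<Sum>i<0. sc (c i) (b U i)) - (\<Sum>i<0. sc (c i) (b U i)) = 0"
          by (auto simp: fun_eq_iff ltr_def zero_ext_def)
        then show ?case by (simp only: X_zero nrm_zero) simp
      next
        case (Suc m)
        let ?s = "\<Sum>i<m. sc (c i) (b U i)"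
        have m: "m < dm U" using Suc.prems by simp
        have eq: "ltr g (?s + sc (c m) (b U m)) - (?s + sc (c m) (b U m)) = (ltr g ?s - ?s) + sc (c m) (ltr g (b U m) - b U m)"
          unfolding ltr_add ltr_sc sc_diff by (rule add_diff_add)
        have IH: "ltr g ?s - ?s \<in> UC" "nrm (ltr g ?s - ?s) \<le> (\<Sum>i<m. cmod (c i)) * \<eta>"
          using Suc.IH[OF Suc_leD[OF Suc.prems]] by blast+
        have "(U, m) \<in> K" using p m by (auto simp: K_def)
        then have "nrm (ltr g (b U m) - b U m) \<le> \<eta>" using small less_imp_le by blast
        then have "nrm (sc (c m) (ltr g (b U m) - b U m)) \<le> cmod (c m) * \<eta>"
          unfolding nrm_sc[OF dU[OF m]] by (simp add: mult_left_mono)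
        then have "nrm ((ltr g ?s - ?s) + sc (c m) (ltr g (b U m) - b U m)) \<le> (\<Sum>i<m. cmod (c i)) * \<eta> + cmod (c m) * \<eta>"
          using nrm_triangle[OF IH(1) X_sc[OF dU[OF m]], of "c m"] IH(2) by linarith
        moreover have "(ltr g ?s - ?s) + sc (c m) (ltr g (b U m) - b U m) \<in> UC" by (intro X_add IH(1) X_sc dU m)
        ultimately show ?case unfolding sum.lessThan_Suc eq by (simp only: distrib_right)
      qed
      have "proj (b U) (dm U) \<phi> = \<phi>" by (rule basisD(4)[OF bU psD(2)[OF p]])
      then have "\<phi> = (\<Sum>i<dm U. sc (ip \<phi> (b U i)) (b U i))" by (simp only: proj_def)
      then show ?thesis using part[OF order_refl, of "\<lambda>i. ip \<phi> (b U i)"] by (simp only: )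
    qed
    have total: "ltr g (sum_list (map snd qs)) - sum_list (map snd qs) \<in> UC \<and>
        nrm (ltr g (sum_list (map snd qs)) - sum_list (map snd qs)) \<le> (\<Sum>p\<leftarrow>qs. \<Sum>i<dm (fst p). cmod (ip (snd p) (b (fst p) i))) * \<eta>"
      if "set qs \<subseteq> set ps" for qs
      using that
    proof (induction qs)
      case Nil
      have "ltr g (sum_list (map snd ([] :: (('a \<Rightarrow> complex) set \<times> ('a \<Rightarrow> complex)) list))) - sum_list (map snd ([] :: (('a \<Rightarrow> complex) set \<times> ('a \<Rightarrow> complex)) list)) = 0"
        by (auto simp: fun_eq_iff ltr_def zero_ext_def)
      then show ?case by (simp only: X_zero nrm_zero) simp
    next
      case (Cons p qs)
      obtain U \<phi> where p: "p = (U, \<phi>)" by (cases p)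
      have qs: "set qs \<subseteq> set ps" using Cons.prems by simp
      let ?s = "sum_list (map snd qs)"
      have st: "ltr g \<phi> - \<phi> \<in> UC" "nrm (ltr g \<phi> - \<phi>) \<le> (\<Sum>i<dm U. cmod (ip \<phi> (b U i))) * \<eta>"
        using step[of U \<phi>] Cons.prems p by auto
      have IH: "ltr g ?s - ?s \<in> UC" "nrm (ltr g ?s - ?s) \<le> (\<Sum>p\<leftarrow>qs. \<Sum>i<dm (fst p). cmod (ip (snd p) (b (fst p) i))) * \<eta>"
        using Cons.IH[OF qs] by blast+
      have eq: "ltr g (\<phi> + ?s) - (\<phi> + ?s) = (ltr g \<phi> - \<phi>) + (ltr g ?s - ?s)"
        unfolding ltr_add by (rule add_diff_add)
      show ?case
        unfolding list.map sum_list.Cons p snd_conv fst_conv eq distrib_right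
        using X_add[OF st(1) IH(1)] nrm_triangle[OF st(1) IH(1)] st(2) IH(2) by linarith
    qed
    show "nrm (ltr g \<psi> - \<psi>) < \<delta>"
      using total[OF order_refl] \<eta>(2) unfolding ps(1)[symmetric] M_def[symmetric] by linarith
  qed
  moreover have "finite K" unfolding K_def by auto
  moreover have "\<forall>(V, i)\<in>K. minimal_invariant two_sided_ops V \<and> i < dm V"
    using psD(1) by (auto simp: K_def)
  ultimately show ?thesis using \<eta>(1) by (intro exI[of _ K] exI[of _ \<eta>]) simp
qed

text \<open>Countably many minimal spaces with finite bases, and base points \<open>a\<close> from a
  countable group, would give countably many functions measuring the distance between the translates
  of a basis vector by \<open>x\<close> and by \<open>a\<close>. Minimal separation, carried from
  the identity to \<open>a\<close>, shows that they determine the topology.\<close>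

lemma uncountable_minimal:
  assumes "\<not> metrizable_space T"
  shows "uncountable {V. minimal_invariant two_sided_ops V}"
proof
  assume count: "countable {V. minimal_invariant two_sided_ops V}"
  have "\<forall>V. \<exists>p. minimal_invariant two_sided_ops V \<longrightarrow> basis V (fst p) (snd p)"
    by (auto simp: minimal_invariant_def)
  then obtain p where p: "\<forall>V. minimal_invariant two_sided_ops V \<longrightarrow> basis V (fst (p V)) (snd (p V))"
    by (rule choice[THEN exE])
  define b where "b V = fst (p V)" for V
  define dm where "dm V = snd (p V)" for V
  have B: "basis V (b V) (dm V)" if "minimal_invariant two_sided_ops V" for V
    using p that by (simp add: b_def dm_def)
  define fn where "fn V i a x = nrm (ltr x (b V i) - ltr a (b V i))" for V i a x
  define \<F> where "\<F> = (\<lambda>(V, i, a). fn V i a) ` (SIGMA V : {V. minimal_invariant two_sided_ops V}. {..<dm V} \<times> carrier G)"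
  have "metrizable_space T"
  proof (rule metrizable_space_if_countable_functions[OF Hausdorff])
    show "countable \<F>"
      unfolding \<F>_def by (intro countable_image countable_SIGMA count countable_carrier) auto
    fix f assume "f \<in> \<F>"
    then obtain V i a where f: "f = fn V i a" "minimal_invariant two_sided_ops V" "i < dm V" "a \<in> carrier G"
      by (auto simp: \<F>_def)
    have eU: "b V i \<in> UC" by (rule orthonormalD(1)[OF basisD(2)[OF B[OF f(2)]] f(3)])
    have "continuous_map T euclidean (\<lambda>x. complex_of_real (fn V i a x))"
      unfolding fn_def by (intro unif_cont_continuous unif_cont_nrm_ltr eU ltr_UC f(4))
    from continuous_map_compose[OF this, of euclideanreal Re]
    show "continuous_map T euclideanreal f" by (simp add: o_def f(1) continuous_on_Re)
  next
    fix U a assume U: "openin T U" "a \<in> U"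
    have a: "a \<in> carrier G" by (rule openin_carrier[OF U])
    let ?N = "{x \<in> carrier G. a \<otimes> x \<in> U}"
    have N: "openin T ?N" "\<one> \<in> ?N" using translate_open[OF U(1) a] a U(2) by auto
    obtain K \<eta> where K: "finite K" "0 < \<eta>"
      "\<forall>(V, i)\<in>K. minimal_invariant two_sided_ops V \<and> i < dm V"
      "\<forall>g\<in>carrier G. (\<forall>(V, i)\<in>K. nrm (ltr g (b V i) - b V i) < \<eta>) \<longrightarrow> g \<in> ?N"
    proof -
      have "\<forall>V. minimal_invariant two_sided_ops V \<longrightarrow> basis V (b V) (dm V)" using B by blast
      from minimal_separation[OF N this] show ?thesis by (elim exE conjE) (rule that)
    qed
    let ?F = "(\<lambda>(V, i). fn V i a) ` K"
    have "x \<in> U" if x: "x \<in> topspace T" and small: "\<forall>f\<in>?F. \<bar>f x - f a\<bar> < \<eta>" for x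
    proof -
      have xG: "x \<in> carrier G" using x topspace_eq by simp
      have "\<forall>(V, i)\<in>K. nrm (ltr (inv a \<otimes> x) (b V i) - b V i) < \<eta>"
      proof (intro ballI, clarify)
        fix V i assume Vi: "(V, i) \<in> K"
        have eU: "b V i \<in> UC" using bspec[OF K(3) Vi] orthonormalD(1)[OF basisD(2)[OF B]] by blast
        have "\<bar>fn V i a x - fn V i a a\<bar> < \<eta>" using small Vi by force
        then have "nrm (ltr x (b V i) - ltr a (b V i)) < \<eta>" by (simp add: fn_def)
        moreover have "nrm (ltr a (ltr (inv a \<otimes> x) (b V i) - b V i)) = nrm (ltr (inv a \<otimes> x) (b V i) - b V i)"
          by (rule nrm_ltr) (use a xG eU X_diff ltr_UC in auto)
        moreover have "ltr a (ltr (inv a \<otimes> x) (b V i) - b V i) = ltr x (b V i) - ltr a (b V i)"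
          using a xG by (simp add: ltr_diff ltr_ltr m_assoc[symmetric])
        ultimately show "nrm (ltr (inv a \<otimes> x) (b V i) - b V i) < \<eta>" by simp
      qed
      then have "inv a \<otimes> x \<in> ?N" using K(4) a xG by blast
      then show ?thesis using a xG by (simp add: m_assoc[symmetric])
    qed
    moreover have "?F \<subseteq> \<F>" using K(3) a by (force simp: \<F>_def)
    ultimately show "\<exists>F \<eta>. finite F \<and> F \<subseteq> \<F> \<and> 0 < (\<eta>::real) \<and>
        (\<forall>x\<in>topspace T. (\<forall>f\<in>F. \<bar>f x - f a\<bar> < \<eta>) \<longrightarrow> x \<in> U)"
      using K(1,2) by (intro exI[of _ ?F] exI[of _ \<eta>]) auto
  qed
  then show False using assms by blast
qed

end

section \<open>Close pairs of representations\<close>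

lemma uncountable_fibre:
  assumes "uncountable I" "countable D" "g ` I \<subseteq> D"
  obtains d where "uncountable {i \<in> I. g i = d}"
proof -
  have "I \<subseteq> (\<Union>d\<in>D. {i \<in> I. g i = d})" using assms(3) by blast
  then have "uncountable (\<Union>d\<in>D. {i \<in> I. g i = d})" using assms(1) countable_subset by blast
  moreover have "countable (\<Union>d\<in>D. {i \<in> I. g i = d})" if "\<forall>d\<in>D. countable {i \<in> I. g i = d}"
    by (rule countable_UN[OF assms(2)]) (use that in simp)
  ultimately have "\<exists>d\<in>D. uncountable {i \<in> I. g i = d}" by (rule_tac ccontr) simp
  then obtain d where "uncountable {i \<in> I. g i = d}" by blast
  then show ?thesis by (rule that)
qed

text \<open>Finite intersections of sets that separate a point of \<open>C\<close> from other points
  of \<open>C\<close>. There are countably many since \<open>C\<close> is countable, and they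
  suffice since the part of \<open>C\<close> outside \<open>Q\<close> is compact and is disposed of
  by finitely many separations. The sets form a base only relative to \<open>C\<close>.\<close>

lemma countable_compact_base:
  assumes C: "compactin X C" "countable C" and haus: "Hausdorff_space X"
  obtains \<B> where "countable \<B>" "\<And>B. B \<in> \<B> \<Longrightarrow> openin X B"
    "\<And>Q x. openin X Q \<Longrightarrow> x \<in> C \<Longrightarrow> x \<in> Q \<Longrightarrow> \<exists>B\<in>\<B>. x \<in> B \<and> B \<inter> C \<subseteq> Q"
proof -
  have CX: "C \<subseteq> topspace X" using C(1) compactin_subset_topspace by blast
  have "\<forall>p. \<exists>q. fst p \<in> C \<and> snd p \<in> C \<and> fst p \<noteq> snd p \<longrightarrow> openin X (fst q) \<and> openin X (snd q) \<and>
      fst p \<in> fst q \<and> snd p \<in> snd q \<and> disjnt (fst q) (snd q)"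
  proof
    fix p :: "'a \<times> 'a"
    show "\<exists>q. fst p \<in> C \<and> snd p \<in> C \<and> fst p \<noteq> snd p \<longrightarrow> openin X (fst q) \<and> openin X (snd q) \<and>
      fst p \<in> fst q \<and> snd p \<in> snd q \<and> disjnt (fst q) (snd q)"
    proof (cases "fst p \<in> C \<and> snd p \<in> C \<and> fst p \<noteq> snd p")
      case True
      then have "fst p \<in> topspace X" "snd p \<in> topspace X" "fst p \<noteq> snd p" using CX by auto
      then have "\<exists>U V. openin X U \<and> openin X V \<and> fst p \<in> U \<and> snd p \<in> V \<and> disjnt U V"
        using haus by (simp add: Hausdorff_space_def)
      then obtain U V where "openin X U" "openin X V" "fst p \<in> U" "snd p \<in> V" "disjnt U V"
        by (elim exE conjE) (rule that)
      then show ?thesis by (intro exI[of _ "(U, V)"]) simp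
    qed blast
  qed
  then obtain q where q: "\<forall>p. fst p \<in> C \<and> snd p \<in> C \<and> fst p \<noteq> snd p \<longrightarrow> openin X (fst (q p)) \<and> openin X (snd (q p)) \<and>
      fst p \<in> fst (q p) \<and> snd p \<in> snd (q p) \<and> disjnt (fst (q p)) (snd (q p))"
    by (rule choice[THEN exE])
  define U where "U x y = fst (q (x, y))" for x y
  define V where "V x y = snd (q (x, y))" for x y
  have UV: "openin X (U x y)" "openin X (V x y)" "x \<in> U x y" "y \<in> V x y" "disjnt (U x y) (V x y)"
    if "x \<in> C" "y \<in> C" "x \<noteq> y" for x y
    using q[rule_format, of "(x, y)"] that by (auto simp: U_def V_def)
  define \<B> where "\<B> = (\<lambda>(x, F). (\<Inter>y\<in>F. U x y) \<inter> topspace X) ` (SIGMA x : C. {F. finite F \<and> F \<subseteq> C - {x}})"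
  have "countable {F. finite F \<and> F \<subseteq> C - {x}}" for x
    using countable_Collect_finite_subset[of "C - {x}"] C(2) by (simp add: conj_commute)
  then have "countable \<B>" unfolding \<B>_def using C(2) by (intro countable_image countable_SIGMA) auto
  moreover have "openin X B" if "B \<in> \<B>" for B
    using that UV(1) unfolding \<B>_def by (auto intro!: openin_INT)
  moreover have "\<exists>B\<in>\<B>. x \<in> B \<and> B \<inter> C \<subseteq> Q" if Q: "openin X Q" "x \<in> C" "x \<in> Q" for Q x
  proof -
    have "closedin X (topspace X - Q)" using Q(1) by blast
    then have K: "compactin X ((topspace X - Q) \<inter> C)" using C(1) closed_Int_compactin by blast
    let ?K = "(topspace X - Q) \<inter> C"
    have "\<exists>\<F>. finite \<F> \<and> \<F> \<subseteq> V x ` ?K \<and> ?K \<subseteq> \<Union>\<F>"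
    proof (rule compactinD[OF K])
      show "openin X W" if "W \<in> V x ` ?K" for W using that UV(2) Q(2,3) by auto
      show "?K \<subseteq> \<Union> (V x ` ?K)" using UV(4) Q(2,3) by fastforce
    qed
    then obtain F where F: "finite F" "F \<subseteq> ?K" "?K \<subseteq> (\<Union>y\<in>F. V x y)"
      using finite_subset_image by (metis (no_types, lifting))
    let ?B = "(\<Inter>y\<in>F. U x y) \<inter> topspace X"
    have "?B \<in> \<B>" unfolding \<B>_def using F(1,2) Q(2,3) by (intro image_eqI[of _ _ "(x, F)"]) auto
    moreover have "x \<in> ?B"
    proof -
      have "x \<in> U x y" if y: "y \<in> F" for y
      proof (rule UV(3)[OF Q(2)])
        show "y \<in> C" using F(2) y by blast
        show "x \<noteq> y" using F(2) y Q(3) by blast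
      qed
      then show ?thesis using Q(2) CX by blast
    qed
    moreover have "?B \<inter> C \<subseteq> Q"
    proof
      fix z assume z: "z \<in> ?B \<inter> C"
      show "z \<in> Q"
      proof (rule ccontr)
        assume "z \<notin> Q"
        then have "z \<in> ?K" using z by blast
        then obtain y where y: "y \<in> F" "z \<in> V x y" using F(3) by blast
        have "y \<in> C" "x \<noteq> y" using F(2) y(1) Q(3) by auto
        then show False using UV(5)[of x y] Q(2) z y by (auto simp: disjnt_iff)
      qed
    qed
    ultimately show ?thesis by blast
  qed
  ultimately show ?thesis by (rule that)
qed

text \<open>Continuous functions on a countable compact set form a separable space: up to \<open>\<epsilon>\<close> such a
  function is described by finitely many pairs of a basic open set and a value from a countable dense set.\<close>

lemma close_uncountable_subfamily:
  fixes u :: "'i \<Rightarrow> 'a \<Rightarrow> complex"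
  assumes C: "compactin X C" "countable C" and haus: "Hausdorff_space X"
    and I: "uncountable I" and cont: "\<And>i. i \<in> I \<Longrightarrow> continuous_map X euclidean (u i)" and \<epsilon>: "0 < \<epsilon>"
  shows "\<exists>I'\<subseteq>I. uncountable I' \<and> (\<forall>i\<in>I'. \<forall>j\<in>I'. \<forall>x\<in>C. cmod (u i x - u j x) < \<epsilon>)"
proof -
  obtain \<B> where \<B>: "countable \<B>" "\<And>B. B \<in> \<B> \<Longrightarrow> openin X B"
    "\<And>Q x. openin X Q \<Longrightarrow> x \<in> C \<Longrightarrow> x \<in> Q \<Longrightarrow> \<exists>B\<in>\<B>. x \<in> B \<and> B \<inter> C \<subseteq> Q"
    by (rule countable_compact_base[OF C haus]) (rule that)
  obtain D :: "complex set" where D: "countable D" "\<And>X. open X \<Longrightarrow> X \<noteq> {} \<Longrightarrow> \<exists>d\<in>D. d \<in> X"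
    by (rule countable_dense_setE) blast
  have CX: "C \<subseteq> topspace X" using C(1) compactin_subset_topspace by blast
  have "\<exists>d. d \<subseteq> \<B> \<times> D \<and> finite d \<and> C \<subseteq> \<Union>(fst ` d) \<and> (\<forall>(B, q)\<in>d. \<forall>z\<in>B \<inter> C. cmod (u i z - q) < \<epsilon> / 2)"
    if i: "i \<in> I" for i
  proof -
    have "\<forall>x\<in>C. \<exists>p. fst p \<in> \<B> \<and> snd p \<in> D \<and> x \<in> fst p \<and> (\<forall>z\<in>fst p \<inter> C. cmod (u i z - snd p) < \<epsilon> / 2)"
    proof
      fix x assume x: "x \<in> C"
      obtain q where q: "q \<in> D" "q \<in> ball (u i x) (\<epsilon> / 4)" using D(2)[of "ball (u i x) (\<epsilon> / 4)"] \<epsilon> by auto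
      have "openin X {z \<in> topspace X. u i z \<in> ball (u i x) (\<epsilon> / 4)}"
        by (rule openin_continuous_map_preimage[OF cont[OF i]]) simp
      then obtain B where B: "B \<in> \<B>" "x \<in> B" "B \<inter> C \<subseteq> {z \<in> topspace X. u i z \<in> ball (u i x) (\<epsilon> / 4)}"
        using \<B>(3)[OF _ x] x CX \<epsilon> by force
      have "cmod (u i z - q) < \<epsilon> / 2" if "z \<in> B \<inter> C" for z
      proof -
        have "dist (u i x) (u i z) < \<epsilon> / 4" using B(3) that by auto
        moreover have "dist (u i x) q < \<epsilon> / 4" using q(2) by simp
        ultimately show ?thesis using dist_triangle[of "u i z" q "u i x"] by (simp add: dist_commute dist_norm[symmetric])
      qed
      then show "\<exists>p. fst p \<in> \<B> \<and> snd p \<in> D \<and> x \<in> fst p \<and> (\<forall>z\<in>fst p \<inter> C. cmod (u i z - snd p) < \<epsilon> / 2)"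
        using B(1,2) q(1) by (intro exI[of _ "(B, q)"]) simp
    qed
    then obtain p where p: "\<forall>x\<in>C. fst (p x) \<in> \<B> \<and> snd (p x) \<in> D \<and> x \<in> fst (p x) \<and>
        (\<forall>z\<in>fst (p x) \<inter> C. cmod (u i z - snd (p x)) < \<epsilon> / 2)"
      by (rule bchoice[THEN exE])
    have "\<exists>\<F>. finite \<F> \<and> \<F> \<subseteq> (\<lambda>x. fst (p x)) ` C \<and> C \<subseteq> \<Union>\<F>"
      by (rule compactinD[OF C(1)]) (use p \<B>(2) in auto)
    then obtain F where F: "finite F" "F \<subseteq> C" "C \<subseteq> (\<Union>x\<in>F. fst (p x))"
      using finite_subset_image by (metis (no_types, lifting))
    show ?thesis
    proof (intro exI[of _ "p ` F"] conjI)
      show "p ` F \<subseteq> \<B> \<times> D"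
      proof (rule image_subsetI)
        fix x assume "x \<in> F"
        then have "x \<in> C" using F(2) by blast
        then show "p x \<in> \<B> \<times> D" using p by (simp add: mem_Times_iff)
      qed
      show "finite (p ` F)" using F(1) by simp
      show "C \<subseteq> \<Union> (fst ` p ` F)" using F(3) by auto
      have "\<forall>r\<in>p ` F. \<forall>z\<in>fst r \<inter> C. cmod (u i z - snd r) < \<epsilon> / 2" using p F(2) by blast
      then show "\<forall>(B, q)\<in>p ` F. \<forall>z\<in>B \<inter> C. cmod (u i z - q) < \<epsilon> / 2" by (simp add: case_prod_beta)
    qed
  qed
  then have "\<forall>i\<in>I. \<exists>d. d \<subseteq> \<B> \<times> D \<and> finite d \<and> C \<subseteq> \<Union>(fst ` d) \<and> (\<forall>(B, q)\<in>d. \<forall>z\<in>B \<inter> C. cmod (u i z - q) < \<epsilon> / 2)"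
    by blast
  then obtain d where d: "\<forall>i\<in>I. d i \<subseteq> \<B> \<times> D \<and> finite (d i) \<and> C \<subseteq> \<Union>(fst ` d i) \<and>
      (\<forall>(B, q)\<in>d i. \<forall>z\<in>B \<inter> C. cmod (u i z - q) < \<epsilon> / 2)"
    by (rule bchoice[THEN exE])
  have "countable {F. finite F \<and> F \<subseteq> \<B> \<times> D}"
    by (rule countable_Collect_finite_subset) (use \<B>(1) D(1) in simp)
  moreover have "d ` I \<subseteq> {F. finite F \<and> F \<subseteq> \<B> \<times> D}" using d by blast
  \<comment> \<open>Only countably many descriptions exist, so uncountably many indices share one.
    At a point of \<open>C\<close> two such functions are within \<epsilon>/2 of the same
    value.\<close>
  ultimately obtain e where e: "uncountable {i \<in> I. d i = e}" by (rule uncountable_fibre[OF I])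
  have "cmod (u i x - u j x) < \<epsilon>" if ij: "i \<in> {i \<in> I. d i = e}" "j \<in> {i \<in> I. d i = e}" and x: "x \<in> C" for i j x
  proof -
    have i: "i \<in> I" "d i = e" and j: "j \<in> I" "d j = e" using ij by auto
    have "C \<subseteq> \<Union>(fst ` e)" using d i by blast
    then obtain B q where Bq: "(B, q) \<in> e" "x \<in> B" using x by auto
    have "\<forall>(B, q)\<in>e. \<forall>z\<in>B \<inter> C. cmod (u i z - q) < \<epsilon> / 2" "\<forall>(B, q)\<in>e. \<forall>z\<in>B \<inter> C. cmod (u j z - q) < \<epsilon> / 2"
      using d i j by blast+
    then have "cmod (u i x - q) < \<epsilon> / 2" "cmod (u j x - q) < \<epsilon> / 2" using Bq x by auto
    then show ?thesis using norm_triangle_ineq4[of "u i x - q" "u j x - q"] by simp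
  qed
  note close = this
  show ?thesis
  proof (intro exI[of _ "{i \<in> I. d i = e}"] conjI ballI)
    show "{i \<in> I. d i = e} \<subseteq> I" by blast
    show "uncountable {i \<in> I. d i = e}" by (rule e)
    fix i j x assume "i \<in> {i \<in> I. d i = e}" "j \<in> {i \<in> I. d i = e}" "x \<in> C"
    then show "cmod (u i x - u j x) < \<epsilon>" by (rule close)
  qed
qed

text \<open>The functions are treated one after the other; the index set stays uncountable at each
  refinement and closeness passes to subsets.\<close>

lemma close_uncountable_subfamily_finite:
  fixes u :: "'j \<Rightarrow> 'i \<Rightarrow> 'a \<Rightarrow> complex"
  assumes C: "compactin X C" "countable C" and haus: "Hausdorff_space X" and J: "finite J"
    and I: "uncountable I" and cont: "\<And>i j. j \<in> J \<Longrightarrow> i \<in> I \<Longrightarrow> continuous_map X euclidean (u j i)" and \<epsilon>: "0 < \<epsilon>"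
  shows "\<exists>I'\<subseteq>I. uncountable I' \<and> (\<forall>j\<in>J. \<forall>i\<in>I'. \<forall>i'\<in>I'. \<forall>x\<in>C. cmod (u j i x - u j i' x) < \<epsilon>)"
  using J cont
proof (induction J rule: finite_induct)
  case empty
  then show ?case using I by auto
next
  case (insert j J)
  then obtain I1 where I1: "I1 \<subseteq> I" "uncountable I1" "\<forall>j\<in>J. \<forall>i\<in>I1. \<forall>i'\<in>I1. \<forall>x\<in>C. cmod (u j i x - u j i' x) < \<epsilon>"
    by (metis insertCI)
  have "continuous_map X euclidean (u j i)" if "i \<in> I1" for i using insert.prems I1(1) that by blast
  then have "\<exists>I'\<subseteq>I1. uncountable I' \<and> (\<forall>i\<in>I'. \<forall>i'\<in>I'. \<forall>x\<in>C. cmod (u j i x - u j i' x) < \<epsilon>)"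
    by (rule close_uncountable_subfamily[OF C haus I1(2) _ \<epsilon>])
  then obtain I2 where I2: "I2 \<subseteq> I1" "uncountable I2" "\<forall>i\<in>I2. \<forall>i'\<in>I2. \<forall>x\<in>C. cmod (u j i x - u j i' x) < \<epsilon>"
    by blast
  have "cmod (u j' i x - u j' i' x) < \<epsilon>" if "j' \<in> insert j J" "i \<in> I2" "i' \<in> I2" "x \<in> C" for j' i i' x
  proof (cases "j' = j")
    case True
    then show ?thesis using I2(3) that(2-4) by simp
  next
    case False
    then have "j' \<in> J" "i \<in> I1" "i' \<in> I1" using that I2(1) by auto
    then show ?thesis using I1(3) that(4) by simp
  qed
  note close = this
  show ?case
  proof (intro exI[of _ I2] conjI ballI)
    show "I2 \<subseteq> I" using I1(1) I2(1) by blast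
    show "uncountable I2" by (rule I2(2))
    fix j' i i' x assume "j' \<in> insert j J" "i \<in> I2" "i' \<in> I2" "x \<in> C"
    then show "cmod (u j' i x - u j' i' x) < \<epsilon>" by (rule close)
  qed
qed

section \<open>Spans of finite sets\<close>

context function_inner_space
begin

lemma proj_self: "orthonormal e n \<Longrightarrow> i < n \<Longrightarrow> proj e n (e i) = e i"
proof (rule ext)
  fix x assume e: "orthonormal e n" "i < n"
  have "proj e n (e i) x = (\<Sum>j<n. ip (e i) (e j) * e j x)" by (simp add: proj_def)
  also have "\<dots> = (\<Sum>j<n. if j = i then e j x else 0)"
    using orthonormalD(2)[OF e] by (intro sum.cong) auto
  finally show "proj e n (e i) x = e i x" using e(2) by simp
qed

lemma basis_range_proj: "orthonormal e n \<Longrightarrow> basis {f \<in> X. proj e n f = f} e n"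
  unfolding basis_def subsp_def
  by (auto simp: X_zero X_add X_sc proj_add proj_sc proj_zero proj_self orthonormalD)

text \<open>Gram-Schmidt, one generator at a time. The minimality clause lets a property that
  defines a subspace be verified on \<open>S\<close> alone.\<close>

lemma hull_basis:
  assumes "finite S" "S \<subseteq> X"
  shows "\<exists>W e k. basis W e k \<and> S \<subseteq> W \<and> k \<le> card S \<and> (\<forall>U. subsp U \<longrightarrow> S \<subseteq> U \<longrightarrow> W \<subseteq> U)"
  using assms
proof (induction S rule: finite_induct)
  case empty
  have "basis {0} e 0" for e
    by (auto simp: basis_def subsp_def X_zero orthonormal_def proj_def)
  then show ?case using subspD(2) by (intro exI[of _ "{0}"] exI[of _ "\<lambda>_. 0"] exI[of _ 0]) auto
next
  case (insert s S)
  then obtain W e k where W: "basis W e k" "S \<subseteq> W" "k \<le> card S" "\<forall>U. subsp U \<longrightarrow> S \<subseteq> U \<longrightarrow> W \<subseteq> U"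
    by (metis insert_subset)
  have sX: "s \<in> X" using insert.prems by simp
  note on = basisD(2)[OF W(1)]
  show ?case
  proof (cases "s - proj e k s = 0")
    case True
    then have "s = proj e k s" by simp
    then have "s \<in> W" using proj_in[OF W(1), of s] by simp
    then show ?thesis using W insert.hyps
      by (intro exI[of _ W] exI[of _ e] exI[of _ k]) (simp add: le_SucI)
  next
    case False
    define r where "r = s - proj e k s"
    have r: "r \<noteq> 0" "r \<in> X" using False X_diff[OF sX proj_in_X[OF on]] by (simp_all add: r_def)
    define e' where "e' = e(k := sc (1 / nrm r) r)"
    have on': "orthonormal e' (Suc k)"
      unfolding e'_def by (rule orthonormal_extend[OF on r(2,1)]) (use ip_residual_e[OF on _ sX] in \<open>simp add: r_def\<close>)
    define W' where "W' = {f \<in> X. proj e' (Suc k) f = f}"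
    have W': "basis W' e' (Suc k)" unfolding W'_def by (rule basis_range_proj[OF on'])
    note sW' = basisD(1)[OF W']
    have eW': "e i \<in> W'" if "i < k" for i
      using basisD(3)[OF W', of i] that by (simp add: e'_def)
    have pW': "proj e k f \<in> W'" for f
      unfolding proj_def by (intro subsp_sum[OF sW'] subspD(4)[OF sW'] eW') simp
    have "S \<subseteq> W'" using W(2) basisD(4)[OF W(1)] pW' by (metis subsetD subsetI)
    moreover have "s \<in> W'"
    proof -
      have "sc (nrm r) (e' k) \<in> W'" by (rule subspD(4)[OF sW' basisD(3)[OF W']]) simp
      moreover have "sc (nrm r) (e' k) = r" using nrm_pos[OF r(2,1)] by (simp add: e'_def)
      ultimately have "r \<in> W'" by simp
      from subspD(3)[OF sW' this pW'[of s]] show ?thesis by (simp only: r_def diff_add_cancel)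
    qed
    moreover have "W' \<subseteq> U" if U: "subsp U" "insert s S \<subseteq> U" for U
    proof
      fix f assume f: "f \<in> W'"
      have WU: "W \<subseteq> U" using W(4) U by blast
      have "r \<in> U" unfolding r_def by (rule subsp_diff[OF U(1)]) (use U(2) WU proj_in[OF W(1)] in auto)
      then have "e' i \<in> U" if "i < Suc k" for i
        using that WU basisD(3)[OF W(1)] subspD(4)[OF U(1)] by (auto simp: e'_def less_Suc_eq)
      then have "proj e' (Suc k) f \<in> U"
        unfolding proj_def by (intro subsp_sum[OF U(1)] subspD(4)[OF U(1)]) simp
      then show "f \<in> U" using f by (simp add: W'_def)
    qed
    ultimately show ?thesis using W' W(3) insert.hyps
      by (intro exI[of _ W'] exI[of _ e'] exI[of _ "Suc k"]) simp
  qed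
qed

end

section \<open>Matrix coefficients of finite-dimensional invariant spaces\<close>

context totally_bounded_group
begin

lemma unif_cont_ip_ltr:
  assumes f: "f \<in> UC" and h: "h \<in> UC"
  shows "unif_cont (\<lambda>y. ip (ltr y f) h)"
proof (rule unif_cont_dominated1[OF UC_unif_cont[OF f]])
  fix \<epsilon> :: real assume e: "0 < \<epsilon>"
  let ?d = "\<epsilon> / (nrm h + 1)"
  have n: "0 \<le> nrm h" by (rule nrm_nonneg[OF h])
  have le: "?d * nrm h \<le> \<epsilon>" using e n by (simp add: field_simps)
  have "near (\<lambda>y. ip (ltr y f) h) \<epsilon> u \<one>" if u: "u \<in> carrier G" "near f ?d u \<one>" for u
    unfolding near_def
  proof (intro ballI)
    fix s t assume st: "s \<in> carrier G" "t \<in> carrier G"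
    let ?a = "ltr (s \<otimes> u \<otimes> t) f" and ?b = "ltr (s \<otimes> \<one> \<otimes> t) f"
    have ab: "?a \<in> UC" "?b \<in> UC" using st u f by (auto intro!: ltr_UC)
    have "cmod (ip (?a - ?b) h) \<le> nrm (?a - ?b) * nrm h" by (rule cauchy_schwarz[OF X_diff[OF ab] h])
    also have "\<dots> \<le> ?d * nrm h" by (rule mult_right_mono[OF nrm_ltr_diff[OF f u(2,1) st] n])
    finally show "cmod (ip ?a h - ip ?b h) \<le> \<epsilon>" using le ab h by (simp add: ip_diff)
  qed
  moreover have "0 < ?d" using e n by simp
  ultimately show "\<exists>\<delta>>0. \<forall>x\<in>carrier G. near f \<delta> x \<one> \<longrightarrow> near (\<lambda>y. ip (ltr y f) h) \<epsilon> x \<one>" by blast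
qed

text \<open>For an invariant space, \<open>\<parallel>q\<parallel>\<^sup>2\<close> of the reproducing element \<open>q\<close> is the dimension.\<close>

lemma evaluation_bound:
  assumes W: "basis W e k" "invariant left_ops W" and f: "f \<in> W"
  shows "cmod (f \<one>) \<le> sqrt k * nrm f"
proof -
  note sW = basisD(1)[OF W(1)] and on = basisD(2)[OF W(1)]
  have eU: "e i \<in> UC" if "i < k" for i by (rule orthonormalD(1)[OF on that])
  \<comment> \<open>The reproducing element: on \<open>W\<close>, pairing with \<open>q\<close> is
    evaluation at the identity, and pairing with its left translates is evaluation
    elsewhere.\<close>
  define q where "q = (\<Sum>i<k. sc (cnj (e i \<one>)) (e i))"
  have qU: "q \<in> UC" unfolding q_def by (rule comb_in_X[OF on])
  have qW: "q \<in> W" unfolding q_def by (intro subsp_sum[OF sW] subspD(4)[OF sW] basisD(3)[OF W(1)]) simp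
  have ipq: "ip h q = h \<one>" if h: "h \<in> W" for h
  proof -
    have "ip h q = (\<Sum>i<k. ip h (sc (cnj (e i \<one>)) (e i)))"
      unfolding q_def by (rule ip_sum_right) (use eU X_sc subspD(1)[OF sW h] in auto)
    also have "\<dots> = proj e k h \<one>"
      using eU subspD(1)[OF sW h] by (simp add: proj_def ip_sc_right mult.commute)
    finally show ?thesis using basisD(4)[OF W(1) h] by simp
  qed
  have ipx: "ip h (ltr x q) = h x" if h: "h \<in> W" and x: "x \<in> carrier G" for h x
  proof -
    have hU: "h \<in> UC" by (rule subspD(1)[OF sW h])
    have "ltr (inv x) h \<in> W" by (rule invariantD[OF W(2) _ h]) (use x in auto)
    then have "ip (ltr (inv x) h) q = h x" using ipq x by simp
    then show ?thesis using ip_ltr[OF hU qU inv_closed[OF x]] x by simp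
  qed
  \<comment> \<open>Parseval for \<open>ltr x q\<close>: the squared moduli of the basis functions
    at \<open>x\<close> add up to a number independent of \<open>x\<close>. Its mean is that number,
    and orthonormality evaluates the mean to \<open>k\<close>.\<close>
  have sumsq: "(\<Sum>i<k. e i x * cnj (e i x)) = complex_of_real ((nrm q)\<^sup>2)" if x: "x \<in> carrier G" for x
  proof -
    have xW: "ltr x q \<in> W" by (rule invariantD[OF W(2) _ qW]) (use x in auto)
    have xU: "ltr x q \<in> UC" by (rule ltr_UC[OF qU x])
    have "(nrm (ltr x q))\<^sup>2 = (\<Sum>i<k. (cmod (ip (ltr x q) (e i)))\<^sup>2)"
      using nrm_comb[OF on, of "\<lambda>i. ip (ltr x q) (e i)"] basisD(4)[OF W(1) xW] by (simp add: proj_def)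
    also have "\<dots> = (\<Sum>i<k. (cmod (e i x))\<^sup>2)"
    proof (rule sum.cong[OF refl])
      fix i assume "i \<in> {..<k}"
      then have "ip (ltr x q) (e i) = cnj (e i x)"
        using ip_commute[OF xU eU] ipx[OF basisD(3)[OF W(1)] x] by simp
      then show "(cmod (ip (ltr x q) (e i)))\<^sup>2 = (cmod (e i x))\<^sup>2" by simp
    qed
    finally have "(nrm q)\<^sup>2 = (\<Sum>i<k. (cmod (e i x))\<^sup>2)" using nrm_ltr[OF qU x] by simp
    then show ?thesis by (simp only: complex_norm_square of_real_sum)
  qed
  have uc: "unif_cont (\<lambda>x. e i x * cnj (e i x))" if "i < k" for i by (rule unif_cont_ip[OF eU[OF that] eU[OF that]])
  have "mean (\<lambda>x. \<Sum>i<k. e i x * cnj (e i x)) = (\<Sum>i<k. ip (e i) (e i))"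
    unfolding ip_def by (rule mean_sum) (use uc in auto)
  also have "\<dots> = of_nat k" using orthonormalD(2)[OF on] by simp
  finally have "complex_of_real ((nrm q)\<^sup>2) = complex_of_real (real k)"
    using mean_eq_const[of "\<lambda>x. \<Sum>i<k. e i x * cnj (e i x)", OF sumsq] by simp
  then have "(nrm q)\<^sup>2 = real k" by (simp only: of_real_eq_iff)
  then have "nrm q = sqrt k" using nrm_nonneg[OF qU] by (metis real_sqrt_abs abs_of_nonneg)
  then show ?thesis
    using cauchy_schwarz[OF subspD(1)[OF sW f] qU] ipq[OF f] by (simp add: mult.commute)
qed

text \<open>Row \<open>a\<close>, column \<open>b\<close> of the matrix of \<open>ltr x\<close> in
  the basis \<open>e\<close>. With this order of the indices \<open>coef_mult\<close> is ordinary
  matrix multiplication.\<close>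

definition coef :: "(nat \<Rightarrow> 'a \<Rightarrow> complex) \<Rightarrow> nat \<Rightarrow> nat \<Rightarrow> 'a \<Rightarrow> complex"
  where "coef e a b x = ip (ltr x (e b)) (e a)"

lemma coef_mult:
  assumes V: "basis V e n" "invariant left_ops V" and ab: "a < n" "b < n" and xy: "x \<in> carrier G" "y \<in> carrier G"
  shows "coef e a b (x \<otimes> y) = (\<Sum>c<n. coef e a c x * coef e c b y)"
proof -
  note on = basisD(2)[OF V(1)]
  have eU: "i < n \<Longrightarrow> e i \<in> UC" for i by (rule orthonormalD(1)[OF on])
  have yV: "ltr y (e b) \<in> V" by (rule invariantD[OF V(2) _ basisD(3)[OF V(1) ab(2)]]) (use xy in auto)
  have xU: "ltr (inv x) (e a) \<in> UC" by (rule ltr_UC[OF eU[OF ab(1)] inv_closed[OF xy(1)]])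
  have "coef e a b (x \<otimes> y) = ip (ltr x (ltr y (e b))) (e a)" using xy by (simp add: coef_def ltr_ltr)
  also have "\<dots> = ip (ltr y (e b)) (ltr (inv x) (e a))"
    by (rule ip_ltr[OF ltr_UC[OF eU[OF ab(2)] xy(2)] eU[OF ab(1)] xy(1)])
  also have "\<dots> = ip (proj e n (ltr y (e b))) (ltr (inv x) (e a))" using basisD(4)[OF V(1) yV] by simp
  also have "\<dots> = (\<Sum>c<n. ip (sc (ip (ltr y (e b)) (e c)) (e c)) (ltr (inv x) (e a)))"
    unfolding proj_def by (rule ip_sum) (use eU X_sc xU in auto)
  also have "\<dots> = (\<Sum>c<n. coef e a c x * coef e c b y)"
    using eU xU ip_ltr[OF _ eU[OF ab(1)] xy(1)] by (intro sum.cong refl) (simp add: ip_sc coef_def)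
  finally show ?thesis .
qed

lemma coef_inv:
  assumes on: "orthonormal e n" and ab: "a < n" "b < n" and x: "x \<in> carrier G"
  shows "coef e a b (inv x) = cnj (coef e b a x)"
proof -
  have eU: "e a \<in> UC" "e b \<in> UC" using orthonormalD(1)[OF on] ab by auto
  have "ip (ltr (inv x) (e b)) (e a) = ip (e b) (ltr x (e a))"
    using ip_ltr[OF eU(2,1) inv_closed[OF x]] x by simp
  also have "\<dots> = cnj (ip (ltr x (e a)) (e b))" by (rule ip_commute[OF eU(2) ltr_UC[OF eU(1) x]])
  finally show ?thesis by (simp add: coef_def)
qed

lemma coef_bound:
  assumes on: "orthonormal e n" and ab: "a < n" "b < n" and x: "x \<in> carrier G"
  shows "cmod (coef e a b x) \<le> 1"
  using cauchy_schwarz[OF ltr_UC[OF orthonormalD(1)[OF on ab(2)] x] orthonormalD(1)[OF on ab(1)]]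
    nrm_ltr[OF orthonormalD(1)[OF on ab(2)] x] orthonormal_nrm[OF on] ab by (simp add: coef_def)

lemma coef_one: "orthonormal e n \<Longrightarrow> a < n \<Longrightarrow> b < n \<Longrightarrow> coef e a b \<one> = (if a = b then 1 else 0)"
  using orthonormalD[of e n] by (simp add: coef_def ltr_one)

text \<open>Orthonormality of the rows, read off from the matrix at
  \<open>x \<otimes> inv x\<close>.\<close>

lemma coef_unitary:
  assumes V: "basis V e n" "invariant left_ops V" and pq: "p < n" "q < n" and x: "x \<in> carrier G"
  shows "(\<Sum>c<n. cnj (coef e p c x) * coef e q c x) = (if q = p then 1 else 0)"
proof -
  note on = basisD(2)[OF V(1)]
  have "coef e q p (x \<otimes> inv x) = (\<Sum>c<n. coef e q c x * coef e c p (inv x))"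
    by (rule coef_mult[OF V pq(2,1) x inv_closed[OF x]])
  also have "\<dots> = (\<Sum>c<n. cnj (coef e p c x) * coef e q c x)"
    using coef_inv[OF on _ pq(1) x] by (intro sum.cong refl) (simp add: mult.commute)
  finally show ?thesis using coef_one[OF on pq(2,1)] x by simp
qed

lemma unif_cont_coef: "orthonormal e n \<Longrightarrow> a < n \<Longrightarrow> b < n \<Longrightarrow> unif_cont (coef e a b)"
  unfolding coef_def by (intro unif_cont_ip_ltr orthonormalD(1))

text \<open>The conjugated entry at \<open>x\<close> is the transposed entry at
  \<open>inv x\<close>, and as a function of \<open>x\<close> this is a right coefficient of a
  vector of \<open>V\<close>.\<close>

lemma cnj_coef_in:
  assumes V: "basis V e n" "invariant two_sided_ops V" and ab: "a < n" "b < n"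
  shows "zero_ext (\<lambda>x. cnj (coef e a b x)) \<in> V"
proof -
  note on = basisD(2)[OF V(1)]
  have "zero_ext (\<lambda>x. cnj (coef e a b x)) = zero_ext (\<lambda>x. ip (ltr (inv x) (e a)) (e b))"
    using coef_inv[OF on ab(2,1)] by (auto simp: fun_eq_iff zero_ext_def coef_def)
  then show ?thesis
    using right_coeff_in[OF V basisD(3)[OF V(1) ab(1)] orthonormalD(1)[OF on ab(2)]] by simp
qed

end

lemma sum_product_rearrange:
  fixes A A' :: "nat \<Rightarrow> complex" and B B' :: "nat \<Rightarrow> nat \<Rightarrow> complex"
  shows "(\<Sum>c<n. (\<Sum>r<n. A r * B r c) * (\<Sum>s<n. A' s * B' s c))
    = (\<Sum>r<n. \<Sum>s<n. (A r * A' s) * (\<Sum>c<n. B r c * B' s c))"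
proof -
  have "(\<Sum>c<n. (\<Sum>r<n. A r * B r c) * (\<Sum>s<n. A' s * B' s c))
      = (\<Sum>c<n. \<Sum>r<n. \<Sum>s<n. (A r * A' s) * (B r c * B' s c))"
    unfolding sum_product by (intro sum.cong refl) (simp add: algebra_simps)
  also have "\<dots> = (\<Sum>r<n. \<Sum>c<n. \<Sum>s<n. (A r * A' s) * (B r c * B' s c))" by (rule sum.swap)
  also have "\<dots> = (\<Sum>r<n. \<Sum>s<n. \<Sum>c<n. (A r * A' s) * (B r c * B' s c))"
    by (intro sum.cong refl sum.swap)
  finally show ?thesis unfolding sum_distrib_left .
qed

section \<open>The product of one representation with the adjoint of another\<close>

context totally_bounded_group
begin

text \<open>The matrix entries of \<open>x \<mapsto> \<pi>(x) \<pi>'(x)\<^sup>*\<close>, where \<open>\<pi>\<close> and \<open>\<pi>'\<close> are the representations on the spans of \<open>e\<close> and \<open>e'\<close>.\<close>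

definition pair_coef :: "nat \<Rightarrow> (nat \<Rightarrow> 'a \<Rightarrow> complex) \<Rightarrow> (nat \<Rightarrow> 'a \<Rightarrow> complex) \<Rightarrow> nat \<Rightarrow> nat \<Rightarrow> 'a \<Rightarrow> complex"
  where "pair_coef n e e' p q = zero_ext (\<lambda>x. \<Sum>c<n. coef e p c x * cnj (coef e' q c x))"

lemma pair_coef_UC:
  assumes "orthonormal e n" "orthonormal e' n" "p < n" "q < n"
  shows "pair_coef n e e' p q \<in> UC"
  unfolding pair_coef_def
  by (intro zero_ext_UC unif_cont_sum unif_cont_mult unif_cont_cnj unif_cont_coef[OF assms(1)] unif_cont_coef[OF assms(2)])
    (use assms in auto)

lemma pair_coef_bound:
  assumes "orthonormal e n" "orthonormal e' n" "p < n" "q < n" "x \<in> carrier G"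
  shows "cmod (pair_coef n e e' p q x) \<le> n"
proof -
  have "cmod (\<Sum>c<n. coef e p c x * cnj (coef e' q c x)) \<le> of_nat (card {..<n}) * 1"
  proof (rule sum_norm_bound)
    fix c assume "c \<in> {..<n}"
    then show "cmod (coef e p c x * cnj (coef e' q c x)) \<le> 1"
      unfolding norm_mult complex_mod_cnj
      using coef_bound[OF assms(1,3) _ assms(5)] coef_bound[OF assms(2,4) _ assms(5)]
      by (intro mult_le_one) auto
  qed
  then show ?thesis using assms(5) by (simp add: pair_coef_def)
qed

lemma pair_coef_one:
  assumes "orthonormal e n" "orthonormal e' n" "p < n"
  shows "pair_coef n e e' p p \<one> = 1"
proof -
  have "(\<Sum>c<n. coef e p c \<one> * cnj (coef e' p c \<one>)) = (\<Sum>c<n. if c = p then 1 else 0)"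
    using coef_one[OF assms(1,3)] coef_one[OF assms(2,3)] by (intro sum.cong) auto
  then show ?thesis using assms(3) by (simp add: pair_coef_def)
qed

text \<open>Translating by \<open>g\<close> multiplies the matrix by \<pi>(g) from the left and by
  the adjoint of \<pi>'(g) from the right, so the entries span a left-invariant space.\<close>

lemma pair_coef_translate:
  assumes V: "basis V e n" "invariant left_ops V" and V': "basis V' e' n" "invariant left_ops V'"
    and pq: "p < n" "q < n" and g: "g \<in> carrier G" and x: "x \<in> carrier G"
  shows "pair_coef n e e' p q (g \<otimes> x)
    = (\<Sum>r<n. \<Sum>s<n. (coef e p r g * cnj (coef e' q s g)) * pair_coef n e e' r s x)"
proof -
  have "pair_coef n e e' p q (g \<otimes> x) = (\<Sum>c<n. coef e p c (g \<otimes> x) * cnj (coef e' q c (g \<otimes> x)))"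
    using g x by (simp add: pair_coef_def)
  also have "\<dots> = (\<Sum>c<n. (\<Sum>r<n. coef e p r g * coef e r c x) * (\<Sum>s<n. cnj (coef e' q s g) * cnj (coef e' s c x)))"
    using coef_mult[OF V pq(1) _ g x] coef_mult[OF V' pq(2) _ g x] by (intro sum.cong refl) simp
  also have "\<dots> = (\<Sum>r<n. \<Sum>s<n. (coef e p r g * cnj (coef e' q s g)) * (\<Sum>c<n. coef e r c x * cnj (coef e' s c x)))"
    by (rule sum_product_rearrange)
  finally show ?thesis using x by (simp only: pair_coef_def zero_ext_simps)
qed

text \<open>Each summand has as its mean the inner product of an element of \<open>V'\<close> with
  an element of \<open>V\<close>, and these spaces are orthogonal.\<close>

lemma mean_pair_coef:
  assumes M: "minimal_invariant two_sided_ops V" "minimal_invariant two_sided_ops V'" "V \<noteq> V'"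
    and V: "basis V e n" and V': "basis V' e' n" and pq: "p < n" "q < n"
  shows "mean (pair_coef n e e' p q) = 0"
proof -
  note on = basisD(2)[OF V] and on' = basisD(2)[OF V']
  have I: "invariant two_sided_ops V" "invariant two_sided_ops V'" using M by (simp_all add: minimal_invariant_def)
  have u: "unif_cont (\<lambda>x. coef e p c x * cnj (coef e' q c x))" if "c < n" for c
    by (intro unif_cont_mult unif_cont_cnj unif_cont_coef[OF on] unif_cont_coef[OF on'] pq that)
  have us: "unif_cont (\<lambda>x. \<Sum>c<n. coef e p c x * cnj (coef e' q c x))" by (rule unif_cont_sum) (use u in auto)
  have "mean (\<lambda>x. coef e p c x * cnj (coef e' q c x)) = 0" if c: "c < n" for c
  proof -
    let ?A = "zero_ext (\<lambda>x. cnj (coef e p c x))" and ?A' = "zero_ext (\<lambda>x. cnj (coef e' q c x))"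
    have A: "?A \<in> V" by (rule cnj_coef_in[OF V I(1) pq(1) c])
    have A': "?A' \<in> V'" by (rule cnj_coef_in[OF V' I(2) pq(2) c])
    have "mean (\<lambda>x. coef e p c x * cnj (coef e' q c x)) = ip ?A' ?A"
      unfolding ip_def by (rule mean_cong[OF u[OF c]]) (simp add: mult.commute)
    then show ?thesis using distinct_minimal_orthogonal[OF M A' A] by simp
  qed
  then have "mean (\<lambda>x. \<Sum>c<n. coef e p c x * cnj (coef e' q c x)) = 0"
    using mean_sum[of "{..<n}" "\<lambda>c x. coef e p c x * cnj (coef e' q c x)"] u by simp
  then show ?thesis
    unfolding pair_coef_def using mean_cong[OF us, of "zero_ext (\<lambda>x. \<Sum>c<n. coef e p c x * cnj (coef e' q c x))"] by simp
qed

text \<open>If \<pi> and \<pi>' agreed at \<open>g\<close>, translation by \<open>g\<close> would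
  conjugate the product matrix by a unitary one and preserve the trace. In general the change of the
  trace pairs the product matrix with a matrix whose entries are at most n \<eta>; its n^2 terms are
  each at most n^2 \<eta>, and the normalization divides by n. The same normalization gives
  \<open>\<phi>\<close> the value 1 at the identity, which will bound its norm from below.\<close>

lemma pair_vector:
  assumes M: "minimal_invariant two_sided_ops V" "minimal_invariant two_sided_ops V'" "V \<noteq> V'"
    and V: "basis V e n" and V': "basis V' e' n"
    and C: "C \<subseteq> carrier G" and \<eta>: "0 \<le> \<eta>"
    and close: "\<And>p q x. p < n \<Longrightarrow> q < n \<Longrightarrow> x \<in> C \<Longrightarrow> cmod (coef e p q x - coef e' p q x) \<le> \<eta>"
  shows "\<exists>W b k \<phi>. basis W b k \<and> k \<le> n * n \<and> invariant left_ops W \<and> (\<forall>f\<in>W. mean f = 0) \<and> \<phi> \<in> W \<and>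
    \<phi> \<one> = 1 \<and> (\<forall>g\<in>C. nrm (ltr g \<phi> - \<phi>) \<le> real n ^ 3 * \<eta>)"
proof -
  note on = basisD(2)[OF V] and on' = basisD(2)[OF V']
  have I: "invariant left_ops V" "invariant left_ops V'" using M by (auto simp: minimal_invariant_def invariant_def)
  let ?f = "pair_coef n e e'"
  have fU: "?f p q \<in> UC" if "p < n" "q < n" for p q by (rule pair_coef_UC[OF on on' that])
  have "n \<noteq> 0"
    using basis_zero[of V e] V M(1) by (auto simp: minimal_invariant_def)
  define S where "S = (\<lambda>(p, q). ?f p q) ` ({..<n} \<times> {..<n})"
  have S: "finite S" "S \<subseteq> UC" using fU by (auto simp: S_def)
  have fS: "?f p q \<in> S" if "p < n" "q < n" for p q using that by (auto simp: S_def)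
  have cS: "card S \<le> n * n" unfolding S_def using card_image_le[of "{..<n} \<times> {..<n}" "\<lambda>(p, q). ?f p q"] by simp
  obtain W b k where W: "basis W b k" "S \<subseteq> W" "k \<le> card S" "\<forall>U. subsp U \<longrightarrow> S \<subseteq> U \<longrightarrow> W \<subseteq> U"
    using hull_basis[OF S] by (elim exE conjE) (rule that)
  note sW = basisD(1)[OF W(1)]
  have fW: "?f p q \<in> W" if "p < n" "q < n" for p q using fS[OF that] W(2) by blast
  have inv: "ltr g h \<in> W" if g: "g \<in> carrier G" and h: "h \<in> W" for g h
  proof -
    \<comment> \<open>A subspace, so by minimality of the hull it is enough that it contains the
      generators.\<close>
    let ?U = "{h \<in> UC. ltr g h \<in> W}"
    have z: "ltr g 0 = 0" by (auto simp: fun_eq_iff ltr_def zero_ext_def)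
    have "subsp ?U"
      unfolding subsp_def
    proof (intro conjI ballI allI)
      show "0 \<in> ?U" using X_zero subspD(2)[OF sW] by (simp only: mem_Collect_eq z simp_thms)
      fix f assume f: "f \<in> ?U"
      show "sc c f \<in> ?U" for c using f X_sc subspD(4)[OF sW] by (simp only: mem_Collect_eq ltr_sc simp_thms)
      fix h assume "h \<in> ?U"
      then show "f + h \<in> ?U" using f X_add subspD(3)[OF sW] by (simp only: mem_Collect_eq ltr_add simp_thms)
    qed blast
    moreover have "S \<subseteq> ?U"
    proof
      fix h assume "h \<in> S"
      then obtain p q where pq: "p < n" "q < n" "h = ?f p q" by (auto simp: S_def)
      define c where "c r s = coef e p r (inv g) * cnj (coef e' q s (inv g))" for r s
      have sU: "(\<Sum>r<n. \<Sum>s<n. sc (c r s) (?f r s)) \<in> UC" by (intro X_sum X_sc fU) auto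
      have "ltr g (?f p q) = (\<Sum>r<n. \<Sum>s<n. sc (c r s) (?f r s))"
      proof (rule UC_eqI[OF ltr_UC[OF fU[OF pq(1,2)] g] sU])
        fix x assume x: "x \<in> carrier G"
        show "ltr g (?f p q) x = (\<Sum>r<n. \<Sum>s<n. sc (c r s) (?f r s)) x"
          using pair_coef_translate[OF V I(1) V' I(2) pq(1,2) inv_closed[OF g] x] x by (simp add: c_def)
      qed
      also have "\<dots> \<in> W" by (intro subsp_sum[OF sW] subspD(4)[OF sW] fW) auto
      finally show "h \<in> ?U" using fU[OF pq(1,2)] pq(3) by blast
    qed
    ultimately have "W \<subseteq> ?U" using W(4) by blast
    then show ?thesis using h by blast
  qed
  have mean0: "mean h = 0" if h: "h \<in> W" for h
  proof -
    have "subsp {h \<in> UC. mean h = 0}"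
      unfolding subsp_def
    proof (intro conjI ballI allI)
      show "0 \<in> {h \<in> UC. mean h = 0}" using X_zero mean_const[of 0] by (simp add: zero_fun_def)
      fix f assume f: "f \<in> {h \<in> UC. mean h = 0}"
      show "sc c f \<in> {h \<in> UC. mean h = 0}" for c
        using f X_sc[of f c] mean_cmult[OF UC_unif_cont, of f c] by (simp add: sc_def)
      fix h assume "h \<in> {h \<in> UC. mean h = 0}"
      then show "f + h \<in> {h \<in> UC. mean h = 0}"
        using f X_add[of f h] mean_add[OF UC_unif_cont UC_unif_cont, of f h] by (simp add: plus_fun_def)
    qed blast
    moreover have "S \<subseteq> {h \<in> UC. mean h = 0}"
      using fU mean_pair_coef[OF M V V'] by (auto simp: S_def)
    ultimately show ?thesis using W(4) h by blast
  qed
  define \<phi> where "\<phi> = sc (1 / of_nat n) (\<Sum>p<n. ?f p p)"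
  have \<phi>W: "\<phi> \<in> W" unfolding \<phi>_def by (intro subspD(4)[OF sW] subsp_sum[OF sW] fW) auto
  have \<phi>U: "\<phi> \<in> UC" by (rule subspD(1)[OF sW \<phi>W])
  have \<phi>x: "\<phi> x = (\<Sum>p<n. ?f p p x) / of_nat n" for x by (simp add: \<phi>_def)
  have "\<phi> \<one> = 1" using pair_coef_one[OF on on'] \<open>n \<noteq> 0\<close> by (simp add: \<phi>x)
  moreover have "nrm (ltr g \<phi> - \<phi>) \<le> real n ^ 3 * \<eta>" if g: "g \<in> C" for g
  proof (rule nrm_le)
    have gG: "g \<in> carrier G" using g C by blast
    show "ltr g \<phi> - \<phi> \<in> UC" by (intro X_diff ltr_UC \<phi>U gG)
    fix x assume x: "x \<in> carrier G"
    define D where "D r s = (\<Sum>c<n. cnj (coef e r c g) * (coef e' s c g - coef e s c g))" for r s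
    have "(\<Sum>p<n. ?f p p (inv g \<otimes> x)) = (\<Sum>p<n. \<Sum>r<n. \<Sum>s<n. (coef e p r (inv g) * cnj (coef e' p s (inv g))) * ?f r s x)"
      by (intro sum.cong refl pair_coef_translate[OF V I(1) V' I(2) _ _ inv_closed[OF gG] x]) auto
    also have "\<dots> = (\<Sum>p<n. \<Sum>r<n. \<Sum>s<n. (cnj (coef e r p g) * coef e' s p g) * ?f r s x)"
      by (intro sum.cong refl) (simp add: coef_inv[OF on _ _ gG] coef_inv[OF on' _ _ gG])
    also have "\<dots> = (\<Sum>r<n. \<Sum>p<n. \<Sum>s<n. (cnj (coef e r p g) * coef e' s p g) * ?f r s x)" by (rule sum.swap)
    also have "\<dots> = (\<Sum>r<n. \<Sum>s<n. \<Sum>p<n. (cnj (coef e r p g) * coef e' s p g) * ?f r s x)"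
      by (intro sum.cong refl sum.swap)
    finally have 1: "(\<Sum>p<n. ?f p p (inv g \<otimes> x)) = (\<Sum>r<n. \<Sum>s<n. (\<Sum>p<n. cnj (coef e r p g) * coef e' s p g) * ?f r s x)"
      by (simp only: sum_distrib_right)
    \<comment> \<open>Unitarity rewrites the untranslated trace in the shape of the translated one,
      so that the difference has the coefficients \<open>D\<close>.\<close>
    have "(\<Sum>r<n. ?f r r x) = (\<Sum>r<n. \<Sum>s<n. (if s = r then 1 else 0) * ?f r s x)"
      by (intro sum.cong refl) (simp add: if_distrib[of "\<lambda>z. z * _"] cong: if_cong)
    also have "\<dots> = (\<Sum>r<n. \<Sum>s<n. (\<Sum>p<n. cnj (coef e r p g) * coef e s p g) * ?f r s x)"
      by (intro sum.cong refl) (simp add: coef_unitary[OF V I(1) _ _ gG])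
    finally have 2: "(\<Sum>r<n. ?f r r x) = (\<Sum>r<n. \<Sum>s<n. (\<Sum>p<n. cnj (coef e r p g) * coef e s p g) * ?f r s x)" .
    have eq: "(ltr g \<phi> - \<phi>) x = (\<Sum>r<n. \<Sum>s<n. D r s * ?f r s x) / of_nat n"
      using x unfolding D_def right_diff_distrib sum_subtractf left_diff_distrib
      by (simp add: \<phi>x 1 2 diff_divide_distrib)
    have Dle: "cmod (D r s) \<le> n * \<eta>" if "r < n" "s < n" for r s
    proof -
      have "cmod (D r s) \<le> of_nat (card {..<n}) * \<eta>"
        unfolding D_def
      proof (rule sum_norm_bound)
        fix c assume c: "c \<in> {..<n}"
        have "cmod (coef e r c g) * cmod (coef e' s c g - coef e s c g) \<le> 1 * \<eta>"
          using coef_bound[OF on that(1) _ gG, of c] close[OF that(2) _ g, of c] c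
          by (intro mult_mono) (auto simp: norm_minus_commute)
        then show "cmod (cnj (coef e r c g) * (coef e' s c g - coef e s c g)) \<le> \<eta>" by (simp add: norm_mult)
      qed
      then show ?thesis by simp
    qed
    have "cmod (\<Sum>r<n. \<Sum>s<n. D r s * ?f r s x) \<le> of_nat (card {..<n}) * (of_nat (card {..<n}) * (n * \<eta> * n))"
    proof (intro sum_norm_bound)
      fix r s assume "r \<in> {..<n}" "s \<in> {..<n}"
      then have rs: "r < n" "s < n" by auto
      show "cmod (D r s * ?f r s x) \<le> n * \<eta> * n"
        unfolding norm_mult
        by (rule mult_mono[OF Dle[OF rs] pair_coef_bound[OF on on' rs x]]) (use \<eta> in auto)
    qed
    then have "cmod (\<Sum>r<n. \<Sum>s<n. D r s * ?f r s x) / n \<le> (n * (n * (n * \<eta> * n))) / n"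
      by (intro divide_right_mono) auto
    then show "cmod ((ltr g \<phi> - \<phi>) x) \<le> real n ^ 3 * \<eta>"
      unfolding eq using \<open>n \<noteq> 0\<close> by (simp add: norm_divide power3_eq_cube mult_ac)
  qed
  ultimately show ?thesis
    using W(1,3) cS inv mean0 \<phi>W
    by (intro exI[of _ W] exI[of _ b] exI[of _ k] exI[of _ \<phi>]) (auto simp: invariant_def)
qed

end

section \<open>From a close pair to an almost invariant vector\<close>

context countable_precompact_group
begin

text \<open>Uncountably many minimal spaces share one dimension \<open>n\<close>. For each \<eta>
  uncountably many of these have pairwise close coefficients on \<open>C\<close>, hence at least
  two.\<close>

lemma close_minimal_pair:
  assumes nm: "\<not> metrizable_space T" and C: "compactin T C"
  obtains n where "0 < n" "\<And>\<eta>. 0 < \<eta> \<Longrightarrow> \<exists>V V' e e'. minimal_invariant two_sided_ops V \<and>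
    minimal_invariant two_sided_ops V' \<and> V \<noteq> V' \<and> basis V e n \<and> basis V' e' n \<and>
    (\<forall>p<n. \<forall>q<n. \<forall>x\<in>C. cmod (coef e p q x - coef e' p q x) \<le> (\<eta>::real))"
proof -
  let ?MM = "{V. minimal_invariant two_sided_ops V}"
  have CG: "C \<subseteq> carrier G" using compactin_subset_topspace[OF C] topspace_eq by simp
  have cC: "countable C" by (rule countable_subset[OF CG countable_carrier])
  have "\<forall>V\<in>?MM. \<exists>p. basis V (fst p) (snd p)" by (auto simp: minimal_invariant_def)
  then obtain p where p: "\<forall>V\<in>?MM. basis V (fst (p V)) (snd (p V))" by (rule bchoice[THEN exE])
  define b where "b V = fst (p V)" for V
  define dm where "dm V = snd (p V)" for V
  have B: "basis V (b V) (dm V)" if "V \<in> ?MM" for V using p that by (simp add: b_def dm_def)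
  obtain n where n: "uncountable {V \<in> ?MM. dm V = n}"
    by (rule uncountable_fibre[OF uncountable_minimal[OF nm], of UNIV dm]) auto
  let ?I = "{V \<in> ?MM. dm V = n}"
  have Bn: "basis V (b V) n" if "V \<in> ?I" for V using B that by auto
  have "?I \<noteq> {}"
  proof
    assume e: "?I = {}"
    show False using n unfolding e by simp
  qed
  then obtain V0 where V0: "V0 \<in> ?I" by blast
  have "n \<noteq> 0"
  proof
    assume "n = 0"
    then have "V0 = {0}" using basis_zero Bn[OF V0] by blast
    then show False using V0 by (simp add: minimal_invariant_def)
  qed
  have "\<exists>V V' e e'. minimal_invariant two_sided_ops V \<and>
    minimal_invariant two_sided_ops V' \<and> V \<noteq> V' \<and> basis V e n \<and> basis V' e' n \<and>
    (\<forall>p<n. \<forall>q<n. \<forall>x\<in>C. cmod (coef e p q x - coef e' p q x) \<le> \<eta>)" if \<eta>: "0 < \<eta>" for \<eta> :: real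
  proof -
    have "\<exists>I'\<subseteq>?I. uncountable I' \<and> (\<forall>j\<in>{..<n} \<times> {..<n}. \<forall>V\<in>I'. \<forall>V'\<in>I'. \<forall>x\<in>C.
        cmod (coef (b V) (fst j) (snd j) x - coef (b V') (fst j) (snd j) x) < \<eta>)"
    proof (rule close_uncountable_subfamily_finite[OF C cC Hausdorff _ n _ \<eta>])
      fix V j assume j: "j \<in> {..<n} \<times> {..<n}" and V: "V \<in> ?I"
      show "continuous_map T euclidean (coef (b V) (fst j) (snd j))"
        by (intro unif_cont_continuous unif_cont_coef[OF basisD(2)[OF Bn[OF V]]]) (use j in auto)
    qed simp
    then obtain I' where I': "I' \<subseteq> ?I" "uncountable I'" "\<forall>j\<in>{..<n} \<times> {..<n}. \<forall>V\<in>I'. \<forall>V'\<in>I'. \<forall>x\<in>C.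
        cmod (coef (b V) (fst j) (snd j) x - coef (b V') (fst j) (snd j) x) < \<eta>"
      by (elim exE conjE) (rule that)
    have "I' \<noteq> {}" using I'(2) countable_empty by blast
    then obtain V where V: "V \<in> I'" by blast
    have "\<not> I' \<subseteq> {V}" using I'(2) countable_subset[of I' "{V}"] by auto
    then obtain V' where V': "V' \<in> I'" "V \<noteq> V'" by blast
    have "cmod (coef (b V) p q x - coef (b V') p q x) \<le> \<eta>" if "p < n" "q < n" "x \<in> C" for p q x
    proof -
      have pq: "(p, q) \<in> {..<n} \<times> {..<n}" using that by simp
      have "cmod (coef (b V) (fst (p, q)) (snd (p, q)) x - coef (b V') (fst (p, q)) (snd (p, q)) x) < \<eta>"
        by (rule bspec[OF bspec[OF bspec[OF bspec[OF I'(3) pq] V] V'(1)] that(3)])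
      then show ?thesis by simp
    qed
    moreover have "V \<in> ?I" "V' \<in> ?I" using I'(1) V V'(1) by blast+
    ultimately show ?thesis using V'(2) Bn
      by (intro exI[of _ V] exI[of _ V'] exI[of _ "b V"] exI[of _ "b V'"]) simp
  qed
  then show ?thesis using that \<open>n \<noteq> 0\<close> by blast
qed

text \<open>The value 1 at the identity and \<open>evaluation_bound\<close> give
  \<open>\<phi>\<close> norm at least 1/n. It has at most n^2 components, each displaced by at most
  n^3 \<eta>, and one of them has norm above 1/(2 n^3); normalizing that one costs a factor below 2
  n^3.\<close>

lemma almost_invariant_vector:
  assumes nm: "\<not> metrizable_space T" and C: "compactin T C" and \<epsilon>: "0 < \<epsilon>"
  obtains U v where "minimal_invariant left_ops U" "\<And>f. f \<in> U \<Longrightarrow> mean f = 0" "v \<in> U" "nrm v = 1"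
    "\<And>g. g \<in> C \<Longrightarrow> nrm (ltr g v - v) < \<epsilon>"
proof -
  obtain n where n: "0 < n" "\<And>\<eta>. 0 < \<eta> \<Longrightarrow> \<exists>V V' e e'. minimal_invariant two_sided_ops V \<and>
    minimal_invariant two_sided_ops V' \<and> V \<noteq> V' \<and> basis V e n \<and> basis V' e' n \<and>
    (\<forall>p<n. \<forall>q<n. \<forall>x\<in>C. cmod (coef e p q x - coef e' p q x) \<le> (\<eta>::real))"
    by (rule close_minimal_pair[OF nm C]) (rule that)
  have CG: "C \<subseteq> carrier G" using compactin_subset_topspace[OF C] topspace_eq by simp
  \<comment> \<open>The displacement after normalization is at most 2 n^6 \<eta>, which this choice
    makes equal to \<epsilon>/2.\<close>
  define \<eta> where "\<eta> = \<epsilon> / (4 * real n ^ 6)"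
  have \<eta>: "0 < \<eta>" using \<epsilon> n(1) by (simp add: \<eta>_def)
  obtain V V' e e' where V: "minimal_invariant two_sided_ops V" "minimal_invariant two_sided_ops V'" "V \<noteq> V'"
    "basis V e n" "basis V' e' n" "\<forall>p<n. \<forall>q<n. \<forall>x\<in>C. cmod (coef e p q x - coef e' p q x) \<le> \<eta>"
    using n(2)[OF \<eta>] by (elim exE conjE) (rule that)
  have "\<exists>W b k \<phi>. basis W b k \<and> k \<le> n * n \<and> invariant left_ops W \<and> (\<forall>f\<in>W. mean f = 0) \<and> \<phi> \<in> W \<and>
    \<phi> \<one> = 1 \<and> (\<forall>g\<in>C. nrm (ltr g \<phi> - \<phi>) \<le> real n ^ 3 * \<eta>)"
    by (rule pair_vector[OF V(1-5) CG]) (use \<eta> V(6) in auto)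
  then obtain W b k \<phi> where W: "basis W b k" "k \<le> n * n" "invariant left_ops W" "\<forall>f\<in>W. mean f = 0" "\<phi> \<in> W"
    "\<phi> \<one> = 1" "\<forall>g\<in>C. nrm (ltr g \<phi> - \<phi>) \<le> real n ^ 3 * \<eta>"
    by (elim exE conjE) (rule that)
  obtain ps where ps: "length ps \<le> k" "\<phi> = sum_list (map snd ps)" "\<forall>(U, v)\<in>set ps. minimal_invariant left_ops U \<and>
    U \<subseteq> W \<and> v \<in> U \<and> (\<forall>\<gamma>\<in>left_ops. nrm (\<gamma> v - v) \<le> nrm (\<gamma> \<phi> - \<phi>))"
    using decomposition[OF op_family_left W(1,3,5)] by (elim exE conjE) (rule that)
  note sW = basisD(1)[OF W(1)]
  have \<phi>U: "\<phi> \<in> UC" by (rule subspD(1)[OF sW W(5)])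
  have "1 \<le> sqrt k * nrm \<phi>" using evaluation_bound[OF W(1,3,5)] W(6) by simp
  also have "\<dots> \<le> n * nrm \<phi>"
  proof (rule mult_right_mono[OF _ nrm_nonneg[OF \<phi>U]])
    have "sqrt (real k) \<le> sqrt (real (n * n))" using W(2) by (intro real_sqrt_le_mono) (simp only: of_nat_le_iff)
    then show "sqrt (real k) \<le> real n" by (simp add: real_sqrt_mult)
  qed
  finally have \<phi>n: "1 / n \<le> nrm \<phi>" using n(1) by (simp add: field_simps)
  have psU: "set (map snd ps) \<subseteq> UC" using ps(3) subspD(1)[OF sW] by fastforce
  \<comment> \<open>Otherwise the norms of the at most n^2 components add up to at most 1/(2n), half
    of the lower bound for the norm of \<open>\<phi>\<close>.\<close>
  have "\<exists>p\<in>set ps. 1 / (2 * real n ^ 3) < nrm (snd p)"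
  proof (rule ccontr)
    assume "\<not> ?thesis"
    then have "(\<Sum>p\<leftarrow>ps. nrm (snd p)) \<le> (\<Sum>p\<leftarrow>ps. 1 / (2 * real n ^ 3))"
      by (intro sum_list_mono) (auto simp: not_less)
    also have "\<dots> = length ps * (1 / (2 * real n ^ 3))" by (simp add: sum_list_triv)
    also have "\<dots> \<le> (real n * real n) * (1 / (2 * real n ^ 3))"
      using ps(1) W(2) by (intro mult_right_mono) (auto simp flip: of_nat_mult)
    also have "\<dots> = 1 / (2 * n)" using n(1) by (simp add: power3_eq_cube)
    finally have "(\<Sum>f\<leftarrow>map snd ps. nrm f) \<le> 1 / (2 * n)" by (simp add: o_def)
    moreover have "nrm \<phi> \<le> (\<Sum>f\<leftarrow>map snd ps. nrm f)" using nrm_triangle_sum_list[OF psU] ps(2) by simp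
    ultimately have "1 / n \<le> 1 / (2 * real n)" using \<phi>n by linarith
    then show False using n(1) by (simp add: field_simps)
  qed
  then obtain U v where Uv: "(U, v) \<in> set ps" "1 / (2 * real n ^ 3) < nrm v" by auto
  have D: "minimal_invariant left_ops U" "U \<subseteq> W" "v \<in> U" "\<forall>\<gamma>\<in>left_ops. nrm (\<gamma> v - v) \<le> nrm (\<gamma> \<phi> - \<phi>)"
    using bspec[OF ps(3) Uv(1)] by auto
  have vU: "v \<in> UC" using subspD(1)[OF sW] D(2,3) by blast
  have vp: "0 < nrm v" by (rule le_less_trans[OF _ Uv(2)]) simp
  define w where "w = sc (1 / nrm v) v"
  have "subsp U" using D(1) basisD(1) by (auto simp: minimal_invariant_def)
  then have wU: "w \<in> U" unfolding w_def by (rule subspD(4)[OF _ D(3)])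
  have nw: "nrm w = 1" using nrm_sc[OF vU, of "1 / nrm v"] vp by (simp add: w_def norm_divide)
  have "nrm (ltr g w - w) < \<epsilon>" if g: "g \<in> C" for g
  proof -
    have gG: "g \<in> carrier G" using g CG by blast
    have dU: "ltr g v - v \<in> UC" by (intro X_diff ltr_UC vU gG)
    have "ltr g w - w = sc (1 / nrm v) (ltr g v - v)" unfolding w_def ltr_sc sc_diff ..
    then have "nrm (ltr g w - w) = nrm (ltr g v - v) / nrm v"
      using nrm_sc[OF dU, of "1 / nrm v"] vp by (simp add: norm_divide)
    also have "\<dots> \<le> (real n ^ 3 * \<eta>) / nrm v"
    proof (rule divide_right_mono)
      have "nrm (ltr g v - v) \<le> nrm (ltr g \<phi> - \<phi>)" by (rule bspec[OF D(4) imageI[OF gG]])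
      then show "nrm (ltr g v - v) \<le> real n ^ 3 * \<eta>" using bspec[OF W(7) g] by (rule order_trans)
      show "0 \<le> nrm v" using vp by simp
    qed
    also have "\<dots> \<le> (real n ^ 3 * \<eta>) / (1 / (2 * real n ^ 3))"
      using Uv(2) n(1) \<eta> vp by (intro divide_left_mono) auto
    also have "\<dots> = \<epsilon> / 2" using n(1) by (simp add: \<eta>_def field_simps power_add[symmetric])
    finally show ?thesis using \<epsilon> by linarith
  qed
  moreover have "mean f = 0" if "f \<in> U" for f using bspec[OF W(4)] D(2) that by blast
  ultimately show ?thesis using that[OF D(1) _ wU nw] by simp
qed

end

section \<open>Invariant spaces as unitary representations\<close>

context function_inner_space
begin

definition space :: "('a \<Rightarrow> complex) set \<Rightarrow> ('a \<Rightarrow> complex) inner_space"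
  where "space U = \<lparr>carrier = U, mult = (\<lambda>f h. f), one = 0, zero = 0, add = (+), smult = sc, cinner = ip\<rparr>"

lemma space_simps [simp]:
  "carrier (space U) = U" "zero (space U) = 0" "add (space U) = (+)" "smult (space U) = sc" "cinner (space U) = ip"
  by (simp_all add: space_def)

lemma module_space:
  assumes U: "subsp U"
  shows "Module.module complex_field (space U)"
proof (rule Module.moduleI[OF cring_complex_field])
  show "abelian_group (space U)"
  proof (rule abelian_groupI)
    fix x y z assume "x \<in> carrier (space U)" "y \<in> carrier (space U)"
    then show "x \<oplus>\<^bsub>space U\<^esub> y \<in> carrier (space U)" using subspD(3)[OF U] by (simp only: space_simps)
  next
    show "\<zero>\<^bsub>space U\<^esub> \<in> carrier (space U)" using subspD(2)[OF U] by (simp only: space_simps)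
  next
    fix x assume "x \<in> carrier (space U)"
    then have "sc (-1) x \<in> U" using subspD(4)[OF U] by (simp only: space_simps)
    moreover have "sc (-1) x + x = 0" by (simp add: fun_eq_iff)
    ultimately show "\<exists>y\<in>carrier (space U). y \<oplus>\<^bsub>space U\<^esub> x = \<zero>\<^bsub>space U\<^esub>"
      unfolding space_simps by blast
  qed (simp_all only: space_simps ac_simps add_0 add_0_right)
  fix a b x y
  show "a \<odot>\<^bsub>space U\<^esub> x \<in> carrier (space U)" if "x \<in> carrier (space U)"
    using that subspD(4)[OF U] by (simp only: space_simps)
  show "(a \<oplus>\<^bsub>complex_field\<^esub> b) \<odot>\<^bsub>space U\<^esub> x = a \<odot>\<^bsub>space U\<^esub> x \<oplus>\<^bsub>space U\<^esub> b \<odot>\<^bsub>space U\<^esub> x"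
    by (simp add: complex_field_def fun_eq_iff algebra_simps)
  show "a \<odot>\<^bsub>space U\<^esub> (x \<oplus>\<^bsub>space U\<^esub> y) = a \<odot>\<^bsub>space U\<^esub> x \<oplus>\<^bsub>space U\<^esub> a \<odot>\<^bsub>space U\<^esub> y"
    by (simp add: fun_eq_iff algebra_simps)
  show "(a \<otimes>\<^bsub>complex_field\<^esub> b) \<odot>\<^bsub>space U\<^esub> x = a \<odot>\<^bsub>space U\<^esub> (b \<odot>\<^bsub>space U\<^esub> x)"
    by (simp add: complex_field_def)
  show "\<one>\<^bsub>complex_field\<^esub> \<odot>\<^bsub>space U\<^esub> x = x" by (simp add: complex_field_def)
qed

lemma hdist_space:
  assumes U: "subsp U" and xy: "x \<in> U" "y \<in> U"
  shows "hdist (space U) x y = nrm (x - y)"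
proof -
  interpret M: Module.module complex_field "space U" by (rule module_space[OF U])
  have "\<ominus>\<^bsub>space U\<^esub> y = sc (-1) y"
  proof (rule M.minus_equality)
    show "sc (-1) y \<oplus>\<^bsub>space U\<^esub> y = \<zero>\<^bsub>space U\<^esub>" by (simp add: fun_eq_iff)
  qed (use xy subspD(4)[OF U] in \<open>simp_all only: space_simps\<close>)
  then have "x \<ominus>\<^bsub>space U\<^esub> y = x - y" by (simp add: a_minus_def)
  then show ?thesis using xy by (simp add: hdist_def hnorm_def nrm_def)
qed

lemma Metric_space_space:
  assumes U: "subsp U"
  shows "Metric_space U (hdist (space U))"
proof
  note UX = subspD(1)[OF U]
  fix x y
  have "0 \<le> hdist (space U) x y \<and> hdist (space U) x y = hdist (space U) y x"
  proof (cases "x \<in> U \<and> y \<in> U")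
    case True
    then show ?thesis using UX nrm_diff_commute[of x y] nrm_nonneg[OF X_diff, of x y] by (simp add: hdist_space[OF U])
  next
    case False
    then show ?thesis unfolding hdist_def by auto
  qed
  then show "0 \<le> hdist (space U) x y" "hdist (space U) x y = hdist (space U) y x" by auto
  show "hdist (space U) x y = 0 \<longleftrightarrow> x = y" if xy: "x \<in> U" "y \<in> U"
    using nrm_eq_zero[OF X_diff[OF UX[OF xy(1)] UX[OF xy(2)]]] by (simp add: hdist_space[OF U xy])
  fix z assume z: "x \<in> U" "y \<in> U" "z \<in> U"
  have "nrm ((x - y) + (y - z)) \<le> nrm (x - y) + nrm (y - z)" by (intro nrm_triangle X_diff UX z)
  moreover have "(x - y) + (y - z) = x - z" by simp
  ultimately show "hdist (space U) x z \<le> hdist (space U) x y + hdist (space U) y z"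
    using z by (simp only: hdist_space[OF U])
qed

text \<open>A Cauchy sequence is followed coordinate by coordinate; the limits of the finitely many
  coordinates give the limit vector.\<close>

lemma hilbert_space_space:
  assumes B: "basis U e n"
  shows "hilbert_space (space U)"
proof -
  note U = basisD(1)[OF B] and on = basisD(2)[OF B]
  note UX = subspD(1)[OF U]
  interpret D: Metric_space U "hdist (space U)" by (rule Metric_space_space[OF U])
  have "D.mcomplete"
    unfolding D.mcomplete_def
  proof (intro allI impI)
    fix \<sigma> :: "nat \<Rightarrow> 'a \<Rightarrow> complex" assume M: "D.MCauchy \<sigma>"
    have \<sigma>U: "\<sigma> k \<in> U" for k using M unfolding D.MCauchy_def by blast
    have "Cauchy (\<lambda>k. ip (\<sigma> k) (e i))" if i: "i < n" for i
    proof (rule CauchyI)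
      fix \<epsilon> :: real assume "0 < \<epsilon>"
      then obtain N where N: "\<forall>k l. N \<le> k \<longrightarrow> N \<le> l \<longrightarrow> hdist (space U) (\<sigma> k) (\<sigma> l) < \<epsilon>"
        using M unfolding D.MCauchy_def by blast
      have "norm (ip (\<sigma> k) (e i) - ip (\<sigma> l) (e i)) < \<epsilon>" if kl: "N \<le> k" "N \<le> l" for k l
      proof -
        have eX: "e i \<in> X" by (rule orthonormalD(1)[OF on i])
        have "cmod (ip (\<sigma> k - \<sigma> l) (e i)) \<le> nrm (\<sigma> k - \<sigma> l) * nrm (e i)"
          by (rule cauchy_schwarz[OF X_diff[OF UX[OF \<sigma>U] UX[OF \<sigma>U]] eX])
        moreover have "nrm (\<sigma> k - \<sigma> l) < \<epsilon>" using N kl hdist_space[OF U \<sigma>U \<sigma>U] by metis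
        ultimately show ?thesis
          using orthonormal_nrm[OF on i] ip_diff[OF UX[OF \<sigma>U] UX[OF \<sigma>U] eX] by simp
      qed
      then show "\<exists>N. \<forall>k\<ge>N. \<forall>l\<ge>N. norm (ip (\<sigma> k) (e i) - ip (\<sigma> l) (e i)) < \<epsilon>" by blast
    qed
    then have "\<forall>i. \<exists>c. i < n \<longrightarrow> (\<lambda>k. ip (\<sigma> k) (e i)) \<longlonglongrightarrow> c"
      using Cauchy_convergent convergent_def by blast
    then obtain c where c: "\<forall>i. i < n \<longrightarrow> (\<lambda>k. ip (\<sigma> k) (e i)) \<longlonglongrightarrow> c i" by (rule choice[THEN exE])
    define f where "f = (\<Sum>i<n. sc (c i) (e i))"
    have fU: "f \<in> U" unfolding f_def by (intro subsp_sum[OF U] subspD(4)[OF U] basisD(3)[OF B]) simp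
    have dist: "(nrm (\<sigma> k - f))\<^sup>2 = (\<Sum>i<n. (cmod (ip (\<sigma> k) (e i) - c i))\<^sup>2)" for k
    proof -
      have "\<sigma> k - f = proj e n (\<sigma> k) - f" using basisD(4)[OF B \<sigma>U] by simp
      also have "\<dots> = (\<Sum>i<n. sc (ip (\<sigma> k) (e i) - c i) (e i))"
        by (rule ext) (simp add: proj_def f_def left_diff_distrib sum_subtractf)
      finally show ?thesis using nrm_comb[OF on, of "\<lambda>i. ip (\<sigma> k) (e i) - c i"] by simp
    qed
    have "(\<lambda>k. \<Sum>i<n. (cmod (ip (\<sigma> k) (e i) - c i))\<^sup>2) \<longlonglongrightarrow> (\<Sum>i<n. (cmod (c i - c i))\<^sup>2)"
      by (intro tendsto_intros) (use c in auto)
    then have "(\<lambda>k. (nrm (\<sigma> k - f))\<^sup>2) \<longlonglongrightarrow> 0" unfolding dist by simp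
    then have "(\<lambda>k. sqrt ((nrm (\<sigma> k - f))\<^sup>2)) \<longlonglongrightarrow> sqrt 0" by (rule tendsto_real_sqrt)
    then have lim: "(\<lambda>k. nrm (\<sigma> k - f)) \<longlonglongrightarrow> 0" using nrm_nonneg[OF X_diff[OF UX[OF \<sigma>U] UX[OF fU]]] by simp
    have "limitin D.mtopology \<sigma> f sequentially"
      unfolding D.limit_metric_sequentially
    proof (intro conjI allI impI)
      show "f \<in> U" by (rule fU)
      fix \<epsilon> :: real assume "0 < \<epsilon>"
      then obtain N where "\<forall>k\<ge>N. nrm (\<sigma> k - f) < \<epsilon>"
        using order_tendstoD(2)[OF lim] unfolding eventually_sequentially by blast
      then show "\<exists>N. \<forall>k\<ge>N. \<sigma> k \<in> U \<and> hdist (space U) (\<sigma> k) f < \<epsilon>"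
        using \<sigma>U hdist_space[OF U \<sigma>U fU] by auto
    qed
    then show "\<exists>x. limitin D.mtopology \<sigma> x sequentially" by blast
  qed
  then show ?thesis
  proof (intro hilbert_space.intro module_space[OF U] hilbert_space_axioms.intro, goal_cases)
    case (1 x y z)
    then show ?case using ip_add UX by (simp only: space_simps)
  next
    case (2 x y c)
    then show ?case using ip_sc UX by (simp only: space_simps)
  next
    case (3 x y)
    then show ?case using ip_commute UX unfolding space_simps by blast
  next
    case (4 x)
    show ?case unfolding space_simps by (rule ip_pos) (use UX 4 in \<open>simp_all only: space_simps not_False_eq_True\<close>)
  next
    case 5
    then show ?case by (simp only: space_simps)
  qed
qed

end

context countable_precompact_group
begin

text \<open>Restricted to \<open>U\<close> because unitary operators are extensional on the
  carrier.\<close>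

definition trans_rep :: "('a \<Rightarrow> complex) set \<Rightarrow> 'a \<Rightarrow> ('a \<Rightarrow> complex) \<Rightarrow> 'a \<Rightarrow> complex"
  where "trans_rep U g = (\<lambda>f\<in>U. ltr g f)"

lemma trans_rep_unitary:
  assumes U: "subsp U" "invariant left_ops U" and g: "g \<in> carrier G"
  shows "trans_rep U g \<in> unitary_ops (space U) (space U)"
proof -
  note UX = subspD(1)[OF U(1)]
  have inv: "ltr x f \<in> U" if "x \<in> carrier G" "f \<in> U" for x f using invariantD[OF U(2)] that by blast
  have cancel: "ltr (inv g) (ltr g f) = f" "ltr g (ltr (inv g) f) = f" if "f \<in> U" for f
    using that g UX by (simp_all add: ltr_ltr ltr_one)
  have "bij_betw (trans_rep U g) U U"
  proof (rule bij_betwI[where g = "ltr (inv g)"])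
    show "trans_rep U g \<in> U \<rightarrow> U" using inv g by (auto simp: trans_rep_def)
    show "ltr (inv g) \<in> U \<rightarrow> U" using inv g by auto
    show "ltr (inv g) (trans_rep U g x) = x" if "x \<in> U" for x using cancel that by (simp add: trans_rep_def)
    show "trans_rep U g (ltr (inv g) y) = y" if "y \<in> U" for y using cancel inv g that by (simp add: trans_rep_def)
  qed
  moreover have "trans_rep U g (x + y) = trans_rep U g x + trans_rep U g y" if "x \<in> U" "y \<in> U" for x y
    unfolding trans_rep_def restrict_apply' [OF subspD(3)[OF U(1) that]] restrict_apply'[OF that(1)] restrict_apply'[OF that(2)]
    by (rule ltr_add)
  moreover have "trans_rep U g (sc c x) = sc c (trans_rep U g x)" if "x \<in> U" for c x
    unfolding trans_rep_def restrict_apply'[OF subspD(4)[OF U(1) that]] restrict_apply'[OF that] by (rule ltr_sc)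
  moreover have "ip (trans_rep U g x) (trans_rep U g y) = ip x y" if "x \<in> U" "y \<in> U" for x y
    using ip_ltr_ltr[OF UX[OF that(1)] UX[OF that(2)] g] that by (simp add: trans_rep_def)
  moreover have "trans_rep U g \<in> extensional U" by (simp add: trans_rep_def)
  ultimately show ?thesis unfolding unitary_ops_def space_simps by blast
qed

text \<open>Strong continuity is the uniform continuity of the individual functions of
  \<open>U\<close>: a small change of the group element moves a function little uniformly, hence in
  norm.\<close>

lemma unitary_rep_trans_rep:
  assumes B: "basis U e n" and I: "invariant left_ops U"
  shows "unitary_rep G T (space U, trans_rep U)"
proof -
  note U = basisD(1)[OF B]
  note UX = subspD(1)[OF U]
  note un = trans_rep_unitary[OF U I]
  have inv: "ltr x f \<in> U" if "x \<in> carrier G" "f \<in> U" for x f using invariantD[OF I] that by blast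
  have bij: "trans_rep U g \<in> Bij U" if "g \<in> carrier G" for g
    using un[OF that] unfolding unitary_ops_def Bij_def space_simps by blast
  have "trans_rep U \<in> hom G (unitary_group (space U))"
  proof (rule homI)
    fix x assume "x \<in> carrier G"
    then show "trans_rep U x \<in> carrier (unitary_group (space U))" using un by (simp add: unitary_group_def)
    fix y assume y: "y \<in> carrier G"
    have "compose U (trans_rep U x) (trans_rep U y) = trans_rep U (x \<otimes> y)"
      using \<open>x \<in> carrier G\<close> y inv by (auto simp: compose_def trans_rep_def ltr_ltr fun_eq_iff restrict_def)
    then show "trans_rep U (x \<otimes> y) = trans_rep U x \<otimes>\<^bsub>unitary_group (space U)\<^esub> trans_rep U y"
      using bij \<open>x \<in> carrier G\<close> y by (simp add: unitary_group_def BijGroup_def)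
  qed
  moreover have "continuous_map T (unitary_topology (space U)) (trans_rep U)"
    unfolding unitary_topology_def continuous_map_in_subtopology continuous_map_componentwise space_simps
  proof (intro conjI ballI)
    show "trans_rep U ` topspace T \<subseteq> extensional U" by (auto simp: trans_rep_def)
    show "trans_rep U \<in> topspace T \<rightarrow> unitary_ops (space U) (space U)" using un topspace_eq by blast
    fix f assume f: "f \<in> U"
    interpret D: Metric_space U "hdist (space U)" by (rule Metric_space_space[OF U])
    show "continuous_map T (hilbert_topology (space U)) (\<lambda>x. trans_rep U x f)"
      unfolding hilbert_topology_def space_simps D.continuous_map_to_metric
    proof (intro ballI allI impI)
      fix g and \<epsilon> :: real assume "g \<in> topspace T" and \<epsilon>: "0 < \<epsilon>"
      then have g: "g \<in> carrier G" using topspace_eq by simp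
      have "0 < \<epsilon> / 2" using \<epsilon> by simp
      then obtain N where N: "openin T N" "\<one> \<in> N" "\<forall>x\<in>N. near f (\<epsilon> / 2) x \<one>"
        using UC_unif_cont[OF UX[OF f]] unfolding unif_cont_def by blast
      let ?V = "{x \<in> carrier G. inv g \<otimes> x \<in> N}"
      have "trans_rep U y f \<in> D.mball (trans_rep U g f) \<epsilon>" if y: "y \<in> ?V" for y
      proof -
        have yG: "y \<in> carrier G" and yN: "inv g \<otimes> y \<in> N" using y by auto
        have "nrm (ltr (g \<otimes> (inv g \<otimes> y) \<otimes> \<one>) f - ltr (g \<otimes> \<one> \<otimes> \<one>) f) \<le> \<epsilon> / 2"
          by (rule nrm_ltr_diff[OF UX[OF f]]) (use N(3) yN yG g in auto)
        then have "nrm (ltr y f - ltr g f) \<le> \<epsilon> / 2" using yG g by (simp add: m_assoc[symmetric])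
        then have "hdist (space U) (ltr g f) (ltr y f) < \<epsilon>"
          using \<epsilon> hdist_space[OF U inv[OF g f] inv[OF yG f]] nrm_diff_commute[OF UX[OF inv[OF g f]] UX[OF inv[OF yG f]]]
          by linarith
        then show ?thesis using f inv[OF g f] inv[OF yG f] by (simp add: trans_rep_def)
      qed
      moreover have "openin T ?V" by (rule translate_open[OF N(1) inv_closed[OF g]])
      moreover have "g \<in> ?V" using g N(2) by simp
      ultimately show "\<exists>V. openin T V \<and> g \<in> V \<and> (\<forall>y\<in>V. trans_rep U y f \<in> D.mball (trans_rep U g f) \<epsilon>)" by blast
    qed
  qed
  ultimately show ?thesis unfolding unitary_rep_def using hilbert_space_space[OF B] by simp
qed

lemma irreducible_rep_trans_rep:
  assumes M: "minimal_invariant left_ops U"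
  shows "irreducible_rep G T (space U, trans_rep U)"
proof -
  obtain e n where B: "basis U e n" using M by (auto simp: minimal_invariant_def)
  note U = basisD(1)[OF B]
  have I: "invariant left_ops U" and U0: "U \<noteq> {0}" using M by (auto simp: minimal_invariant_def)
  have "E = {0} \<or> E = U" if E: "submodule E complex_field (space U)" "\<forall>g\<in>carrier G. trans_rep U g ` E \<subseteq> E" "E \<subseteq> U" for E
  proof -
    interpret E: submodule E complex_field "space U" by (rule E(1))
    have "subsp E"
      unfolding subsp_def
    proof (intro conjI ballI allI)
      show "E \<subseteq> UC" using E(3) subspD(1)[OF U] by blast
      show "0 \<in> E" using E.one_closed by simp
      show "f + h \<in> E" if "f \<in> E" "h \<in> E" for f h using E.m_closed[OF that] by (simp only: monoid.simps space_simps)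
      show "sc c f \<in> E" if "f \<in> E" for c f using E.smult_closed[of c f] that by (simp add: complex_field_def)
    qed
    moreover have "invariant left_ops E"
      unfolding invariant_def
    proof (intro ballI)
      fix \<gamma> f assume "\<gamma> \<in> left_ops" and f: "f \<in> E"
      then obtain g where g: "g \<in> carrier G" "\<gamma> = ltr g" by blast
      have fU: "f \<in> U" by (rule subsetD[OF E(3) f])
      have "trans_rep U g f \<in> E" by (rule subsetD[OF bspec[OF E(2) g(1)] imageI[OF f]])
      then show "\<gamma> f \<in> E" unfolding g(2) trans_rep_def restrict_apply'[OF fU] .
    qed
    ultimately show ?thesis using M E(3) unfolding minimal_invariant_def by blast
  qed
  then have "\<not> (\<exists>E. submodule E complex_field (space U) \<and> closedin (hilbert_topology (space U)) E \<and>
      (\<forall>g\<in>carrier G. trans_rep U g ` E \<subseteq> E) \<and> {0} \<subset> E \<and> E \<subset> U)" by blast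
  then show ?thesis
    unfolding irreducible_rep_def prod.case space_simps using unitary_rep_trans_rep[OF B I] U0 by blast
qed

text \<open>Equivalence transports the trivial action, so the coefficient of a vector is its squared
  norm at every point of the group.\<close>

lemma trivial_class_coeff:
  assumes "f \<in> class_coeff_sums G (trivial_class G T)"
  shows "\<exists>r\<ge>0. \<forall>x\<in>carrier G. f x = complex_of_real r"
proof -
  obtain H \<sigma> where H: "(H, \<sigma>) \<in> trivial_class G T" "f \<in> coeff_sums G (H, \<sigma>)"
    using assms unfolding class_coeff_sums_def by auto
  have "rep_equiv G trivial_rep (H, \<sigma>)" using H(1) by (simp add: trivial_class_def rep_class_def)
  then obtain W where W: "W \<in> unitary_ops (const_line :: ('a \<Rightarrow> complex) inner_space) H"
    "\<forall>g\<in>carrier G. \<forall>v\<in>carrier const_line. W ((\<lambda>x\<in>carrier const_line. x) v) = \<sigma> g (W v)"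
    unfolding rep_equiv_def trivial_rep_def prod.case by blast
  have coeff: "\<exists>r\<ge>0. \<forall>x\<in>carrier G. p x = complex_of_real r" if p: "p \<in> coeffs G (H, \<sigma>)" for p
  proof -
    obtain v where v: "v \<in> carrier H" "p = (\<lambda>g\<in>carrier G. cinner H (\<sigma> g v) v)" using p unfolding coeffs_def by auto
    have "W ` carrier (const_line :: ('a \<Rightarrow> complex) inner_space) = carrier H" using W(1) unfolding unitary_ops_def bij_betw_def by blast
    then obtain z where z: "z \<in> carrier const_line" "v = W z" using v(1) by blast
    have "cinner H v v = cinner const_line z z" using W(1) z unfolding unitary_ops_def by blast
    then have "cinner H v v = complex_of_real ((cmod (z undefined))\<^sup>2)"
      by (simp only: const_line_simps complex_norm_square)
    moreover have "\<sigma> g v = v" if "g \<in> carrier G" for g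
      using W(2) that z by (metis restrict_apply')
    ultimately have "\<forall>x\<in>carrier G. p x = complex_of_real ((cmod (z undefined))\<^sup>2)" using v(2) by simp
    then show ?thesis using zero_le_power2 by blast
  qed
  obtain n :: nat and p where f: "f = (\<lambda>g\<in>carrier G. \<Sum>i<n. p i g)" "\<forall>i<n. p i \<in> coeffs G (H, \<sigma>)"
    using H(2) unfolding coeff_sums_def by auto
  have "\<forall>i. \<exists>r. i < n \<longrightarrow> 0 \<le> r \<and> (\<forall>x\<in>carrier G. p i x = complex_of_real r)" using coeff f(2) by blast
  then obtain r where r: "\<forall>i. i < n \<longrightarrow> 0 \<le> r i \<and> (\<forall>x\<in>carrier G. p i x = complex_of_real (r i))"
    by (rule choice[THEN exE])
  have "f x = complex_of_real (\<Sum>i<n. r i)" if "x \<in> carrier G" for x using f(1) r that by simp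
  moreover have "0 \<le> (\<Sum>i<n. r i)" using r by (intro sum_nonneg) auto
  ultimately show ?thesis by blast
qed

text \<open>A basic neighbourhood of the trivial class prescribes finitely many nonnegative
  constants. The vector \<open>v\<close>, scaled by the square root of such a constant, has a
  coefficient that differs from it on \<open>C\<close> by at most the constant times the
  displacement of \<open>v\<close>.\<close>

lemma not_isolated_if_almost_invariant:
  assumes av: "\<And>C \<epsilon>. compactin T C \<Longrightarrow> 0 < \<epsilon> \<Longrightarrow> \<exists>U v. minimal_invariant left_ops U \<and> (\<forall>f\<in>U. mean f = 0) \<and>
    v \<in> U \<and> nrm v = 1 \<and> (\<forall>g\<in>C. nrm (ltr g v - v) < \<epsilon>)"
  shows "\<not> openin (fell_topology G T (dual_object G T)) {trivial_class G T}"
proof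
  assume "openin (fell_topology G T (dual_object G T)) {trivial_class G T}"
  then have "fell_open G T (dual_object G T) {trivial_class G T}" by (simp only: openin_fell_topology)
  then have "\<exists>fs C \<epsilon>. set fs \<subseteq> class_coeff_sums G (trivial_class G T) \<and>
      compactin T C \<and> 0 < \<epsilon> \<and> fell_nbhd G (dual_object G T) fs C \<epsilon> \<subseteq> {trivial_class G T}"
    unfolding fell_open_def by blast
  then obtain fs C \<epsilon> where fs: "set fs \<subseteq> class_coeff_sums G (trivial_class G T)" and C: "compactin T C"
    and \<epsilon>: "0 < \<epsilon>" and nbhd: "fell_nbhd G (dual_object G T) fs C \<epsilon> \<subseteq> {trivial_class G T}"
    by (elim exE conjE) (rule that)
  have CG: "C \<subseteq> carrier G" using compactin_subset_topspace[OF C] topspace_eq by simp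
  have "\<forall>i. \<exists>r. i < length fs \<longrightarrow> 0 \<le> r \<and> (\<forall>x\<in>carrier G. (fs ! i) x = complex_of_real r)"
    using trivial_class_coeff fs by (meson nth_mem subsetD)
  then obtain r where r: "\<forall>i. i < length fs \<longrightarrow> 0 \<le> r i \<and> (\<forall>x\<in>carrier G. (fs ! i) x = complex_of_real (r i))"
    by (rule choice[THEN exE])
  define R where "R = (\<Sum>i<length fs. r i)"
  have R: "0 \<le> R" unfolding R_def using r by (intro sum_nonneg) auto
  have rR: "r i \<le> R" if "i < length fs" for i
    unfolding R_def by (rule member_le_sum) (use r that in auto)
  \<comment> \<open>\<open>R\<close> bounds all the constants at once; adding 1 keeps the
    denominator positive when all of them vanish or the list is empty.\<close>
  define \<delta> where "\<delta> = \<epsilon> / (R + 1)"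
  have \<delta>: "0 < \<delta>" "R * \<delta> < \<epsilon>" using \<epsilon> R by (simp_all add: \<delta>_def field_simps)
  obtain U v where Uv: "minimal_invariant left_ops U" "\<forall>f\<in>U. mean f = 0" "v \<in> U" "nrm v = 1"
    "\<forall>g\<in>C. nrm (ltr g v - v) < \<delta>"
    using av[OF C \<delta>(1)] by (elim exE conjE) (rule that)
  obtain e n where B: "basis U e n" using Uv(1) by (auto simp: minimal_invariant_def)
  note U = basisD(1)[OF B]
  have I: "invariant left_ops U" using Uv(1) by (simp add: minimal_invariant_def)
  have vU: "v \<in> UC" by (rule subspD(1)[OF U Uv(3)])
  let ?\<rho> = "(space U, trans_rep U)"
  let ?c = "rep_class G T ?\<rho>"
  have irr: "irreducible_rep G T ?\<rho>" by (rule irreducible_rep_trans_rep[OF Uv(1)])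
  have un: "unitary_rep G T ?\<rho>" by (rule unitary_rep_trans_rep[OF B I])
  have "(\<lambda>x\<in>U. x) \<in> unitary_ops (space U) (space U)"
    unfolding unitary_ops_def space_simps
    using subspD(3,4)[OF U] by (auto simp: bij_betw_def inj_on_def simp del: plus_fun_apply)
  moreover have "\<forall>g\<in>carrier G. \<forall>f\<in>U. (\<lambda>x\<in>U. x) (trans_rep U g f) = trans_rep U g ((\<lambda>x\<in>U. x) f)"
    using invariantD[OF I] by (auto simp: trans_rep_def)
  ultimately have "rep_equiv G ?\<rho> ?\<rho>" unfolding rep_equiv_def prod.case space_simps by blast
  then have self: "?\<rho> \<in> ?c" using un by (simp add: rep_class_def)
  \<comment> \<open>An equivalence with the trivial representation would make all translations fix
    \<open>v\<close>, hence make \<open>v\<close> constant on the group; mean zero then leaves only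
    0, which is not a unit vector.\<close>
  have nontriv: "?c \<noteq> trivial_class G T"
  proof
    assume "?c = trivial_class G T"
    then have "rep_equiv G trivial_rep ?\<rho>" using self by (simp add: trivial_class_def rep_class_def)
    then obtain W where W: "W \<in> unitary_ops (const_line :: ('a \<Rightarrow> complex) inner_space) (space U)"
      "\<forall>g\<in>carrier G. \<forall>z\<in>carrier const_line. W ((\<lambda>x\<in>carrier const_line. x) z) = trans_rep U g (W z)"
      unfolding rep_equiv_def trivial_rep_def prod.case by blast
    have "W ` carrier (const_line :: ('a \<Rightarrow> complex) inner_space) = U" using W(1) unfolding unitary_ops_def bij_betw_def space_simps by blast
    then obtain z where z: "z \<in> carrier const_line" "v = W z" using Uv(3) by blast
    have "trans_rep U g v = v" if "g \<in> carrier G" for g using W(2) that z by (metis restrict_apply')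
    then have fix_v: "ltr g v = v" if "g \<in> carrier G" for g using that Uv(3) by (simp add: trans_rep_def)
    have const: "v g = v \<one>" if g: "g \<in> carrier G" for g
      using fun_cong[OF fix_v[OF g], of g] g by simp
    then have "mean v = v \<one>" by (rule mean_eq_const)
    then have "v \<one> = 0" using Uv(2,3) by simp
    then have "v x = 0 x" if "x \<in> carrier G" for x using const[OF that] by simp
    then have "v = 0" by (rule UC_eqI[OF vU X_zero])
    then show False using Uv(4) by simp
  qed
  have "?c \<in> fell_nbhd G (dual_object G T) fs C \<epsilon>"
  proof -
    define g where "g i = (\<lambda>x\<in>carrier G. cinner (space U) (trans_rep U x (sc (sqrt (r i)) v)) (sc (sqrt (r i)) v))" for i
    have gx: "g i x = complex_of_real (r i) * ip (ltr x v) v" if "x \<in> carrier G" "i < length fs" for i x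
    proof -
      have sU: "sc (complex_of_real (sqrt (r i))) v \<in> U" by (rule subspD(4)[OF U Uv(3)])
      have "g i x = ip (ltr x (sc (complex_of_real (sqrt (r i))) v)) (sc (complex_of_real (sqrt (r i))) v)"
        unfolding g_def trans_rep_def space_simps restrict_apply'[OF that(1)] restrict_apply'[OF sU] ..
      also have "\<dots> = complex_of_real (sqrt (r i)) * complex_of_real (sqrt (r i)) * ip (ltr x v) v"
        unfolding ltr_sc ip_sc[OF ltr_UC[OF vU that(1)] X_sc[OF vU]] ip_sc_right[OF vU ltr_UC[OF vU that(1)]] by simp
      also have "complex_of_real (sqrt (r i)) * complex_of_real (sqrt (r i)) = complex_of_real (r i)"
        using r that(2) by (simp flip: of_real_mult)
      finally show ?thesis .
    qed
    have "g i \<in> class_coeff_sums G ?c" for i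
    proof -
      have "sc (complex_of_real (sqrt (r i))) v \<in> U" by (rule subspD(4)[OF U Uv(3)])
      then have "g i \<in> coeffs G ?\<rho>" unfolding coeffs_def g_def prod.case space_simps by blast
      moreover have "(\<lambda>x\<in>carrier G. \<Sum>j<(1::nat). g i x) = g i" by (auto simp: g_def)
      ultimately have "g i \<in> coeff_sums G ?\<rho>"
        unfolding coeff_sums_def by (intro CollectI exI[of _ "1::nat"] exI[of _ "\<lambda>_. g i"] conjI) simp_all
      then show ?thesis unfolding class_coeff_sums_def using self by blast
    qed
    then have "set (map g [0..<length fs]) \<subseteq> class_coeff_sums G ?c" by auto
    moreover have "cmod ((fs ! i) x - (map g [0..<length fs] ! i) x) < \<epsilon>" if x: "x \<in> C" and i: "i < length fs" for x i
    proof -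
      have xG: "x \<in> carrier G" using x CG by blast
      have xU: "ltr x v \<in> UC" by (rule ltr_UC[OF vU xG])
      have "ip v v = 1" using ip_self[OF vU] Uv(4) by simp
      then have "1 - ip (ltr x v) v = - ip (ltr x v - v) v" using ip_diff[OF xU vU vU] by simp
      then have "cmod (1 - ip (ltr x v) v) \<le> \<delta>"
        using cauchy_schwarz[OF X_diff[OF xU vU] vU] bspec[OF Uv(5) x] Uv(4)
        by simp
      then have "r i * cmod (1 - ip (ltr x v) v) \<le> R * \<delta>"
        using rR[OF i] r i R by (intro mult_mono) auto
      moreover have "(fs ! i) x - (map g [0..<length fs] ! i) x = complex_of_real (r i) * (1 - ip (ltr x v) v)"
        using r i xG gx[OF xG i] by (simp add: algebra_simps)
      ultimately show ?thesis using \<delta>(2) r i by (simp add: norm_mult)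
    qed
    moreover have "?c \<in> dual_object G T" unfolding dual_object_def using irr by blast
    moreover have "length (map g [0..<length fs]) = length fs" by simp
    ultimately show ?thesis unfolding fell_nbhd_def by blast
  qed
  then show False using nbhd nontriv by blast
qed

end

section \<open>Compact groups and their subgroups\<close>

context topological_group
begin

lemma one_in_topspace: "\<one> \<in> topspace T"
  using topspace_eq by simp

text \<open>The pieces are small sets instead of translates of \<open>M\<close>, because a subgroup
  needs centres of its own: any of its points in a piece can serve as the centre of that
  piece.\<close>

lemma finite_cover_if_compact:
  assumes "compact_space T" and O: "openin T M" "\<one> \<in> M"
  shows "\<exists>\<O>. finite \<O> \<and> carrier G = \<Union>\<O> \<and> (\<forall>W\<in>\<O>. \<forall>x\<in>W. \<forall>y\<in>W. inv x \<otimes> y \<in> M)"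
proof -
  define F where "F = {W. openin T W \<and> (\<forall>x\<in>W. \<forall>y\<in>W. inv x \<otimes> y \<in> M)}"
  have cover: "\<exists>W\<in>F. k \<in> W" if k: "k \<in> carrier G" for k
  proof -
    have "continuous_map (prod_topology T T) T ((\<lambda>(x, y). x \<otimes> y) \<circ> (\<lambda>(x, y). (inv x, y)))"
      by (rule continuous_map_compose[OF _ continuous_mult])
        (simp add: case_prod_unfold continuous_map_pairwise o_def continuous_map_fst_of
          continuous_map_compose[OF continuous_map_fst continuous_inv, unfolded o_def] continuous_map_snd)
    then have "continuous_map (prod_topology T T) T (\<lambda>(x, y). inv x \<otimes> y)"
      by (simp add: o_def case_prod_unfold)
    then have "openin (prod_topology T T) {p \<in> topspace (prod_topology T T). (\<lambda>(x, y). inv x \<otimes> y) p \<in> M}"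
      by (rule openin_continuous_map_preimage[OF _ O(1)])
    moreover have "(k, k) \<in> {p \<in> topspace (prod_topology T T). (\<lambda>(x, y). inv x \<otimes> y) p \<in> M}"
      using k O(2) by (simp add: topspace_eq)
    ultimately have "\<exists>U V. openin T U \<and> openin T V \<and> k \<in> U \<and> k \<in> V \<and>
      U \<times> V \<subseteq> {p \<in> topspace (prod_topology T T). (\<lambda>(x, y). inv x \<otimes> y) p \<in> M}"
      unfolding openin_prod_topology_alt by blast
    then obtain U V where UV: "openin T U" "openin T V" "k \<in> U" "k \<in> V"
      "U \<times> V \<subseteq> {p \<in> topspace (prod_topology T T). (\<lambda>(x, y). inv x \<otimes> y) p \<in> M}"
      by (elim exE conjE) (rule that)
    have "U \<inter> V \<in> F" unfolding F_def using UV(1,2,5) by (auto intro: openin_Int)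
    then show ?thesis using UV(3,4) by blast
  qed
  have comp: "compactin T (topspace T)" using assms(1) by (simp add: compact_space_def)
  have sub: "topspace T \<subseteq> \<Union>F" using cover topspace_eq by blast
  have "\<exists>\<O>. finite \<O> \<and> \<O> \<subseteq> F \<and> topspace T \<subseteq> \<Union>\<O>"
    by (rule compactinD[OF comp _ sub]) (simp add: F_def)
  then obtain \<O> where \<O>: "finite \<O>" "\<O> \<subseteq> F" "topspace T \<subseteq> \<Union>\<O>" by (elim exE conjE) (rule that)
  have "\<Union>\<O> \<subseteq> topspace T" using \<O>(2) openin_subset unfolding F_def by blast
  then have "carrier G = \<Union>\<O>" using \<O>(3) topspace_eq by blast
  moreover have "\<forall>W\<in>\<O>. \<forall>x\<in>W. \<forall>y\<in>W. inv x \<otimes> y \<in> M" using \<O>(2) unfolding F_def by blast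
  ultimately show ?thesis using \<O>(1) by blast
qed

lemma Urysohn_bump:
  assumes "compact_space T" and M: "openin T M" "\<one> \<in> M"
  shows "\<exists>F :: 'a \<Rightarrow> real. continuous_map T euclideanreal F \<and> F \<one> = 1 \<and> (\<forall>x\<in>carrier G - M. F x = 0)"
proof -
  have N: "normal_space T" using compact_Hausdorff_or_regular_imp_normal_space assms(1) Hausdorff by blast
  have c1: "closedin T (topspace T - M)" using M(1) by blast
  have c2: "closedin T {\<one>}" by (rule closedin_Hausdorff_singleton[OF Hausdorff one_in_topspace])
  have "disjnt (topspace T - M) {\<one>}" using M(2) by simp
  then obtain F where F: "continuous_map T (top_of_set {0..1::real}) F" "F ` (topspace T - M) \<subseteq> {0}" "F ` {\<one>} \<subseteq> {1}"
    by (rule Urysohn_lemma[OF N c1 c2 _ zero_le_one])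
  have "continuous_map T euclideanreal F" using F(1) by (simp add: continuous_map_in_subtopology)
  then show ?thesis using F(2,3) topspace_eq by (intro exI[of _ F]) auto
qed

text \<open>The difference vanishes at the identity for all \<open>s\<close> and \<open>t\<close>,
  so the tube lemma over the compact square gives one neighbourhood that works for all
  pairs.\<close>

lemma unif_cont_if_compact:
  assumes K: "compact_space T" and F: "continuous_map T euclideanreal F" and \<epsilon>: "0 < \<epsilon>"
  shows "\<exists>M. openin T M \<and> \<one> \<in> M \<and>
    (\<forall>x\<in>M. \<forall>s\<in>carrier G. \<forall>t\<in>carrier G. \<bar>F (s \<otimes> x \<otimes> t) - F (s \<otimes> t)\<bar> < \<epsilon>)"
proof -
  let ?P = "prod_topology T (prod_topology T T)"
  define f where "f = (\<lambda>p. F (fst (snd p) \<otimes> fst p \<otimes> snd (snd p)) - F (fst (snd p) \<otimes> snd (snd p)))"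
  have mult: "continuous_map ?P T (\<lambda>p. a p \<otimes> b p)" if "continuous_map ?P T a" "continuous_map ?P T b" for a b
  proof -
    have "continuous_map ?P (prod_topology T T) (\<lambda>p. (a p, b p))" using that by (simp add: continuous_map_pairwise o_def)
    from continuous_map_compose[OF this continuous_mult] show ?thesis by (simp add: o_def)
  qed
  have c: "continuous_map ?P T fst" "continuous_map ?P T (\<lambda>p. fst (snd p))" "continuous_map ?P T (\<lambda>p. snd (snd p))"
    using continuous_map_compose[OF continuous_map_snd[of T "prod_topology T T"] continuous_map_fst[of T T]]
      continuous_map_compose[OF continuous_map_snd[of T "prod_topology T T"] continuous_map_snd[of T T]]
    by (simp_all add: continuous_map_fst o_def)
  have "continuous_map ?P euclideanreal f"
    unfolding f_def
    by (intro continuous_map_diff continuous_map_compose[OF _ F, unfolded o_def] mult c)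
  then have op: "openin ?P {p \<in> topspace ?P. f p \<in> {-\<epsilon><..<\<epsilon>}}"
    by (rule openin_continuous_map_preimage) simp
  have comp: "compactin (prod_topology T T) (topspace (prod_topology T T))"
    using K compact_space_prod_topology[of T T] by (simp only: compact_space_def) blast
  have sub: "{\<one>} \<times> topspace (prod_topology T T) \<subseteq> {p \<in> topspace ?P. f p \<in> {-\<epsilon><..<\<epsilon>}}"
    using \<epsilon> by (auto simp: f_def topspace_eq)
  have "\<exists>U V. openin T U \<and> openin (prod_topology T T) V \<and> \<one> \<in> U \<and> topspace (prod_topology T T) \<subseteq> V \<and>
      U \<times> V \<subseteq> {p \<in> topspace ?P. f p \<in> {-\<epsilon><..<\<epsilon>}}"
    using tube_lemma_right[OF op comp one_in_topspace sub] by blast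
  then obtain U V where UV: "openin T U" "\<one> \<in> U" "topspace (prod_topology T T) \<subseteq> V"
    "U \<times> V \<subseteq> {p \<in> topspace ?P. f p \<in> {-\<epsilon><..<\<epsilon>}}"
    by (elim exE conjE) (rule that)
  have "\<bar>F (s \<otimes> x \<otimes> t) - F (s \<otimes> t)\<bar> < \<epsilon>" if x: "x \<in> U" and st: "s \<in> carrier G" "t \<in> carrier G" for x s t
  proof -
    have "(s, t) \<in> V" using UV(3) st topspace_eq by auto
    then have "(x, s, t) \<in> {p \<in> topspace ?P. f p \<in> {-\<epsilon><..<\<epsilon>}}" using UV(4) x by blast
    then show ?thesis by (simp add: f_def abs_less_iff)
  qed
  then show ?thesis using UV(1,2) by blast
qed

end

text \<open>Covers and bump functions are pulled back from the compact group along the embedding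
  \<open>\<phi>\<close>.\<close>

lemma countable_precompact_groupI:
  fixes G :: "'a monoid" (structure)
  assumes "topological_group G T" "countable (carrier G)" "precompact_group TYPE('k) G T"
  shows "countable_precompact_group G T"
proof -
  interpret topological_group G T by fact
  have "\<exists>(K :: 'k monoid) S H \<phi>. topological_group K S \<and> compact_space S \<and> subgroup H K \<and>
       \<phi> \<in> iso G (K\<lparr>carrier := H\<rparr>) \<and> homeomorphic_map T (subtopology S H) \<phi>"
    using assms(3) by (simp only: precompact_group_def)
  then obtain K :: "'k monoid" and S H \<phi> where KK: "topological_group K S" "compact_space S" "subgroup H K"
     "\<phi> \<in> iso G (K\<lparr>carrier := H\<rparr>)" "homeomorphic_map T (subtopology S H) \<phi>"
    by (elim exE conjE) (rule that)
  interpret K: topological_group K S by (rule KK(1))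
  interpret H: subgroup H K by (rule KK(3))
  have bij: "bij_betw \<phi> (carrier G) H" using KK(4) by (simp add: iso_def)
  have mem: "\<phi> x \<in> H" "\<phi> x \<in> carrier K" if "x \<in> carrier G" for x
    using bij_betwE[OF bij] that H.subset by auto
  have hm: "\<phi> (x \<otimes> y) = \<phi> x \<otimes>\<^bsub>K\<^esub> \<phi> y" if "x \<in> carrier G" "y \<in> carrier G" for x y
    using KK(4) that by (simp add: iso_def hom_def)
  have h1: "\<phi> \<one> = \<one>\<^bsub>K\<^esub>" using hm[of \<one> \<one>] mem by (metis K.r_cancel_one' l_one one_closed)
  have hi: "\<phi> (inv x) = inv\<^bsub>K\<^esub> (\<phi> x)" if x: "x \<in> carrier G" for x
  proof (rule K.inv_equality[symmetric])
    show "\<phi> (inv x) \<otimes>\<^bsub>K\<^esub> \<phi> x = \<one>\<^bsub>K\<^esub>" using hm[of "inv x" x] x h1 by simp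
  qed (use mem x in auto)
  have cont: "continuous_map T S \<phi>"
    using homeomorphic_imp_continuous_map[OF KK(5)] by (simp add: continuous_map_in_subtopology)
  \<comment> \<open>\<open>\<phi>\<close> is open onto its image, so every neighbourhood of the
    identity in \<open>G\<close> contains the preimage of one in the compact group.\<close>
  have pull: "\<exists>M. openin S M \<and> \<one>\<^bsub>K\<^esub> \<in> M \<and> (\<forall>x\<in>carrier G. \<phi> x \<in> M \<longrightarrow> x \<in> N)" if N: "openin T N" "\<one> \<in> N" for N
  proof -
    have NG: "N \<subseteq> carrier G" using openin_subset[OF N(1)] topspace_eq by simp
    have "openin (subtopology S H) (\<phi> ` N)"
      using homeomorphic_imp_open_map[OF KK(5)] N(1) by (simp add: open_map_def)
    then obtain M where M: "openin S M" "\<phi> ` N = M \<inter> H" unfolding openin_subtopology by blast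
    have "\<phi> \<one> \<in> M" using imageI[OF N(2), of \<phi>] unfolding M(2) by (rule IntD1)
    then have "\<one>\<^bsub>K\<^esub> \<in> M" unfolding h1 .
    moreover have "x \<in> N" if x: "x \<in> carrier G" "\<phi> x \<in> M" for x
    proof -
      have "\<phi> x \<in> \<phi> ` N" unfolding M(2) using x(2) mem(1)[OF x(1)] by (rule IntI)
      then show ?thesis using bij_betw_imp_inj_on[OF bij] x(1) NG by (simp add: inj_on_image_mem_iff)
    qed
    ultimately show ?thesis using M(1) by blast
  qed
  interpret tb: totally_bounded_group G T
  proof
    fix N assume N: "openin T N" "\<one> \<in> N"
    obtain M where M: "openin S M" "\<one>\<^bsub>K\<^esub> \<in> M" "\<forall>x\<in>carrier G. \<phi> x \<in> M \<longrightarrow> x \<in> N"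
      using pull[OF N] by (elim exE conjE) (rule that)
    obtain \<O> where \<O>: "finite \<O>" "carrier K = \<Union>\<O>" "\<forall>W\<in>\<O>. \<forall>x\<in>W. \<forall>y\<in>W. inv\<^bsub>K\<^esub> x \<otimes>\<^bsub>K\<^esub> y \<in> M"
      using K.finite_cover_if_compact[OF KK(2) M(1,2)] by (elim exE conjE) (rule that)
    \<comment> \<open>A centre in \<open>G\<close> for each piece that meets the image of
      \<open>\<phi>\<close>; pieces that miss the image are left out of \<open>A\<close>.\<close>
    define a where "a W = (SOME x. x \<in> carrier G \<and> \<phi> x \<in> W)" for W
    define A where "A = a ` {W \<in> \<O>. \<exists>x\<in>carrier G. \<phi> x \<in> W}"
    have a: "a W \<in> carrier G \<and> \<phi> (a W) \<in> W" if "\<exists>x\<in>carrier G. \<phi> x \<in> W" for W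
      unfolding a_def by (rule someI_ex) (use that in blast)
    have "\<exists>b\<in>A. inv b \<otimes> x \<in> N" if x: "x \<in> carrier G" for x
    proof -
      obtain W where W: "W \<in> \<O>" "\<phi> x \<in> W" using mem(2)[OF x] \<O>(2) by blast
      have aW: "a W \<in> carrier G" "\<phi> (a W) \<in> W" using a[of W] x W(2) by blast+
      have "\<phi> (inv (a W) \<otimes> x) \<in> M" using \<O>(3) W aW x by (simp add: hm hi)
      then have "inv (a W) \<otimes> x \<in> N" using M(3) aW(1) x by simp
      moreover have "a W \<in> A" unfolding A_def using W x by blast
      ultimately show ?thesis by blast
    qed
    moreover have "finite A" "A \<subseteq> carrier G" using \<O>(1) a by (auto simp: A_def)
    ultimately show "\<exists>A. finite A \<and> A \<subseteq> carrier G \<and> (\<forall>x\<in>carrier G. \<exists>a\<in>A. inv a \<otimes> x \<in> N)"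
      by (intro exI[of _ A]) blast
  qed
  show ?thesis
  proof
    show "countable (carrier G)" by (rule assms(2))
    fix N assume N: "openin T N" "\<one> \<in> N"
    obtain M where M: "openin S M" "\<one>\<^bsub>K\<^esub> \<in> M" "\<forall>x\<in>carrier G. \<phi> x \<in> M \<longrightarrow> x \<in> N"
      using pull[OF N] by (elim exE conjE) (rule that)
    obtain F :: "'k \<Rightarrow> real" where F: "continuous_map S euclideanreal F" "F \<one>\<^bsub>K\<^esub> = 1" "\<forall>x\<in>carrier K - M. F x = 0"
      using K.Urysohn_bump[OF KK(2) M(1,2)] by (elim exE conjE) (rule that)
    define f where "f = (\<lambda>x. complex_of_real (F (\<phi> x)))"
    have "unif_cont f"
      unfolding unif_cont_def
    proof (intro allI impI)
      fix \<epsilon> :: real assume \<epsilon>: "0 < \<epsilon>"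
      obtain O1 where O1: "openin S O1" "\<one>\<^bsub>K\<^esub> \<in> O1"
        "\<forall>x\<in>O1. \<forall>s\<in>carrier K. \<forall>t\<in>carrier K. \<bar>F (s \<otimes>\<^bsub>K\<^esub> x \<otimes>\<^bsub>K\<^esub> t) - F (s \<otimes>\<^bsub>K\<^esub> t)\<bar> < \<epsilon>"
        using K.unif_cont_if_compact[OF KK(2) F(1) \<epsilon>] by (elim exE conjE) (rule that)
      let ?N = "{x \<in> topspace T. \<phi> x \<in> O1}"
      have "near f \<epsilon> x \<one>" if "x \<in> ?N" for x
      proof -
        have "\<bar>F (\<phi> (s \<otimes> x \<otimes> t)) - F (\<phi> (s \<otimes> \<one> \<otimes> t))\<bar> < \<epsilon>" if "s \<in> carrier G" "t \<in> carrier G" for s t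
          using O1(3) that \<open>x \<in> ?N\<close> mem by (simp add: hm topspace_eq h1)
        then show ?thesis unfolding near_def f_def of_real_diff[symmetric] norm_of_real by (simp add: less_imp_le)
      qed
      moreover have "openin T ?N" by (rule openin_continuous_map_preimage[OF cont O1(1)])
      moreover have "\<one> \<in> ?N" using O1(2) h1 topspace_eq by simp
      ultimately show "\<exists>N. openin T N \<and> \<one> \<in> N \<and> (\<forall>x\<in>N. near f \<epsilon> x \<one>)" by blast
    qed
    moreover have "f \<one> = 1" by (simp add: f_def h1 F(2))
    moreover have "f x = 0" if "x \<in> carrier G - N" for x
      using that M(3) F(3) mem by (auto simp: f_def)
    ultimately show "\<exists>f. unif_cont f \<and> f \<one> = 1 \<and> (\<forall>x\<in>carrier G - N. f x = 0)" by blast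
  qed
qed

theorem theorem5p1:
  fixes G :: "'a monoid" and T :: "'a topology"
  assumes "topological_group G T"
    and "countable (carrier G)" and "infinite (carrier G)"
    and "precompact_group TYPE('k) G T"
    and "\<not> metrizable_space T"
  shows "\<not> openin (fell_topology G T (dual_object G T)) {trivial_class G T}"
proof -
  interpret countable_precompact_group G T
    by (rule countable_precompact_groupI[OF assms(1,2,4)])
  show ?thesis
  proof (rule not_isolated_if_almost_invariant)
    fix C and \<epsilon> :: real assume "compactin T C" "0 < \<epsilon>"
    then obtain U v where U: "minimal_invariant left_ops U" "\<And>f. f \<in> U \<Longrightarrow> mean f = 0" "v \<in> U" "nrm v = 1"
      "\<And>g. g \<in> C \<Longrightarrow> nrm (ltr g v - v) < \<epsilon>"
      by (rule almost_invariant_vector[OF assms(5)]) (rule that)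
    show "\<exists>U v. minimal_invariant left_ops U \<and> (\<forall>f\<in>U. mean f = 0) \<and> v \<in> U \<and> nrm v = 1 \<and>
        (\<forall>g\<in>C. nrm (ltr g v - v) < \<epsilon>)"
      by (intro exI[of _ U] exI[of _ v] conjI ballI U)
  qed
qed

end
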